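(* Let $L=L_1\sqcup\cdots\sqcup L_m$ be an $m$-component link in $S^3$ and suppose that $L_i$ is unknotted for some fixed $i$. Fix an orientation of $L$. Suppose $L$ can be transformed to a split link by $\alpha+\beta$ crossing changes involving distinct components, where $\alpha$ of these involve $L_i$ and $\beta$ of these do not involve $L_i$. Then the 2-fold covering link $J$ of $L$ with respect to $L_i$ can be altered by performing $\alpha$ internal band sums and $2\beta$ crossing changes between different components to the split union of $2(m-1)$ knots comprising two copies of $L_j$ for each $j\neq i$.
   Context: Links are smooth links in $S^3$. The notation $L=L_1\sqcup\cdots\sqcup L_m$ for a link lists its components, which may be linked with each other. A link is called split if it is a split union of knots, i.e. its components lie in pairwise disjoint 3-balls in $S^3$. A crossing change "involving distinct components" is a crossing change between two different components; it "involves $L_i$" if $L_i$ is one of these two components. 2-fold covering link: for a link $L=L_1\sqcup\cdots\sqcup L_m$ with $L_i$ unknotted, let $p\colon S^3\to S^3$ be the double branched cover of $S^3$ with branching set the unknot $L_i$. The link $p^{-1}(L\setminus L_i)\subset S^3$ is the 2-fold covering link of $L$ with respect to $L_i$. An orientation of $L$ induces an orientation of its covering links. Internal band sum: an operation on an oriented link $L$. The data is an embedding $f\colon D^1\times D^1\to S^3$ (with $D^1=[-1,1]$) such that $f(D^1\times D^1)\cap L=f(\{-1,1\}\times D^1)$, the orientation of $f(\{-1\}\times D^1)$ agrees with that of $L$, and the orientation of $f(\{1\}\times D^1)$ is opposite to that of $L$. The output is the new oriented link $(L\setminus f(\{-1,1\}\times D^1))\cup f(D^1\times\{-1,1\})$,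 after rounding corners, with the orientation induced from $L$. *)

theory Defs
  imports "HOL-Analysis.Analysis"
begin

section \<open>Smooth maps and the 3-sphere\<close>

text \<open>Differentiability of class \<open>C\<^sup>k\<close>; meaningful for open \<open>U\<close> and finite-dimensional domain.\<close>

primrec Ck_on :: "nat \<Rightarrow> 'a::real_normed_vector set \<Rightarrow> ('a \<Rightarrow> 'b::real_normed_vector) \<Rightarrow> bool" where
  "Ck_on 0 U f \<longleftrightarrow> continuous_on U f"
| "Ck_on (Suc k) U f \<longleftrightarrow>
     f differentiable_on U \<and> (\<forall>v. Ck_on k U (\<lambda>x. frechet_derivative f (at x) v))"

definition smooth_on :: "'a::real_normed_vector set \<Rightarrow> ('a \<Rightarrow> 'b::real_normed_vector) \<Rightarrow> bool" where
  "smooth_on U f \<longleftrightarrow> open U \<and> (\<forall>k. Ck_on k U f)"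

definition extends_smoothly :: "'a::real_normed_vector set \<Rightarrow> ('a \<Rightarrow> 'b::real_normed_vector) \<Rightarrow> bool" where
  "extends_smoothly S f \<longleftrightarrow> (\<exists>U g. S \<subseteq> U \<and> smooth_on U g \<and> (\<forall>x\<in>S. g x = f x))"

abbreviation S3 :: "(real^4) set" where
  "S3 \<equiv> sphere 0 1"

definition diffeo_S3 :: "(real^4 \<Rightarrow> real^4) \<Rightarrow> bool" where
  "diffeo_S3 h \<longleftrightarrow> bij_betw h S3 S3 \<and> extends_smoothly S3 h \<and> extends_smoothly S3 (inv_into S3 h)"

definition ambient_isotopy :: "(real \<Rightarrow> real^4 \<Rightarrow> real^4) \<Rightarrow> bool" where
  "ambient_isotopy H \<longleftrightarrow>
     extends_smoothly ({0..1} \<times> S3) (\<lambda>(t, x). H t x) \<and>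
     (\<forall>t\<in>{0..1}. diffeo_S3 (H t)) \<and> (\<forall>x\<in>S3. H 0 x = x)"

text \<open>Orientation-preserving smooth parametrizations of open subsets of the sphere by the open
  3-ball of radius 2. The sphere is oriented as the boundary of the 4-ball (outward normal first);
  positivity of the determinant also expresses that the map is an immersion.\<close>

definition oriented_chart :: "(real^3 \<Rightarrow> real^4) \<Rightarrow> bool" where
  "oriented_chart e \<longleftrightarrow>
     smooth_on (ball 0 2) e \<and> inj_on e (ball 0 2) \<and> e ` ball 0 2 \<subseteq> S3 \<and>
     (\<forall>q\<in>ball 0 2.
        let D = frechet_derivative e (at q) in
        det (vector [e q, D (axis 1 1), D (axis 2 1), D (axis 3 1)] :: real^4^4) > 0)"

text \<open>Smoothly embedded closed 3-balls. Precomposing with a reflection shows that asking the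
  embedding to preserve orientation is no restriction.\<close>

definition three_ball :: "(real^4) set \<Rightarrow> bool" where
  "three_ball B \<longleftrightarrow> (\<exists>e. oriented_chart e \<and> B = e ` cball 0 1)"


section \<open>Oriented knots and links\<close>

text \<open>An oriented 1-dimensional submanifold of the sphere is represented by the set of its positive
  unit tangent vectors \<open>(x, v)\<close>, that is, by the graph of its orientation.\<close>

type_synonym oriented_curve = "((real^4) \<times> (real^4)) set"

abbreviation carrier :: "oriented_curve \<Rightarrow> (real^4) set" where
  "carrier A \<equiv> fst ` A"

definition directed_arc :: "(real \<Rightarrow> real^4) \<Rightarrow> real set \<Rightarrow> oriented_curve" where
  "directed_arc c T = (\<lambda>t. (c t, sgn (vector_derivative c (at t)))) ` T"

text \<open>The image of a unit tangent vector of the sphere under the derivative of a map \<open>h\<close> defined on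
  the sphere, normalized. The derivative is computed on the radially constant extension of \<open>h\<close>, so
  values of \<open>h\<close> off the sphere play no role.\<close>

definition tangent_map :: "(real^4 \<Rightarrow> real^4) \<Rightarrow> (real^4) \<times> (real^4) \<Rightarrow> (real^4) \<times> (real^4)" where
  "tangent_map h = (\<lambda>(x, v). (h x, sgn (frechet_derivative (\<lambda>y. h (sgn y)) (at x) v)))"

definition oriented_knot :: "oriented_curve \<Rightarrow> bool" where
  "oriented_knot K \<longleftrightarrow>
     (\<exists>\<gamma>. smooth_on UNIV \<gamma> \<and> range \<gamma> \<subseteq> S3 \<and> (\<forall>t. \<gamma> (t + 1) = \<gamma> t) \<and> inj_on \<gamma> {0..<1} \<and>
          (\<forall>t. vector_derivative \<gamma> (at t) \<noteq> 0) \<and> K = directed_arc \<gamma> UNIV)"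

definition oriented_link :: "oriented_curve \<Rightarrow> bool" where
  "oriented_link A \<longleftrightarrow>
     (\<exists>F. finite F \<and> (\<forall>K\<in>F. oriented_knot K) \<and> disjoint_family_on carrier F \<and> A = \<Union>F)"

text \<open>A knot contained in a link is automatically one of its components.\<close>

definition knot_components :: "oriented_curve \<Rightarrow> oriented_curve set" where
  "knot_components A = {K. oriented_knot K \<and> K \<subseteq> A}"

text \<open>Links with components labelled by \<open>I\<close>.\<close>

definition labelled_link :: "'k set \<Rightarrow> ('k \<Rightarrow> oriented_curve) \<Rightarrow> bool" where
  "labelled_link I L \<longleftrightarrow>
     finite I \<and> (\<forall>j\<in>I. oriented_knot (L j)) \<and> disjoint_family_on (\<lambda>j. carrier (L j)) I"

definition split_link :: "'k set \<Rightarrow> ('k \<Rightarrow> oriented_curve) \<Rightarrow> bool" where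
  "split_link I L \<longleftrightarrow>
     labelled_link I L \<and>
     (\<exists>B. (\<forall>j\<in>I. three_ball (B j) \<and> carrier (L j) \<subseteq> B j) \<and> disjoint_family_on B I)"

definition isotopic :: "oriented_curve \<Rightarrow> oriented_curve \<Rightarrow> bool" where
  "isotopic A A' \<longleftrightarrow> (\<exists>H. ambient_isotopy H \<and> A' = tangent_map (H 1) ` A)"

definition labelled_isotopic :: "'k set \<Rightarrow> ('k \<Rightarrow> oriented_curve) \<Rightarrow> ('k \<Rightarrow> oriented_curve) \<Rightarrow> bool" where
  "labelled_isotopic I L L' \<longleftrightarrow>
     (\<exists>H. ambient_isotopy H \<and> (\<forall>j\<in>I. L' j = tangent_map (H 1) ` L j))"

definition unknotted :: "oriented_curve \<Rightarrow> bool" where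
  "unknotted K \<longleftrightarrow>
     (\<exists>H. ambient_isotopy H \<and> H 1 ` carrier K = {x \<in> S3. x $ 3 = 0 \<and> x $ 4 = 0})"


section \<open>Crossing changes\<close>

text \<open>In a 3-ball the link consists of the segment of the x-axis and of the arc
  \<open>{(0, y, g y)}\<close>, which forms a single crossing with the x-axis in the projection to the
  xy-plane; the crossing change replaces \<open>g\<close> by \<open>- g\<close>. The sign of \<open>g 0\<close> is arbitrary. Every choice
  of directions of the two strands reduces to the one below, by half-turns of the ball about the
  z-axis (reversing both strands) or the x-axis (reversing the second strand, and the sign
  of \<open>g\<close>). The strands belong to \<open>K\<^sub>1\<close> and \<open>K\<^sub>2\<close>.\<close>

definition crossing_change ::
  "oriented_curve \<Rightarrow> oriented_curve \<Rightarrow> oriented_curve \<Rightarrow> oriented_curve \<Rightarrow> bool" where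
  "crossing_change K\<^sub>1 K\<^sub>2 A A' \<longleftrightarrow>
     (\<exists>e g. oriented_chart e \<and> smooth_on UNIV g \<and> g 0 \<noteq> 0 \<and>
        (\<forall>y. \<bar>g y\<bar> \<le> 1/2) \<and> (\<forall>y. \<bar>y\<bar> \<ge> 1/2 \<longrightarrow> g y = 0) \<and>
        (let B = e ` cball 0 1;
             S = directed_arc (\<lambda>x. e (vector [x, 0, 0])) {-1..1};
             T = directed_arc (\<lambda>y. e (vector [0, y, g y])) {-1..1};
             T' = directed_arc (\<lambda>y. e (vector [0, y, - g y])) {-1..1}
         in S \<subseteq> K\<^sub>1 \<and> T \<subseteq> K\<^sub>2 \<and>
            {(x, v) \<in> A. x \<in> B} = S \<union> T \<and>
            A' = {(x, v) \<in> A. x \<notin> B} \<union> S \<union> T'))"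

definition crossing_change_distinct :: "oriented_curve \<Rightarrow> oriented_curve \<Rightarrow> bool" where
  "crossing_change_distinct A A' \<longleftrightarrow>
     (\<exists>K\<^sub>1\<in>knot_components A. \<exists>K\<^sub>2\<in>knot_components A. K\<^sub>1 \<noteq> K\<^sub>2 \<and> crossing_change K\<^sub>1 K\<^sub>2 A A')"

text \<open>A crossing change between the components labelled \<open>a\<close> and \<open>b\<close>. The new component \<open>L' b\<close> is
  determined because the components of \<open>L'\<close> are disjoint.\<close>

definition labelled_crossing_change ::
  "'k set \<Rightarrow> 'k \<Rightarrow> 'k \<Rightarrow> ('k \<Rightarrow> oriented_curve) \<Rightarrow> ('k \<Rightarrow> oriented_curve) \<Rightarrow> bool" where
  "labelled_crossing_change I a b L L' \<longleftrightarrow>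
     a \<in> I \<and> b \<in> I \<and> a \<noteq> b \<and> labelled_link I L' \<and> (\<forall>j\<in>I - {b}. L' j = L j) \<and>
     crossing_change (L a) (L b) (\<Union>j\<in>I. L j) (\<Union>j\<in>I. L' j)"

text \<open>\<open>link_unlinks I i \<alpha> \<beta> L L'\<close>: up to isotopy, \<open>L\<close> is transformed to \<open>L'\<close> by crossing changes
  between distinct components, in any order, \<open>\<alpha>\<close> of which involve the component labelled \<open>i\<close> and
  \<open>\<beta>\<close> of which do not.\<close>

inductive link_unlinks ::
  "'k set \<Rightarrow> 'k \<Rightarrow> nat \<Rightarrow> nat \<Rightarrow> ('k \<Rightarrow> oriented_curve) \<Rightarrow> ('k \<Rightarrow> oriented_curve) \<Rightarrow> bool"
  for I :: "'k set" and i :: 'k where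
  refl: "link_unlinks I i 0 0 L L"
| isotopy: "link_unlinks I i \<alpha> \<beta> L L' \<Longrightarrow> labelled_isotopic I L' L'' \<Longrightarrow> link_unlinks I i \<alpha> \<beta> L L''"
| involving: "link_unlinks I i \<alpha> \<beta> L L' \<Longrightarrow> labelled_crossing_change I a b L' L'' \<Longrightarrow> i \<in> {a, b}
    \<Longrightarrow> link_unlinks I i (Suc \<alpha>) \<beta> L L''"
| not_involving: "link_unlinks I i \<alpha> \<beta> L L' \<Longrightarrow> labelled_crossing_change I a b L' L'' \<Longrightarrow> i \<notin> {a, b}
    \<Longrightarrow> link_unlinks I i \<alpha> (Suc \<beta>) L L''"


section \<open>Internal band sums\<close>

definition embedded_square :: "(real \<times> real \<Rightarrow> real^4) \<Rightarrow> bool" where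
  "embedded_square f \<longleftrightarrow>
     (\<exists>U. {-1..1} \<times> {-1..1} \<subseteq> U \<and> smooth_on U f) \<and>
     inj_on f ({-1..1} \<times> {-1..1}) \<and> f ` ({-1..1} \<times> {-1..1}) \<subseteq> S3 \<and>
     (\<forall>q\<in>{-1..1} \<times> {-1..1}. inj (frechet_derivative f (at q)))"

definition arc_in_square :: "(real \<Rightarrow> real \<times> real) \<Rightarrow> bool" where
  "arc_in_square c \<longleftrightarrow>
     smooth_on UNIV c \<and> inj_on c {0..1} \<and> c ` {0..1} \<subseteq> {-1..1} \<times> {-1..1} \<and>
     (\<forall>t\<in>{0..1}. vector_derivative c (at t) \<noteq> 0)"

text \<open>Rounding the corners: the two edges \<open>f (D\<^sup>1 \<times> {-1})\<close> and \<open>f (D\<^sup>1 \<times> {1})\<close> are replaced by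
  disjoint arcs \<open>f \<circ> c\<close> and \<open>f \<circ> d\<close> in the band with the same end points, directed consistently
  with the link, such that the result is smooth; so the arcs leave their end points in the
  direction of the link. As arcs in the square with given end points are unique up to isotopy, so
  is the result.\<close>

definition internal_band_sum :: "oriented_curve \<Rightarrow> oriented_curve \<Rightarrow> bool" where
  "internal_band_sum A A' \<longleftrightarrow>
     (\<exists>f c d. embedded_square f \<and>
        f ` ({-1..1} \<times> {-1..1}) \<inter> carrier A = f ` ({-1, 1} \<times> {-1..1}) \<and>
        (\<forall>s\<in>{-1..1}.
           (f (-1, s), sgn (frechet_derivative f (at (-1, s)) (0, 1))) \<in> A \<and>
           (f (1, s), - sgn (frechet_derivative f (at (1, s)) (0, 1))) \<in> A) \<and>
        arc_in_square c \<and> c 0 = (-1, -1) \<and> c 1 = (1, -1) \<and>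
        arc_in_square d \<and> d 0 = (1, 1) \<and> d 1 = (-1, 1) \<and>
        c ` {0..1} \<inter> d ` {0..1} = {} \<and>
        A' = {(x, v) \<in> A. x \<notin> f ` ({-1, 1} \<times> {-1..1})} \<union>
             directed_arc (f \<circ> c) {0..1} \<union> directed_arc (f \<circ> d) {0..1} \<and>
        oriented_link A')"

text \<open>\<open>link_altered a n A A'\<close>: up to isotopy, \<open>A\<close> is altered to \<open>A'\<close> by \<open>a\<close> internal band sums and \<open>n\<close>
  crossing changes between different components, in some order.\<close>

inductive link_altered :: "nat \<Rightarrow> nat \<Rightarrow> oriented_curve \<Rightarrow> oriented_curve \<Rightarrow> bool" where
  refl: "link_altered 0 0 A A"
| isotopy: "link_altered a n A A' \<Longrightarrow> isotopic A' A'' \<Longrightarrow> link_altered a n A A''"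
| band: "link_altered a n A A' \<Longrightarrow> internal_band_sum A' A'' \<Longrightarrow> link_altered (Suc a) n A A''"
| crossing: "link_altered a n A A' \<Longrightarrow> crossing_change_distinct A' A'' \<Longrightarrow> link_altered a (Suc n) A A''"


section \<open>Covering links\<close>

text \<open>\<open>p\<close> is a double cover of the sphere by the sphere branched along \<open>K\<close>: away from \<open>K\<close> a two-fold
  covering and a local diffeomorphism, and along \<open>K\<close> given in local coordinates on
  \<open>\<complex> \<times> \<real>\<close> by \<open>(z, t) \<mapsto> (z\<^sup>2, t)\<close>. The covering sphere carries the orientation lifted along \<open>p\<close>,
  i.e. \<open>p\<close> preserves orientation; otherwise covering links would be replaced by their mirror
  images. Smoothness of \<open>p\<close> follows from the conditions in charts.\<close>

definition double_branched_cover :: "(real^4 \<Rightarrow> real^4) \<Rightarrow> (real^4) set \<Rightarrow> bool" where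
  "double_branched_cover p K \<longleftrightarrow>
     covering_space (S3 - p -` K) p (S3 - K) \<and>
     (\<forall>y\<in>S3 - K. card {x \<in> S3. p x = y} = 2) \<and>
     (\<forall>x\<in>S3 - p -` K. \<exists>\<phi>. oriented_chart \<phi> \<and> \<phi> 0 = x \<and> oriented_chart (p \<circ> \<phi>)) \<and>
     (\<forall>x\<in>S3 \<inter> p -` K. \<exists>\<phi> \<psi>. oriented_chart \<phi> \<and> \<phi> 0 = x \<and> oriented_chart \<psi> \<and>
        (\<forall>q\<in>ball 0 2. \<psi> q \<in> K \<longleftrightarrow> q $ 1 = 0 \<and> q $ 2 = 0) \<and>
        (\<forall>q\<in>ball 0 1. p (\<phi> q) = \<psi> (vector [(q $ 1)\<^sup>2 - (q $ 2)\<^sup>2, 2 * q $ 1 * q $ 2, q $ 3])))"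

text \<open>The preimage of an oriented curve disjoint from the branching set, with the induced
  orientation.\<close>

definition preimage_curve :: "(real^4 \<Rightarrow> real^4) \<Rightarrow> oriented_curve \<Rightarrow> oriented_curve" where
  "preimage_curve p A = {(x, v). x \<in> S3 \<and> norm v = 1 \<and> x \<bullet> v = 0 \<and> tangent_map p (x, v) \<in> A}"

end

theory Submission
 imports Defs "HOL-Analysis.Analysis"
begin

text \<open>All ambient isotopies used here are composed of small diffeomorphisms supported in charts, so that no
  flows are needed. An isotopy of the base is absorbed into the covering map and does not change the
  covering link; hence only the crossing changes matter. A ball disjoint from \<open>L\<^sub>i\<close> lifts to two disjoint
  copies, and a crossing change in it lifts to two crossing changes. At a crossing with \<open>L\<^sub>i\<close>, which is
  taken to be the x-axis of a chart, the covering is the squaring map after an alignment of the chart. A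
  strand passing in front of the axis lifts to the two branches \<open>u = \<plusminus> hyp v\<close> of a smoothed cross, a strand
  passing behind it to the two branches \<open>v = \<plusminus> hyp u\<close>, and the region between the former is a band whose
  sum exchanges the two. If \<open>L\<^sub>i\<close> contains the other strand of the crossing, shears reduce to this case.
  Finally the balls of the split link that are disjoint from \<open>L\<^sub>i\<close> lift to two balls each, and the knots in
  them are isotopic to the original ones because any two oriented charts of the sphere are isotopic.\<close>

subsection \<open>Calculus of smooth maps\<close>

text \<open>Crossing changes and band sums are conditions on actual curves, with smooth joins, and
  not on isotopy classes; this shapes the model of the band. The cross \<open>u^2 = v^2\<close> is
  smoothed only where the free parameter is less than 1/2 in absolute value, so both resolutions
  coincide near the ends of the band, and the graphs below them vanish for
  \<open>|y| >= 1/8\<close>. The squaring map makes the computation exact, but only after the given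
  chart agrees with a chart of the cover near the branching set. An isotopy that keeps the axis can
  realize an upper triangular linear part only; what remains of the derivative is a conformal map of
  the normal plane, and squaring absorbs it because complex numbers have square roots. The induction
  cannot fix the cover, since isotopies move the branching set; its invariant asserts that some
  cover branched along the current component has a covering link reached from \<open>J\<close>.
  Components of covering links carry no labels: that two of them differ is read off from the
  disjoint knots below them.\<close>

abbreviation FD :: "('a::real_normed_vector => 'b::real_normed_vector) => 'a => 'a => 'b" where
 "FD f x \<equiv> frechet_derivative f (at x)"

abbreviation VD :: "(real => 'a::real_normed_vector) => real => 'a" where
 "VD c t \<equiv> vector_derivative c (at t)"

lemma frechet_derivative_cong:
 assumes "open U" "x : U" "!!y. y : U ==> f y = g y"
 shows "FD f x = FD g x"
proof -
 have "(f has_derivative D) (at x) \<longleftrightarrow> (g has_derivative D) (at x)" for D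
  using assms has_derivative_transform_within_open by metis
 thus ?thesis by (simp add: frechet_derivative_def)
qed

lemma Ck_on_cong:
 assumes "open U" "!!x. x : U ==> f x = g x" "Ck_on k U f"
 shows "Ck_on k U g"
 using assms(2,3)
proof (induction k arbitrary: f g)
 case 0
 thus ?case using continuous_on_cong by (metis Ck_on.simps(1))
next
 case (Suc k)
 have "g differentiable_on U"
  unfolding differentiable_on_eq_differentiable_at[OF assms(1)]
 proof
  fix x assume x: "x : U"
  have "f differentiable (at x)" using Suc.prems(2) x differentiable_on_eq_differentiable_at[OF assms(1)] by auto
  thus "g differentiable (at x)" unfolding differentiable_def
   using has_derivative_transform_within_open[OF _ assms(1) x] Suc.prems(1) by metis
 qed
 moreover have "Ck_on k U (%x. FD g x v)" for v
 proof (rule Suc.IH)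
  show "Ck_on k U (%x. FD f x v)" using Suc.prems by simp
  show "FD f x v = FD g x v" if "x : U" for x using frechet_derivative_cong[OF assms(1) that Suc.prems(1)] by simp
 qed
 ultimately show ?case by simp
qed

text \<open>\<open>frechet_derivative\<close> is defined by choice. Uniqueness of derivatives on
  open sets allows any explicit derivative \<open>D\<close> in its place, which is how the later
  smoothness inductions compute.\<close>

lemma Ck_on_Suc_iff:
 assumes "open U"
 shows "Ck_on (Suc k) U f \<longleftrightarrow>
  (EX D. (ALL x:U. (f has_derivative D x) (at x)) & (ALL v. Ck_on k U (%x. D x v)))"
proof
 assume L: "Ck_on (Suc k) U f"
 hence "(f has_derivative FD f x) (at x)" if "x : U" for x
  using that assms differentiable_on_eq_differentiable_at frechet_derivative_works by (metis Ck_on.simps(2))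
 thus "EX D. (ALL x:U. (f has_derivative D x) (at x)) & (ALL v. Ck_on k U (%x. D x v))"
  using L by (intro exI[of _ "%x. FD f x"]) auto
next
 assume "EX D. (ALL x:U. (f has_derivative D x) (at x)) & (ALL v. Ck_on k U (%x. D x v))"
 then obtain D where D: "!!x. x : U ==> (f has_derivative D x) (at x)" "!!v. Ck_on k U (%x. D x v)"
  by blast
 have "f differentiable_on U"
  using D(1) assms differentiable_def differentiable_on_eq_differentiable_at by blast
 moreover have "Ck_on k U (%x. FD f x v)" for v
  by (rule Ck_on_cong[OF assms _ D(2)[of v]]) (use D(1) frechet_derivative_at in metis)
 ultimately show "Ck_on (Suc k) U f" by simp
qed

lemma Ck_on_SucI:
 assumes "open U" "!!x. x : U ==> (f has_derivative D x) (at x)" "!!v. Ck_on k U (%x. D x v)"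
 shows "Ck_on (Suc k) U f"
 using assms Ck_on_Suc_iff by blast

lemma Ck_on_imp_continuous: "Ck_on k U f ==> continuous_on U f"
 by (cases k) (auto simp: differentiable_imp_continuous_on)

lemma Ck_on_Suc_D: "Ck_on (Suc k) U f ==> Ck_on k U f"
 by (induction k arbitrary: f) (auto simp: differentiable_imp_continuous_on)

lemma Ck_on_subset:
 assumes "V \<subseteq> U" "Ck_on k U f"
 shows "Ck_on k V f"
 using assms(2)
 by (induction k arbitrary: f) (use assms(1) continuous_on_subset differentiable_on_subset in auto)

lemma Ck_on_local:
 assumes "open U" "!!x. x : U ==> EX V. open V & x : V & Ck_on k V f"
 shows "Ck_on k U f"
 using assms(2)
proof (induction k arbitrary: f)
 case 0
 thus ?case
  using assms(1) by (metis Ck_on.simps(1) continuous_at_imp_continuous_on continuous_on_eq_continuous_at)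
next
 case (Suc k)
 have "f differentiable (at x)" if "x : U" for x
  using Suc.prems[OF that] by (metis Ck_on.simps(2) differentiable_on_eq_differentiable_at)
 moreover have "Ck_on k U (%x. FD f x v)" for v
  using Suc.prems by (intro Suc.IH) (metis Ck_on.simps(2))
 ultimately show ?case
  by (simp add: differentiable_on_eq_differentiable_at[OF assms(1)])
qed

lemma Ck_on_const: "Ck_on k U (%x. c)"
proof (induction k arbitrary: c)
 case (Suc k)
 thus ?case
  by (simp add: differentiable_on_const)
qed simp

lemma Ck_on_bounded_linear:
 assumes "bounded_linear L" "open U"
 shows "Ck_on k U L"
proof (cases k)
 case 0
 thus ?thesis using bounded_linear.continuous_on[OF assms(1) continuous_on_id] by simp
next
 case (Suc n)
 show ?thesis unfolding Suc
  by (rule Ck_on_SucI[OF assms(2), where D = "%x. L"])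
   (use assms bounded_linear_imp_has_derivative Ck_on_const in auto)
qed

lemma Ck_on_add:
 assumes "open U" "Ck_on k U f" "Ck_on k U g"
 shows "Ck_on k U (%x. f x + g x)"
 using assms(2,3)
proof (induction k arbitrary: f g)
 case 0
 thus ?case by (auto intro: continuous_intros)
next
 case (Suc k)
 obtain D E where D: "!!x. x : U ==> (f has_derivative D x) (at x)" "!!v. Ck_on k U (%x. D x v)"
  and E: "!!x. x : U ==> (g has_derivative E x) (at x)" "!!v. Ck_on k U (%x. E x v)"
  using Suc.prems unfolding Ck_on_Suc_iff[OF assms(1)] by blast
 show ?case
  by (rule Ck_on_SucI[OF assms(1), where D = "%x v. D x v + E x v"])
   (use D E Suc.IH has_derivative_add in auto)
qed

lemma Ck_on_bilinear:
 assumes "bounded_bilinear pr" "open U" "Ck_on k U f" "Ck_on k U g"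
 shows "Ck_on k U (%x. pr (f x) (g x))"
 using assms(3,4)
proof (induction k arbitrary: f g)
 case 0
 thus ?case by (auto intro: bounded_bilinear.continuous_on[OF assms(1)])
next
 case (Suc k)
 obtain D E where D: "!!x. x : U ==> (f has_derivative D x) (at x)" "!!v. Ck_on k U (%x. D x v)"
  and E: "!!x. x : U ==> (g has_derivative E x) (at x)" "!!v. Ck_on k U (%x. E x v)"
  using Suc.prems unfolding Ck_on_Suc_iff[OF assms(2)] by blast
 have "Ck_on k U f" "Ck_on k U g" using Suc.prems Ck_on_Suc_D by blast+
 thus ?case
  by (intro Ck_on_SucI[OF assms(2), where D = "%x v. pr (f x) (E x v) + pr (D x v) (g x)"]
    Ck_on_add assms Suc.IH bounded_bilinear.FDERIV[OF assms(1)])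
   (use D E in auto)
qed

lemma Ck_on_sum:
 assumes "open U" "!!i. i : I ==> Ck_on k U (f i)"
 shows "Ck_on k U (%x. \<Sum>i\<in>I. f i x)"
 using assms(2)
 by (induction I rule: infinite_finite_induct) (auto simp: Ck_on_const Ck_on_add[OF assms(1)])

text \<open>\<open>Ck_on\<close> controls derivatives in constant directions only, whereas the chain
  rule applies the derivative of \<open>g\<close> to the moving vector \<open>D x v\<close>.
  Expanding this vector in a basis reduces to constant directions, hence the Euclidean type in the
  middle.\<close>

lemma Ck_on_compose:
 fixes f :: "'a::real_normed_vector => 'b::euclidean_space"
  and g :: "'b => 'c::real_normed_vector"
 assumes "open U" "open W" "f ` U \<subseteq> W" "Ck_on k U f" "Ck_on k W g"
 shows "Ck_on k U (%x. g (f x))"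
 using assms(4,5)
proof (induction k arbitrary: g)
 case 0
 thus ?case using assms(3) continuous_on_compose2 by (metis Ck_on.simps(1))
next
 case (Suc k)
 obtain D E where D: "!!x. x : U ==> (f has_derivative D x) (at x)" "!!v. Ck_on k U (%x. D x v)"
  and E: "!!x. x : W ==> (g has_derivative E x) (at x)" "!!v. Ck_on k W (%x. E x v)"
  using Suc.prems unfolding Ck_on_Suc_iff[OF assms(1)] Ck_on_Suc_iff[OF assms(2)] by blast
 have f: "Ck_on k U f" using Suc.prems Ck_on_Suc_D by blast
 show ?case
 proof (rule Ck_on_SucI[OF assms(1), where D = "%x v. \<Sum>b\<in>Basis. (D x v \<bullet> b) *\<^sub>R E (f x) b"])
  fix x assume x: "x : U"
  hence lin: "linear (E (f x))" using E(1)[of "f x"] assms(3) has_derivative_linear by blast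
  have "((%x. g (f x)) has_derivative (%v. E (f x) (D x v))) (at x)"
   using diff_chain_at[OF D(1)[OF x] E(1)] x assms(3) by (auto simp: o_def)
  moreover have "E (f x) (D x v) = (\<Sum>b\<in>Basis. (D x v \<bullet> b) *\<^sub>R E (f x) b)" for v
   by (subst euclidean_representation[of "D x v", symmetric])
    (simp only: linear_sum[OF lin] linear_cmul[OF lin])
  ultimately show "((%x. g (f x)) has_derivative (%v. \<Sum>b\<in>Basis. (D x v \<bullet> b) *\<^sub>R E (f x) b)) (at x)" by simp
 next
  fix v
  have "Ck_on k U (%x. D x v \<bullet> b)" for b by (rule Ck_on_bilinear[OF bounded_bilinear_inner assms(1) D(2) Ck_on_const])
  thus "Ck_on k U (%x. \<Sum>b\<in>Basis. (D x v \<bullet> b) *\<^sub>R E (f x) b)"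
   by (intro Ck_on_sum assms Ck_on_bilinear[OF bounded_bilinear_scaleR] Suc.IH f E)
 qed
qed

lemma smooth_open: "smooth_on U f ==> open U"
 by (simp add: smooth_on_def)

lemma smooth_continuous: "smooth_on U f ==> continuous_on U f"
 by (auto simp: smooth_on_def intro: Ck_on_imp_continuous)

lemma smooth_has_derivative:
 assumes "smooth_on U f" "x : U"
 shows "(f has_derivative FD f x) (at x)"
proof -
 have "Ck_on (Suc 0) U f" "open U" using assms(1) by (auto simp: smooth_on_def simp del: Ck_on.simps)
 thus ?thesis using assms(2) differentiable_on_eq_differentiable_at frechet_derivative_works
  by (metis Ck_on.simps(2))
qed

lemma smooth_frechet: "smooth_on U f ==> smooth_on U (%x. FD f x v)"
 by (metis Ck_on.simps(2) smooth_on_def)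

lemma smooth_cong:
 assumes "smooth_on U f" "!!x. x : U ==> f x = g x"
 shows "smooth_on U g"
 using assms Ck_on_cong unfolding smooth_on_def by metis

lemma smooth_subset: "smooth_on U f ==> open V ==> V \<subseteq> U ==> smooth_on V f"
 using Ck_on_subset unfolding smooth_on_def by metis

lemma smooth_local:
 assumes "!!x. x : U ==> EX V. x : V & smooth_on V f" "open U"
 shows "smooth_on U f"
 unfolding smooth_on_def by (intro conjI allI assms(2) Ck_on_local) (metis assms(1) smooth_on_def)

lemma smooth_on_Un: "smooth_on U f ==> smooth_on V f ==> smooth_on (U Un V) f"
 by (rule smooth_local) (auto simp: smooth_on_def)

lemma smooth_const: "open U ==> smooth_on U (%x. c)"
 by (simp add: smooth_on_def Ck_on_const)

lemma smooth_linear: "bounded_linear L ==> open U ==> smooth_on U L"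
 by (simp add: smooth_on_def Ck_on_bounded_linear)

lemma smooth_id: "open U ==> smooth_on U (%x. x)"
 by (simp add: smooth_linear bounded_linear_ident)

lemma smooth_compose:
 fixes f :: "'a::real_normed_vector => 'b::euclidean_space"
 assumes "smooth_on U f" "smooth_on W g" "f ` U \<subseteq> W"
 shows "smooth_on U (%x. g (f x))"
 using assms Ck_on_compose unfolding smooth_on_def by metis

lemma smooth_linear_comp:
 fixes f :: "'a::real_normed_vector => 'b::euclidean_space"
 assumes "bounded_linear L" "smooth_on U f"
 shows "smooth_on U (%x. L (f x))"
 using smooth_compose[OF assms(2) smooth_linear[OF assms(1) open_UNIV]] by simp

lemma smooth_add: "smooth_on U f ==> smooth_on U g ==> smooth_on U (%x. f x + g x)"
 by (simp add: smooth_on_def Ck_on_add)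

lemma smooth_sum:
 assumes "open U" "!!i. i : I ==> smooth_on U (f i)"
 shows "smooth_on U (%x. \<Sum>i\<in>I. f i x)"
 using assms by (auto simp: smooth_on_def intro!: Ck_on_sum)

lemma smooth_bilinear:
 "bounded_bilinear pr ==> smooth_on U f ==> smooth_on U g ==> smooth_on U (%x. pr (f x) (g x))"
 by (simp add: smooth_on_def Ck_on_bilinear)

lemmas smooth_scaleR = smooth_bilinear[OF bounded_bilinear_scaleR]
lemmas smooth_mult = smooth_bilinear[OF bounded_bilinear_mult]
lemmas smooth_inner = smooth_bilinear[OF bounded_bilinear_inner]

lemma smooth_cmult:
 fixes f :: "'a::real_normed_vector => 'b::real_normed_vector"
 shows "smooth_on U f ==> smooth_on U (%x. c *\<^sub>R f x)"
 by (rule smooth_scaleR[OF smooth_const]) (auto simp: smooth_on_def)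

lemma smooth_uminus:
 fixes f :: "'a::real_normed_vector => 'b::real_normed_vector"
 shows "smooth_on U f ==> smooth_on U (%x. - f x)"
 using smooth_cmult[of U f "-1"] by simp

lemma smooth_diff:
 fixes f :: "'a::real_normed_vector => 'b::real_normed_vector"
 shows "smooth_on U f ==> smooth_on U g ==> smooth_on U (%x. f x - g x)"
 using smooth_add[of U f "%x. - g x"] smooth_uminus[of U g] by simp

lemma smooth_power:
 fixes f :: "'a::real_normed_vector => 'b::real_normed_algebra_1"
 shows "smooth_on U f ==> smooth_on U (%x. f x ^ n)"
 by (induction n) (auto simp: smooth_mult smooth_const smooth_on_def Ck_on_const
   intro: Ck_on_bilinear[OF bounded_bilinear_mult])

lemma smooth_prod:
 fixes f :: "'i => 'a::real_normed_vector => real"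
 assumes "open U" "!!i. i : I ==> smooth_on U (f i)"
 shows "smooth_on U (%x. \<Prod>i\<in>I. f i x)"
 using assms(2)
 by (induction I rule: infinite_finite_induct) (auto simp: smooth_const[OF assms(1)] smooth_mult)

lemma smooth_componentwise:
 fixes f :: "'a::real_normed_vector => 'b::euclidean_space"
 assumes "open U" "!!b. b : Basis ==> smooth_on U (%x. f x \<bullet> b)"
 shows "smooth_on U f"
proof -
 have "smooth_on U (%x. \<Sum>b\<in>Basis. (f x \<bullet> b) *\<^sub>R b)"
  by (intro smooth_sum smooth_scaleR smooth_const assms)
 thus ?thesis by (simp add: euclidean_representation)
qed

lemma smooth_vec:
 fixes f :: "'a::real_normed_vector => real^'n"
 assumes "open U" "!!i. smooth_on U (%x. f x $ i)"
 shows "smooth_on U f"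
 by (rule smooth_componentwise[OF assms(1)])
  (auto simp: Basis_vec_def inner_axis intro: assms(2))

lemma smooth_nth:
 fixes f :: "'a::real_normed_vector => real^'n"
 shows "smooth_on U f ==> smooth_on U (%x. f x $ i)"
 by (rule smooth_linear_comp[OF bounded_linear_vec_nth])

lemma smooth_on_Pair:
 fixes f :: "'a::real_normed_vector => 'b::euclidean_space" and g :: "'a => 'c::euclidean_space"
 assumes "smooth_on U f" "smooth_on U g"
 shows "smooth_on U (%x. (f x, g x))"
proof -
 have "smooth_on U (%x. (f x, 0) + (0, g x))"
  using assms by (intro smooth_add smooth_linear_comp[where L = "%y. (y, 0)"] smooth_linear_comp[where L = "%y. (0, y)"])
   (auto intro: bounded_linear_Pair bounded_linear_ident bounded_linear_zero)
 thus ?thesis by simp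
qed

lemma smooth_fst: "open U ==> smooth_on U fst"
 by (rule smooth_linear[OF bounded_linear_fst])

lemma smooth_snd: "open U ==> smooth_on U snd"
 by (rule smooth_linear[OF bounded_linear_snd])

lemma smooth_inverse_real: "smooth_on (-{0}) (inverse :: real => real)"
proof -
 have "Ck_on k (-{0}) (inverse :: real => real)" for k
 proof (induction k)
  case 0
  thus ?case by (auto intro!: continuous_intros)
 next
  case (Suc k)
  show ?case
  proof (rule Ck_on_SucI[where D = "%x v. - (inverse x * v * inverse x)"])
   show "(inverse has_derivative (%v. - (inverse x * v * inverse x))) (at x)" if "x : -{0}" for x :: real
    using that by (auto intro!: derivative_eq_intros)
   have "Ck_on k (-{0}) (%x. (-1) * (inverse x * v * inverse x))" for v :: real
    by (intro Ck_on_bilinear[OF bounded_bilinear_mult] Ck_on_const Suc) auto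
   thus "Ck_on k (-{0}) (%x. - (inverse x * v * inverse x))" for v :: real by simp
  qed auto
 qed
 thus ?thesis by (simp add: smooth_on_def open_Compl)
qed

lemma smooth_inverse:
 fixes f :: "'a::real_normed_vector => real"
 assumes "smooth_on U f" "!!x. x : U ==> f x ~= 0"
 shows "smooth_on U (%x. inverse (f x))"
 by (rule smooth_compose[OF assms(1) smooth_inverse_real]) (use assms(2) in auto)

lemma smooth_divide:
 fixes f g :: "'a::real_normed_vector => real"
 assumes "smooth_on U f" "smooth_on U g" "!!x. x : U ==> g x ~= 0"
 shows "smooth_on U (%x. f x / g x)"
 unfolding divide_inverse by (intro smooth_mult smooth_inverse assms)

lemma smooth_sqrt_real: "smooth_on {0<..} sqrt"
proof -
 have "Ck_on k {0<..} sqrt" for k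
 proof (induction k)
  case 0
  thus ?case by (auto intro!: continuous_intros)
 next
  case (Suc k)
  show ?case
  proof (rule Ck_on_SucI[where D = "%x v. inverse (sqrt x) * (v / 2)"])
   show "(sqrt has_derivative (%v. inverse (sqrt x) * (v / 2))) (at x)" if "x : {0<..}" for x :: real
    using that by (auto intro!: derivative_eq_intros simp: field_simps)
   show "Ck_on k {0<..} (%x. inverse (sqrt x) * (v / 2))" for v :: real by (intro Ck_on_bilinear[OF bounded_bilinear_mult] Ck_on_const
      Ck_on_compose[OF _ _ _ Suc, where W = "-{0}" and g = inverse])
     (use smooth_inverse_real in \<open>auto simp: smooth_on_def\<close>)
  qed auto
 qed
 thus ?thesis by (simp add: smooth_on_def)
qed

lemma smooth_sqrt:
 assumes "smooth_on U f" "!!x. x : U ==> f x > 0"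
 shows "smooth_on U (%x. sqrt (f x))"
 by (rule smooth_compose[OF assms(1) smooth_sqrt_real]) (use assms(2) in auto)

lemma smooth_norm:
 fixes f :: "'a::real_normed_vector => 'b::real_inner"
 assumes "smooth_on U f" "!!x. x : U ==> f x ~= 0"
 shows "smooth_on U (%x. norm (f x))"
 unfolding norm_eq_sqrt_inner
 by (intro smooth_sqrt smooth_inner assms) (use assms(2) in auto)

lemma smooth_sgn:
 fixes f :: "'a::real_normed_vector => 'b::real_inner"
 assumes "smooth_on U f" "!!x. x : U ==> f x ~= 0"
 shows "smooth_on U (%x. sgn (f x))"
 unfolding sgn_div_norm
 by (intro smooth_scaleR smooth_inverse smooth_norm assms) (use assms(2) in auto)

text \<open>Bootstrapping: the derivative of \<open>G\<close> at \<open>y\<close> is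
  \<open>M (G y)\<close>, so if \<open>G\<close> is of class k then so is its derivative, and
  \<open>G\<close> is of class k + 1.\<close>

lemma Ck_on_inverse_function:
 fixes G :: "'b::euclidean_space => 'a::euclidean_space"
 assumes "open V" "smooth_on U (%x. x)" "G ` V \<subseteq> U"
  and "!!y. y : V ==> (G has_derivative M (G y)) (at y)"
  and "!!v. smooth_on U (%x. M x v)"
 shows "smooth_on V G"
proof -
 have "Ck_on k V G" for k
 proof (induction k)
  case 0
  have "isCont G y" if "y : V" for y using assms(4)[OF that] has_derivative_continuous by blast
  thus ?case by (simp add: continuous_at_imp_continuous_on)
 next
  case (Suc k)
  show ?case by (rule Ck_on_SucI[OF assms(1,4)])
    (use Ck_on_compose[OF assms(1) _ assms(3) Suc] assms(5) in \<open>auto simp: smooth_on_def\<close>)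
 qed
 thus ?thesis by (simp add: smooth_on_def assms(1))
qed

lemma smooth_det:
 fixes A :: "'a::real_normed_vector => real^'n^'n"
 assumes "open U" "!!i j. smooth_on U (%x. A x $ i $ j)"
 shows "smooth_on U (%x. det (A x))"
 unfolding det_def by (intro smooth_sum smooth_mult smooth_prod smooth_const assms)

text \<open>Invariance of domain makes the image open without estimates, and Cramer's rule writes
  the inverse of the derivative as a quotient of determinants, hence smooth in the point.\<close>

lemma smooth_inverse_function:
 fixes F :: "real^'n => real^'n"
 assumes F: "smooth_on U F" and inj: "inj_on F U"
  and D: "!!x v. x : U ==> FD F x v = 0 ==> v = 0"
 shows "open (F ` U)" "smooth_on (F ` U) (inv_into U F)"
proof -
 have oU: "open U" using F by (simp add: smooth_on_def)
 show op: "open (F ` U)"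
  by (rule invariance_of_domain[OF smooth_continuous[OF F] oU inj])
 define A where "A x = matrix (FD F x)" for x
 have lin: "linear (FD F x)" if "x : U" for x
  using smooth_has_derivative[OF F that] has_derivative_linear by blast
 have A: "A x *v v = FD F x v" if "x : U" for x v
  unfolding A_def using fun_cong[OF matrix_vector_mul(2)[OF lin[OF that]]] by simp
 have detA: "det (A x) ~= 0" if "x : U" for x
 proof -
  have "inj ((*v) (A x))" using D[OF that] A[OF that]
   by (metis (no_types, lifting) matrix_left_invertible_injective matrix_left_invertible_ker)
  thus ?thesis by (metis det_eq_0_rank full_rank_injective less_irrefl)
 qed
 define M where "M x v = (\<chi> k. det (\<chi> i j. if j = k then v $ i else A x $ i $ j) / det (A x))" for x v
 have M: "A x *v M x v = v" if "x : U" for x v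
  using cramer[OF detA[OF that]] by (simp add: M_def)
 have M': "M x (A x *v v) = v" if "x : U" for x v
  using cramer[OF detA[OF that], of v "A x *v v"] by (simp add: M_def)
 show "smooth_on (F ` U) (inv_into U F)"
 proof (rule Ck_on_inverse_function[OF op smooth_id[OF oU], where M = M])
  show "inv_into U F ` F ` U \<subseteq> U" using inj by simp
  show "(inv_into U F has_derivative M (inv_into U F y)) (at y)" if "y : F ` U" for y
  proof -
   from that obtain x where x: "x : U" "y = F x" by blast
   have "(inv_into U F has_derivative M x) (at (F x))"
    by (rule has_derivative_inverse_strong[OF oU x(1) smooth_continuous[OF F] _ smooth_has_derivative[OF F x(1)]])
     (use inj M[OF x(1)] A[OF x(1)] in auto)
   thus ?thesis using x inj by simp
  qed
  have Aij: "smooth_on U (%x. A x $ i $ j)" for i j by (auto simp: A_def matrix_def intro!: smooth_nth smooth_frechet[OF F])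
  have "smooth_on U (%x. if b then v $ i else A x $ i $ j)" for b v i j by (cases b) (auto simp: Aij smooth_const oU)
  thus "smooth_on U (%x. M x v)" for v unfolding M_def by (intro smooth_vec[OF oU]) (simp add: smooth_divide smooth_det oU Aij detA)
 qed
qed

lemma smooth_inverse_function_real:
 fixes F :: "real => real"
 assumes F: "smooth_on UNIV F" and bij: "bij F"
  and D: "!!x. (F has_real_derivative F' x) (at x)" "!!x. F' x ~= 0"
 shows "smooth_on UNIV (inv F)"
proof (rule Ck_on_inverse_function[OF open_UNIV smooth_id[OF open_UNIV], where M = "%x v. v / F' x"])
 have F': "FD F x = (*) (F' x)" for x
  using D(1)[of x] frechet_derivative_at by (metis has_field_derivative_def)
 show "(inv F has_derivative (%v. v / F' (inv F y))) (at y)" for y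
 proof -
  obtain x where x: "y = F x" using bij by (meson bij_is_surj surjE)
  have "(inv F has_derivative (%v. v / F' x)) (at (F x))"
   by (rule has_derivative_inverse_strong[OF open_UNIV UNIV_I smooth_continuous[OF F] _
      smooth_has_derivative[OF F UNIV_I]])
    (use bij D(2) in \<open>auto simp: F' bij_is_inj\<close>)
  thus ?thesis using bij x by (simp add: bij_is_inj)
 qed
 have "smooth_on UNIV F'"
  using smooth_frechet[OF F, of 1] by (simp add: F')
 thus "smooth_on UNIV (%x. v / F' x)" for v
  by (intro smooth_divide smooth_const) (use D(2) in auto)
qed auto

subsection \<open>Bump functions\<close>

definition flat_exp :: "real => real" where
 "flat_exp t = (if t > 0 then exp (- inverse t) else 0)"

lemma flat_exp_pos: "t > 0 ==> flat_exp t > 0"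
 and flat_exp_zero: "t <= 0 ==> flat_exp t = 0"
 and flat_exp_nonneg: "flat_exp t >= 0"
 by (auto simp: flat_exp_def)

lemma tendsto_inverse_power_flat_exp: "((%t. inverse t ^ n * flat_exp t) \<longlongrightarrow> 0) (at 0)"
proof -
 have "((%x::real. x ^ n / exp x) \<longlongrightarrow> 0) at_top"
  by (rule tendsto_power_div_exp_0)
 hence "((%t. inverse t ^ n / exp (inverse t)) \<longlongrightarrow> 0) (at_right (0::real))"
  using filterlim_compose filterlim_inverse_at_top_right by blast
 hence "((%t. inverse t ^ n * flat_exp t) \<longlongrightarrow> 0) (at_right 0)"
  by (rule Lim_transform_eventually)
   (auto simp: eventually_at_right_field flat_exp_def exp_minus divide_inverse intro!: exI[of _ 1])
 moreover have "((%t. inverse t ^ n * flat_exp t) \<longlongrightarrow> 0) (at_left 0)"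
  by (rule Lim_transform_eventually[OF tendsto_const])
   (auto simp: eventually_at_left_field flat_exp_def intro!: exI[of _ "-1"])
 ultimately show ?thesis by (simp add: filterlim_split_at)
qed

text \<open>The functions \<open>inverse t ^ n * flat_exp t\<close> span a space closed under
  differentiation, so one induction on the order, for all \<open>n\<close> at once, proves
  smoothness. At 0 the difference quotient is the next member of the family, which tends to
  0.\<close>

lemma has_derivative_inverse_power_flat_exp:
 "((%t. inverse t ^ n * flat_exp t) has_real_derivative
  (inverse t ^ (n + 2) * flat_exp t - n * (inverse t ^ (n + 1) * flat_exp t))) (at t)"
proof -
 consider "t > 0" | "t < 0" | "t = 0" by linarith
 thus ?thesis
 proof cases
  case 1
  have "((%t. inverse t ^ n * exp (- inverse t)) has_real_derivative
  (inverse t ^ (n + 2) * exp (- inverse t) - n * (inverse t ^ (n + 1) * exp (- inverse t)))) (at t)"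
  proof -
   have i: "(inverse has_real_derivative - (inverse t * inverse t)) (at t)"
    using 1 DERIV_inverse[of t] by (simp add: power2_eq_square numeral_2_eq_2)
   have "((%t. inverse t ^ n) has_real_derivative n * (- (inverse t * inverse t) * inverse t ^ (n - 1))) (at t)"
    using DERIV_power[OF i, of n] by simp
   moreover have "((%t. exp (- inverse t)) has_real_derivative exp (- inverse t) * (inverse t * inverse t)) (at t)"
    using DERIV_chain2[OF DERIV_exp DERIV_minus[OF i]] by simp
   ultimately have D: "((%t. inverse t ^ n * exp (- inverse t)) has_real_derivative
     n * (- (inverse t * inverse t) * inverse t ^ (n - 1)) * exp (- inverse t)
     + exp (- inverse t) * (inverse t * inverse t) * inverse t ^ n) (at t)"
    by (rule DERIV_mult)
   show ?thesis by (rule DERIV_cong[OF D]) (cases n; simp add: algebra_simps)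
  qed
  thus ?thesis by (rule DERIV_cong_ev[THEN iffD1, rotated 3])
    (use 1 in \<open>auto simp: flat_exp_def eventually_nhds intro!: exI[of _ "{0<..}"]\<close>)
 next
  case 2
  have "((%t. 0) has_real_derivative 0) (at t)" by simp
  thus ?thesis by (rule DERIV_cong_ev[THEN iffD1, rotated 3])
    (use 2 in \<open>auto simp: flat_exp_def eventually_nhds intro!: exI[of _ "{..<0}"]\<close>)
 next
  case 3
  have "((%h. inverse h ^ Suc n * flat_exp h) \<longlongrightarrow> 0) (at 0)" by (rule tendsto_inverse_power_flat_exp)
  hence "((%h. (inverse (0 + h) ^ n * flat_exp (0 + h) - inverse 0 ^ n * flat_exp 0) / h) \<longlongrightarrow> 0) (at 0)"
   by (simp add: flat_exp_def[of 0] divide_inverse mult_ac)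
  thus ?thesis unfolding DERIV_def 3 by (simp add: flat_exp_def[of 0])
 qed
qed

lemma smooth_flat_exp: "smooth_on UNIV flat_exp"
proof -
 have "Ck_on k UNIV (%t. inverse t ^ n * flat_exp t)" for k n
 proof (induction k arbitrary: n)
  case 0
  show ?case using DERIV_isCont[OF has_derivative_inverse_power_flat_exp] by (simp add: continuous_at_imp_continuous_on)
 next
  case (Suc k)
  show ?case
  proof (rule Ck_on_SucI)
   show "((%t. inverse t ^ n * flat_exp t) has_derivative
    (%v. (inverse t ^ (n + 2) * flat_exp t + (- n) * (inverse t ^ (n + 1) * flat_exp t)) * v)) (at t)" for t
    using has_derivative_inverse_power_flat_exp[of n t] unfolding has_field_derivative_def by simp
   show "Ck_on k UNIV (%t. (inverse t ^ (n + 2) * flat_exp t + (- n) * (inverse t ^ (n + 1) * flat_exp t)) * v)" for v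
    by (intro Ck_on_bilinear[OF bounded_bilinear_mult] Ck_on_add Ck_on_const Suc) auto
  qed auto
 qed
 from this[of _ 0] show ?thesis by (simp add: smooth_on_def)
qed

definition smooth_step :: "real => real" where
 "smooth_step t = flat_exp t / (flat_exp t + flat_exp (1 - t))"

lemma smooth_step_denominator: "flat_exp t + flat_exp (1 - t) > 0"
 using flat_exp_pos[of t] flat_exp_pos[of "1 - t"] flat_exp_nonneg[of t] flat_exp_nonneg[of "1 - t"]
 by (cases "t > 0") auto

lemma smooth_smooth_step: "smooth_on UNIV smooth_step"
proof -
 have "smooth_on UNIV (%t. flat_exp (1 - t))"
  by (rule smooth_compose[OF _ smooth_flat_exp]) (auto intro!: smooth_diff smooth_const smooth_id)
 moreover have "flat_exp t + flat_exp (1 - t) ~= 0" for t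
  using smooth_step_denominator[of t] by linarith
 ultimately have "smooth_on UNIV (%t. flat_exp t / (flat_exp t + flat_exp (1 - t)))"
  by (intro smooth_divide smooth_add smooth_flat_exp)
 thus ?thesis unfolding smooth_step_def[abs_def] .
qed

lemma smooth_step_le_0: "t <= 0 ==> smooth_step t = 0"
 and smooth_step_ge_1: "t >= 1 ==> smooth_step t = 1"
 and smooth_step_nonneg: "0 <= smooth_step t"
 and smooth_step_le_one: "smooth_step t <= 1"
 using smooth_step_denominator[of t] flat_exp_nonneg[of t] flat_exp_nonneg[of "1 - t"]
 by (auto simp: smooth_step_def flat_exp_zero)

text \<open>Finitely many radial bumps \<open>b\<close> cover \<open>C\<close> by compactness. One
  minus the product of the \<open>1 - b\<close> is 1 wherever some bump is 1 and 0 wherever all of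
  them are 0.\<close>

lemma bump_function_exists:
 fixes C U :: "'a::euclidean_space set"
 assumes "compact C" "open U" "C \<subseteq> U"
 obtains et C' W where "smooth_on UNIV et" "!!x. 0 <= et x" "!!x. et x <= (1::real)"
  "open W" "C \<subseteq> W" "!!x. x : W ==> et x = 1"
  "compact C'" "C' \<subseteq> U" "!!x. x ~: C' ==> et x = 0"
proof -
 define b where "b c r x = smooth_step (2 - (norm (x - c))\<^sup>2 / r\<^sup>2)" for c x :: 'a and r
 have sm: "smooth_on UNIV (b c r)" for c r
 proof -
  have "smooth_on UNIV (%x. 2 - ((x - c) \<bullet> (x - c)) * inverse (r\<^sup>2))"
   by (intro smooth_diff smooth_const smooth_mult smooth_inner smooth_id) auto
  from smooth_compose[OF this smooth_smooth_step]
  show ?thesis by (simp add: b_def[abs_def] power2_norm_eq_inner divide_inverse)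
 qed
 have b1: "b c r x = 1" if "norm (x - c) < r" for c r x
 proof -
  have "(norm (x - c))\<^sup>2 < r\<^sup>2" using that by (intro power_strict_mono) auto
  hence "(norm (x - c))\<^sup>2 / r\<^sup>2 <= 1" by (simp add: divide_le_eq)
  thus ?thesis unfolding b_def by (intro smooth_step_ge_1) auto
 qed
 have b0: "b c r x = 0" if "norm (x - c) > 2 * r" "r > 0" for c r x
 proof -
  have "(norm (x - c))\<^sup>2 >= (2 * r)\<^sup>2" using that by (intro power_mono) auto
  hence "(norm (x - c))\<^sup>2 / r\<^sup>2 >= 4" using that by (simp add: le_divide_eq power_mult_distrib)
  thus ?thesis unfolding b_def by (intro smooth_step_le_0) auto
 qed
 have "EX r>0. cball c (2 * r) \<subseteq> U" if "c : C" for c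
 proof -
  have "c : U" using that assms by blast
  then obtain e where "e > 0" "cball c e \<subseteq> U" using assms(2) open_contains_cball by metis
  thus ?thesis by (intro exI[of _ "e/2"]) auto
 qed
 then obtain r where r: "!!c. c : C ==> r c > 0" "!!c. c : C ==> cball c (2 * r c) \<subseteq> U"
  by metis
 have "C \<subseteq> (UN c:C. ball c (r c))" using r by auto
 then obtain D where D: "D \<subseteq> C" "finite D" "C \<subseteq> (UN c:D. ball c (r c))"
  by (rule compactE_image[OF assms(1) open_ball])
 define et where "et x = 1 - (\<Prod>c\<in>D. 1 - b c (r c) x)" for x
 have b01: "0 <= b c r x" "b c r x <= 1" for c r x
  by (auto simp: b_def smooth_step_nonneg smooth_step_le_one)
 show thesis
 proof
  show "smooth_on UNIV et" unfolding et_def by (intro smooth_diff smooth_const smooth_prod sm) auto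
  show "0 <= et x" for x using prod_le_1[of D "%c. 1 - b c (r c) x"] b01 by (simp add: et_def)
  show "et x <= 1" for x using prod_nonneg[of D "%c. 1 - b c (r c) x"] b01 by (simp add: et_def)
  show "open (UN c:D. ball c (r c))" by auto
  show "C \<subseteq> (UN c:D. ball c (r c))" by (rule D)
  show "et x = 1" if x: "x : (UN c:D. ball c (r c))" for x
  proof -
   obtain c where c: "c : D" "norm (x - c) < r c" using x by (auto simp: dist_norm norm_minus_commute)
   thus ?thesis unfolding et_def using D(2) c(1) b1[OF c(2)] by auto
  qed
  show "compact (UN c:D. cball c (2 * r c))" using D(2) by (intro compact_UN) auto
  show "(UN c:D. cball c (2 * r c)) \<subseteq> U" by (rule UN_least) (use D(1) r(2) in blast)
  show "et x = 0" if nx: "x ~: (UN c:D. cball c (2 * r c))" for x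
  proof -
   have "b c (r c) x = 0" if c: "c : D" for c
   proof (rule b0)
    show "r c > 0" using c D r(1) by blast
    have "x ~: cball c (2 * r c)" using nx c by blast
    thus "norm (x - c) > 2 * r c" by (simp add: dist_norm norm_minus_commute)
   qed
   thus ?thesis by (simp add: et_def)
  qed
 qed
qed

subsection \<open>Smooth extensions\<close>

lemma extends_smoothlyI: "smooth_on U f ==> S \<subseteq> U ==> extends_smoothly S f"
 by (auto simp: extends_smoothly_def)

lemma extends_smoothly_compose:
 fixes f :: "'a::real_normed_vector => 'b::euclidean_space"
 assumes "extends_smoothly S f" "extends_smoothly T g" "f ` S \<subseteq> T"
 shows "extends_smoothly S (%x. g (f x))"
proof -
 obtain U F where U: "S \<subseteq> U" "smooth_on U F" "!!x. x : S ==> F x = f x"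
  using assms(1) by (auto simp: extends_smoothly_def)
 obtain V G where V: "T \<subseteq> V" "smooth_on V G" "!!x. x : T ==> G x = g x"
  using assms(2) by (auto simp: extends_smoothly_def)
 have o: "open (U Int F -` V)"
  by (rule continuous_open_preimage[OF smooth_continuous[OF U(2)] smooth_open[OF U(2)] smooth_open[OF V(2)]])
 have "smooth_on (U Int F -` V) (%x. G (F x))"
  by (rule smooth_compose[OF smooth_subset[OF U(2) o] V(2)]) auto
 moreover have "S \<subseteq> U Int F -` V"
 proof
  fix x assume x: "x : S"
  hence "F x : V" using U(3)[OF x] V(1) assms(3) by (metis image_subset_iff subsetD)
  thus "x : U Int F -` V" using x U(1) by blast
 qed
 moreover have "G (F x) = g (f x)" if "x : S" for x
  using U(3)[OF that] V(3)[of "f x"] that assms(3) by (metis image_subset_iff)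
 ultimately show ?thesis
  unfolding extends_smoothly_def by blast
qed

lemma extends_smoothly_Pair:
 fixes f :: "'a::real_normed_vector => 'b::euclidean_space" and g :: "'a => 'c::euclidean_space"
 assumes "extends_smoothly S f" "extends_smoothly S g"
 shows "extends_smoothly S (%x. (f x, g x))"
proof -
 obtain U F where U: "S \<subseteq> U" "smooth_on U F" "!!x. x : S ==> F x = f x"
  using assms(1) by (auto simp: extends_smoothly_def)
 obtain V G where V: "S \<subseteq> V" "smooth_on V G" "!!x. x : S ==> G x = g x"
  using assms(2) by (auto simp: extends_smoothly_def)
 have "open (U Int V)" using smooth_open[OF U(2)] smooth_open[OF V(2)] by blast
 hence "smooth_on (U Int V) (%x. (F x, G x))"
  by (intro smooth_on_Pair smooth_subset[OF U(2)] smooth_subset[OF V(2)]) auto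
 thus ?thesis
  using U V unfolding extends_smoothly_def by (intro exI[of _ "U Int V"] exI[of _ "%x. (F x, G x)"]) auto
qed

section \<open>Smooth maps on the 3-sphere and their derivatives\<close>

lemma sgn_S3: "(y::real^4) ~= 0 ==> sgn y : S3"
 by (simp add: norm_sgn)

lemma sgn_of_S3: "(y::real^4) : S3 ==> sgn y = y"
 by (simp add: sgn_div_norm)

text \<open>\<open>smooth_on\<close> asks for open sets of the ambient space, so a subset of the
  sphere is thickened to the set of all positive multiples of its points.\<close>

definition cone :: "(real^4) set => (real^4) set" where
 "cone A = {y. y ~= 0 & sgn y : A}"

lemma S3_nonzero: "(y::real^4) : S3 ==> y ~= 0"
 by auto

lemma cone_contains: "A \<subseteq> S3 ==> A \<subseteq> cone A"
 by (auto simp: cone_def sgn_of_S3 subset_iff)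

lemma cone_S3: "cone S3 = -{0}"
 by (auto simp: cone_def norm_sgn)

lemma open_cone:
 assumes "openin (top_of_set S3) A"
 shows "open (cone A)"
proof -
 obtain W where W: "open W" "A = S3 Int W" using assms by (metis openin_open)
 have "open ((-{0}) Int sgn -` W)"
  by (intro continuous_open_preimage[OF _ _ W(1)] smooth_continuous[OF smooth_sgn[OF smooth_id]]) auto
 moreover have "cone A = (-{0}) Int sgn -` W"
  using W sgn_S3 by (auto simp: cone_def)
 ultimately show ?thesis by simp
qed

lemma openin_S3_of_cone: "open (cone A) ==> A \<subseteq> S3 ==> openin (top_of_set S3) A"
 unfolding openin_open
 by (intro exI[of _ "cone A"]) (auto simp: cone_def sgn_of_S3 S3_nonzero subset_iff)

text \<open>Maps on the sphere are differentiated through their extensions by \<open>sgn\<close>, which are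
 functorial for maps of the sphere to itself.\<close>

definition smooth_at_S3 :: "(real^4) set => (real^4 => 'b::real_normed_vector) => bool" where
 "smooth_at_S3 A h \<longleftrightarrow> A \<subseteq> S3 & smooth_on (cone A) (%y. h (sgn y))"

definition dS :: "(real^4 => 'b::real_normed_vector) => real^4 => real^4 => 'b" where
 "dS h x v = FD (%y. h (sgn y)) x v"

lemma smooth_at_S3_openin: "smooth_at_S3 A h ==> openin (top_of_set S3) A"
 using smooth_open openin_S3_of_cone by (auto simp: smooth_at_S3_def)

lemma smooth_at_S3_subset:
 "smooth_at_S3 A h ==> openin (top_of_set S3) B ==> B \<subseteq> A ==> smooth_at_S3 B h"
 unfolding smooth_at_S3_def
 by (auto intro!: smooth_subset[of "cone A"] open_cone) (auto simp: cone_def)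

lemma smooth_at_S3_cong:
 "smooth_at_S3 A h ==> (!!x. x : A ==> h x = h' x) ==> smooth_at_S3 A h'"
 unfolding smooth_at_S3_def by (auto intro: smooth_cong simp: cone_def)

lemma smooth_at_S3_local:
 assumes "openin (top_of_set S3) A" "!!x. x : A ==> EX B. x : B & smooth_at_S3 B h"
 shows "smooth_at_S3 A h"
 unfolding smooth_at_S3_def
proof
 show "A \<subseteq> S3" using assms(1) openin_imp_subset by blast
 show "smooth_on (cone A) (%y. h (sgn y))"
 proof (rule smooth_local[OF _ open_cone[OF assms(1)]])
  fix x assume "x : cone A"
  then obtain B where "sgn x : B" "smooth_at_S3 B h" "x ~= 0" using assms(2) by (auto simp: cone_def)
  thus "EX V. x : V & smooth_on V (%y. h (sgn y))" by (intro exI[of _ "cone B"]) (auto simp: smooth_at_S3_def cone_def)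
 qed
qed

lemma smooth_at_S3_continuous:
 assumes "smooth_at_S3 A h" shows "continuous_on A h"
proof -
 have "continuous_on A (%y. h (sgn y))"
  using assms cone_contains smooth_continuous continuous_on_subset unfolding smooth_at_S3_def by metis
 thus ?thesis
  using assms sgn_of_S3 by (metis (no_types, lifting) continuous_on_cong smooth_at_S3_def subsetD)
qed

lemma dS_has_derivative:
 assumes "smooth_at_S3 A h" "x : A"
 shows "((%y. h (sgn y)) has_derivative dS h x) (at x)"
proof -
 have "x : cone A" using assms cone_contains by (auto simp: smooth_at_S3_def)
 thus ?thesis
  using smooth_has_derivative assms unfolding smooth_at_S3_def dS_def by fastforce
qed

lemma dS_linear: "smooth_at_S3 A h ==> x : A ==> linear (dS h x)"
 using dS_has_derivative has_derivative_linear by blast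

lemma dS_cong:
 assumes "openin (top_of_set S3) A" "x : A" "!!y. y : A ==> h y = h' y"
 shows "dS h x = dS h' x"
proof -
 have "A \<subseteq> S3" using assms(1) openin_imp_subset by blast
 hence "x : cone A" using assms(2) cone_contains by blast
 hence "FD (%y. h (sgn y)) x = FD (%y. h' (sgn y)) x"
  by (rule frechet_derivative_cong[OF open_cone[OF assms(1)]]) (auto simp: cone_def assms(3))
 thus ?thesis by (simp add: dS_def fun_eq_iff)
qed

lemma extends_smoothly_S3_iff: "extends_smoothly S3 h \<longleftrightarrow> smooth_at_S3 S3 h"
proof
 assume "extends_smoothly S3 h"
 then obtain U g where U: "S3 \<subseteq> U" "smooth_on U g" "!!x. x : S3 ==> g x = h x"
  by (auto simp: extends_smoothly_def)
 have "smooth_on (-{0}) (%y. g (sgn y))"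
  by (rule smooth_compose[OF smooth_sgn[OF smooth_id] U(2)]) (use U(1) sgn_S3 in blast)+
 hence "smooth_on (-{0}) (%y. h (sgn y))"
  by (rule smooth_cong) (use U(3) sgn_S3 in auto)
 thus "smooth_at_S3 S3 h" by (simp add: smooth_at_S3_def cone_S3)
next
 assume "smooth_at_S3 S3 h"
 thus "extends_smoothly S3 h"
  unfolding smooth_at_S3_def cone_S3 extends_smoothly_def by (intro exI[of _ "-{0}"] exI[of _ "%y. h (sgn y)"]) (auto simp: sgn_of_S3)
qed

lemma extends_smoothly_param_S3:
 assumes "smooth_on (T \<times> (-{0})) (%(t, y). h t (sgn y))" "T' \<subseteq> T"
 shows "extends_smoothly (T' \<times> S3) (%(t, x). h t x)"
 unfolding extends_smoothly_def
 by (intro exI[of _ "T \<times> (-{0})"] exI[of _ "%(t, y). h t (sgn y)"] conjI assms(1))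
  (use assms(2) in \<open>auto simp: sgn_of_S3\<close>)

definition UT :: "((real^4) \<times> (real^4)) set" where
 "UT = {(x, v). norm x = 1 & norm v = 1 & x \<bullet> v = 0}"

lemma UT_iff: "(x, v) : UT \<longleftrightarrow> x : S3 & norm v = 1 & x \<bullet> v = 0"
 by (simp add: UT_def)

lemma sgn_has_derivative_tangent:
 assumes "(x::real^4) : S3"
 shows "(sgn has_derivative (%v. v - (x \<bullet> v) *\<^sub>R x)) (at x)"
proof -
 have n: "norm x = 1" using assms by simp
 have "(norm has_derivative (%v. x \<bullet> v)) (at x)"
  using GDERIV_norm[of x] n by (cases "x = 0") (simp_all add: gderiv_def sgn_div_norm inner_commute)
 hence "((%y. inverse (norm y) *\<^sub>R y) has_derivative (%v. v - (x \<bullet> v) *\<^sub>R x)) (at x)"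
  using n by (auto intro!: derivative_eq_intros)
 thus ?thesis by (simp add: sgn_div_norm[abs_def])
qed

text \<open>At a point of the sphere the derivative of \<open>sgn\<close> is the orthogonal
  projection to the tangent space, so on tangent vectors the radial extension has the same
  derivative as any smooth extension.\<close>

lemma dS_of_smooth:
 assumes "smooth_on U g" "x : U" "x : S3" "x \<bullet> v = 0"
 shows "dS g x v = FD g x v"
proof -
 have "(g has_derivative FD g x) (at (sgn x))"
  using smooth_has_derivative[OF assms(1,2)] sgn_of_S3[OF assms(3)] by simp
 from diff_chain_at[OF sgn_has_derivative_tangent[OF assms(3)] this]
 have "((%y. g (sgn y)) has_derivative (%v. FD g x (v - (x \<bullet> v) *\<^sub>R x))) (at x)"
  by (simp add: o_def)
 from fun_cong[OF frechet_derivative_at[OF this], of v]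
 show ?thesis by (simp add: dS_def assms(4))
qed

lemma dS_id:
 assumes "x : S3" "x \<bullet> v = 0"
 shows "dS (%x. x) x v = v"
 by (rule trans[OF dS_of_smooth[OF smooth_id[OF open_UNIV] UNIV_I assms]])
  (rule fun_cong[OF frechet_derivative_at[OF has_derivative_ident], symmetric])

lemma smooth_at_S3_compose:
 assumes h1: "smooth_at_S3 A h1" and h2: "smooth_at_S3 B h2" and "h1 ` A \<subseteq> B"
 shows "smooth_at_S3 A (%x. h2 (h1 x))"
proof -
 have in_B: "h1 (sgn y) : B" "sgn (h1 (sgn y)) = h1 (sgn y)" "h1 (sgn y) ~= 0" if "y : cone A" for y
 proof -
  show B: "h1 (sgn y) : B" using that assms(3) by (auto simp: cone_def)
  hence S: "h1 (sgn y) : S3" using h2 by (auto simp: smooth_at_S3_def)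
  show "sgn (h1 (sgn y)) = h1 (sgn y)" by (rule sgn_of_S3[OF S])
  show "h1 (sgn y) ~= 0" by (rule S3_nonzero[OF S])
 qed
 have "smooth_on (cone A) (%y. h2 (sgn (h1 (sgn y))))"
 proof (rule smooth_compose[where g = "%y. h2 (sgn y)"])
  show "smooth_on (cone A) (%y. h1 (sgn y))" using h1 by (simp add: smooth_at_S3_def)
  show "smooth_on (cone B) (%y. h2 (sgn y))" using h2 by (simp add: smooth_at_S3_def)
  show "(%y. h1 (sgn y)) ` cone A \<subseteq> cone B" using in_B by (simp add: cone_def image_subset_iff)
 qed
 hence "smooth_on (cone A) (%y. h2 (h1 (sgn y)))"
  by (rule smooth_cong) (simp add: in_B)
 thus ?thesis using h1 by (simp add: smooth_at_S3_def)
qed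

lemma dS_compose:
 assumes h1: "smooth_at_S3 A h1" and h2: "smooth_at_S3 B h2" and "h1 ` A \<subseteq> B" "x : A"
 shows "dS (%x. h2 (h1 x)) x v = dS h2 (h1 x) (dS h1 x v)"
proof -
 have x: "x : S3" "sgn x = x" using assms sgn_of_S3 by (auto simp: smooth_at_S3_def)
 have "((%y. h2 (sgn y)) has_derivative dS h2 (h1 (sgn x))) (at (h1 (sgn x)))"
  using dS_has_derivative[OF h2, of "h1 x"] assms(3,4) x by auto
 from diff_chain_at[OF dS_has_derivative[OF h1 assms(4)] this]
 have D: "((%y. h2 (sgn (h1 (sgn y)))) has_derivative (%v. dS h2 (h1 x) (dS h1 x v))) (at x)"
  by (simp add: o_def x)
 have "x : cone A" "open (cone A)" using assms cone_contains smooth_open by (auto simp: smooth_at_S3_def)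
 hence "((%y. h2 (h1 (sgn y))) has_derivative (%v. dS h2 (h1 x) (dS h1 x v))) (at x)"
 proof (intro has_derivative_transform_within_open[OF D])
  fix y assume "y : cone A"
  hence "h1 (sgn y) : B" using assms(3) by (auto simp: cone_def)
  hence "h1 (sgn y) : S3" using h2 by (auto simp: smooth_at_S3_def)
  thus "h2 (sgn (h1 (sgn y))) = h2 (h1 (sgn y))" by (simp only: sgn_of_S3)
 qed
 from fun_cong[OF frechet_derivative_at[OF this], of v]
 show ?thesis by (simp add: dS_def)
qed

lemma dS_tangent:
 assumes h: "smooth_at_S3 A h" "h ` A \<subseteq> S3" "x : A"
 shows "h x \<bullet> dS h x v = 0"
proof -
 note D = dS_has_derivative[OF h(1,3)]
 have x: "sgn x = x" "x : cone A" "open (cone A)"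
  using assms sgn_of_S3 cone_contains smooth_open by (auto simp: smooth_at_S3_def)
 have "((%y. h (sgn y) \<bullet> h (sgn y)) has_derivative (%v. h (sgn x) \<bullet> dS h x v + dS h x v \<bullet> h (sgn x))) (at x)"
  by (rule has_derivative_inner[OF D D])
 moreover have "((%y. h (sgn y) \<bullet> h (sgn y)) has_derivative (%v. 0)) (at x)"
 proof (rule has_derivative_transform_within_open[OF _ x(3,2)])
  show "((%y. 1) has_derivative (%v. 0)) (at x)" by simp
  show "1 = h (sgn y) \<bullet> h (sgn y)" if "y : cone A" for y using that h(2) by (auto simp: cone_def dot_square_norm image_subset_iff)
 qed
 ultimately have "h (sgn x) \<bullet> dS h x v + dS h x v \<bullet> h (sgn x) = 0"
  by (rule fun_cong[OF has_derivative_unique])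
 thus ?thesis by (simp add: x(1) inner_commute)
qed

lemma tangent_map_dS: "tangent_map h (x, v) = (h x, sgn (dS h x v))"
 by (simp add: tangent_map_def dS_def)

subsection \<open>Oriented patches of the sphere\<close>

lemma vector_4:
 "(vector [a, b, c, d] :: 'a::zero^4) $ 1 = a" "(vector [a, b, c, d] :: 'a^4) $ 2 = b"
 "(vector [a, b, c, d] :: 'a^4) $ 3 = c" "(vector [a, b, c, d] :: 'a^4) $ 4 = d"
 unfolding vector_def by simp_all

lemma det_vector_4_nonzero_iff:
 "det (vector [a, b, c, d] :: real^4^4) ~= 0 \<longleftrightarrow>
  (ALL r s t u. r *\<^sub>R a + s *\<^sub>R b + t *\<^sub>R c + u *\<^sub>R d = 0 --> r = 0 & s = 0 & t = 0 & u = 0)"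
proof -
 define M where "M = (vector [a, b, c, d] :: real^4^4)"
 have "det M ~= 0 \<longleftrightarrow> invertible (transpose M)"
  by (simp add: invertible_det_nz)
 also have "\<dots> \<longleftrightarrow> (ALL x. transpose M *v x = 0 --> x = 0)"
  by (simp add: invertible_left_inverse matrix_left_invertible_ker)
 also have "\<dots> \<longleftrightarrow> (ALL x::real^4. x $ 1 *\<^sub>R a + x $ 2 *\<^sub>R b + x $ 3 *\<^sub>R c + x $ 4 *\<^sub>R d = 0 --> x = 0)"
 proof -
  have "transpose M *v x = x $ 1 *\<^sub>R a + x $ 2 *\<^sub>R b + x $ 3 *\<^sub>R c + x $ 4 *\<^sub>R d" for x
   by (simp add: matrix_mult_sum sum_4 row_def M_def vector_4 scalar_mult_eq_scaleR vec_lambda_eta)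
  thus ?thesis by simp
 qed
 also have "\<dots> \<longleftrightarrow> (ALL r s t u. r *\<^sub>R a + s *\<^sub>R b + t *\<^sub>R c + u *\<^sub>R d = 0 --> r = 0 & s = 0 & t = 0 & u = 0)"
  (is "?L \<longleftrightarrow> ?R")
 proof
  assume L: ?L
  show ?R
  proof (intro allI impI)
   fix r s t u assume "r *\<^sub>R a + s *\<^sub>R b + t *\<^sub>R c + u *\<^sub>R d = 0"
   hence "(vector [r, s, t, u] :: real^4) = 0" using L[rule_format, of "vector [r, s, t, u]"] by (simp add: vector_4)
   thus "r = 0 & s = 0 & t = 0 & u = 0" by (metis vector_4 zero_index)
  qed
 next
  assume R: ?R
  show ?L
  proof (intro allI impI)
   fix x :: "real^4" assume "x $ 1 *\<^sub>R a + x $ 2 *\<^sub>R b + x $ 3 *\<^sub>R c + x $ 4 *\<^sub>R d = 0"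
   from R[rule_format, OF this] show "x = 0" by (simp add: vec_eq_iff forall_4)
  qed
 qed
 finally show ?thesis by (simp add: M_def)
qed

definition frame_det :: "(real^3 => real^4) => real^3 => real" where
 "frame_det e q = (let D = FD e q in
  det (vector [e q, D (axis 1 1), D (axis 2 1), D (axis 3 1)] :: real^4^4))"

text \<open>Charts on arbitrary open domains: the arguments restrict charts to small balls and slit
  balls and precompose them with linear maps, and thereby leave the fixed domain
  \<open>ball 0 2\<close> of \<open>oriented_chart\<close>.\<close>

definition patch :: "(real^3) set => (real^3 => real^4) => bool" where
 "patch U e \<longleftrightarrow> smooth_on U e & inj_on e U & e ` U \<subseteq> S3 & (ALL q:U. frame_det e q > 0)"

lemma oriented_chart_iff_patch: "oriented_chart e \<longleftrightarrow> patch (ball 0 2) e"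
 by (simp add: oriented_chart_def patch_def frame_det_def Let_def)

lemma patch_smooth: "patch U e ==> smooth_on U e"
 and patch_inj: "patch U e ==> inj_on e U"
 and patch_open: "patch U e ==> open U"
 and patch_image: "patch U e ==> e ` U \<subseteq> S3"
 by (auto simp: patch_def smooth_on_def)

lemma patch_S3: "patch U e ==> q : U ==> e q : S3"
 using patch_image by blast

lemma patch_norm: "patch U e ==> q : U ==> norm (e q) = 1"
 using patch_S3 by fastforce

lemma patch_has_derivative: "patch U e ==> q : U ==> (e has_derivative FD e q) (at q)"
 by (rule smooth_has_derivative[OF patch_smooth])

lemma patch_linear: "patch U e ==> q : U ==> linear (FD e q)"
 by (rule has_derivative_linear[OF patch_has_derivative])

lemma patch_subset: "patch U e ==> open V ==> V \<subseteq> U ==> patch V e"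
 unfolding patch_def by (auto intro: smooth_subset inj_on_subset)

lemma inner_constant_norm_derivative:
 assumes "(e has_derivative D) (at q)" "open U" "q : U" "!!x. x : U ==> norm (e x) = 1"
 shows "e q \<bullet> D v = 0"
proof -
 have "((%y. e y \<bullet> e y) has_derivative (%v. e q \<bullet> D v + D v \<bullet> e q)) (at q)"
  by (rule has_derivative_inner[OF assms(1) assms(1)])
 moreover have "((%y. e y \<bullet> e y) has_derivative (%v. 0)) (at q)"
  by (rule has_derivative_transform_within_open[OF has_derivative_const[of 1] assms(2,3)])
   (simp add: dot_square_norm assms(4))
 ultimately have "e q \<bullet> D v + D v \<bullet> e q = 0"
  by (rule fun_cong[OF has_derivative_unique])
 thus ?thesis by (simp add: inner_commute)
qed

lemma patch_tangent:
 assumes "patch U e" "q : U"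
 shows "e q \<bullet> FD e q v = 0"
 by (rule inner_constant_norm_derivative[OF patch_has_derivative[OF assms] patch_open[OF assms(1)] assms(2)
   patch_norm[OF assms(1)]])

lemma vec3_expand: "(v::real^3) = v $ 1 *\<^sub>R axis 1 1 + v $ 2 *\<^sub>R axis 2 1 + v $ 3 *\<^sub>R axis 3 1"
 by (simp add: vec_eq_iff forall_3 axis_def)

lemma linear_vec3: "linear D ==> D v = v $ 1 *\<^sub>R D (axis 1 1) + v $ 2 *\<^sub>R D (axis 2 1) + v $ 3 *\<^sub>R D (axis 3 1)"
 for v :: "real^3"
 by (subst vec3_expand[of v]) (simp only: linear_add linear_cmul)

text \<open>The derivative takes values orthogonal to the unit vector \<open>e q\<close>, so
  adjoining \<open>e q\<close> to the frame tests exactly the injectivity of the derivative.\<close>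

lemma frame_det_nonzero_iff:
 assumes e: "(e has_derivative D) (at q)" and "open U" "q : U" "!!x. x : U ==> norm (e x) = 1"
 shows "frame_det e q ~= 0 \<longleftrightarrow> (ALL v. D v = 0 --> v = 0)"
proof -
 have fD: "FD e q = D"
  using frechet_derivative_at[OF e] by simp
 have t: "e q \<bullet> D v = 0" for v
  by (rule inner_constant_norm_derivative[OF assms])
 have n: "e q \<bullet> e q = 1" using assms(3,4) by (simp add: dot_square_norm)
 note lin = linear_vec3[OF has_derivative_linear[OF e]]
 show ?thesis
  unfolding frame_det_def Let_def fD det_vector_4_nonzero_iff
 proof safe
  fix v assume H: "ALL r s ta u. r *\<^sub>R e q + s *\<^sub>R D (axis 1 1) + ta *\<^sub>R D (axis 2 1) + u *\<^sub>R D (axis 3 1) = 0 -->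
    r = 0 & s = 0 & ta = 0 & u = 0" and v: "D v = 0"
  have "0 *\<^sub>R e q + v $ 1 *\<^sub>R D (axis 1 1) + v $ 2 *\<^sub>R D (axis 2 1) + v $ 3 *\<^sub>R D (axis 3 1) = 0"
   using v lin[of v] by simp
  from H[rule_format, OF this] show "v = 0" by (simp add: vec_eq_iff forall_3)
 next
  fix r s t' u
  assume H: "ALL v. D v = 0 --> v = 0"
   and z: "r *\<^sub>R e q + s *\<^sub>R D (axis 1 1) + t' *\<^sub>R D (axis 2 1) + u *\<^sub>R D (axis 3 1) = 0"
  have "e q \<bullet> (r *\<^sub>R e q + s *\<^sub>R D (axis 1 1) + t' *\<^sub>R D (axis 2 1) + u *\<^sub>R D (axis 3 1)) = r"
   by (simp add: inner_add_right t n)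
  thus r: "r = 0" using z by simp
  have "D (vector [s, t', u]) = 0" using z lin[of "vector [s, t', u]"] r by simp
  hence "vector [s, t', u] = (0::real^3)" using H by blast
  thus "s = 0" "t' = 0" "u = 0" by (metis vector_3 zero_index)+
 qed
qed

lemma patch_derivative_inj:
 assumes "patch U e" "q : U" "FD e q v = 0"
 shows "v = 0"
proof -
 have "frame_det e q ~= 0" using assms by (auto simp: patch_def)
 thus ?thesis
  using frame_det_nonzero_iff[OF patch_has_derivative[OF assms(1,2)] patch_open[OF assms(1)] assms(2)
    patch_norm[OF assms(1)]] assms(3) by blast
qed

definition tail3 :: "real^4 => real^3" where
 "tail3 w = vector [w $ 2, w $ 3, w $ 4]"

lemma tail3_nth: "tail3 w $ 1 = w $ 2" "tail3 w $ 2 = w $ 3" "tail3 w $ 3 = w $ 4"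
 by (simp_all add: tail3_def)

lemma bounded_linear_tail3: "bounded_linear tail3"
 by (intro linear_conv_bounded_linear[THEN iffD1] linearI)
  (simp_all add: vec_eq_iff forall_3 tail3_nth)

lemma tail3_vector: "tail3 (vector [r, q $ 1, q $ 2, q $ 3]) = q"
 by (simp add: vec_eq_iff forall_3 tail3_nth vector_4)

text \<open>The radius is added as a fourth coordinate. Then \<open>F\<close> is a map between open
  subsets of 4-space, to which the inverse function theorem applies, and its image is the cone over
  the image of \<open>e\<close>.\<close>

lemma patch_smooth_inverse:
 assumes e: "patch U e"
 shows "smooth_at_S3 (e ` U) (inv_into U e)"
proof -
 define V where "V = {w::real^4. w $ 1 > 0} Int tail3 -` U"
 define F where "F w = w $ 1 *\<^sub>R e (tail3 w)" for w
 have "open V"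
  unfolding V_def using patch_open[OF e]
  by (intro open_Int open_vimage open_halfspace_component_gt_cart linear_continuous_on[OF bounded_linear_tail3, THEN continuous_on_subset])
   (auto intro: linear_continuous_on[OF bounded_linear_tail3])
 hence tl: "smooth_on V tail3" "smooth_on V (%w. w $ 1)"
  by (auto intro: smooth_linear bounded_linear_tail3 bounded_linear_vec_nth)
 have e_tl: "smooth_on V (%w. e (tail3 w))"
  by (rule smooth_compose[OF tl(1) patch_smooth[OF e]]) (auto simp: V_def)
 hence F: "smooth_on V F"
  unfolding F_def by (intro smooth_scaleR tl)
 have nF: "norm (F w) = w $ 1" "sgn (F w) = e (tail3 w)" if "w : V" for w
  using that patch_norm[OF e, of "tail3 w"] by (auto simp: F_def V_def sgn_div_norm)
 have inj: "inj_on F V"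
 proof (rule inj_onI)
  fix w w' assume w: "w : V" "w' : V" "F w = F w'"
  hence "w $ 1 = w' $ 1" "e (tail3 w) = e (tail3 w')" using nF by metis+
  hence "w $ 1 = w' $ 1" "tail3 w = tail3 w'" using inj_onD[OF patch_inj[OF e]] w by (auto simp: V_def)
  thus "w = w'" by (simp add: vec_eq_iff forall_3 forall_4 tail3_nth)
 qed
 have D: "v = 0" if w: "w : V" and v: "FD F w v = 0" for w v
 proof -
  have q: "tail3 w : U" "w $ 1 > 0" using w by (auto simp: V_def)
  let ?E = "FD e (tail3 w)"
  have "((%w. e (tail3 w)) has_derivative (%v. ?E (tail3 v))) (at w)"
   using diff_chain_at[OF bounded_linear_imp_has_derivative[OF bounded_linear_tail3] patch_has_derivative[OF e q(1)]] by (simp add: o_def)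
  hence "(F has_derivative (%v. w $ 1 *\<^sub>R ?E (tail3 v) + v $ 1 *\<^sub>R e (tail3 w))) (at w)" unfolding F_def
   by (intro has_derivative_scaleR bounded_linear_imp_has_derivative bounded_linear_vec_nth)
  from fun_cong[OF frechet_derivative_at[OF this], of v] v
  have z: "w $ 1 *\<^sub>R ?E (tail3 v) + v $ 1 *\<^sub>R e (tail3 w) = 0" by simp
  have "e (tail3 w) \<bullet> (w $ 1 *\<^sub>R ?E (tail3 v) + v $ 1 *\<^sub>R e (tail3 w)) = v $ 1"
   using patch_tangent[OF e q(1)] patch_norm[OF e q(1)] by (simp add: inner_add_right dot_square_norm)
  hence v1: "v $ 1 = 0" using z by simp
  hence "?E (tail3 v) = 0" using z q by simp
  hence "tail3 v = 0" by (rule patch_derivative_inj[OF e q(1)])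
  thus "v = 0" using v1 tail3_nth[of v] by (simp add: vec_eq_iff forall_4)
 qed
 have im: "F ` V = cone (e ` U)"
 proof safe
  fix w assume "w : V"
  thus "F w : cone (e ` U)" using nF[of w] by (auto simp: cone_def V_def)
 next
  fix y assume "y : cone (e ` U)"
  then obtain q where q: "q : U" "sgn y = e q" "y ~= 0" by (auto simp: cone_def)
  have "norm y *\<^sub>R sgn y = y" using q(3) by (simp add: sgn_div_norm)
  hence "F (vector [norm y, q $ 1, q $ 2, q $ 3]) = y" using q by (simp add: F_def tail3_vector vector_4)
  moreover have "vector [norm y, q $ 1, q $ 2, q $ 3] : V" using q by (simp add: V_def tail3_vector vector_4)
  ultimately show "y : F ` V" by (metis image_eqI)
 qed
 note inv = smooth_inverse_function[OF F inj D]
 have "smooth_on (cone (e ` U)) (%y. tail3 (inv_into V F y))"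
  using smooth_linear_comp[OF bounded_linear_tail3 inv(2)] by (simp add: im)
 hence "smooth_on (cone (e ` U)) (%y. inv_into U e (sgn y))"
 proof (rule smooth_cong)
  fix y assume "y : cone (e ` U)"
  hence y: "inv_into V F y : V" "F (inv_into V F y) = y" unfolding im[symmetric] by (auto intro: inv_into_into f_inv_into_f)
  hence "sgn y = e (tail3 (inv_into V F y))" using nF(2) by metis
  thus "tail3 (inv_into V F y) = inv_into U e (sgn y)" using y(1) patch_inj[OF e] by (simp add: V_def inv_into_f_f)
 qed
 thus ?thesis using patch_image[OF e] by (simp add: smooth_at_S3_def)
qed

lemma patch_openin: "patch U e ==> openin (top_of_set S3) (e ` U)"
 by (rule smooth_at_S3_openin[OF patch_smooth_inverse])

lemma smooth_patch_compose:
 assumes e: "smooth_on U e" and h: "smooth_at_S3 A h" and "e ` U \<subseteq> A"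
 shows "smooth_on U (%q. h (e q))"
proof -
 have A: "A \<subseteq> S3" using h by (simp add: smooth_at_S3_def)
 have "smooth_on U (%q. h (sgn (e q)))"
  by (rule smooth_compose[OF e, of "cone A" "%y. h (sgn y)"])
   (use h assms(3) cone_contains[OF A] in \<open>auto simp: smooth_at_S3_def\<close>)
 thus ?thesis
 proof (rule smooth_cong)
  show "h (sgn (e q)) = h (e q)" if "q : U" for q
  proof -
   have "e q : S3" using that assms(3) A by blast
   thus ?thesis by (simp only: sgn_of_S3)
  qed
 qed
qed

lemma has_derivative_patch_compose:
 assumes e: "(e has_derivative D) (at q)" and h: "smooth_at_S3 A h" and "open U" "q : U" "e ` U \<subseteq> A"
 shows "((%q. h (e q)) has_derivative (%v. dS h (e q) (D v))) (at q)"
proof -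
 have A: "A \<subseteq> S3" using h by (simp add: smooth_at_S3_def)
 have "((%q. h (sgn (e q))) has_derivative (%v. dS h (e q) (D v))) (at q)"
  using diff_chain_at[OF e dS_has_derivative[OF h]] assms(4,5) by (auto simp: o_def)
 thus ?thesis
 proof (rule has_derivative_transform_within_open[OF _ assms(3,4)])
  fix q assume "q : U"
  hence "e q : S3" using assms(5) A by blast
  thus "h (sgn (e q)) = h (e q)" by (simp only: sgn_of_S3)
 qed
qed

lemma frechet_derivative_patch_compose:
 assumes "patch U e" and "smooth_at_S3 A h" and "q : U" "e ` U \<subseteq> A"
 shows "FD (%q. h (e q)) q v = dS h (e q) (FD e q v)"
 using fun_cong[OF frechet_derivative_at[OF has_derivative_patch_compose[OF patch_has_derivative[OF assms(1,3)] assms(2)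
     patch_open[OF assms(1)] assms(3,4)]], of v] by simp

text \<open>The range of the injective derivative and the orthogonal complement of
  \<open>e q\<close> both have dimension 3.\<close>

lemma patch_tangent_surj:
 assumes e: "patch U e" "q : U" and w: "e q \<bullet> w = 0"
 obtains v where "FD e q v = w"
proof -
 let ?D = "FD e q"
 have lin: "linear ?D" by (rule patch_linear[OF e])
 have inj: "inj ?D"
  using patch_derivative_inj[OF e] linear_injective_0[OF lin] by blast
 have "dim (range ?D) = 3"
  using dim_image_eq[OF lin, of UNIV] inj by simp
 moreover have "dim {x. e q \<bullet> x = 0} = 3"
  using dim_hyperplane[of "e q"] S3_nonzero[OF patch_S3[OF e]] by simp
 moreover have "subspace (range ?D)" by (rule linear_subspace_image[OF lin subspace_UNIV])
 moreover have "range ?D \<subseteq> {x. e q \<bullet> x = 0}" using patch_tangent[OF e] by auto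
 ultimately have "range ?D = {x. e q \<bullet> x = 0}"
  by (intro subspace_dim_equal) (auto simp: subspace_hyperplane)
 hence "w : range ?D" using w by simp
 thus thesis by (auto intro: that)
qed

subsection \<open>Ambient isotopies\<close>

lemma diffeo_S3I:
 assumes "!!x. x : S3 ==> h x : S3" "!!x. x : S3 ==> g x : S3"
  "!!x. x : S3 ==> g (h x) = x" "!!x. x : S3 ==> h (g x) = x"
  "smooth_at_S3 S3 h" "smooth_at_S3 S3 g"
 shows "diffeo_S3 h"
proof -
 have bij: "bij_betw h S3 S3"
  by (rule bij_betw_byWitness[where f' = g]) (use assms in auto)
 have "smooth_at_S3 S3 (inv_into S3 h)"
 proof (rule smooth_at_S3_cong[OF assms(6)])
  fix y assume y: "y : S3"
  have "inv_into S3 h (h (g y)) = g y" by (rule inv_into_f_f[OF bij_betw_imp_inj_on[OF bij] assms(2)[OF y]])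
  thus "g y = inv_into S3 h y" using assms(4)[OF y] by simp
 qed
 thus ?thesis
  using bij assms(5) by (simp add: diffeo_S3_def extends_smoothly_S3_iff)
qed

lemma diffeo_S3D:
 assumes "diffeo_S3 h"
 shows "!!x. x : S3 ==> h x : S3" "!!x. x : S3 ==> inv_into S3 h x : S3"
  "!!x. x : S3 ==> inv_into S3 h (h x) = x" "!!x. x : S3 ==> h (inv_into S3 h x) = x"
  "smooth_at_S3 S3 h" "smooth_at_S3 S3 (inv_into S3 h)" "inj_on h S3" "h ` S3 = S3"
proof -
 have bij: "bij_betw h S3 S3" using assms by (simp add: diffeo_S3_def)
 show inj: "inj_on h S3" and im: "h ` S3 = S3"
  using bij by (simp_all add: bij_betw_def)
 show "h x : S3" if "x : S3" for x using im that by (metis image_eqI)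
 show "inv_into S3 h x : S3" if "x : S3" for x by (rule inv_into_into) (simp only: im that)
 show "inv_into S3 h (h x) = x" if "x : S3" for x by (rule inv_into_f_f[OF inj that])
 show "h (inv_into S3 h x) = x" if "x : S3" for x by (rule f_inv_into_f) (simp only: im that)
 show "smooth_at_S3 S3 h" "smooth_at_S3 S3 (inv_into S3 h)"
  using assms by (simp_all add: diffeo_S3_def extends_smoothly_S3_iff)
qed

lemma diffeo_S3_inv: "diffeo_S3 h ==> diffeo_S3 (inv_into S3 h)"
 by (rule diffeo_S3I[where g = h]) (simp_all only: diffeo_S3D)

lemma diffeo_S3_compose:
 assumes h: "diffeo_S3 h" and k: "diffeo_S3 k"
 shows "diffeo_S3 (%x. k (h x))"
proof (rule diffeo_S3I[where g = "%x. inv_into S3 h (inv_into S3 k x)"])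
 show "smooth_at_S3 S3 (%x. k (h x))"
  by (rule smooth_at_S3_compose[OF diffeo_S3D(5)[OF h] diffeo_S3D(5)[OF k]])
   (simp only: diffeo_S3D(8)[OF h] order_refl)
 show "smooth_at_S3 S3 (%x. inv_into S3 h (inv_into S3 k x))"
  by (rule smooth_at_S3_compose[OF diffeo_S3D(6)[OF k] diffeo_S3D(6)[OF h]])
   (simp only: diffeo_S3D(8)[OF diffeo_S3_inv[OF k]] order_refl)
qed (simp_all only: diffeo_S3D[OF h] diffeo_S3D[OF k])

lemma smooth_at_S3_id: "smooth_at_S3 S3 (%x. x)"
 unfolding smooth_at_S3_def cone_S3 by (auto intro!: smooth_sgn smooth_id)

lemma diffeo_S3_id: "diffeo_S3 (%x. x)"
 by (rule diffeo_S3I[where g = "%x. x"]) (simp_all add: smooth_at_S3_id)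

lemma diffeo_S3_cong: "diffeo_S3 h ==> (!!x. x : S3 ==> h x = k x) ==> diffeo_S3 k"
 using diffeo_S3D[of h]
 by (intro diffeo_S3I[where g = "inv_into S3 h"] smooth_at_S3_cong[of S3 h k]) metis+

lemma dS_inv:
 assumes h: "diffeo_S3 h" and "x : S3" "x \<bullet> v = 0"
 shows "dS (inv_into S3 h) (h x) (dS h x v) = v"
proof -
 have "dS (%x. inv_into S3 h (h x)) x v = dS (inv_into S3 h) (h x) (dS h x v)"
  by (rule dS_compose[OF diffeo_S3D(5,6)[OF h] _ assms(2)]) (simp only: diffeo_S3D(8)[OF h] order_refl)
 moreover have "dS (%x. inv_into S3 h (h x)) x = dS (%x. x) x"
  by (rule dS_cong[OF _ assms(2)]) (simp_all only: diffeo_S3D[OF h] openin_subtopology_self)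
 ultimately show ?thesis using dS_id[OF assms(2,3)] by simp
qed

lemma diffeo_dS_inj:
 assumes h: "diffeo_S3 h" and "x : S3" "x \<bullet> v = 0" "dS h x v = 0"
 shows "v = 0"
 using dS_inv[OF assms(1-3)] linear_0[OF dS_linear[OF diffeo_S3D(6)[OF h] diffeo_S3D(1)[OF h assms(2)]]]
 by (simp add: assms(4))

lemma sgn_linear_sgn:
 assumes "linear (D :: 'a::real_normed_vector => 'b::real_normed_vector)"
 shows "sgn (D (sgn w)) = sgn (D w)"
proof (cases "w = 0")
 case False
 thus ?thesis by (simp add: sgn_div_norm linear_cmul[OF assms])
qed simp

lemma tangent_map_compose:
 assumes h1: "smooth_at_S3 A h1" and h2: "smooth_at_S3 B h2" and "h1 ` A \<subseteq> B" "fst a : A"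
 shows "tangent_map (%x. h2 (h1 x)) a = tangent_map h2 (tangent_map h1 a)"
proof -
 obtain x v where a: "a = (x, v)" by fastforce
 have "h1 x : B" using assms a by auto
 thus ?thesis
  using dS_compose[OF assms(1-3), of x v] assms(4) sgn_linear_sgn[OF dS_linear[OF h2], of "h1 x" "dS h1 x v"]
  by (simp add: a tangent_map_dS)
qed

lemma tangent_map_cong:
 assumes "openin (top_of_set S3) A" "fst a : A" "!!y. y : A ==> h y = h' y"
 shows "tangent_map h a = tangent_map h' a"
 using dS_cong[OF assms(1) _ assms(3), of "fst a"] assms(2,3)
 by (cases a) (simp add: tangent_map_dS)

lemma UT_S3: "a : UT ==> fst a : S3"
 by (cases a) (simp add: UT_iff)

lemma tangent_map_id: "a : UT ==> tangent_map (%x. x) a = a"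
 by (cases a) (auto simp: tangent_map_dS UT_iff dS_id sgn_div_norm)

lemma tangent_map_cong_S3: "(!!y. y : S3 ==> h y = h' y) ==> a : UT ==> tangent_map h a = tangent_map h' a"
 by (rule tangent_map_cong[OF openin_subtopology_self UT_S3])

lemma tangent_map_UT:
 assumes h: "diffeo_S3 h" and a: "a : UT"
 shows "tangent_map h a : UT"
proof -
 obtain x v where xv: "a = (x, v)" "x : S3" "norm v = 1" "x \<bullet> v = 0" using a by (cases a) (auto simp: UT_iff)
 have "v ~= 0" using xv by auto
 hence "dS h x v ~= 0" using diffeo_dS_inj[OF h xv(2,4)] by blast
 moreover have "h x \<bullet> dS h x v = 0"
  by (rule dS_tangent[OF diffeo_S3D(5)[OF h] _ xv(2)]) (simp only: diffeo_S3D(8)[OF h] order_refl)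
 moreover have "h x : S3" by (rule diffeo_S3D(1)[OF h xv(2)])
 ultimately show ?thesis by (simp add: xv(1) tangent_map_dS UT_iff norm_sgn sgn_div_norm)
qed

lemma tangent_map_inv:
 assumes h: "diffeo_S3 h" and a: "a : UT"
 shows "tangent_map (inv_into S3 h) (tangent_map h a) = a"
proof -
 have "tangent_map (%x. inv_into S3 h (h x)) a = tangent_map (inv_into S3 h) (tangent_map h a)"
  by (rule tangent_map_compose[OF diffeo_S3D(5,6)[OF h] _ UT_S3[OF a]]) (simp only: diffeo_S3D(8)[OF h] order_refl)
 moreover have "tangent_map (%x. inv_into S3 h (h x)) a = tangent_map (%x. x) a"
  by (rule tangent_map_cong_S3[OF _ a]) (rule diffeo_S3D(3)[OF h])
 ultimately show ?thesis using tangent_map_id[OF a] by simp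
qed

text \<open>Isotopic curves depend on the isotopy only through its time-1 map, and on this map only
  through its values on the sphere; this form is stable under composition and inversion.\<close>

definition iso_end :: "(real^4 => real^4) => bool" where
 "iso_end h \<longleftrightarrow> (EX H. ambient_isotopy H & (ALL x:S3. H 1 x = h x))"

lemma iso_end_diffeo: "iso_end h ==> diffeo_S3 h"
proof -
 assume "iso_end h"
 then obtain H where H: "ambient_isotopy H" "ALL x:S3. H 1 x = h x"
  unfolding iso_end_def by blast
 hence "diffeo_S3 (H 1)" unfolding ambient_isotopy_def by simp
 thus ?thesis by (rule diffeo_S3_cong) (rule H(2)[rule_format])
qed

lemma iso_endE:
 assumes "iso_end h"
 obtains H :: "real => real^4 => real^4" where "extends_smoothly ({0..1} \<times> S3) (%p. H (fst p) (snd p))"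
   "!!t. t : {0..1} ==> diffeo_S3 (H t)" "!!x. x : S3 ==> H 0 x = x" "!!x. x : S3 ==> H 1 x = h x"
proof -
 obtain H where H: "ambient_isotopy H" "ALL x:S3. H 1 x = h x"
  using assms unfolding iso_end_def by blast
 show thesis
  by (rule that[of H]) (use H in \<open>simp_all add: ambient_isotopy_def case_prod_unfold\<close>)
qed

lemma iso_end_of: "ambient_isotopy H ==> iso_end (H 1)"
 unfolding iso_end_def by auto

lemma iso_end_cong: "iso_end h ==> (!!x. x : S3 ==> h x = k x) ==> iso_end k"
 unfolding iso_end_def by auto

lemma extends_smoothly_fst: "extends_smoothly (S :: ('a::euclidean_space \<times> 'b::euclidean_space) set) fst"
 by (rule extends_smoothlyI[OF smooth_fst[OF open_UNIV] subset_UNIV])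

lemma extends_smoothly_snd: "extends_smoothly (S :: ('a::euclidean_space \<times> 'b::euclidean_space) set) snd"
 by (rule extends_smoothlyI[OF smooth_snd[OF open_UNIV] subset_UNIV])

lemma iso_end_id: "iso_end (%x. x)"
proof -
 have "extends_smoothly ({0..1::real} \<times> S3) (%(t, x). x)"
  using extends_smoothly_snd[of "{0..1::real} \<times> S3"] by (simp add: case_prod_unfold)
 hence "ambient_isotopy (%t x. x)"
  by (simp only: ambient_isotopy_def diffeo_S3_id) blast
 thus ?thesis unfolding iso_end_def by blast
qed

lemma iso_end_compose:
 assumes "iso_end h" "iso_end k"
 shows "iso_end (%x. k (h x))"
proof -
 obtain H K :: "real => real^4 => real^4" where H: "extends_smoothly ({0..1} \<times> S3) (%p. H (fst p) (snd p))"
   "!!t. t : {0..1} ==> diffeo_S3 (H t)" "!!x. x : S3 ==> H 0 x = x" "!!x. x : S3 ==> H 1 x = h x"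
  and K: "extends_smoothly ({0..1} \<times> S3) (%p. K (fst p) (snd p))"
   "!!t. t : {0..1} ==> diffeo_S3 (K t)" "!!x. x : S3 ==> K 0 x = x" "!!x. x : S3 ==> K 1 x = k x"
  by (rule iso_endE[OF assms(1)], rule iso_endE[OF assms(2)], rule that)
 have "extends_smoothly ({0..1} \<times> S3) (%p. K (fst (fst p, H (fst p) (snd p))) (snd (fst p, H (fst p) (snd p))))"
 proof (rule extends_smoothly_compose[OF extends_smoothly_Pair[OF extends_smoothly_fst H(1)] K(1)])
  show "(%p. (fst p, H (fst p) (snd p))) ` ({0..1} \<times> S3) \<subseteq> {0..1} \<times> S3"
   using diffeo_S3D(1)[OF H(2)] by (simp add: image_subset_iff)
 qed
 hence "extends_smoothly ({0..1} \<times> S3) (%(t, x). K t (H t x))" by (simp add: case_prod_unfold)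
 moreover have "diffeo_S3 (%x. K t (H t x))" if "t : {0..1}" for t
  by (rule diffeo_S3_compose[OF H(2)[OF that] K(2)[OF that]])
 ultimately have "ambient_isotopy (%t x. K t (H t x))"
  unfolding ambient_isotopy_def using H(3) K(3) by simp
 moreover have "K 1 (H 1 x) = k (h x)" if "x : S3" for x
  using H(4)[OF that] K(4)[OF diffeo_S3D(1)[OF H(2)[of 1] that]] by simp
 ultimately show ?thesis unfolding iso_end_def by blast
qed

text \<open>The isotopy is run backwards as \<open>H (1 - t)\<close> after the inverse of the end
  map. Thus only one inverse occurs, and joint smoothness of the inverses of all \<open>H t\<close>
  never has to be shown.\<close>

lemma iso_end_inv:
 assumes "iso_end h"
 shows "iso_end (inv_into S3 h)"
proof -
 obtain H :: "real => real^4 => real^4" where H: "extends_smoothly ({0..1} \<times> S3) (%p. H (fst p) (snd p))"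
   "!!t. t : {0..1} ==> diffeo_S3 (H t)" "!!x. x : S3 ==> H 0 x = x" "!!x. x : S3 ==> H 1 x = h x" by (rule iso_endE[OF assms], rule that)
 note h = iso_end_diffeo[OF assms]
 define g where "g = inv_into S3 h"
 have g: "extends_smoothly S3 g" using diffeo_S3D(6)[OF h] by (simp add: g_def extends_smoothly_S3_iff)
 have gS: "g x : S3" if "x : S3" for x unfolding g_def by (rule diffeo_S3D(2)[OF h that])
 have "extends_smoothly ({0..1::real} \<times> S3) (%p. 1 - fst p)"
  by (rule extends_smoothlyI[OF smooth_diff[OF smooth_const[OF open_UNIV] smooth_fst[OF open_UNIV]] subset_UNIV])
 moreover have "extends_smoothly ({0..1::real} \<times> S3) (%p. g (snd p))"
  by (rule extends_smoothly_compose[OF extends_smoothly_snd g]) auto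
 ultimately have "extends_smoothly ({0..1} \<times> S3) (%p. (1 - fst p :: real, g (snd p)))"
  by (rule extends_smoothly_Pair)
 hence "extends_smoothly ({0..1} \<times> S3)
   (%p. H (fst (1 - fst p, g (snd p))) (snd (1 - fst p, g (snd p))))"
  by (rule extends_smoothly_compose[OF _ H(1)]) (use gS in \<open>simp add: image_subset_iff\<close>)
 hence "extends_smoothly ({0..1} \<times> S3) (%(t, x). H (1 - t) (g x))" by (simp add: case_prod_unfold)
 moreover have "diffeo_S3 (%x. H (1 - t) (g x))" if "t : {0..1}" for t
  unfolding g_def by (rule diffeo_S3_compose[OF diffeo_S3_inv[OF h] H(2)]) (use that in auto)
 moreover have "H (1 - 0) (g x) = x" "H (1 - 1) (g x) = g x" if "x : S3" for x
  using H(3,4)[OF gS[OF that]] diffeo_S3D(4)[OF h that] by (simp_all add: g_def)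
 ultimately show ?thesis
  unfolding iso_end_def ambient_isotopy_def g_def[symmetric] by (intro exI[of _ "%t x. H (1 - t) (g x)"]) auto
qed

lemma isotopic_iff: "A \<subseteq> UT ==> isotopic A A' \<longleftrightarrow> (EX h. iso_end h & A' = tangent_map h ` A)"
proof
 assume "isotopic A A'"
 thus "EX h. iso_end h & A' = tangent_map h ` A"
  using iso_end_of unfolding isotopic_def by blast
next
 assume A: "A \<subseteq> UT" and "EX h. iso_end h & A' = tangent_map h ` A"
 then obtain h H where h: "A' = tangent_map h ` A" "ambient_isotopy H" "!!x. x : S3 ==> H 1 x = h x"
  unfolding iso_end_def by blast
 have "tangent_map h ` A = tangent_map (H 1) ` A"
 proof (rule image_cong[OF HOL.refl])
  fix a assume "a : A"
  hence "a : UT" using A by blast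
  show "tangent_map h a = tangent_map (H 1) a" by (rule tangent_map_cong_S3[OF h(3)[symmetric] \<open>a : UT\<close>])
 qed
 thus "isotopic A A'" using h unfolding isotopic_def by blast
qed

lemma isotopic_UT: "isotopic A A' ==> A \<subseteq> UT ==> A' \<subseteq> UT"
 using tangent_map_UT[OF iso_end_diffeo] by (auto simp: isotopic_iff)

lemma isotopic_refl:
 assumes "A \<subseteq> UT" shows "isotopic A A"
proof -
 have "tangent_map (%x. x) ` A = (%a. a) ` A"
  by (rule image_cong[OF HOL.refl tangent_map_id]) (use assms in blast)
 thus ?thesis unfolding isotopic_iff[OF assms] using iso_end_id by (intro exI[of _ "%x. x"]) simp
qed

lemma tangent_map_iso_compose:
 assumes "iso_end h" "iso_end k" "A \<subseteq> UT"
 shows "tangent_map (%x. k (h x)) ` A = tangent_map k ` tangent_map h ` A"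
 unfolding image_image
proof (rule image_cong[OF HOL.refl])
 fix a assume "a : A"
 hence "fst a : S3" using assms(3) UT_S3 by blast
 thus "tangent_map (%x. k (h x)) a = tangent_map k (tangent_map h a)"
  by (intro tangent_map_compose[OF diffeo_S3D(5)[OF iso_end_diffeo] diffeo_S3D(5)[OF iso_end_diffeo]] assms)
   (simp only: diffeo_S3D(8)[OF iso_end_diffeo[OF assms(1)]] order_refl)
qed

lemma isotopic_trans:
 assumes "isotopic A B" "isotopic B C" "A \<subseteq> UT"
 shows "isotopic A C"
proof -
 obtain h where h: "iso_end h" "B = tangent_map h ` A" using assms by (auto simp: isotopic_iff)
 obtain k where k: "iso_end k" "C = tangent_map k ` B"
  using assms isotopic_UT[OF assms(1,3)] by (auto simp: isotopic_iff)
 show ?thesis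
  using iso_end_compose[OF h(1) k(1)] tangent_map_iso_compose[OF h(1) k(1) assms(3)] h(2) k(2)
  unfolding isotopic_iff[OF assms(3)] by (intro exI[of _ "%x. k (h x)"]) simp
qed

text \<open>The determinant of the frame never vanishes along an ambient isotopy, so its sign is constant.\<close>

lemma patch_iso_end:
 assumes "iso_end h" and e: "patch U e"
 shows "patch U (%q. h (e q))"
proof -
 obtain H :: "real => real^4 => real^4" where H: "extends_smoothly ({0..1} \<times> S3) (%p. H (fst p) (snd p))"
   "!!t. t : {0..1} ==> diffeo_S3 (H t)" "!!x. x : S3 ==> H 0 x = x" "!!x. x : S3 ==> H 1 x = h x"
  by (rule iso_endE[OF assms(1)], rule that)
 obtain W G where W: "{0..1} \<times> S3 \<subseteq> W" "smooth_on W G"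
   "!!t x. t : {0..1} ==> x : S3 ==> G (t, x) = H t x" using H(1) unfolding extends_smoothly_def by auto
 have pos: "frame_det (%q. h (e q)) q > 0" if q: "q : U" for q
 proof -
  let ?x = "e q" and ?D = "FD e q"
  have x: "?x : S3" by (rule patch_S3[OF e q])
  have tx: "?x \<bullet> ?D v = 0" for v by (rule patch_tangent[OF e q])
  define V where "V = {t::real. (t, ?x) : W}"
  have V: "open V" "{0..1} \<subseteq> V"
  proof -
   have "V = (%t. (t, ?x)) -` W" by (auto simp: V_def)
   thus "open V" using smooth_open[OF W(2)] by (auto intro!: open_vimage continuous_intros)
   show "{0..1} \<subseteq> V" using W(1) x by (auto simp: V_def)
  qed
  have sPair: "smooth_on V (%t. (t, ?x))" by (intro smooth_on_Pair smooth_id smooth_const V)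
  \<comment> \<open>Derivative of the extension \<open>G\<close> in a space direction. On tangent
    vectors it equals \<open>dS (H t)\<close>, but in this form its continuity in \<open>t\<close>
    is visible.\<close>
  define E where "E v t = FD G (t, ?x) (0, v)" for v t
  have E: "smooth_on V (E v)" for v unfolding E_def by (rule smooth_compose[OF sPair smooth_frechet[OF W(2)]]) (auto simp: V_def)
  have G: "smooth_on V (%t. G (t, ?x))" by (rule smooth_compose[OF sPair W(2)]) (auto simp: V_def)
  define d where "d t = det (vector [G (t, ?x), E (?D (axis 1 1)) t, E (?D (axis 2 1)) t, E (?D (axis 3 1)) t] :: real^4^4)" for t
  have "smooth_on V (%t. vector [G (t, ?x), E (?D (axis 1 1)) t, E (?D (axis 2 1)) t, E (?D (axis 3 1)) t] $ i $ j)"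
   for i j :: 4 using exhaust_4[of i] by (auto simp: vector_4 intro!: smooth_nth E G)
  hence "smooth_on V d" unfolding d_def by (intro smooth_det V)
  hence cont: "continuous_on {0..1} d" using continuous_on_subset[OF smooth_continuous V(2)] by blast
  have D: "((%q. H t (e q)) has_derivative (%v. dS (H t) ?x (?D v))) (at q)"
   "frame_det (%q. H t (e q)) q = d t" "d t ~= 0" if t: "t : {0..1}" for t
  proof -
   note Ht = diffeo_S3D[OF H(2)[OF t]]
   show D: "((%q. H t (e q)) has_derivative (%v. dS (H t) ?x (?D v))) (at q)"
    by (rule has_derivative_patch_compose[OF patch_has_derivative[OF e q] Ht(5) patch_open[OF e] q patch_image[OF e]])
   have dE: "dS (H t) ?x v = E v t" if v: "?x \<bullet> v = 0" for v
   proof -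
    have G': "((%x. G (t, x)) has_derivative (%v. FD G (t, y) (0, v))) (at y)"
     if "(t, y) : W" for y
    proof -
     have "((%x. (t, x)) has_derivative (%v. (0, v))) (at y)" by (intro has_derivative_Pair has_derivative_const has_derivative_ident)
     from diff_chain_at[OF this smooth_has_derivative[OF W(2) that]] show ?thesis by (simp add: o_def)
    qed
    have "open {x. (t, x) : W}"
    proof -
     have "{x. (t, x) : W} = (%x. (t, x)) -` W" by auto
     thus ?thesis using smooth_open[OF W(2)] by (auto intro!: open_vimage continuous_intros)
    qed
    hence "smooth_on {x. (t, x) : W} (%x. G (t, x))" by (intro smooth_compose[OF _ W(2)] smooth_on_Pair smooth_id smooth_const) auto
    hence "dS (%x. G (t, x)) ?x v = FD (%x. G (t, x)) ?x v" by (rule dS_of_smooth[OF _ _ x v]) (use W(1) t x in auto)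
    also have "\<dots> = E v t" unfolding E_def by (rule fun_cong[OF frechet_derivative_at[OF G', symmetric]]) (use W(1) t x in auto)
    finally have "dS (%x. G (t, x)) ?x v = E v t" .
    moreover have "dS (H t) ?x = dS (%x. G (t, x)) ?x" by (rule dS_cong[OF openin_subtopology_self x]) (rule W(3)[OF t, symmetric])
    ultimately show ?thesis by (simp only:)
   qed
   show *: "frame_det (%q. H t (e q)) q = d t" unfolding frame_det_def Let_def d_def frechet_derivative_at[OF D, symmetric]
    by (simp only: dE tx W(3)[OF t x])
   have nH: "norm (H t (e y)) = 1" if "y : U" for y using Ht(1)[OF patch_S3[OF e that]] by simp
   have "frame_det (%q. H t (e q)) q ~= 0"
   proof (rule frame_det_nonzero_iff[OF D patch_open[OF e] q nH, THEN iffD2, rule_format])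
    fix v assume "dS (H t) ?x (?D v) = 0"
    hence "?D v = 0" by (rule diffeo_dS_inj[OF H(2)[OF t] x tx])
    thus "v = 0" by (rule patch_derivative_inj[OF e q])
   qed
   thus "d t ~= 0" by (simp only: * not_False_eq_True)
  qed
  have c: "frame_det (%q. H 0 (e q)) q = frame_det e q" "frame_det (%q. H 1 (e q)) q = frame_det (%q. h (e q)) q"
  proof -
   have "FD (%q. H 0 (e q)) q = ?D" by (rule frechet_derivative_cong[OF patch_open[OF e] q]) (rule H(3)[OF patch_S3[OF e]])
   thus "frame_det (%q. H 0 (e q)) q = frame_det e q" unfolding frame_det_def H(3)[OF x] by simp
   have "FD (%q. H 1 (e q)) q = FD (%q. h (e q)) q" by (rule frechet_derivative_cong[OF patch_open[OF e] q]) (rule H(4)[OF patch_S3[OF e]])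
   thus "frame_det (%q. H 1 (e q)) q = frame_det (%q. h (e q)) q" unfolding frame_det_def H(4)[OF x] by simp
  qed
  have "d 0 > 0" using D(2)[of 0] c(1) e q by (auto simp: patch_def)
  have "d 1 > 0"
  proof (rule ccontr)
   assume "~ d 1 > 0"
   hence "EX t. 0 <= t & t <= 1 & d t = 0" using \<open>d 0 > 0\<close> by (intro IVT2'[OF _ _ _ cont]) auto
   thus False using D(3) by auto
  qed
  thus ?thesis using D(2)[of 1] c(2) by simp
 qed
 note h = diffeo_S3D[OF iso_end_diffeo[OF assms(1)]]
 show ?thesis
  unfolding patch_def
 proof (intro conjI ballI pos)
  show "smooth_on U (%q. h (e q))" by (rule smooth_patch_compose[OF patch_smooth[OF e] h(5) patch_image[OF e]])
  show "inj_on (%q. h (e q)) U" using comp_inj_on[OF patch_inj[OF e] inj_on_subset[OF h(7) patch_image[OF e]]] by (simp add: o_def)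
  show "(%q. h (e q)) ` U \<subseteq> S3" using h(1) patch_S3[OF e] by blast
 qed
qed

subsection \<open>Isotopies supported in a patch\<close>

text \<open>Every local isotopy below is a composition of isotopies \<open>x \<mapsto> x + t u x\<close> with \<open>u\<close> a contraction,
 for which no vector field has to be integrated. The set \<open>V\<close> is preserved.\<close>

definition wiggle :: "(real^3) set => (real^3) set => (real^3 => real^3) => bool" where
 "wiggle U V u \<longleftrightarrow> smooth_on UNIV u & (EX C. compact C & C \<subseteq> U & (ALL x. x ~: C --> u x = 0)) &
  (ALL x y. norm (u x - u y) <= norm (x - y) / 2) & (ALL x:V. u x : V)"

inductive moves :: "(real^3) set => (real^3) set => (real^3 => real^3) => bool" for U V where
 moves_id: "moves U V (%x. x)"
| moves_step: "moves U V h ==> wiggle U V u ==> moves U V (%x. h x + u (h x))"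

definition compact_diffeo :: "(real^3) set => (real^3 => real^3) => (real^3 => real^3) => bool" where
 "compact_diffeo U h g \<longleftrightarrow> smooth_on UNIV h & smooth_on UNIV g & (ALL x. g (h x) = x) & (ALL x. h (g x) = x) &
  (EX C. compact C & C \<subseteq> U & (ALL x. x ~: C --> h x = x))"

lemma compact_diffeo_image:
 assumes "compact_diffeo U h g" "x : U"
 shows "h x : U"
proof (rule ccontr)
 assume n: "h x ~: U"
 obtain C where C: "C \<subseteq> U" "!!x. x ~: C ==> h x = x" using assms(1) by (auto simp: compact_diffeo_def)
 have "h (h x) = h x" using n C by blast
 hence "h x = x" using assms(1) unfolding compact_diffeo_def by metis
 thus False using n assms(2) by simp
qed

lemma compact_diffeo_sym:
 assumes "compact_diffeo U h g"
 shows "compact_diffeo U g h"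
proof -
 obtain C where C: "compact C" "C \<subseteq> U" "!!x. x ~: C ==> h x = x" using assms by (auto simp: compact_diffeo_def)
 have "g x = x" if "x ~: C" for x
  using C(3)[OF that] assms unfolding compact_diffeo_def by metis
 thus ?thesis using assms C unfolding compact_diffeo_def by blast
qed

lemma compact_diffeo_compose:
 assumes "compact_diffeo U h g" "compact_diffeo U h' g'"
 shows "compact_diffeo U (%x. h' (h x)) (%x. g (g' x))"
proof -
 obtain C where C: "compact C" "C \<subseteq> U" "!!x. x ~: C ==> h x = x" using assms(1) by (auto simp: compact_diffeo_def)
 obtain C' where C': "compact C'" "C' \<subseteq> U" "!!x. x ~: C' ==> h' x = x" using assms(2) by (auto simp: compact_diffeo_def)
 have "smooth_on UNIV (%x. h' (h x))" "smooth_on UNIV (%x. g (g' x))"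
  using assms by (auto simp: compact_diffeo_def intro: smooth_compose[where W = UNIV])
 moreover have "EX C. compact C & C \<subseteq> U & (ALL x. x ~: C --> h' (h x) = x)"
  by (rule exI[of _ "C Un C'"]) (use C C' in auto)
 ultimately show ?thesis using assms by (auto simp: compact_diffeo_def)
qed

lemma compact_diffeo_id: "compact_diffeo U (%x. x) (%x. x)"
 unfolding compact_diffeo_def by (auto simp: smooth_id intro: exI[of _ "{}"])

lemma expanding_derivative_inj:
 fixes F :: "'a::real_normed_vector => 'b::real_normed_vector"
 assumes D: "(F has_derivative D) (at x)" and "c > 0"
  and ex: "!!x y. c * norm (x - y) <= norm (F x - F y)" and v: "D v = 0"
 shows "v = 0"
proof (rule ccontr)
 assume "v ~= 0"
 obtain d where d: "d > 0" "!!y. norm (y - x) < d ==> norm (F y - F x - D (y - x)) <= c / 2 * norm (y - x)"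
  using D \<open>c > 0\<close> unfolding has_derivative_at_alt by (metis half_gt_zero)
 define s where "s = d / (2 * norm v)"
 have s: "s > 0" "norm (s *\<^sub>R v) < d" using d \<open>v ~= 0\<close> by (auto simp: s_def)
 have "D (s *\<^sub>R v) = 0" using v linear_cmul[OF has_derivative_linear[OF D]] by simp
 hence "norm (F (x + s *\<^sub>R v) - F x) <= c / 2 * norm (s *\<^sub>R v)"
  using d(2)[of "x + s *\<^sub>R v"] s(2) by simp
 moreover have "c * norm (s *\<^sub>R v) <= norm (F (x + s *\<^sub>R v) - F x)"
  using ex[of "x + s *\<^sub>R v" x] by simp
 ultimately have "c * norm (s *\<^sub>R v) <= 0" by simp
 thus False using \<open>c > 0\<close> s(1) \<open>v ~= 0\<close> by (simp add: mult_le_0_iff)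
qed

text \<open>Distances shrink at most by the factor \<open>1 - |t| / 2 > 0\<close>, which makes the
  map injective and immersive. It is onto because \<open>y - t u x\<close> is a contraction in
  \<open>x\<close>, whose fixed point is the preimage of \<open>y\<close>. The bound 2 leaves an
  open interval around [0, 1] for the isotopy parameter.\<close>

lemma wiggle_compact_diffeo:
 assumes u: "wiggle U V u" and t: "\<bar>t\<bar> < 2"
 obtains g where "compact_diffeo U (%x. x + t *\<^sub>R u x) g"
proof -
 define F where "F x = x + t *\<^sub>R u x" for x
 have sm: "smooth_on UNIV u" and lip: "norm (u x - u y) <= norm (x - y) / 2" for x y
  using u by (auto simp: wiggle_def)
 have F: "smooth_on UNIV F"
  unfolding F_def by (intro smooth_add smooth_cmult sm smooth_id open_UNIV)
 have lip': "norm (t *\<^sub>R u x - t *\<^sub>R u y) <= \<bar>t\<bar> / 2 * norm (x - y)" for x y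
  using mult_left_mono[OF lip[of x y], of "\<bar>t\<bar>"] by (simp add: scaleR_diff_right[symmetric])
 have ex: "(1 - \<bar>t\<bar> / 2) * norm (x - y) <= norm (F x - F y)" for x y
 proof -
  have "norm (x - y) <= norm (F x - F y) + norm (t *\<^sub>R u x - t *\<^sub>R u y)"
   using norm_triangle_ineq4[of "F x - F y" "t *\<^sub>R u x - t *\<^sub>R u y"] by (simp add: F_def algebra_simps)
  thus ?thesis using lip'[of x y] by (simp add: algebra_simps)
 qed
 have c: "1 - \<bar>t\<bar> / 2 > 0" using t by simp
 have inj: "inj_on F UNIV"
 proof (rule inj_onI)
  fix x y assume "F x = F y"
  hence "(1 - \<bar>t\<bar> / 2) * norm (x - y) <= 0" using ex[of x y] by simp
  thus "x = y" using c by (simp add: mult_le_0_iff)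
 qed
 have surj: "F ` UNIV = UNIV"
 proof (rule UNIV_eq_I[symmetric])
  fix y
  have "EX! x. y - t *\<^sub>R u x = x"
   using t lip' by (intro banach_fix_type[of "\<bar>t\<bar> / 2"]) (auto simp: dist_norm norm_minus_commute)
  then obtain x where "y - t *\<^sub>R u x = x" by blast
  hence "y = F x" by (simp add: F_def algebra_simps)
  thus "y : range F" by blast
 qed
 have "v = 0" if "FD F x v = 0" for x v
  by (rule expanding_derivative_inj[OF smooth_has_derivative[OF F UNIV_I] c ex that])
 hence "smooth_on UNIV (inv F)"
  using smooth_inverse_function(2)[OF F inj] by (simp only: surj)
 moreover have "EX C. compact C & C \<subseteq> U & (ALL x. x ~: C --> F x = x)"
  using u by (auto simp: wiggle_def F_def)
 ultimately have "compact_diffeo U F (inv F)"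
  using F inj surj by (auto simp: compact_diffeo_def surj_f_inv_f)
 thus thesis using that unfolding F_def[abs_def] by blast
qed

lemma moves_compact_diffeo:
 assumes "moves U V h"
 obtains g where "compact_diffeo U h g"
proof -
 have "EX g. compact_diffeo U h g"
  using assms
 proof induction
  case moves_id
  show ?case using compact_diffeo_id by blast
 next
  case (moves_step h u)
  obtain g' where "compact_diffeo U (%x. x + 1 *\<^sub>R u x) g'" using wiggle_compact_diffeo[OF moves_step(2), of 1] by auto
  moreover obtain g where "compact_diffeo U h g" using moves_step by blast
  ultimately show ?case using compact_diffeo_compose[of U h g "%x. x + 1 *\<^sub>R u x" g'] by auto
 qed
 thus thesis using that by blast
qed

lemma moves_compose: "moves U V k ==> moves U V h ==> moves U V (%x. k (h x))"
 by (induction rule: moves.induct) (auto intro: moves_step)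

lemma moves_funpow: "moves U V h ==> moves U V (h ^^ n)"
 by (induction n) (auto simp: o_def id_def intro: moves_id moves_compose)

lemma wiggle_moves: "wiggle U V u ==> moves U V (%x. x + u x)"
 using moves_step[OF moves_id] by simp

text \<open>A contraction preserving a closed subspace has its fixed points there.\<close>

lemma moves_preserve:
 assumes "moves U V h" "subspace V"
 shows "h x : V \<longleftrightarrow> x : V"
 using assms(1)
proof induction
 case (moves_step h u)
 have "y + u y : V \<longleftrightarrow> y : V" for y
 proof
  assume z: "y + u y : V"
  define z where "z = y + u y"
  have uV: "u x : V" if "x : V" for x using moves_step(2) that by (auto simp: wiggle_def)
  have lip: "dist (u x) (u y) <= 1/2 * dist x y" for x y using moves_step(2) by (auto simp: wiggle_def dist_norm)
  have "EX! x. x : V & z - u x = x"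
  proof (rule Banach_fix)
   show "complete V" using assms(2) by (simp add: complete_subspace)
   show "V ~= {}" using subspace_0[OF assms(2)] by blast
   show "(%x. z - u x) ` V \<subseteq> V" using z uV subspace_diff[OF assms(2)] by (auto simp: z_def)
   show "dist (z - u x) (z - u y) <= 1/2 * dist x y" for x y using lip[of x y] by (simp add: dist_norm norm_minus_commute)
  qed auto
  then obtain x where x: "x : V" "z - u x = x" by blast
  have "y = x"
  proof -
   have "x - y = u y - u x" using x(2) by (simp add: z_def algebra_simps)
   hence "norm (x - y) = norm (u y - u x)" by simp
   also have "\<dots> <= norm (x - y) / 2" using lip[of y x] by (simp add: dist_norm norm_minus_commute)
   finally show ?thesis by simp
  qed
  thus "y : V" using x(1) by simp
 next
  assume "y : V"
  thus "y + u y : V" using moves_step(2) subspace_add[OF assms(2)] by (auto simp: wiggle_def)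
 qed
 thus ?case using moves_step.IH by simp
qed simp

definition push :: "(real^3) set => (real^3 => real^4) => (real^3 => real^3) => real^4 => real^4" where
 "push U e h x = (if x : e ` U then e (h (inv_into U e x)) else x)"

lemma push_patch: "patch U e ==> q : U ==> push U e h (e q) = e (h q)"
 by (auto simp: push_def patch_inj)

lemma push_outside: "x ~: e ` U ==> push U e h x = x"
 by (simp add: push_def)

lemma push_S3: "patch U e ==> (!!q. q : U ==> h q : U) ==> x : S3 ==> push U e h x : S3"
 unfolding push_def using patch_S3[of U e] inv_into_into[of x e U] by (simp del: mem_sphere)

lemma push_compose:
 assumes "patch U e" "!!q. q : U ==> h q : U"
 shows "push U e k (push U e h x) = push U e (%q. k (h q)) x"
proof (cases "x : e ` U")
 case True
 then obtain q where "q : U" "x = e q" by blast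
 thus ?thesis using assms by (simp add: push_patch)
qed (simp add: push_outside)

lemma push_support:
 assumes "patch U e" "!!q. q : U ==> q ~: C ==> h q = q" "x ~: e ` (U Int C)"
 shows "push U e h x = x"
proof (cases "x : e ` U")
 case True
 then obtain q where q: "q : U" "x = e q" by blast
 hence "h q = q" using assms(2,3) by blast
 thus ?thesis using q by (simp add: push_patch[OF assms(1)])
qed (simp add: push_outside)

text \<open>Two open pieces cover the sphere: over the image of \<open>U\<close> the map is read in
  the chart, and off the image of the compact support it is the identity. The parameter ranges over
  an open set because smoothness is defined on open sets.\<close>

lemma smooth_push_param:
 fixes h :: "real => real^3 => real^3"
 assumes e: "patch U e" and T: "open T" and h: "smooth_on (T \<times> UNIV) (%p. h (fst p) (snd p))"
  and C: "compact C" "C \<subseteq> U" "!!t x. t : T ==> x ~: C ==> h t x = x"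
  and U: "!!t x. t : T ==> x : U ==> h t x : U"
 shows "smooth_on (T \<times> (-{0})) (%(t, y). push U e (h t) (sgn y))"
proof -
 let ?f = "%p. push U e (h (fst p)) (sgn (snd p))"
 have oc: "open (cone (e ` U))" by (rule open_cone[OF patch_openin[OF e]])
 have eC: "compact (e ` C)"
  by (rule compact_continuous_image[OF continuous_on_subset[OF smooth_continuous[OF patch_smooth[OF e]] C(2)] C(1)])
 have "openin (top_of_set S3) (S3 - e ` C)"
  using openin_open_Int[of "- (e ` C)" S3] compact_imp_closed[OF eC] by (simp add: Diff_eq open_Compl)
 hence od: "open (cone (S3 - e ` C))" by (rule open_cone)
 have sm1: "smooth_on (T \<times> cone (e ` U)) ?f"
 proof -
  let ?W = "T \<times> cone (e ` U)"
  have oW: "open ?W" by (rule open_Times[OF T oc])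
  have q: "smooth_on ?W (%p. inv_into U e (sgn (snd p)))"
   by (rule smooth_compose[OF smooth_snd[OF oW], where W = "cone (e ` U)" and g = "%y. inv_into U e (sgn y)"])
    (use patch_smooth_inverse[OF e] in \<open>auto simp: smooth_at_S3_def\<close>)
  have "smooth_on ?W (%p. h (fst (fst p, inv_into U e (sgn (snd p)))) (snd (fst p, inv_into U e (sgn (snd p)))))"
   by (rule smooth_compose[OF smooth_on_Pair[OF smooth_fst[OF oW] q] h]) auto
  hence "smooth_on ?W (%p. e (h (fst p) (inv_into U e (sgn (snd p)))))" by (intro smooth_compose[OF _ patch_smooth[OF e]])
    (auto simp: cone_def intro!: U inv_into_into)
  thus ?thesis by (rule smooth_cong) (auto simp: push_def cone_def)
 qed
 have sm2: "smooth_on (T \<times> cone (S3 - e ` C)) ?f"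
 proof -
  let ?W = "T \<times> cone (S3 - e ` C)"
  have oW: "open ?W" by (rule open_Times[OF T od])
  have "smooth_on ?W (%p. sgn (snd p))" by (rule smooth_sgn[OF smooth_snd[OF oW]]) (auto simp: cone_def)
  thus ?thesis
  proof (rule smooth_cong)
   fix p assume p: "p : ?W"
   show "sgn (snd p) = ?f p" by (rule push_support[OF e, of C, symmetric]) (use p C(3) in \<open>auto simp: cone_def\<close>)
  qed
 qed
 have "T \<times> cone (e ` U) Un T \<times> cone (S3 - e ` C) = T \<times> (-{0})"
  using C(2) by (auto simp: cone_def norm_sgn)
 thus ?thesis using smooth_on_Un[OF sm1 sm2] by (simp add: case_prod_unfold)
qed

lemma smooth_push:
 assumes e: "patch U e" and h: "compact_diffeo U h g"
 shows "smooth_at_S3 S3 (push U e h)"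
proof -
 obtain C where C: "compact C" "C \<subseteq> U" "!!x. x ~: C ==> h x = x" using h by (auto simp: compact_diffeo_def)
 have "smooth_on (UNIV \<times> UNIV) (%p::real \<times> (real^3). h (snd p))"
  by (rule smooth_compose[OF smooth_snd, where W = UNIV]) (use h in \<open>auto simp: compact_diffeo_def\<close>)
 hence S: "smooth_on (UNIV \<times> (-{0})) (%(t::real, y). push U e h (sgn y))"
  by (intro smooth_push_param[OF e open_UNIV _ C(1,2)]) (use C(3) compact_diffeo_image[OF h] in auto)
 have P: "smooth_on (-{0}) (%y::real^4. (0::real, y))"
  by (intro smooth_on_Pair smooth_const smooth_id) auto
 have "smooth_on (-{0}) (%y. (%(t::real, y). push U e h (sgn y)) (0, y))"
  by (rule smooth_compose[OF P S]) auto
 thus ?thesis by (simp add: smooth_at_S3_def cone_S3)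
qed

lemma diffeo_push:
 assumes e: "patch U e" and h: "compact_diffeo U h g"
 shows "diffeo_S3 (push U e h)"
proof (rule diffeo_S3I[where g = "push U e g"])
 note h' = compact_diffeo_sym[OF h]
 note U = compact_diffeo_image[OF h] compact_diffeo_image[OF h']
 show "smooth_at_S3 S3 (push U e h)" by (rule smooth_push[OF e h])
 show "smooth_at_S3 S3 (push U e g)" by (rule smooth_push[OF e h'])
 show "push U e h x : S3" "push U e g x : S3" if "x : S3" for x
  by (rule push_S3[OF e U(1) that], assumption, rule push_S3[OF e U(2) that])
 have id: "push U e (%x. x) x = x" for x by (auto simp: push_def f_inv_into_f)
 show "push U e g (push U e h x) = x" "push U e h (push U e g x) = x" for x
  using h id by (simp_all add: push_compose[OF e U(1)] push_compose[OF e U(2)] compact_diffeo_def)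
qed

lemma iso_end_push_wiggle:
 assumes e: "patch U e" and u: "wiggle U V u"
 shows "iso_end (push U e (%x. x + u x))"
proof -
 let ?h = "%t x. x + t *\<^sub>R u x"
 let ?T = "{-2<..<2::real}"
 obtain C where C: "compact C" "C \<subseteq> U" "!!x. x ~: C ==> u x = 0" and sm: "smooth_on UNIV u"
  using u by (auto simp: wiggle_def)
 have oW: "open (?T \<times> (UNIV :: (real^3) set))" by (intro open_Times) auto
 have su: "smooth_on (?T \<times> UNIV) (%p. u (snd p))"
  by (rule smooth_compose[OF smooth_snd[OF oW] sm]) auto
 have "smooth_on (?T \<times> UNIV) (%p. ?h (fst p) (snd p))"
  by (intro smooth_add smooth_scaleR su smooth_fst smooth_snd oW)
 moreover have "?h t x : U" if "t : ?T" "x : U" for t x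
 proof -
  have "\<bar>t\<bar> < 2" using that(1) by auto
  then obtain g where "compact_diffeo U (?h t) g" by (rule wiggle_compact_diffeo[OF u])
  thus ?thesis using compact_diffeo_image that(2) by blast
 qed
 ultimately have "smooth_on (?T \<times> (-{0})) (%(t, y). push U e (?h t) (sgn y))"
  by (intro smooth_push_param[OF e _ _ C(1,2)]) (auto simp: C(3))
 hence "extends_smoothly ({0..1} \<times> S3) (%(t, x). push U e (?h t) x)"
  by (rule extends_smoothly_param_S3) auto
 moreover have "diffeo_S3 (push U e (?h t))" if t: "t : {0..1}" for t
 proof -
  have "\<bar>t\<bar> < 2" using t by auto
  then obtain g where "compact_diffeo U (?h t) g" by (rule wiggle_compact_diffeo[OF u])
  thus ?thesis by (rule diffeo_push[OF e])
 qed
 moreover have "push U e (?h 0) x = x" for x by (auto simp: push_def f_inv_into_f)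
 ultimately have "ambient_isotopy (%t. push U e (?h t))" unfolding ambient_isotopy_def by blast
 from iso_end_of[OF this] show ?thesis by simp
qed

lemma iso_end_push:
 assumes e: "patch U e" and h: "moves U V h"
 shows "iso_end (push U e h)"
 using h
proof induction
 case moves_id
 show ?case by (rule iso_end_cong[OF iso_end_id]) (auto simp: push_def f_inv_into_f)
next
 case (moves_step h u)
 obtain g where g: "compact_diffeo U h g" by (rule moves_compact_diffeo[OF moves_step(1)])
 show ?case
  by (rule iso_end_cong[OF iso_end_compose[OF moves_step.IH iso_end_push_wiggle[OF e moves_step(2)]]])
   (rule push_compose[OF e compact_diffeo_image[OF g]])
qed

subsection \<open>Realizing germs of diffeomorphisms by local isotopies\<close>

lemma norm_linear_le_sum_Basis:
 fixes D :: "'a::euclidean_space => 'b::real_normed_vector"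
 assumes "linear D" "!!b. b : Basis ==> norm (D b) <= M"
 shows "norm (D v) <= real DIM('a) * M * norm v"
proof -
 have "D v = (\<Sum>b\<in>Basis. (v \<bullet> b) *\<^sub>R D b)"
  by (subst euclidean_representation[of v, symmetric])
   (simp only: linear_sum[OF assms(1)] linear_cmul[OF assms(1)])
 also have "norm \<dots> <= (\<Sum>b\<in>(Basis::'a set). norm v * M)"
 proof (rule sum_norm_le)
  fix b :: 'a assume b: "b : Basis"
  have "\<bar>v \<bullet> b\<bar> * norm (D b) <= norm v * M" using Basis_le_norm[OF b] assms(2)[OF b] by (intro mult_mono) auto
  thus "norm ((v \<bullet> b) *\<^sub>R D b) <= norm v * M" by simp
 qed
 finally show ?thesis by (simp add: mult_ac)
qed

lemma lipschitz_of_derivative_bound: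
 fixes u :: "'a::euclidean_space => 'b::real_normed_vector"
 assumes "!!x. (u has_derivative D x) (at x)" "!!x v. norm (D x v) <= L * norm v"
 shows "norm (u x - u y) <= L * norm (x - y)"
proof (rule differentiable_bound[OF convex_UNIV, where f' = D])
 show "onorm (D x) <= L" for x
  by (rule onorm_le) (rule assms(2))
qed (use assms(1) in auto)

lemma compact_support_lipschitz:
 fixes w :: "'a::euclidean_space => 'b::real_normed_vector"
 assumes w: "smooth_on UNIV w" and C: "compact C" "!!x. x ~: C ==> w x = 0"
 obtains L where "L > 0" "!!x y. norm (w x - w y) <= L * norm (x - y)"
  "!!x v. norm (FD w x v) <= L * norm v"
proof -
 let ?D = "%x. FD w x"
 have off: "?D x v = 0" if "x ~: C" for x v
 proof -
  have "?D x = FD (%x. 0) x" by (rule frechet_derivative_cong[of "- C"]) (use that C compact_imp_closed in auto)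
  thus ?thesis by simp
 qed
 have "EX M. ALL x. norm (?D x b) <= M" for b
 proof -
  have "continuous_on C (%x. ?D x b)" using smooth_continuous[OF smooth_frechet[OF w]] continuous_on_subset by blast
  hence "bounded ((%x. ?D x b) ` C)" using compact_continuous_image[OF _ C(1)] compact_imp_bounded by blast
  then obtain M where M: "!!x. x : C ==> norm (?D x b) <= M" unfolding bounded_iff by auto
  have "norm (?D x b) <= max M 0" for x using M[of x] off[of x b] by (cases "x : C") auto
  thus ?thesis by blast
 qed
 then obtain M where M: "!!b x. norm (?D x b) <= M b" by metis
 define K where "K = (\<Sum>b\<in>Basis. M b)"
 have M0: "M b >= 0" for b using M[of 0 b] norm_ge_zero order_trans by blast
 have K: "norm (?D x b) <= K" if "b : Basis" for x b
  using M[of x b] member_le_sum[of b Basis M] M0 that unfolding K_def by fastforce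
 have K0: "K >= 0" unfolding K_def by (intro sum_nonneg M0)
 define L where "L = real DIM('a) * K + 1"
 have L: "norm (?D x v) <= L * norm v" for x v
 proof -
  have "norm (?D x v) <= real DIM('a) * K * norm v"
   by (rule norm_linear_le_sum_Basis[OF has_derivative_linear[OF smooth_has_derivative[OF w UNIV_I]] K])
  also have "\<dots> <= L * norm v" by (intro mult_right_mono) (auto simp: L_def)
  finally show ?thesis .
 qed
 show thesis
 proof (rule that[of L])
  show "L > 0" using K0 by (simp add: L_def add_nonneg_pos)
  show "norm (w x - w y) <= L * norm (x - y)" for x y by (rule lipschitz_of_derivative_bound[OF smooth_has_derivative[OF w UNIV_I] L])
 qed (rule L)
qed

text \<open>Realizability inside every ball around 0, however small, so that the isotopy can be kept
  away from strands passing at a distance. The subspace \<open>V\<close>, later the branching axis,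
  is respected by every step.\<close>

definition germ_ok :: "(real^3) set => (real^3 => real^3) => bool" where
 "germ_ok V A \<longleftrightarrow> (ALL de>0. EX h. moves (ball 0 de) V h & (EX ep>0. ALL x:ball 0 ep. h x = A x))"

text \<open>A compactly supported smooth field is Lipschitz, so a small multiple of it is a
  contraction. Large displacements are obtained later by iterating such small steps.\<close>

lemma small_multiple_wiggle:
 assumes w: "smooth_on UNIV w" and C: "compact C" "C \<subseteq> U" "!!x. x ~: C ==> w x = 0"
  and V: "subspace V" "!!x. x : V ==> w x : V"
 obtains s0 :: real where "s0 > 0" "!!s. \<bar>s\<bar> <= s0 ==> wiggle U V (%x. s *\<^sub>R w x)"
proof -
 have "EX L>0. ALL x y. norm (w x - w y) <= L * norm (x - y)"
  by (rule compact_support_lipschitz[OF w C(1,3)]) auto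
 then obtain L where L: "L > 0" "!!x y. norm (w x - w y) <= L * norm (x - y)" by blast
 show thesis
 proof (rule that[of "1 / (2 * L)"])
  show "1 / (2 * L) > 0" using L(1) by simp
  show "wiggle U V (%x. s *\<^sub>R w x)" if s: "\<bar>s\<bar> <= 1 / (2 * L)" for s unfolding wiggle_def
  proof (intro conjI allI ballI)
   show "smooth_on UNIV (%x. s *\<^sub>R w x)" by (rule smooth_cmult[OF w])
   show "EX C. compact C & C \<subseteq> U & (ALL x. x ~: C --> s *\<^sub>R w x = 0)" using C by (intro exI[of _ C]) auto
   show "s *\<^sub>R w x : V" if "x : V" for x using V that subspace_scale by blast
   show "norm (s *\<^sub>R w x - s *\<^sub>R w y) <= norm (x - y) / 2" for x y
   proof -
    have "norm (s *\<^sub>R w x - s *\<^sub>R w y) = \<bar>s\<bar> * norm (w x - w y)" by (simp add: scaleR_diff_right[symmetric])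
    also have "\<dots> <= (1 / (2 * L)) * (L * norm (x - y))" using s L by (intro mult_mono) auto
    also have "\<dots> = norm (x - y) / 2" using L(1) by simp
    finally show ?thesis .
   qed
  qed
 qed
qed

lemma germ_ok_compose:
 assumes A: "germ_ok V A" and B: "germ_ok V B" and lin: "isCont B 0" "B 0 = 0"
 shows "germ_ok V (%x. A (B x))"
 unfolding germ_ok_def
proof (intro allI impI)
 fix de :: real assume "de > 0"
 then obtain h k ep ep' where h: "moves (ball 0 de) V h" "ep > 0" "!!x. x : ball 0 ep ==> h x = A x"
  and k: "moves (ball 0 de) V k" "ep' > 0" "!!x. x : ball 0 ep' ==> k x = B x"
  using A B unfolding germ_ok_def by metis
 obtain d where d: "d > 0" "!!x. dist x 0 < d ==> dist (B x) (B 0) < ep"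
  using lin(1) h(2) unfolding continuous_at_eps_delta by metis
 show "EX h. moves (ball 0 de) V h & (EX ep>0. ALL x:ball 0 ep. h x = A (B x))"
 proof (intro exI conjI ballI)
  show "moves (ball 0 de) V (%x. h (k x))" by (rule moves_compose[OF h(1) k(1)])
  show "min d ep' > 0" using d k by simp
  show "h (k x) = A (B x)" if "x : ball 0 (min d ep')" for x using that d(2)[of x] k(3)[of x] h(3)[of "B x"] lin(2) by (simp add: dist_norm)
 qed
qed

lemma germ_ok_cong: "germ_ok V A ==> (!!x. A x = B x) ==> germ_ok V B"
 by (simp add: germ_ok_def)

lemma germ_ok_id: "germ_ok V (%x. x)"
 unfolding germ_ok_def using moves_id by (metis zero_less_one)

lemma unit_bump:
 obtains th :: "real^3 => real" and C rh where "smooth_on UNIV th" "compact C" "C \<subseteq> ball 0 1" "!!x. x ~: C ==> th x = 0"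
  "rh > 0" "!!x. x : ball 0 rh ==> th x = 1" "!!x. 0 <= th x" "!!x. th x <= 1"
proof (rule bump_function_exists[of "cball (0::real^3) (1/2)" "ball 0 1"])
 fix et C' W
 assume H: "smooth_on UNIV et" "!!x. 0 <= et x" "!!x. et x <= (1::real)"
  "open W" "cball (0::real^3) (1/2) \<subseteq> W" "!!x. x : W ==> et x = 1"
  "compact C'" "C' \<subseteq> ball 0 1" "!!x. x ~: C' ==> et x = 0"
 show thesis
 proof (rule that[OF H(1,7,8,9)])
  show "(1/2::real) > 0" by simp
  show "et x = 1" if "x : ball 0 (1/2)" for x using that H(5,6) by force
 qed (use H in auto)
qed auto

text \<open>The cut-off \<open>th (x / de)\<close> times the linear map \<open>N\<close> has a
  Lipschitz constant independent of the scale \<open>de\<close>, so the same range of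
  \<open>t\<close> works in every ball.\<close>

lemma germ_ok_near_id:
 assumes N: "linear N" "!!x. x : V ==> N x : V" and V: "subspace V"
 obtains s where "s > 0" "!!t. \<bar>t\<bar> <= s ==> germ_ok V (%x. x + t *\<^sub>R N x)"
proof -
 obtain th :: "real^3 => real" and C rh where th: "smooth_on UNIV th" "compact C" "C \<subseteq> ball 0 1" "!!x. x ~: C ==> th x = 0"
  "rh > 0" "!!x. x : ball 0 rh ==> th x = 1" by (rule unit_bump, rule that)
 define w where "w x = th x *\<^sub>R N x" for x
 have bN: "bounded_linear N" using N(1) by (simp add: linear_conv_bounded_linear)
 have w: "smooth_on UNIV w"
  unfolding w_def by (intro smooth_scaleR th(1) smooth_linear[OF bN]) auto
 obtain L where L: "L > 0" "!!x y. norm (w x - w y) <= L * norm (x - y)"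
  by (rule compact_support_lipschitz[OF w th(2)]) (auto simp: w_def th(4))
 show thesis
 proof (rule that[of "1 / (2 * L)"])
  show "1 / (2 * L) > 0" using L by simp
  fix t assume t: "\<bar>t\<bar> <= 1 / (2 * L)"
  show "germ_ok V (%x. x + t *\<^sub>R N x)" unfolding germ_ok_def
  proof (intro allI impI)
   fix de :: real assume de: "de > 0"
   define u where "u x = (t * de) *\<^sub>R w (x /\<^sub>R de)" for x
   have u: "u x = (t * th (x /\<^sub>R de)) *\<^sub>R N x" for x using de by (simp add: u_def w_def linear_cmul[OF N(1)])
   have "wiggle (ball 0 de) V u" unfolding wiggle_def
   proof (intro conjI allI ballI)
    have "smooth_on UNIV (%x. w (x /\<^sub>R de))" by (rule smooth_compose[OF smooth_cmult[OF smooth_id] w]) auto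
    thus "smooth_on UNIV u" unfolding u_def by (intro smooth_cmult)
    show "EX C. compact C & C \<subseteq> ball 0 de & (ALL x. x ~: C --> u x = 0)"
    proof (intro exI conjI allI impI)
     show "compact ((%x. de *\<^sub>R x) ` C)" by (rule compact_scaling[OF th(2)])
     show "(%x. de *\<^sub>R x) ` C \<subseteq> ball 0 de" using th(3) de by (auto simp: subset_iff)
     show "u x = 0" if "x ~: (%x. de *\<^sub>R x) ` C" for x
     proof -
      have "x /\<^sub>R de ~: C"
      proof
       assume "x /\<^sub>R de : C"
       hence "de *\<^sub>R (x /\<^sub>R de) : (%x. de *\<^sub>R x) ` C" by blast
       thus False using that de by simp
      qed
      thus ?thesis using th(4) u by simp
     qed
    qed
    show "norm (u x - u y) <= norm (x - y) / 2" for x y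
    proof -
     have "norm (u x - u y) = \<bar>t\<bar> * de * norm (w (x /\<^sub>R de) - w (y /\<^sub>R de))"
      using de by (simp add: u_def scaleR_diff_right[symmetric] abs_mult)
     also have "\<dots> <= \<bar>t\<bar> * de * (L * norm (x /\<^sub>R de - y /\<^sub>R de))" using de by (intro mult_left_mono L) auto
     also have "\<dots> = \<bar>t\<bar> * L * norm (x - y)" using de by (simp add: scaleR_diff_right[symmetric] divide_inverse)
     also have "\<dots> <= (1 / 2) * norm (x - y)" using t L(1) by (intro mult_right_mono) (auto simp: field_simps)
     finally show ?thesis by simp
    qed
    show "u x : V" if "x : V" for x unfolding u by (intro subspace_scale[OF V] N(2) that)
   qed
   hence "moves (ball 0 de) V (%x. x + u x)" by (rule wiggle_moves)
   moreover have "x + u x = x + t *\<^sub>R N x" if "x : ball 0 (rh * de)" for x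
   proof -
    have "x /\<^sub>R de : ball 0 rh" using that de by (simp add: field_simps)
    thus ?thesis using th(6) u by simp
   qed
   ultimately show "EX h. moves (ball 0 de) V h & (EX ep>0. ALL x:ball 0 ep. h x = x + t *\<^sub>R N x)"
    using de th(5) by (intro exI[of _ "%x. x + u x"] conjI exI[of _ "rh * de"]) auto
  qed
 qed
qed

text \<open>As \<open>N\<close> squares to 0, coefficients add under composition, and a large shear
  is an iterate of a small one.\<close>

lemma germ_ok_shear:
 assumes N: "linear N" "!!x. x : V ==> N x : V" "!!x. N (N x) = 0" and V: "subspace V"
 shows "germ_ok V (%x. x + c *\<^sub>R N x)"
proof -
 obtain s where s: "s > 0" "!!t. \<bar>t\<bar> <= s ==> germ_ok V (%x. x + t *\<^sub>R N x)"
  using germ_ok_near_id[OF N(1,2) V] by blast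
 obtain n :: nat where n: "\<bar>c\<bar> / s < real n" using reals_Archimedean2 by blast
 hence n0: "n > 0" using s(1) by (cases n) (auto simp: divide_less_0_iff)
 have "germ_ok V (%x. x + (real k * (c / n)) *\<^sub>R N x)" for k
 proof (induction k)
  case 0
  thus ?case using germ_ok_id by simp
 next
  case (Suc k)
  have "\<bar>c / n\<bar> <= s" using n n0 s(1) by (simp add: field_simps)
  hence g: "germ_ok V (%x. x + (c / n) *\<^sub>R N x)" by (rule s(2))
  have "bounded_linear (%x. x + (c / n) *\<^sub>R N x)"
   using N(1) by (intro bounded_linear_add bounded_linear_ident bounded_linear_scaleR_right bounded_linear_compose[of "%x. (c/n) *\<^sub>R x" N])
    (auto simp: linear_conv_bounded_linear bounded_linear_scaleR_right)
  hence "isCont (%x. x + (c / n) *\<^sub>R N x) 0" by (rule linear_continuous_at)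
  from germ_ok_compose[OF Suc g this] show ?case by (rule germ_ok_cong[rotated 2, OF _ _ ])
    (simp_all add: linear_0[OF N(1)] linear_add[OF N(1)] linear_cmul[OF N(1)] linear_diff[OF N(1)] N(3) algebra_simps add_divide_distrib)
 qed
 from this[of n] show ?thesis using n0 by simp
qed

text \<open>As \<open>N\<close> is idempotent, factors multiply under composition, and a root of
  \<open>c\<close> of high order is as close to 1 as needed.\<close>

lemma germ_ok_dilate:
 assumes N: "linear N" "!!x. x : V ==> N x : V" "!!x. N (N x) = N x" and V: "subspace V" and c: "c > 0"
 shows "germ_ok V (%x. x + (c - 1) *\<^sub>R N x)"
proof -
 obtain s where s: "s > 0" "!!t. \<bar>t\<bar> <= s ==> germ_ok V (%x. x + t *\<^sub>R N x)"
  using germ_ok_near_id[OF N(1,2) V] by blast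
 have "(%n. root n c) \<longlonglongrightarrow> 1" by (rule LIMSEQ_root_const[OF c])
 hence "\<forall>\<^sub>F n in sequentially. dist (root n c) 1 < s" using s(1) by (simp add: tendsto_iff)
 then obtain n where n: "n > 0" "\<bar>root n c - 1\<bar> <= s"
  by (metis (no_types, lifting) dist_real_def eventually_sequentially less_eq_real_def max.cobounded1 max.cobounded2 order_less_le_trans zero_less_one)
 define d where "d = root n c"
 have g: "germ_ok V (%x. x + (d - 1) *\<^sub>R N x)" using s(2)[OF n(2)] by (simp add: d_def)
 have "germ_ok V (%x. x + (d ^ k - 1) *\<^sub>R N x)" for k
 proof (induction k)
  case 0
  thus ?case using germ_ok_id by simp
 next
  case (Suc k)
  have "bounded_linear (%x. x + (d - 1) *\<^sub>R N x)"
   using N(1) by (intro bounded_linear_add bounded_linear_ident bounded_linear_compose[of "%x. (d - 1) *\<^sub>R x" N])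
    (auto simp: linear_conv_bounded_linear bounded_linear_scaleR_right)
  hence "isCont (%x. x + (d - 1) *\<^sub>R N x) 0" by (rule linear_continuous_at)
  from germ_ok_compose[OF Suc g this] show ?case by (rule germ_ok_cong[rotated 2, OF _ _ ])
    (simp_all add: linear_0[OF N(1)] linear_add[OF N(1)] linear_cmul[OF N(1)] linear_diff[OF N(1)] N(3) algebra_simps add_divide_distrib)
 qed
 from this[of n] show ?thesis using n c by (simp add: d_def)
qed

section \<open>Linear germs by row operations\<close>

definition mat3 :: "real => real => real => real => real => real => real => real => real => real^3 => real^3" where
 "mat3 a b c d e f g h i x = vector [a * x $ 1 + b * x $ 2 + c * x $ 3,
  d * x $ 1 + e * x $ 2 + f * x $ 3, g * x $ 1 + h * x $ 2 + i * x $ 3]"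

lemma mat3_nth:
 "mat3 a b c d e f g h i x $ 1 = a * x $ 1 + b * x $ 2 + c * x $ 3"
 "mat3 a b c d e f g h i x $ 2 = d * x $ 1 + e * x $ 2 + f * x $ 3"
 "mat3 a b c d e f g h i x $ 3 = g * x $ 1 + h * x $ 2 + i * x $ 3"
 by (simp_all add: mat3_def)

lemma linear_mat3: "linear (mat3 a b c d e f g h i)"
 by (rule linearI) (simp_all add: vec_eq_iff forall_3 mat3_nth algebra_simps)

lemma isCont_mat3: "isCont (mat3 a b c d e f g h i) x"
 using linear_mat3 by (simp add: linear_conv_bounded_linear linear_continuous_at)

lemma mat3_zero: "mat3 a b c d e f g h i 0 = 0"
 by (rule linear_0[OF linear_mat3])

definition x_axis :: "(real^3) set" where
 "x_axis = {x. x $ 2 = 0 & x $ 3 = 0}"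

lemma subspace_x_axis: "subspace x_axis"
 by (auto simp: x_axis_def subspace_def)

text \<open>For \<open>V = x_axis\<close> the upper triangular operations, which keep the axis, are
  enough; adding the first row to a lower one would tilt it. Scaling factors are positive because a
  dilation is reached from the identity by iterating small ones.\<close>

lemma germ_ok_row_ops:
 assumes "germ_ok V (mat3 a b c d e f g h i)" and V: "V = UNIV | V = x_axis"
 shows "germ_ok V (mat3 (a + k * d) (b + k * e) (c + k * f) d e f g h i)" (is ?r12)
  and "germ_ok V (mat3 (a + k * g) (b + k * h) (c + k * i) d e f g h i)" (is ?r13)
  and "germ_ok V (mat3 a b c (d + k * g) (e + k * h) (f + k * i) g h i)" (is ?r23)
  and "k > 0 ==> germ_ok V (mat3 (k * a) (k * b) (k * c) d e f g h i)"
  and "k > 0 ==> germ_ok V (mat3 a b c (k * d) (k * e) (k * f) g h i)"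
  and "k > 0 ==> germ_ok V (mat3 a b c d e f (k * g) (k * h) (k * i))"
  and "V = UNIV ==> germ_ok V (mat3 a b c (d + k * a) (e + k * b) (f + k * c) g h i)"
  and "V = UNIV ==> germ_ok V (mat3 a b c d e f (g + k * a) (h + k * b) (i + k * c))"
  and "V = UNIV ==> germ_ok V (mat3 a b c d e f (g + k * d) (h + k * e) (i + k * f))"
proof -
 note cmp = germ_ok_compose[OF _ assms(1) isCont_mat3 mat3_zero]
 have sV: "subspace V" using V subspace_x_axis by auto
 \<comment> \<open>The equations \<open>z\<close> make the square of the off-diagonal matrix vanish,
   as \<open>germ_ok_shear\<close> requires; every operation below has a single nonzero
   entry.\<close>
 have shear: "germ_ok V (%x. x + k *\<^sub>R mat3 0 r s t 0 u v w 0 x)"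
  if z: "r * t = 0" "t * r = 0" "r * u = 0" "s * v = 0" "v * s = 0" "s * w = 0" "t * s = 0" "u * v = 0"
   "u * w = 0" "w * u = 0" "v * r = 0" "w * t = 0" and
   tv: "V = UNIV | t = 0 & v = 0" for r s t u v w
 proof (rule germ_ok_shear[OF linear_mat3 _ _ sV])
  show "mat3 0 r s t 0 u v w 0 x : V" if "x : V" for x using tv that V by (auto simp: x_axis_def mat3_nth)
  show "mat3 0 r s t 0 u v w 0 (mat3 0 r s t 0 u v w 0 x) = 0" for x
   by (simp add: vec_eq_iff forall_3 mat3_nth distrib_left mult.assoc[symmetric] z)
 qed
 have dil: "germ_ok V (%x. x + (k - 1) *\<^sub>R mat3 r 0 0 0 s 0 0 0 t x)"
  if "k > 0" "r * r = r" "s * s = s" "t * t = t" for r s t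
 proof (rule germ_ok_dilate[OF linear_mat3 _ _ sV that(1)])
  show "mat3 r 0 0 0 s 0 0 0 t x : V" if "x : V" for x using that V by (auto simp: x_axis_def mat3_nth)
  show "mat3 r 0 0 0 s 0 0 0 t (mat3 r 0 0 0 s 0 0 0 t x) = mat3 r 0 0 0 s 0 0 0 t x" for x
   using that(2-) by (simp add: vec_eq_iff forall_3 mat3_nth mult.assoc[symmetric])
 qed
 note vs = vec_eq_iff forall_3 mat3_nth algebra_simps
 show ?r12 by (rule germ_ok_cong[OF cmp[OF shear[where r = 1 and s = 0 and t = 0 and u = 0 and v = 0 and w = 0]]]) (simp_all add: vs)
 show ?r13 by (rule germ_ok_cong[OF cmp[OF shear[where r = 0 and s = 1 and t = 0 and u = 0 and v = 0 and w = 0]]]) (simp_all add: vs)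
 show ?r23 by (rule germ_ok_cong[OF cmp[OF shear[where r = 0 and s = 0 and t = 0 and u = 1 and v = 0 and w = 0]]]) (simp_all add: vs)
 show "germ_ok V (mat3 (k * a) (k * b) (k * c) d e f g h i)" if "k > 0"
  by (rule germ_ok_cong[OF cmp[OF dil[OF that, of 1 0 0]]]) (simp_all add: vs)
 show "germ_ok V (mat3 a b c (k * d) (k * e) (k * f) g h i)" if "k > 0"
  by (rule germ_ok_cong[OF cmp[OF dil[OF that, of 0 1 0]]]) (simp_all add: vs)
 show "germ_ok V (mat3 a b c d e f (k * g) (k * h) (k * i))" if "k > 0"
  by (rule germ_ok_cong[OF cmp[OF dil[OF that, of 0 0 1]]]) (simp_all add: vs)
 show "germ_ok V (mat3 a b c (d + k * a) (e + k * b) (f + k * c) g h i)" if "V = UNIV"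
  by (rule germ_ok_cong[OF cmp[OF shear[where r = 0 and s = 0 and t = 1 and u = 0 and v = 0 and w = 0]]]) (use that in \<open>simp_all add: vs\<close>)
 show "germ_ok V (mat3 a b c d e f (g + k * a) (h + k * b) (i + k * c))" if "V = UNIV"
  by (rule germ_ok_cong[OF cmp[OF shear[where r = 0 and s = 0 and t = 0 and u = 0 and v = 1 and w = 0]]]) (use that in \<open>simp_all add: vs\<close>)
 show "germ_ok V (mat3 a b c d e f (g + k * d) (h + k * e) (i + k * f))" if "V = UNIV"
  by (rule germ_ok_cong[OF cmp[OF shear[where r = 0 and s = 0 and t = 0 and u = 0 and v = 0 and w = 1]]]) (use that in \<open>simp_all add: vs\<close>)
qed

lemma germ_ok_upper_triangular:
 assumes pos: "a > 0" "e > 0" "i > 0" and V: "V = UNIV | V = x_axis"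
 shows "germ_ok V (mat3 a b c 0 e f 0 0 i)"
proof -
 have "germ_ok V (mat3 1 0 0 0 1 0 0 0 1)"
  by (rule germ_ok_cong[OF germ_ok_id]) (simp add: vec_eq_iff forall_3 mat3_nth)
 from germ_ok_row_ops(4)[OF this V pos(1)]
 have "germ_ok V (mat3 a 0 0 0 1 0 0 0 1)" by simp
 from germ_ok_row_ops(5)[OF this V pos(2)]
 have "germ_ok V (mat3 a 0 0 0 e 0 0 0 1)" by simp
 from germ_ok_row_ops(6)[OF this V pos(3)]
 have "germ_ok V (mat3 a 0 0 0 e 0 0 0 i)" by simp
 from germ_ok_row_ops(1)[OF this V, of "b / e"]
 have "germ_ok V (mat3 a b 0 0 e 0 0 0 i)" using pos by simp
 from germ_ok_row_ops(2)[OF this V, of "c / i"]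
 have "germ_ok V (mat3 a b c 0 e 0 0 0 i)" using pos by simp
 from germ_ok_row_ops(3)[OF this V, of "f / i"]
 show ?thesis using pos by simp
qed

text \<open>Gaussian elimination by row additions only: a nonzero entry below the pivot makes it possible to
 turn the pivot into 1 without scaling a row.\<close>

lemma germ_ok_mat3:
 assumes "a * (e * i - f * h) - b * (d * i - f * g) + c * (d * h - e * g) > 0"
 shows "germ_ok UNIV (mat3 a b c d e f g h i)"
proof -
 let ?ok = "%a b c d e f g h i. germ_ok UNIV (mat3 a b c d e f g h i)"
 \<comment> \<open>Row operations read backwards: the operation with the factor \<open>- k\<close>
   undoes the one with \<open>k\<close>, so the goal may be replaced by a simplified matrix.\<close>
 have ops: "?ok (a + k * d) (b + k * e) (c + k * f) d e f g h i ==> ?ok a b c d e f g h i"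
  "?ok a b c (d + k * g) (e + k * h) (f + k * i) g h i ==> ?ok a b c d e f g h i"
  "?ok a b c (d + k * a) (e + k * b) (f + k * c) g h i ==> ?ok a b c d e f g h i"
  "?ok a b c d e f (g + k * a) (h + k * b) (i + k * c) ==> ?ok a b c d e f g h i"
  "?ok a b c d e f (g + k * d) (h + k * e) (i + k * f) ==> ?ok a b c d e f g h i" for a b c d e f g h i k
  using germ_ok_row_ops(1)[of UNIV "a + k * d" "b + k * e" "c + k * f" d e f g h i "- k"]
   germ_ok_row_ops(3)[of UNIV a b c "d + k * g" "e + k * h" "f + k * i" g h i "- k"]
   germ_ok_row_ops(7)[of UNIV a b c "d + k * a" "e + k * b" "f + k * c" g h i "- k"]
   germ_ok_row_ops(8)[of UNIV a b c d e f "g + k * a" "h + k * b" "i + k * c" "- k"]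
   germ_ok_row_ops(9)[of UNIV a b c d e f "g + k * d" "h + k * e" "i + k * f" "- k"] by simp_all
 have A: "?ok 1 b c 0 e f 0 h i" if "e * i - f * h > 0" "h ~= 0" for b c e f h i
 proof -
  have e1: "0 + (1 - e) / h * 0 = 0" "e + (1 - e) / h * h = 1" using that by simp_all
  have "?ok 1 b c 0 1 (f + ((1 - e) / h) * i) 0 h i"
  proof (rule ops(5)[where k = "- h"])
   have z: "0 + - h * 0 = 0" "h + - h * 1 = 0" by simp_all
   have hX: "h * ((1 - e) / h * i) = (1 - e) * i" using that by simp
   have "i + - h * (f + X) = i - h * f - h * X" for X by (simp add: algebra_simps)
   hence "i + - h * (f + (1 - e) / h * i) = i - h * f - (1 - e) * i" by (simp only: hX)
   moreover have "i - h * f - (1 - e) * i = e * i - f * h" by (simp add: algebra_simps)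
   ultimately have key: "i + - h * (f + (1 - e) / h * i) = e * i - f * h" by (rule trans)
   have pos: "0 < i + - h * (f + (1 - e) / h * i)" unfolding key by (rule that(1))
   have "?ok 1 b c 0 1 (f + ((1 - e) / h) * i) 0 0 (i + - h * (f + (1 - e) / h * i))"
    by (rule germ_ok_upper_triangular[OF zero_less_one zero_less_one pos disjI1[OF HOL.refl]])
   thus "?ok 1 b c 0 1 (f + ((1 - e) / h) * i) (0 + - h * 0) (h + - h * 1) (i + - h * (f + (1 - e) / h * i))" unfolding z .
  qed
  hence "?ok 1 b c (0 + (1 - e) / h * 0) (e + (1 - e) / h * h) (f + (1 - e) / h * i) 0 h i" unfolding e1 .
  thus ?thesis by (rule ops(2))
 qed
 have B: "?ok 1 b c 0 e f 0 h i" if "e * i - f * h > 0" for b c e f h i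
 proof (cases "h = 0")
  case True
  hence "e ~= 0" "e * i > 0" using that by auto
  hence "?ok 1 b c 0 e f 0 (h + 1 * e) (i + 1 * f)" using True by (intro A) (simp_all add: algebra_simps)
  hence "?ok 1 b c 0 e f (0 + 1 * 0) (h + 1 * e) (i + 1 * f)" by simp
  thus ?thesis by (rule ops(5))
 qed (use A that in blast)
 have C: "?ok a b c d e f g h i"
  if D: "a * (e * i - f * h) - b * (d * i - f * g) + c * (d * h - e * g) > 0" and d: "d ~= 0" for a b c d e f g h i
 proof -
  define k where "k = (1 - a) / d"
  have k: "a + k * d = 1" using d by (simp add: k_def)
  have "?ok 1 (b + k * e) (c + k * f) d e f g h i"
  proof (rule ops(3)[where k = "- d"], rule ops(4)[where k = "- g"])
   have a: "a = 1 - k * d" using k by simp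
   have "(e + - d * (b + k * e)) * (i + - g * (c + k * f)) - (f + - d * (c + k * f)) * (h + - g * (b + k * e))
     = a * (e * i - f * h) - b * (d * i - f * g) + c * (d * h - e * g)"
    unfolding a by algebra
   thus "?ok 1 (b + k * e) (c + k * f) (d + - d * 1) (e + - d * (b + k * e)) (f + - d * (c + k * f))
     (g + - g * 1) (h + - g * (b + k * e)) (i + - g * (c + k * f))"
    using D B by simp
  qed
  hence "?ok (a + k * d) (b + k * e) (c + k * f) d e f g h i" unfolding k .
  thus ?thesis by (rule ops(1))
 qed
 show ?thesis
 proof (cases "d = 0")
  case d: True
  show ?thesis
  proof (cases "a = 0")
   case True
   hence "g ~= 0" using assms d by auto
   hence "?ok a b c (d + 1 * g) (e + 1 * h) (f + 1 * i) g h i" using assms d by (intro C) (simp_all add: algebra_simps)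
   thus ?thesis by (rule ops(2))
  next
   case False
   hence "?ok a b c (d + 1 * a) (e + 1 * b) (f + 1 * c) g h i" using assms d by (intro C) (simp_all add: algebra_simps)
   thus ?thesis by (rule ops(3))
  qed
 qed (use C assms in blast)
qed

text \<open>After splitting off the linear part, the remainder times a cutoff at a small scale is a contraction.\<close>

lemma germ_realization:
 fixes f Dinv :: "real^3 => real^3"
 assumes f: "smooth_on (ball 0 rh) f" "rh > 0" "f 0 = 0" and D: "(f has_derivative D) (at 0)" "germ_ok V D"
  and Dinv: "linear Dinv" "!!x. Dinv (D x) = x" "!!x. D (Dinv x) = x"
  and V: "subspace V" "!!x. x : V ==> x : ball 0 rh ==> f x : V" "!!x. x : V ==> Dinv x : V"
  and "de > 0"
 obtains h ep where "moves (ball 0 de) V h" "ep > 0" "!!x. x : ball 0 ep ==> h x = f x"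
proof -
 define r where "r x = Dinv (f x) - x" for x
 have bD: "bounded_linear Dinv" using Dinv(1) by (simp add: linear_conv_bounded_linear)
 have r: "smooth_on (ball 0 rh) r"
  unfolding r_def by (intro smooth_diff smooth_linear_comp[OF bD f(1)] smooth_id open_ball)
 have r0: "r 0 = 0" using f(3) linear_0[OF Dinv(1)] by (simp add: r_def)
 have "((%x. Dinv (f x) - x) has_derivative (%v. Dinv (D v) - v)) (at 0)"
  by (intro has_derivative_diff has_derivative_ident bounded_linear.has_derivative[OF bD D(1)])
 hence "(r has_derivative (%v. 0)) (at 0)" unfolding r_def[abs_def] by (simp add: Dinv(2))
 hence Dr0: "FD r 0 v = 0" for v
  using fun_cong[OF frechet_derivative_at, of r "%v. 0" 0 v] by simp
 have rV: "r x : V" if "x : V" "x : ball 0 rh" for x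
  unfolding r_def by (intro subspace_diff[OF V(1)] V(2,3) that)
 obtain th :: "real^3 => real" and C rh' where th: "smooth_on UNIV th" "compact C" "C \<subseteq> ball 0 1" "!!x. x ~: C ==> th x = 0"
  "rh' > 0" "!!x. x : ball 0 rh' ==> th x = 1" "!!x. 0 <= th x" "!!x. th x <= 1" by (rule unit_bump, rule that)
 have "EX L>0. ALL x v. norm (FD th x v) <= L * norm v"
  by (rule compact_support_lipschitz[OF th(1,2,4)]) blast+
 then obtain L where L: "L > 0" "!!x v. norm (FD th x v) <= L * norm v" by blast
 \<comment> \<open>The product rule bounds the derivative of \<open>th (x / et) r x\<close> by
   \<open>ka + (L / et) * (ka * et) = (L + 1) * ka\<close>, whatever the scale \<open>et\<close>;
   for a contraction this has to be 1/2.\<close>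
 define ka where "ka = 1 / (2 * (L + 1))"
 have ka: "ka > 0" "(L + 1) * ka = 1 / 2" using L by (auto simp: ka_def field_simps)
 have "EX d>0. d <= rh & (ALL x. norm x < d --> norm (FD r x b) < ka / 3)" for b
 proof -
  have "isCont (%x. FD r x b) 0" using smooth_continuous[OF smooth_frechet[OF r]] f(2) by (simp add: continuous_on_eq_continuous_at)
  then obtain d where "d > 0" "!!x. norm x < d ==> norm (FD r x b) < ka / 3"
   using ka(1) Dr0 unfolding continuous_at_eps_delta dist_norm by (metis diff_zero divide_pos_pos zero_less_numeral)
  thus ?thesis using f(2) by (intro exI[of _ "min d rh"]) auto
 qed
 then obtain d where d: "!!b. d b > 0" "!!b. d b <= rh"
  "!!b x. norm x < d b ==> norm (FD r x b) < ka / 3" by metis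
 define et where "et = Min (insert de (d ` (Basis :: (real^3) set)))"
 have et: "et > 0" "et <= de" "et <= rh" "!!b. b : Basis ==> et <= d b"
 proof -
  show "et > 0" using d(1) \<open>de > 0\<close> by (simp add: et_def)
  show "et <= de" by (simp add: et_def)
  show *: "et <= d b" if "b : Basis" for b unfolding et_def by (rule Min_le) (use that in auto)
  obtain b :: "real^3" where "b : Basis" using nonempty_Basis by blast
  thus "et <= rh" using * d(2) order_trans by blast
 qed
 have Dr: "norm (FD r x v) <= ka * norm v" if x: "x : ball 0 et" for x v
 proof -
  have "x : ball 0 rh" using x et(3) by simp
  note lin = has_derivative_linear[OF smooth_has_derivative[OF r this]]
  have "norm (FD r x b) <= ka / 3" if "b : Basis" for b using d(3)[of x b] x et(4)[OF that] by simp
  from norm_linear_le_sum_Basis[OF lin this] show ?thesis by simp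
 qed
 have rn: "norm (r x) <= ka * norm x" if x: "x : ball 0 et" for x
 proof -
  have "norm (r x - r 0) <= ka * norm (x - 0)"
  proof (rule differentiable_bound[of "ball 0 et" r "%x. FD r x"])
   show "(r has_derivative FD r y) (at y within ball 0 et)" if "y : ball 0 et" for y
    using smooth_has_derivative[OF r, of y] that et(3) by (auto intro: has_derivative_at_withinI)
   show "onorm (FD r y) <= ka" if "y : ball 0 et" for y by (rule onorm_le) (rule Dr[OF that])
  qed (use x et in auto)
  thus ?thesis by (simp add: r0)
 qed
 define u where "u x = th (x /\<^sub>R et) *\<^sub>R r x" for x
 define C' where "C' = (%x. et *\<^sub>R x) ` C"
 have C': "compact C'" "C' \<subseteq> ball 0 et"
  unfolding C'_def using th(3) et(1) by (auto intro!: compact_scaling[OF th(2)] simp: subset_iff)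
 have th0: "th (x /\<^sub>R et) = 0" if "x ~: C'" for x
 proof (rule th(4))
  show "x /\<^sub>R et ~: C"
  proof
   assume "x /\<^sub>R et : C"
   hence "et *\<^sub>R (x /\<^sub>R et) : C'" unfolding C'_def by blast
   thus False using that et(1) by simp
  qed
 qed
 have sth: "smooth_on UNIV (%x. th (x /\<^sub>R et))"
  by (rule smooth_compose[OF smooth_cmult[OF smooth_id] th(1)]) auto
 have u1: "smooth_on (ball 0 et) u"
  unfolding u_def by (intro smooth_scaleR smooth_subset[OF sth] smooth_subset[OF r]) (use et in auto)
 have u2: "smooth_on (- C') u"
 proof (rule smooth_cong[OF smooth_const])
  show "open (- C')" using C'(1) compact_imp_closed by blast
  show "0 = u x" if "x : - C'" for x using th0 that by (simp add: u_def)
 qed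
 have "ball 0 et Un - C' = UNIV" using C'(2) by blast
 hence u: "smooth_on UNIV u" using smooth_on_Un[OF u1 u2] by simp
 have Du: "norm (FD u x v) <= 1 / 2 * norm v" for x v
 proof (cases "x : C'")
  case True
  hence x: "x : ball 0 et" "x : ball 0 rh" using C' et(3) by auto
  let ?Dc = "FD th (x /\<^sub>R et)" and ?Dr = "FD r x"
  have "((%x. th (x /\<^sub>R et)) has_derivative (%v. ?Dc (v /\<^sub>R et))) (at x)"
   using diff_chain_at[OF bounded_linear_imp_has_derivative[OF bounded_linear_scaleR_right] smooth_has_derivative[OF th(1) UNIV_I]]
   by (simp add: o_def)
  from has_derivative_scaleR[OF this smooth_has_derivative[OF r x(2)]]
  have "(u has_derivative (%v. th (x /\<^sub>R et) *\<^sub>R ?Dr v + ?Dc (v /\<^sub>R et) *\<^sub>R r x)) (at x)" unfolding u_def[abs_def] .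
  from fun_cong[OF frechet_derivative_at[OF this], of v]
  have "FD u x v = th (x /\<^sub>R et) *\<^sub>R ?Dr v + ?Dc (v /\<^sub>R et) *\<^sub>R r x" by simp
  also have "norm \<dots> <= norm (?Dr v) + L * norm (v /\<^sub>R et) * norm (r x)"
  proof (rule norm_triangle_mono)
   show "norm (th (x /\<^sub>R et) *\<^sub>R ?Dr v) <= norm (?Dr v)" using th(7,8)[of "x /\<^sub>R et"] by (simp add: mult_left_le_one_le)
   show "norm (?Dc (v /\<^sub>R et) *\<^sub>R r x) <= L * norm (v /\<^sub>R et) * norm (r x)"
    using mult_right_mono[OF L(2)[of "x /\<^sub>R et" "v /\<^sub>R et"] norm_ge_zero[of "r x"]] by simp
  qed
  also have "\<dots> <= ka * norm v + L * norm (v /\<^sub>R et) * (ka * et)"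
  proof (intro add_mono mult_left_mono Dr x)
   have "ka * norm x <= ka * et" using x(1) ka(1) by simp
   thus "norm (r x) <= ka * et" using rn[OF x(1)] by linarith
  qed (use L in auto)
  also have "\<dots> = (L + 1) * ka * norm v" using et(1) by (simp add: field_simps)
  also have "\<dots> = 1 / 2 * norm v" unfolding ka(2) ..
  finally show ?thesis .
 next
  case False
  have "FD u x = FD (%x. 0) x" by (rule frechet_derivative_cong[of "- C'"])
    (use False C'(1) compact_imp_closed th0 in \<open>auto simp: u_def\<close>)
  thus ?thesis by simp
 qed
 have wig: "wiggle (ball 0 de) V u"
  unfolding wiggle_def
 proof (intro conjI allI ballI u)
  show "EX C. compact C & C \<subseteq> ball 0 de & (ALL x. x ~: C --> u x = 0)"
   using C' et(2) th0 by (intro exI[of _ C']) (auto simp: u_def subset_iff)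
  show "norm (u x - u y) <= norm (x - y) / 2" for x y
   using lipschitz_of_derivative_bound[OF smooth_has_derivative[OF u UNIV_I] Du, of x y] by simp
  show "u x : V" if "x : V" for x
  proof (cases "x : C'")
   case True
   hence "x : ball 0 rh" using C' et(3) by auto
   thus ?thesis unfolding u_def by (intro subspace_scale[OF V(1)] rV that)
  next
   case False
   thus ?thesis using th0 subspace_0[OF V(1)] by (simp add: u_def)
  qed
 qed
 obtain hD ep where hD: "moves (ball 0 de) V hD" "ep > 0" "!!x. x : ball 0 ep ==> hD x = D x"
  using D(2) \<open>de > 0\<close> unfolding germ_ok_def by metis
 \<comment> \<open>Within this radius the estimate of \<open>r\<close> holds, the cut-off is 1, and
   \<open>x + r x\<close> stays where \<open>hD\<close> agrees with \<open>D\<close>.\<close>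
 define ep' where "ep' = Min {et, rh' * et, ep / (1 + ka)}"
 show thesis
 proof (rule that[OF moves_compose[OF hD(1) wiggle_moves[OF wig]]])
  show "ep' > 0" using et(1) th(5) hD(2) ka(1) by (simp add: ep'_def)
  fix x :: "real^3" assume "x : ball 0 ep'"
  hence x: "x : ball 0 et" "norm x < rh' * et" "norm x < ep / (1 + ka)" by (auto simp: ep'_def)
  have "x /\<^sub>R et : ball 0 rh'" using x(2) et(1) by (simp add: field_simps)
  hence ux: "x + u x = Dinv (f x)" using th(6) by (simp add: u_def r_def)
  have "norm (x + r x) <= norm x + ka * norm x" using rn[OF x(1)] norm_triangle_ineq[of x "r x"] by linarith
  also have "\<dots> < ep" using x(3) ka(1) by (simp add: field_simps)
  finally have "x + u x : ball 0 ep" unfolding ux by (simp add: r_def)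
  thus "hD (x + u x) = f x" using hD(3) ux Dinv(3) by simp
 qed
qed

subsection \<open>Any two oriented charts are ambient isotopic\<close>

lemma det_block_4:
 "det (vector [vector [1, 0, 0, 0], vector [0, a, b, c], vector [0, d, e, f], vector [0, g, h, i]] :: real^4^4)
  = a * (e * i - f * h) - b * (d * i - f * g) + c * (d * h - e * g)"
proof -
 have f1234: "finite {2::4, 3, 4}" "1 ~: {2::4, 3, 4}"
  and f234: "finite {3::4, 4}" "2 ~: {3::4, 4}"
  and f34: "finite {4::4}" "3 ~: {4::4}" by auto
 show ?thesis
  unfolding det_def UNIV_4
  apply (subst sum_over_permutations_insert[OF f1234])
  apply (subst sum_over_permutations_insert[OF f234])
  apply (subst sum_over_permutations_insert[OF f34])
  apply (subst permutes_sing)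
  apply (simp add: sign_swap_id permutation_swap_id sign_compose sign_id vector_4 Transposition.transpose_def)
  apply (simp add: algebra_simps)
  done
qed

definition det3 :: "(real^3 => real^3) => real" where
 "det3 D = (let m = (%j k. D (axis j 1) $ k) in
   m 1 1 * (m 2 2 * m 3 3 - m 2 3 * m 3 2) - m 1 2 * (m 2 1 * m 3 3 - m 2 3 * m 3 1)
   + m 1 3 * (m 2 1 * m 3 2 - m 2 2 * m 3 1))"

text \<open>Both frames contain the same position vector, so the change of frames is a block matrix
  made of 1 and the matrix of \<open>D\<close>.\<close>

lemma frame_det_transition:
 fixes D1 D2 :: "real^3 => real^4" and D :: "real^3 => real^3"
 assumes "!!v. D1 v = D2 (D v)" "linear D2"
 shows "det (vector [x, D1 (axis 1 1), D1 (axis 2 1), D1 (axis 3 1)] :: real^4^4) =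
  det3 D * det (vector [x, D2 (axis 1 1), D2 (axis 2 1), D2 (axis 3 1)] :: real^4^4)"
proof -
 define m where "m j k = D (axis j 1) $ k" for j k
 let ?N = "vector [vector [1, 0, 0, 0], vector [0, m 1 1, m 1 2, m 1 3], vector [0, m 2 1, m 2 2, m 2 3],
  vector [0, m 3 1, m 3 2, m 3 3]] :: real^4^4"
 let ?M = "vector [x, D2 (axis 1 1), D2 (axis 2 1), D2 (axis 3 1)] :: real^4^4"
 have "D1 (axis j 1) = m j 1 *\<^sub>R D2 (axis 1 1) + m j 2 *\<^sub>R D2 (axis 2 1) + m j 3 *\<^sub>R D2 (axis 3 1)" for j
  unfolding assms(1) m_def by (rule linear_vec3[OF assms(2)])
 hence "vector [x, D1 (axis 1 1), D1 (axis 2 1), D1 (axis 3 1)] = ?N ** ?M"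
  by (simp add: vec_eq_iff forall_4 matrix_matrix_mult_def sum_4 vector_4)
 thus ?thesis by (simp add: det_mul det_block_4 m_def det3_def)
qed

lemma linear_eq_mat3:
 fixes D :: "real^3 => real^3"
 assumes "linear D"
 shows "D x = mat3 (D (axis 1 1) $ 1) (D (axis 2 1) $ 1) (D (axis 3 1) $ 1) (D (axis 1 1) $ 2) (D (axis 2 1) $ 2)
  (D (axis 3 1) $ 2) (D (axis 1 1) $ 3) (D (axis 2 1) $ 3) (D (axis 3 1) $ 3) x"
 using linear_vec3[OF assms, of x] by (simp add: vec_eq_iff forall_3 mat3_nth mult.commute)

lemma patch_precompose_linear:
 assumes e: "patch U e" and L: "linear L" "inj L" "det3 L > 0"
 shows "patch (L -` U) (%q. e (L q))"
 unfolding patch_def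
proof (intro conjI ballI)
 have bl: "bounded_linear L" using L(1) by (rule linear_conv_bounded_linear[THEN iffD1])
 have o: "open (L -` U)" using linear_continuous_on[OF bl] patch_open[OF e] by (intro open_vimage)
 show "smooth_on (L -` U) (%q. e (L q))"
  by (rule smooth_compose[OF smooth_linear[OF bl o] patch_smooth[OF e]]) blast
 show "inj_on (%q. e (L q)) (L -` U)"
  by (rule inj_onI) (use inj_onD[OF patch_inj[OF e]] injD[OF L(2)] in blast)
 show "(%q. e (L q)) ` (L -` U) \<subseteq> S3" using patch_image[OF e] by blast
 fix q assume "q : L -` U"
 hence q: "L q : U" by blast
 have d: "((%q. e (L q)) has_derivative (%v. FD e (L q) (L v))) (at q)"
  using diff_chain_at[OF bounded_linear_imp_has_derivative[OF bl] patch_has_derivative[OF e q]] by (simp add: o_def)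
 have "frame_det (%q. e (L q)) q = det3 L * frame_det e (L q)"
  unfolding frame_det_def Let_def
  by (rule frame_det_transition[OF _ patch_linear[OF e q]]) (rule fun_cong[OF frechet_derivative_at[OF d, symmetric]])
 thus "frame_det (%q. e (L q)) q > 0" using L(3) e q by (simp add: patch_def)
qed

text \<open>Both charts are positively oriented at the common point, so their frame determinants
  differ by a positive factor, which is \<open>det3 D\<close>. The radius \<open>rh\<close> is small
  enough for \<open>e\<close> to stay in the image of \<open>e'\<close>.\<close>

lemma patch_transition:
 assumes e: "patch U e" "0 : U" and e': "patch U' e'" "0 : U'" and eq: "e 0 = e' 0"
 obtains f rh D Dinv where "rh > 0" "ball 0 rh \<subseteq> U" "smooth_on (ball 0 rh) f" "f 0 = 0"
  "!!x. x : ball 0 rh ==> f x : U'" "!!x. x : ball 0 rh ==> e' (f x) = e x" "(f has_derivative D) (at 0)" "linear D" "det3 D > 0"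
  "!!v. FD e 0 v = FD e' 0 (D v)"
  "linear Dinv" "!!x. Dinv (D x) = x" "!!x. D (Dinv x) = x"
proof -
 define f where "f = (%x. inv_into U' e' (e x))"
 have "openin (top_of_set U) (U Int e -` (e' ` U'))"
  by (rule continuous_openin_preimage[OF smooth_continuous[OF patch_smooth[OF e(1)]] _ patch_openin[OF e'(1)]])
   (use patch_S3[OF e(1)] in blast)
 hence "open (U Int e -` (e' ` U'))" using patch_open[OF e(1)] openin_open_trans by blast
 moreover have "0 : U Int e -` (e' ` U')" using e(2) e'(2) eq by auto
 ultimately obtain rh where rh: "rh > 0" "ball 0 rh \<subseteq> U Int e -` (e' ` U')"
  using open_contains_ball by blast
 have eb: "patch (ball 0 rh) e" by (rule patch_subset[OF e(1)]) (use rh in auto)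
 have im: "e ` ball 0 rh \<subseteq> e' ` U'" using rh(2) by blast
 have f: "smooth_on (ball 0 rh) f"
  unfolding f_def by (rule smooth_patch_compose[OF patch_smooth[OF eb] patch_smooth_inverse[OF e'(1)] im])
 have ef: "f x : U'" "e' (f x) = e x" if "x : ball 0 rh" for x
 proof -
  have "e x : e' ` U'" using im that by blast
  thus "f x : U'" "e' (f x) = e x" unfolding f_def by (rule inv_into_into, rule f_inv_into_f)
 qed
 have f0: "f 0 = 0" unfolding f_def eq by (rule inv_into_f_f[OF patch_inj[OF e'(1)] e'(2)])
 define D where "D = FD f 0"
 have D: "(f has_derivative D) (at 0)"
  unfolding D_def by (rule smooth_has_derivative[OF f]) (use rh in simp)
 let ?E = "FD e 0" and ?E' = "FD e' 0"
 have ED: "?E v = ?E' (D v)" for v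
 proof -
  have "(e' has_derivative ?E') (at (f 0))" using patch_has_derivative[OF e'] f0 by simp
  from diff_chain_at[OF D this] have "((%x. e' (f x)) has_derivative (%v. ?E' (D v))) (at 0)" by (simp add: o_def)
  hence "(e has_derivative (%v. ?E' (D v))) (at 0)"
   by (rule has_derivative_transform_within_open[OF _ open_ball[of 0 rh]]) (use rh ef in auto)
  from fun_cong[OF frechet_derivative_at[OF this], of v] show ?thesis by simp
 qed
 have "frame_det e 0 = det3 D * frame_det e' 0"
  unfolding frame_det_def Let_def eq by (rule frame_det_transition[of ?E ?E' D, OF ED patch_linear[OF e']])
 moreover have "frame_det e 0 > 0" "frame_det e' 0 > 0" using e e' by (auto simp: patch_def)
 ultimately have dpos: "det3 D > 0" by (simp add: zero_less_mult_iff)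
 have linD: "linear D" by (rule has_derivative_linear[OF D])
 have "inj D"
 proof (rule linear_injective_0[OF linD, THEN iffD2, rule_format])
  fix v assume "D v = 0"
  hence "?E v = 0" using ED[of v] linear_0[OF patch_linear[OF e']] by simp
  thus "v = 0" by (rule patch_derivative_inj[OF e])
 qed
 then obtain Dinv where Dinv: "linear Dinv" "!!x. Dinv (D x) = x" "!!x. D (Dinv x) = x"
  using linear_injective_isomorphism[OF linD] by blast
 show thesis
 proof (rule that[OF rh(1) _ f f0 _ _ D linD dpos ED Dinv])
  show "ball 0 rh \<subseteq> U" using rh(2) by blast
 qed (rule ef, assumption)+
qed

lemma patches_align_germ:
 assumes e: "patch U e" "0 : U" and e': "patch U' e'" "0 : U'" and eq: "e 0 = e' 0" and de: "de > 0"
 obtains h ep where "moves (ball 0 de) UNIV h" "ep > 0" "!!x. x : ball 0 ep ==> x : U & h x : U' & e' (h x) = e x"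
proof -
 obtain f rh D Dinv where rh: "rh > 0" "ball 0 rh \<subseteq> U" and f: "smooth_on (ball 0 rh) f" "f 0 = 0"
  "!!x. x : ball 0 rh ==> f x : U'" "!!x. x : ball 0 rh ==> e' (f x) = e x" and D: "(f has_derivative D) (at 0)" "linear D" "det3 D > 0"
  and Dinv: "linear Dinv" "!!x. Dinv (D x) = x" "!!x. D (Dinv x) = x"
  by (rule patch_transition[OF e e' eq]) blast
 have ok: "germ_ok UNIV D"
  by (rule germ_ok_cong[OF germ_ok_mat3 linear_eq_mat3[OF D(2), symmetric]])
   (use D(3) in \<open>simp add: det3_def Let_def algebra_simps\<close>)
 obtain h ep where h: "moves (ball 0 de) UNIV h" "ep > 0" "!!x. x : ball 0 ep ==> h x = f x"
  by (rule germ_realization[OF f(1) rh(1) f(2) D(1) ok Dinv subspace_UNIV UNIV_I UNIV_I de], rule that)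
 show thesis
 proof (rule that[OF h(1), of "min ep rh"])
  show "min ep rh > 0" using h(2) rh(1) by simp
  show "x : U & h x : U' & e' (h x) = e x" if "x : ball 0 (min ep rh)" for x
  proof -
   have "x : ball 0 rh" "h x = f x" using that h(3)[of x] by auto
   thus ?thesis using rh(2) f by auto
  qed
 qed
qed

text \<open>The rotation is a product of two hyperplane reflections, along \<open>a\<close> and
  along \<open>n t = a + t b\<close>. At time 0 they cancel; at time 1 the second sends
  \<open>- a\<close> to \<open>b\<close>. For \<open>t\<close> in [0, 1] the normal vector
  \<open>n t\<close> could vanish only if \<open>b = - a\<close>.\<close>

lemma iso_end_rotation_aux:
 fixes a b :: "real^4"
 assumes a: "a : S3" and b: "b : S3" and "b ~= - a"
 obtains R where "iso_end R" "R a = b"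
proof -
 define r where "r n x = x - (2 * (x \<bullet> n) / (n \<bullet> n)) *\<^sub>R n" for n x :: "real^4"
 define n where "n t = a + t *\<^sub>R b" for t :: real
 define H where "H t x = r (n t) (r a x)" for t x
 have rr: "r n (r n x) = x" for n x
  by (cases "n = 0") (simp_all add: r_def inner_diff_left)
 have rn: "r n x \<bullet> r n x = x \<bullet> x" for n x
  by (cases "n = 0") (simp_all add: r_def inner_diff_left inner_diff_right inner_commute power2_eq_square)
 have r_S3: "r n x : S3" if "x : S3" for n x
  using that rn[of n x] by (simp add: norm_eq_1)
 define T where "T = {t. n t ~= 0}"
 have oT: "open T"
 proof -
  have "T = n -` (- {0})" by (auto simp: T_def)
  thus ?thesis by (auto intro!: open_vimage simp: n_def[abs_def] continuous_intros open_Compl)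
 qed
 have T01: "{0..1} \<subseteq> T"
 proof
  fix t :: real assume t: "t : {0..1}"
  show "t : T"
  proof (rule ccontr)
   assume "t ~: T"
   hence z: "a = - (t *\<^sub>R b)" by (simp add: T_def n_def eq_neg_iff_add_eq_0)
   hence "norm a = \<bar>t\<bar> * norm b" by simp
   hence "t = 1" using a b t by simp
   thus False using z assms(3) by simp
  qed
 qed
 have a0: "a ~= 0" by (rule S3_nonzero[OF a])
 have sm: "smooth_on (T \<times> (-{0})) (%(t, y). H t (sgn y))"
 proof -
  have oW: "open (T \<times> (-{0::real^4}))" by (intro open_Times oT) (auto simp: open_Compl)
  have s1: "smooth_on (T \<times> (-{0::real^4})) (%p. n (fst p))"
   unfolding n_def by (intro smooth_add smooth_const smooth_scaleR smooth_fst oW)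
  have s2: "smooth_on (T \<times> (-{0::real^4})) (%p. sgn (snd p))" by (rule smooth_sgn[OF smooth_snd[OF oW]]) auto
  have s3: "smooth_on (T \<times> (-{0::real^4})) (%p. r a (sgn (snd p)))" unfolding r_def
   by (intro smooth_diff smooth_scaleR smooth_divide smooth_mult smooth_inner smooth_const s2 oW)
    (use a0 in auto)
  have "smooth_on (T \<times> (-{0::real^4})) (%p. r (n (fst p)) (r a (sgn (snd p))))" unfolding r_def[of "n _"]
   by (intro smooth_diff smooth_scaleR smooth_divide smooth_mult smooth_inner smooth_const s3 s1 oW)
    (auto simp: T_def)
  thus ?thesis by (simp add: H_def case_prod_unfold)
 qed
 have sr: "smooth_at_S3 S3 (r m)" if "m ~= 0" for m
  unfolding smooth_at_S3_def cone_S3 r_def by (intro conjI order_refl smooth_diff smooth_scaleR smooth_divide smooth_mult smooth_inner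
    smooth_const smooth_sgn smooth_id) (use that in auto)
 have dr: "diffeo_S3 (r m)" if "m ~= 0" for m
  by (rule diffeo_S3I[where g = "r m"]) (simp_all only: rr r_S3 sr[OF that])
 have "diffeo_S3 (H t)" if "t : {0..1}" for t
  unfolding H_def by (rule diffeo_S3_compose[OF dr[OF a0] dr]) (use that T01 in \<open>auto simp: T_def\<close>)
 moreover have "H 0 x = x" for x by (simp add: H_def n_def rr)
 ultimately have "ambient_isotopy H"
  using extends_smoothly_param_S3[OF sm T01] by (simp add: ambient_isotopy_def)
 moreover have "H 1 a = b"
 proof -
  have aa: "a \<bullet> a = 1" "b \<bullet> b = 1" using a b by (simp_all add: norm_eq_1)
  have "n 1 ~= 0" using subsetD[OF T01, of 1] by (simp add: T_def)
  moreover have nn: "n 1 \<bullet> n 1 = 2 * (a \<bullet> n 1)" by (simp add: n_def inner_add_left inner_add_right aa inner_commute)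
  ultimately have q: "2 * (a \<bullet> n 1) / (n 1 \<bullet> n 1) = 1" by (metis divide_self inner_eq_zero_iff)
  have ra: "r a a = - a" using a0 by (simp add: r_def scaleR_2)
  have "2 * ((- a) \<bullet> n 1) / (n 1 \<bullet> n 1) = - (2 * (a \<bullet> n 1) / (n 1 \<bullet> n 1))" by simp
  hence "2 * ((- a) \<bullet> n 1) / (n 1 \<bullet> n 1) = - 1" by (simp only: q)
  hence "r (n 1) (- a) = - a + n 1" unfolding r_def by (simp only: scaleR_minus1_left diff_minus_eq_add)
  hence "H 1 a = - a + n 1" by (simp only: H_def ra)
  thus ?thesis by (simp add: n_def)
 qed
 ultimately show thesis using that[OF iso_end_of] by blast
qed

lemma iso_end_transitive:
 fixes a b :: "real^4"
 assumes a: "a : S3" and b: "b : S3"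
 obtains R where "iso_end R" "R a = b"
proof (cases "b = - a")
 case False
 thus thesis using iso_end_rotation_aux[OF a b] that by blast
next
 case True
 obtain c where c: "c ~= 0" "c \<bullet> a = 0"
  using orthogonal_to_vector_exists[of a] by (auto simp: orthogonal_def inner_commute)
 define c' where "c' = sgn c"
 have c': "c' : S3" "c' \<bullet> a = 0" using c sgn_S3 by (auto simp: c'_def sgn_div_norm)
 have "a \<bullet> a = 1" using a by (simp add: norm_eq_1)
 hence "c' ~= - a" "b ~= - c'" using c'(2) True by auto
 then obtain R R' where "iso_end R" "R a = c'" "iso_end R'" "R' c' = b"
  using iso_end_rotation_aux[OF a c'(1)] iso_end_rotation_aux[OF c'(1) b] by metis
 thus thesis using that[OF iso_end_compose, of R R'] by simp
qed

text \<open>Where the cut-off is 1 a step multiplies by \<open>1 - s\<close>, and shrinking keeps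
  points in that region, so \<open>n\<close> steps give the factor
  \<open>(1 - s) ^ n\<close>.\<close>

lemma shrinking_move:
 assumes "ep > 0"
 obtains h mu where "moves (ball 0 2) UNIV h" "0 < mu" "mu < ep" "mu < 1" "!!x. x : ball 0 (3/2) ==> h x = mu *\<^sub>R x"
proof -
 obtain th C W where th: "smooth_on UNIV th" "!!x. x : W ==> th x = (1::real)" "cball (0::real^3) (3/2) \<subseteq> W"
   "compact C" "C \<subseteq> ball 0 2" "!!x. x ~: C ==> th x = 0"
  by (rule bump_function_exists[of "cball (0::real^3) (3/2)" "ball 0 2"]) auto
 define w where "w x = th x *\<^sub>R x" for x
 have w: "smooth_on UNIV w" unfolding w_def by (intro smooth_scaleR th(1) smooth_id) auto
 have w0: "w x = 0" if "x ~: C" for x using th(6)[OF that] by (simp add: w_def)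
 obtain s0 where s0: "s0 > 0" "!!s. \<bar>s\<bar> <= s0 ==> wiggle (ball 0 2) UNIV (%x. s *\<^sub>R w x)"
  by (rule small_multiple_wiggle[OF w th(4,5) w0 subspace_UNIV UNIV_I]) (assumption | blast)+
 define s where "s = min s0 (1/2)"
 have s: "0 < s" "s < 1" using s0(1) by (auto simp: s_def)
 define u where "u x = (- s) *\<^sub>R w x" for x
 have mv: "moves (ball 0 2) UNIV (%x. x + u x)"
  unfolding u_def by (rule wiggle_moves[OF s0(2)]) (use s in \<open>auto simp: s_def\<close>)
 obtain n where n: "(1 - s) ^ n < min ep 1" "n > 0"
 proof -
  obtain k where k: "(1 - s) ^ k < min ep 1" using real_arch_pow_inv[of "min ep 1" "1 - s"] assms s by auto
  have "(1 - s) ^ Suc k <= (1 - s) ^ k" using s by (intro power_decreasing) auto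
  thus ?thesis using that[of "Suc k"] k by simp
 qed
 have "((%x. x + u x) ^^ k) x = (1 - s) ^ k *\<^sub>R x" if x: "x : ball 0 (3/2)" for k x
 proof (induction k)
  case (Suc k)
  have "(1 - s) ^ k <= 1" using s by (intro power_le_one) auto
  hence "norm ((1 - s) ^ k *\<^sub>R x) <= norm x" using s by (simp add: mult_left_le_one_le)
  hence "(1 - s) ^ k *\<^sub>R x : W" using x th(3) by (intro subsetD[OF th(3)]) simp
  thus ?case using Suc th(2) by (simp add: u_def w_def algebra_simps)
 qed simp
 thus thesis
  using n s by (intro that[OF moves_funpow[OF mv], of "(1 - s) ^ n" n]) auto
qed

text \<open>Shrink the ball, move its centre, straighten the germ, and expand again.\<close>

lemma charts_isotopic:
 assumes e: "patch (ball 0 2) e" and e': "patch (ball 0 2) e'"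
 obtains h where "iso_end h" "!!q. q : ball 0 (3/2) ==> h (e q) = e' q"
proof -
 have z: "(0::real^3) : ball 0 2" by simp
 obtain R where R: "iso_end R" "R (e 0) = e' 0" by (rule iso_end_transitive[OF patch_S3[OF e z] patch_S3[OF e' z]])
 note Re = patch_iso_end[OF R(1) e]
 obtain g ep where g: "moves (ball 0 2) UNIV g" "ep > 0"
   "!!x. x : ball 0 ep ==> x : ball 0 2 & g x : ball 0 2 & e' (g x) = R (e x)"
  by (rule patches_align_germ[OF Re z e' z, of 2]) (use R(2) in auto)
 obtain s mu where s: "moves (ball 0 2) UNIV s" "0 < mu" "mu < ep / 2" "mu < 1" "!!x. x : ball 0 (3/2) ==> s x = mu *\<^sub>R x"
  by (rule shrinking_move[of "ep / 2"]) (use g(2) in auto)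
 note p1 = iso_end_push[OF e s(1)] and p2 = iso_end_push[OF e' g(1)] and p3 = iso_end_push[OF e' s(1)]
 let ?h = "%x. inv_into S3 (push (ball 0 2) e' s) (inv_into S3 (push (ball 0 2) e' g) (R (push (ball 0 2) e s x)))"
 show thesis
 proof (rule that)
  show "iso_end ?h" by (rule iso_end_compose[OF iso_end_compose[OF iso_end_compose[OF p1 R(1)] iso_end_inv[OF p2]] iso_end_inv[OF p3]])
  fix q :: "real^3" assume q: "q : ball 0 (3/2)"
  have q2: "q : ball 0 2" using q by simp
  have "norm (mu *\<^sub>R q) < ep" using q s(2,3) mult_strict_mono[of mu "ep / 2" "norm q" 2] by simp
  hence lq: "mu *\<^sub>R q : ball 0 ep" by simp
  note G = g(3)[OF lq]
  have i: "inv_into S3 (push (ball 0 2) e' k) (e' (k x)) = e' x" if k: "moves (ball 0 2) UNIV k" and x: "x : ball 0 2" for k x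
   using diffeo_S3D(3)[OF iso_end_diffeo[OF iso_end_push[OF e' k]] patch_S3[OF e' x]] push_patch[OF e' x] by simp
  have "push (ball 0 2) e s (e q) = e (mu *\<^sub>R q)" using push_patch[OF e q2] s(5)[OF q] by simp
  moreover have "R (e (mu *\<^sub>R q)) = e' (g (mu *\<^sub>R q))" using G by simp
  moreover have "inv_into S3 (push (ball 0 2) e' g) (e' (g (mu *\<^sub>R q))) = e' (mu *\<^sub>R q)" using i[OF g(1)] G by blast
  moreover have "inv_into S3 (push (ball 0 2) e' s) (e' (mu *\<^sub>R q)) = e' q" using i[OF s(1) q2] s(5)[OF q] by simp
  ultimately show "?h (e q) = e' q" by simp
 qed
qed

subsection \<open>Directed arcs and knots\<close>

lemma vector_derivative_eq_frechet:
 assumes "smooth_on J c" "t : J"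
 shows "VD c t = FD c t 1"
proof -
 note D = smooth_has_derivative[OF assms]
 have "FD c t = (%s. s *\<^sub>R FD c t 1)"
 proof
  show "FD c t s = s *\<^sub>R FD c t 1" for s using linear_cmul[OF has_derivative_linear[OF D], of s 1] by simp
 qed
 hence "(c has_vector_derivative FD c t 1) (at t)"
  using D unfolding has_vector_derivative_def by (simp only:)
 thus ?thesis by (rule vector_derivative_at)
qed

lemma smooth_has_vector_derivative:
 assumes "smooth_on J c" "t : J"
 shows "(c has_vector_derivative VD c t) (at t)"
 using assms smooth_has_derivative[OF assms] vector_derivative_works
 by (metis differentiable_def)

lemma vector_derivative_chain_smooth:
 assumes "smooth_on J c" "t : J" "(f has_derivative D) (at (c t))"
 shows "VD (%t. f (c t)) t = D (VD c t)"
proof -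
 have "((%t. f (c t)) has_derivative (%s. D (FD c t s))) (at t)"
  using diff_chain_at[OF smooth_has_derivative[OF assms(1,2)] assms(3)] by (simp add: o_def)
 moreover have "D (FD c t s) = s *\<^sub>R D (VD c t)" for s
  using linear_cmul[OF has_derivative_linear[OF smooth_has_derivative[OF assms(1,2)]], of s 1]
   linear_cmul[OF has_derivative_linear[OF assms(3)]] by (simp add: vector_derivative_eq_frechet[OF assms(1,2)])
 ultimately show ?thesis
  by (intro vector_derivative_at) (simp add: has_vector_derivative_def)
qed

lemma vector_derivative_dS:
 assumes h: "smooth_at_S3 A h" and c: "smooth_on J c" "t : J" "c ` J \<subseteq> A"
 shows "VD (%t. h (c t)) t = dS h (c t) (VD c t)"
proof -
 have "((%t. h (c t)) has_derivative (%s. dS h (c t) (FD c t s))) (at t)"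
  by (rule has_derivative_patch_compose[OF smooth_has_derivative[OF c(1,2)] h smooth_open[OF c(1)] c(2,3)])
 moreover have "dS h (c t) (FD c t s) = s *\<^sub>R dS h (c t) (VD c t)" for s
  using linear_cmul[OF has_derivative_linear[OF smooth_has_derivative[OF c(1,2)]], of s 1]
   linear_cmul[OF dS_linear[OF h]] c(2,3) by (auto simp: vector_derivative_eq_frechet[OF c(1,2)])
 ultimately show ?thesis
  by (intro vector_derivative_at) (simp add: has_vector_derivative_def)
qed

lemma vector_derivative_cong_open:
 assumes "open J" "t : J" "!!s. s : J ==> c s = d s"
 shows "VD c t = VD d t"
proof -
 have "(c has_vector_derivative D) (at t) \<longleftrightarrow> (d has_vector_derivative D) (at t)" for D
  unfolding has_vector_derivative_def using has_derivative_transform_within_open[OF _ assms(1,2)] assms(3) by metis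
 thus ?thesis by (simp add: vector_derivative_def)
qed

lemma directed_arc_cong:
 assumes "open J" "T \<subseteq> J" "!!s. s : J ==> c s = d s"
 shows "directed_arc c T = directed_arc d T"
 unfolding directed_arc_def
proof (rule image_cong[OF HOL.refl])
 fix t assume "t : T"
 hence "t : J" using assms(2) by blast
 thus "(c t, sgn (VD c t)) = (d t, sgn (VD d t))"
  using vector_derivative_cong_open[OF assms(1) _ assms(3)] assms(3) by simp
qed

lemma carrier_directed_arc: "carrier (directed_arc c T) = c ` T"
 by (auto simp: directed_arc_def image_image)

lemma directed_arc_Un: "directed_arc c (S Un T) = directed_arc c S Un directed_arc c T"
 by (simp add: directed_arc_def image_Un)

lemma directed_arc_reparam:
 assumes c: "smooth_on J c" and r: "smooth_on I r" "T \<subseteq> I" "r ` I \<subseteq> J" "!!t. t : T ==> VD r t > 0"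
 shows "directed_arc (%t. c (r t)) T = directed_arc c (r ` T)"
 unfolding directed_arc_def image_image
proof (rule image_cong[OF HOL.refl])
 fix t assume t: "t : T"
 hence tI: "t : I" "r t : J" using r by auto
 have D: "(c has_derivative (%s. s *\<^sub>R VD c (r t))) (at (r t))"
  using smooth_has_vector_derivative[OF c tI(2)] by (simp add: has_vector_derivative_def)
 from vector_derivative_chain_smooth[OF r(1) tI(1) D]
 show "(c (r t), sgn (VD (%t. c (r t)) t)) = (c (r t), sgn (VD c (r t)))"
  using r(4)[OF t] by (simp add: sgn_scaleR)
qed

lemma tangent_map_directed_arc:
 assumes h: "smooth_at_S3 A h" and c: "smooth_on J c" "T \<subseteq> J" "c ` J \<subseteq> A"
 shows "tangent_map h ` directed_arc c T = directed_arc (%t. h (c t)) T"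
 unfolding directed_arc_def image_image
proof (rule image_cong[OF HOL.refl])
 fix t assume "t : T"
 hence t: "t : J" "c t : A" using c by auto
 show "tangent_map h (c t, sgn (VD c t)) = (h (c t), sgn (VD (%t. h (c t)) t))"
  unfolding tangent_map_dS vector_derivative_dS[OF h c(1) t(1) c(3)] by (simp add: sgn_linear_sgn[OF dS_linear[OF h t(2)]])
qed

lemma curve_tangent:
 assumes c: "smooth_on J c" "t : J" "c ` J \<subseteq> S3"
 shows "c t \<bullet> VD c t = 0"
 unfolding vector_derivative_eq_frechet[OF c(1,2)]
 by (rule inner_constant_norm_derivative[OF smooth_has_derivative[OF c(1,2)] smooth_open[OF c(1)] c(2)])
  (use c(3) in auto)

lemma directed_arc_UT:
 assumes c: "smooth_on J c" "T \<subseteq> J" "c ` J \<subseteq> S3" "!!t. t : T ==> VD c t ~= 0"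
 shows "directed_arc c T \<subseteq> UT"
proof
 fix a assume "a : directed_arc c T"
 then obtain t where t: "t : T" "a = (c t, sgn (VD c t))" by (auto simp: directed_arc_def)
 have "t : J" "c t : S3" using t c by blast+
 thus "a : UT"
  using curve_tangent[OF c(1) _ c(3), of t] c(4)[OF t(1)] t(2) by (simp add: UT_iff norm_sgn sgn_div_norm)
qed

lemma oriented_knotE:
 assumes "oriented_knot K"
 obtains ga where "smooth_on UNIV ga" "range ga \<subseteq> S3" "!!t. ga (t + 1) = ga t" "inj_on ga {0..<1}"
  "!!t. VD ga t ~= 0" "K = directed_arc ga UNIV" using assms unfolding oriented_knot_def by blast

lemma oriented_knot_UT: "oriented_knot K ==> K \<subseteq> UT"
 by (elim oriented_knotE) (simp add: directed_arc_UT[of UNIV])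

lemma periodic_int:
 fixes ga :: "real => 'a"
 assumes "!!t. ga (t + 1) = ga t"
 shows "ga (t + of_int n) = ga t"
proof -
 have nat: "ga (t + of_nat k) = ga t" for t and k :: nat
 proof (induction k)
  case (Suc k)
  thus ?case using assms[of "t + of_nat k"] by (simp add: add_ac)
 qed simp
 show ?thesis
 proof (cases "n >= 0")
  case True
  thus ?thesis using nat[of t "nat n"] by simp
 next
  case False
  thus ?thesis using nat[of "t + of_int n" "nat (- n)"] by simp
 qed
qed

lemma periodic_inj:
 fixes ga :: "real => 'a"
 assumes "!!t. ga (t + 1) = ga t" "inj_on ga {0..<1}" "ga s = ga t"
 obtains n :: int where "s = t + of_int n"
proof -
 have "ga (frac s) = ga (frac t)"
  using periodic_int[of ga "frac s" "\<lfloor>s\<rfloor>", OF assms(1)] periodic_int[of ga "frac t" "\<lfloor>t\<rfloor>", OF assms(1)] assms(3)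
  by (simp add: frac_def)
 hence "frac s = frac t"
  by (rule inj_onD[OF assms(2)]) (simp_all add: frac_lt_1)
 hence "s = t + of_int (\<lfloor>s\<rfloor> - \<lfloor>t\<rfloor>)" by (simp add: frac_def)
 thus thesis by (rule that)
qed

lemma periodic_range:
 fixes ga :: "real => 'a"
 assumes "!!t. ga (t + 1) = ga t"
 shows "range ga = ga ` {0..1}"
proof -
 have "ga t = ga (frac t)" for t
  using periodic_int[of ga "frac t" "\<lfloor>t\<rfloor>", OF assms] by (simp add: frac_def)
 moreover have "frac t : {0..1}" for t :: real using frac_lt_1[of t] by (simp add: less_imp_le)
 ultimately show ?thesis by blast
qed

lemma oriented_knot_carrier:
 assumes "oriented_knot K"
 shows "compact (carrier K)" "carrier K ~= {}" "carrier K \<subseteq> S3"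
proof -
 obtain ga where ga: "smooth_on UNIV ga" "range ga \<subseteq> S3" "!!t. ga (t + 1) = ga t" "K = directed_arc ga UNIV"
  using assms by (rule oriented_knotE) blast
 have "carrier K = ga ` {0..1}" using periodic_range[of ga, OF ga(3)] ga(4) by (simp add: carrier_directed_arc)
 thus "compact (carrier K)"
  by (simp add: compact_continuous_image continuous_on_subset[OF smooth_continuous[OF ga(1)]])
 show "carrier K ~= {}" "carrier K \<subseteq> S3" using ga(2,4) by (simp_all add: carrier_directed_arc)
qed

lemma oriented_knot_image:
 assumes h: "diffeo_S3 h" and K: "oriented_knot K"
 shows "oriented_knot (tangent_map h ` K)"
proof -
 obtain ga where ga: "smooth_on UNIV ga" "range ga \<subseteq> S3" "!!t. ga (t + 1) = ga t" "inj_on ga {0..<1}"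
  "!!t. VD ga t ~= 0" "K = directed_arc ga UNIV" using K by (rule oriented_knotE) blast
 note hD = diffeo_S3D[OF h]
 have S: "ga t : S3" for t using ga(2) by blast
 show ?thesis
  unfolding oriented_knot_def
 proof (intro exI[of _ "%t. h (ga t)"] conjI allI)
  show "smooth_on UNIV (%t. h (ga t))" by (rule smooth_patch_compose[OF ga(1) hD(5) ga(2)])
  show "range (%t. h (ga t)) \<subseteq> S3" using hD(1)[OF S] by blast
  show "h (ga (t + 1)) = h (ga t)" for t by (simp add: ga(3))
  show "inj_on (%t. h (ga t)) {0..<1}"
  proof -
   have "ga ` {0..<1} \<subseteq> S3" using ga(2) by blast
   from comp_inj_on[OF ga(4) inj_on_subset[OF hD(7) this]] show ?thesis by (simp add: o_def)
  qed
  show "VD (%t. h (ga t)) t ~= 0" for t unfolding vector_derivative_dS[OF hD(5) ga(1) UNIV_I ga(2)]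
   using diffeo_dS_inj[OF h S curve_tangent[OF ga(1) UNIV_I ga(2)]] ga(5) by blast
  show "tangent_map h ` K = directed_arc (%t. h (ga t)) UNIV"
   unfolding ga(6) by (rule tangent_map_directed_arc[OF hD(5) ga(1) subset_UNIV ga(2)])
 qed
qed

subsection \<open>Double branched covers\<close>

locale branched_cover =
 fixes p :: "real^4 => real^4" and K :: "(real^4) set"
 assumes cover: "double_branched_cover p K" and K_S3: "K \<subseteq> S3" and closed_K: "closed K"
begin

definition X :: "(real^4) set" where
 "X = S3 - p -` K"

lemma covering: "covering_space X p (S3 - K)"
 using cover by (simp add: double_branched_cover_def X_def)

lemma X_S3: "X \<subseteq> S3"
 by (auto simp: X_def)

lemma p_X: "x : X ==> p x : S3 - K"
 using covering_space_imp_surjective[OF covering] by blast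

lemma p_S3: "x : S3 ==> p x : S3"
 using p_X[of x] K_S3 by (cases "p x : K") (auto simp: X_def)

lemma in_X_iff: "x : S3 ==> x : X \<longleftrightarrow> p x ~: K"
 by (simp add: X_def)

lemma fiber:
 assumes "y : S3 - K"
 obtains a b where "a ~= b" "a : X" "b : X" "p a = y" "p b = y" "!!x. x : S3 ==> p x = y ==> x = a | x = b"
proof -
 have "card {x : S3. p x = y} = 2" using cover assms by (simp add: double_branched_cover_def)
 then obtain a b where ab: "{x : S3. p x = y} = {a, b}" "a ~= b" by (meson card_2_iff)
 have "a : {x : S3. p x = y}" "b : {x : S3. p x = y}" unfolding ab by blast+
 hence "a : X" "b : X" "p a = y" "p b = y" using assms by (auto simp: X_def)
 moreover have "x = a | x = b" if "x : S3" "p x = y" for x using that ab(1) by blast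
 ultimately show thesis using that ab(2) by blast
qed

lemma local_chart:
 assumes "x : X"
 obtains ph rh where "rh > 0" "patch (ball 0 rh) ph" "ph 0 = x" "patch (ball 0 rh) (%q. p (ph q))" "ph ` ball 0 rh \<subseteq> X"
proof -
 have "EX ph. patch (ball 0 2) ph & ph 0 = x & patch (ball 0 2) (%q. p (ph q))"
 proof -
  have "ALL x:S3 - p -` K. EX ph. oriented_chart ph & ph 0 = x & oriented_chart (p \<circ> ph)"
   using cover unfolding double_branched_cover_def by blast
  from bspec[OF this assms[unfolded X_def]] obtain ph
   where "oriented_chart ph" "ph 0 = x" "oriented_chart (p \<circ> ph)" by blast
  thus ?thesis by (intro exI[of _ ph]) (simp add: oriented_chart_iff_patch o_def)
 qed
 then obtain ph where ph: "patch (ball 0 2) ph" "ph 0 = x" "patch (ball 0 2) (%q. p (ph q))" by blast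
 have "open (ball 0 2 Int (%q. p (ph q)) -` (- K))"
  by (rule continuous_open_preimage[OF smooth_continuous[OF patch_smooth[OF ph(3)]]]) (use closed_K in auto)
 moreover have "0 : ball 0 2 Int (%q. p (ph q)) -` (- K)" using assms ph(2) by (simp add: X_def)
 ultimately obtain rh where rh: "rh > 0" "ball 0 rh \<subseteq> ball 0 2 Int (%q. p (ph q)) -` (- K)"
  using open_contains_ball by blast
 show thesis
 proof (rule that[of rh ph])
  show "rh > 0" "ph 0 = x" by (fact rh(1) ph(2))+
  show "patch (ball 0 rh) ph" "patch (ball 0 rh) (%q. p (ph q))"
   using patch_subset[OF ph(1) open_ball] patch_subset[OF ph(3) open_ball] rh(2) by blast+
  thus "ph ` ball 0 rh \<subseteq> X" using patch_S3 rh(2) unfolding X_def by blast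
 qed
qed

lemma smooth_p_chart:
 assumes ph: "patch U ph" and pph: "smooth_on U (%q. p (ph q))"
 shows "smooth_at_S3 (ph ` U) p"
 unfolding smooth_at_S3_def
proof
 show "ph ` U \<subseteq> S3" by (rule patch_image[OF ph])
 have "smooth_on (cone (ph ` U)) (%y. p (ph (inv_into U ph (sgn y))))"
  by (rule smooth_compose[OF _ pph, where f = "%y. inv_into U ph (sgn y)"])
   (use patch_smooth_inverse[OF ph] in \<open>auto simp: smooth_at_S3_def cone_def intro!: inv_into_into\<close>)
 thus "smooth_on (cone (ph ` U)) (%y. p (sgn y))"
  by (rule smooth_cong) (auto simp: cone_def f_inv_into_f patch_inj[OF ph])
qed

lemma openin_X: "openin (top_of_set S3) X"
proof (rule openin_subopen[THEN iffD2], intro ballI)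
 fix x assume "x : X"
 then obtain ph rh where ph: "rh > 0" "patch (ball 0 rh) ph" "ph 0 = x" "patch (ball 0 rh) (%q. p (ph q))" "ph ` ball 0 rh \<subseteq> X"
  by (rule local_chart)
 show "EX T. openin (top_of_set S3) T & x : T & T \<subseteq> X"
  using patch_openin[OF ph(2)] ph(1,3,5) by (intro exI[of _ "ph ` ball 0 rh"]) auto
qed

lemma smooth_p: "smooth_at_S3 X p"
proof (rule smooth_at_S3_local[OF openin_X])
 fix x assume "x : X"
 then obtain ph rh where ph: "rh > 0" "patch (ball 0 rh) ph" "ph 0 = x" "patch (ball 0 rh) (%q. p (ph q))"
  by (rule local_chart)
 show "EX B. x : B & smooth_at_S3 B p"
  using smooth_p_chart[OF ph(2) patch_smooth[OF ph(4)]] ph(1,3) by (intro exI[of _ "ph ` ball 0 rh"]) auto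
qed

lemma p_image_S3: "p ` X \<subseteq> S3"
 using p_X by blast

lemma dS_p:
 assumes x: "x : X"
 shows "!!v. x \<bullet> v = 0 ==> dS p x v = 0 ==> v = 0"
  and "!!w. p x \<bullet> w = 0 ==> EX v. x \<bullet> v = 0 & dS p x v = w"
proof -
 obtain ph rh where ph: "rh > 0" "patch (ball 0 rh) ph" "ph 0 = x" "patch (ball 0 rh) (%q. p (ph q))" "ph ` ball 0 rh \<subseteq> X"
  using x by (rule local_chart)
 have z: "0 : ball 0 rh" using ph(1) by simp
 have D: "FD (%q. p (ph q)) 0 v = dS p x (FD ph 0 v)" for v
  using frechet_derivative_patch_compose[OF ph(2) smooth_p z ph(5)] ph(3) by simp
 show "v = 0" if v: "x \<bullet> v = 0" "dS p x v = 0" for v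
 proof -
  have "ph 0 \<bullet> v = 0" using v(1) ph(3) by simp
  then obtain w where w: "FD ph 0 w = v" by (rule patch_tangent_surj[OF ph(2) z])
  hence "w = 0" using patch_derivative_inj[OF ph(4) z] D v(2) by simp
  thus "v = 0" using w linear_0[OF patch_linear[OF ph(2) z]] by simp
 qed
 show "EX v. x \<bullet> v = 0 & dS p x v = w" if w: "p x \<bullet> w = 0" for w
 proof -
  have "p (ph 0) \<bullet> w = 0" using w ph(3) by simp
  then obtain u where "FD (%q. p (ph q)) 0 u = w" by (rule patch_tangent_surj[OF ph(4) z])
  thus ?thesis using D patch_tangent[OF ph(2) z] ph(3) by (intro exI[of _ "FD ph 0 u"]) simp
 qed
qed

lemma preimage_curve_iff:
 "(x, v) : preimage_curve p A \<longleftrightarrow> (x, v) : UT & tangent_map p (x, v) : A"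
 by (auto simp: preimage_curve_def UT_iff)

lemma tangent_map_p_UT:
 assumes "(x, v) : UT" "x : X"
 shows "tangent_map p (x, v) : UT"
proof -
 have "dS p x v ~= 0" using assms dS_p(1)[OF assms(2), of v] by (auto simp: UT_iff)
 moreover have "p x \<bullet> dS p x v = 0" by (rule dS_tangent[OF smooth_p p_image_S3 assms(2)])
 ultimately show ?thesis
  using p_X[OF assms(2)] by (simp add: tangent_map_dS UT_iff norm_sgn sgn_div_norm)
qed

text \<open>Since \<open>p\<close> is an immersion at \<open>x\<close>, positive proportionality of
  the images pulls back to the vectors, and these have norm 1. Hence the direction of a curve
  determines the directions of its lifts.\<close>

lemma tangent_map_p_inj:
 assumes "(x, v) : UT" "(x, w) : UT" "x : X" "tangent_map p (x, v) = tangent_map p (x, w)"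
 shows "v = w"
proof -
 let ?a = "dS p x v" and ?b = "dS p x w"
 have vw: "norm v = 1" "norm w = 1" "x \<bullet> v = 0" "x \<bullet> w = 0" using assms(1,2) by (simp_all add: UT_iff)
 define \<alpha> \<beta> where "\<alpha> = norm ?a" and "\<beta> = norm ?b"
 have "v ~= 0" "w ~= 0" using vw by auto
 hence nz: "?a ~= 0" "?b ~= 0" using dS_p(1)[OF assms(3)] vw(3,4) by blast+
 have sg: "sgn ?a = sgn ?b" using assms(4) by (simp add: tangent_map_dS)
 have "?a = norm ?a *\<^sub>R sgn ?b" unfolding sg[symmetric] using nz(1) by (simp add: sgn_div_norm)
 from arg_cong[OF this, of "%x. norm ?b *\<^sub>R x"]
 have "norm ?b *\<^sub>R ?a = norm ?a *\<^sub>R (norm ?b *\<^sub>R sgn ?b)" by (simp only: scaleR_left_commute)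
 also have "norm ?b *\<^sub>R sgn ?b = ?b" using nz(2) by (simp add: sgn_div_norm)
 finally have "norm ?b *\<^sub>R ?a = norm ?a *\<^sub>R ?b" .
 hence eq: "\<beta> *\<^sub>R ?a = \<alpha> *\<^sub>R ?b" by (simp only: \<alpha>_def \<beta>_def)
 have pos: "\<alpha> > 0" "\<beta> > 0" using nz by (simp_all only: \<alpha>_def \<beta>_def zero_less_norm_iff not_False_eq_True)
 note lin = dS_linear[OF smooth_p assms(3)]
 have "dS p x (\<beta> *\<^sub>R v - \<alpha> *\<^sub>R w) = \<beta> *\<^sub>R ?a - \<alpha> *\<^sub>R ?b"
  by (simp only: linear_diff[OF lin] linear_cmul[OF lin])
 hence "dS p x (\<beta> *\<^sub>R v - \<alpha> *\<^sub>R w) = 0" by (simp only: eq diff_self)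
 moreover have "x \<bullet> (\<beta> *\<^sub>R v - \<alpha> *\<^sub>R w) = 0" by (simp only: inner_diff_right inner_scaleR_right vw mult_zero_right diff_self)
 ultimately have "\<beta> *\<^sub>R v - \<alpha> *\<^sub>R w = 0" using dS_p(1)[OF assms(3)] by blast
 hence e: "\<beta> *\<^sub>R v = \<alpha> *\<^sub>R w" by (simp only: right_minus_eq)
 have "\<beta> = norm (\<beta> *\<^sub>R v)" using pos vw(1) by simp
 also have "\<dots> = \<alpha>" unfolding e using pos vw(2) by simp
 finally show "v = w" using e pos by simp
qed

text \<open>Near \<open>q\<close> the lift \<open>F\<close> and the map \<open>E\<close> below it
  factor through the same map \<open>th\<close> into the domain of a chart \<open>ph\<close> for
  which \<open>p o ph\<close> is a chart as well; smoothness and orientation are compared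
  there.\<close>

definition lift_chart where
 "lift_chart U F E q W ph rh th \<longleftrightarrow> open W & q : W & W \<subseteq> U & patch (ball 0 rh) ph &
  patch (ball 0 rh) (%q. p (ph q)) & smooth_on W th & th ` W \<subseteq> ball 0 rh &
  (ALL y:W. F y = ph (th y)) & (ALL y:W. E y = p (ph (th y)))"

lemma lift_chartD:
 assumes "lift_chart U F E q W ph rh th"
 shows "open W" "q : W" "W \<subseteq> U" "patch (ball 0 rh) ph" "patch (ball 0 rh) (%q. p (ph q))"
  "smooth_on W th" "th ` W \<subseteq> ball 0 rh" "!!y. y : W ==> F y = ph (th y)" "!!y. y : W ==> E y = p (ph (th y))"
 using assms by (simp_all add: lift_chart_def)

lemma lift_local:
 fixes F E :: "'a::euclidean_space => real^4"
 assumes F: "continuous_on U F" "F ` U \<subseteq> X" "!!q. q : U ==> p (F q) = E q" and E: "smooth_on U E" and q: "q : U"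
 shows "EX W ph rh th. lift_chart U F E q W ph rh th"
proof -
 have "F q : X" using F(2) q by blast
 then obtain ph rh where ph: "rh > 0" "patch (ball 0 rh) ph" "ph 0 = F q" "patch (ball 0 rh) (%q. p (ph q))" "ph ` ball 0 rh \<subseteq> X"
  by (rule local_chart)
 define W where "W = U Int F -` (ph ` ball 0 rh)"
 have "openin (top_of_set U) W" unfolding W_def
  by (rule continuous_openin_preimage[OF F(1) _ patch_openin[OF ph(2)]]) (use F(2) X_S3 in blast)
 hence W: "open W" by (rule openin_open_trans[OF _ smooth_open[OF E]])
 have Eim: "E ` W \<subseteq> (%q. p (ph q)) ` ball 0 rh"
 proof
  fix x assume "x : E ` W"
  then obtain y where y: "y : U" "F y : ph ` ball 0 rh" "x = E y" by (auto simp: W_def)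
  then obtain s where "s : ball 0 rh" "F y = ph s" by blast
  thus "x : (%q. p (ph q)) ` ball 0 rh" using F(3)[OF y(1)] y(3) by (intro image_eqI[of _ _ s]) simp_all
 qed
 define th where "th y = inv_into (ball 0 rh) (%q. p (ph q)) (E y)" for y
 have "lift_chart U F E q W ph rh th"
  unfolding lift_chart_def
 proof (intro conjI ballI W ph(2,4))
  have "F q : ph ` ball 0 rh" using ph(1,3) by (intro image_eqI[of _ ph 0]) simp_all
  thus "q : W" "W \<subseteq> U" using q by (simp_all add: W_def)
  thus "smooth_on W th" unfolding th_def by (intro smooth_patch_compose[OF smooth_subset[OF E W] patch_smooth_inverse[OF ph(4)] Eim])
  show "th ` W \<subseteq> ball 0 rh"
  proof (intro image_subsetI)
   fix y assume "y : W"
   thus "th y : ball 0 rh" unfolding th_def by (intro inv_into_into subsetD[OF Eim] imageI)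
  qed
  show "E y = p (ph (th y))" if "y : W" for y
  proof -
   have "E y : (%q. p (ph q)) ` ball 0 rh" using Eim that by blast
   from f_inv_into_f[OF this] show ?thesis by (simp add: th_def)
  qed
  show "F y = ph (th y)" if y: "y : W" for y
  proof -
   obtain s where s: "s : ball 0 rh" "F y = ph s" using y by (auto simp: W_def)
   hence "E y = p (ph s)" using F(3)[of y] y by (simp add: W_def)
   hence "th y = s" unfolding th_def using inv_into_f_f[OF patch_inj[OF ph(4)] s(1)] by simp
   thus ?thesis using s(2) by simp
  qed
 qed
 thus ?thesis by blast
qed

lemma lift_smooth:
 fixes F E :: "'a::euclidean_space => real^4"
 assumes F: "continuous_on U F" "F ` U \<subseteq> X" "!!q. q : U ==> p (F q) = E q" and E: "smooth_on U E"
 shows "smooth_on U F"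
  and "q : U ==> FD E q v = dS p (F q) (FD F q v)"
proof -
 show sm: "smooth_on U F"
 proof (rule smooth_local[OF _ smooth_open[OF E]])
  fix q assume "q : U"
  obtain W ph rh th where "lift_chart U F E q W ph rh th" using lift_local[OF F E \<open>q : U\<close>] by blast
  note W = lift_chartD(1,2,4,6,7,8)[OF this]
  have "smooth_on W (%y. ph (th y))" by (rule smooth_compose[OF W(4) patch_smooth[OF W(3)] W(5)])
  hence "smooth_on W F" by (rule smooth_cong) (simp add: W(6))
  thus "EX V. q : V & smooth_on V F" using W(2) by blast
 qed
 assume q: "q : U"
 have "((%y. p (F y)) has_derivative (%v. dS p (F q) (FD F q v))) (at q)"
  by (rule has_derivative_patch_compose[OF smooth_has_derivative[OF sm q] smooth_p smooth_open[OF E] q F(2)])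
 hence "(E has_derivative (%v. dS p (F q) (FD F q v))) (at q)"
  by (rule has_derivative_transform_within_open[OF _ smooth_open[OF E] q]) (rule F(3))
 from fun_cong[OF frechet_derivative_at[OF this], of v]
 show "FD E q v = dS p (F q) (FD F q v)" by simp
qed

text \<open>\<open>F\<close> and \<open>e\<close> are \<open>ph\<close> and \<open>p o ph\<close>
  after the same map \<open>th\<close>. Both charts are positively oriented, so the determinant of
  \<open>th\<close> decides the sign for \<open>F\<close> and \<open>e\<close> alike.\<close>

lemma lift_patch:
 assumes e: "patch U e" and F: "continuous_on U F" "F ` U \<subseteq> X" "!!q. q : U ==> p (F q) = e q"
 shows "patch U F"
 unfolding patch_def
proof (intro conjI ballI)
 show "smooth_on U F" by (rule lift_smooth(1)[OF F patch_smooth[OF e]])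
 show "inj_on F U" using inj_onD[OF patch_inj[OF e]] F(3) by (metis inj_onI)
 show "F ` U \<subseteq> S3" using F(2) X_S3 by blast
 fix q assume q: "q : U"
 obtain W ph rh th where "lift_chart U F e q W ph rh th"
  using lift_local[OF F patch_smooth[OF e] q] by blast
 note W = lift_chartD[OF this]
 have thq: "th q : ball 0 rh" using W(2,7) by blast
 have D: "FD G q v = FD g (th q) (FD th q v)"
  if g: "patch (ball 0 rh) g" and G: "!!y. y : W ==> G y = g (th y)" for G g v
 proof -
  have "((%y. g (th y)) has_derivative (%v. FD g (th q) (FD th q v))) (at q)"
   using diff_chain_at[OF smooth_has_derivative[OF W(6,2)] patch_has_derivative[OF g thq]] by (simp add: o_def)
  hence "(G has_derivative (%v. FD g (th q) (FD th q v))) (at q)" by (rule has_derivative_transform_within_open[OF _ W(1,2)]) (simp add: G)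
  from fun_cong[OF frechet_derivative_at[OF this], of v] show ?thesis by simp
 qed
 have DF: "FD F q v = FD ph (th q) (FD th q v)" for v
  by (rule D[OF W(4,8)])
 have De: "FD e q v = FD (%q. p (ph q)) (th q) (FD th q v)" for v
  by (rule D[OF W(5,9)])
 note tF = frame_det_transition[where D = "FD th q", OF DF patch_linear[OF W(4) thq]]
 note te = frame_det_transition[where D = "FD th q", OF De patch_linear[OF W(5) thq]]
 define d where "d = det3 (FD th q)"
 have d: "frame_det F q = d * frame_det ph (th q)" "frame_det e q = d * frame_det (%q. p (ph q)) (th q)"
  using tF[of "ph (th q)"] te[of "p (ph (th q))"] by (simp_all only: frame_det_def d_def Let_def W(8)[OF W(2)] W(9)[OF W(2)])
 have "frame_det e q > 0" "frame_det ph (th q) > 0" "frame_det (%q. p (ph q)) (th q) > 0"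
  using e q W(4,5) thq by (auto simp: patch_def)
 thus "frame_det F q > 0" using d by (simp add: zero_less_mult_iff)
qed

section \<open>Lifts over simply connected domains\<close>

lemma lift_exists:
 fixes E :: "'a::euclidean_space => real^4"
 assumes U: "open U" "simply_connected U" and E: "continuous_on U E" "E ` U \<subseteq> S3 - K"
  and z: "z : U" "a : X" "p a = E z"
 obtains F where "continuous_on U F" "F ` U \<subseteq> X" "!!q. q : U ==> p (F q) = E q" "F z = a"
proof -
 have lpc: "locally path_connected U"
  using open_imp_locally_path_connected U(1) by blast
 obtain F where "continuous_on U F" "F : U \<rightarrow> X" "F z = a" "!!q. q : U ==> p (F q) = E q"
  by (rule covering_space_lift_strong[OF covering z(2,1) U(2) lpc E(1)]) (use E(2) z(3) in auto)
 thus thesis using that by (metis image_subset_iff_funcset)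
qed

lemma lift_unique:
 fixes E :: "'a::topological_space => real^4"
 assumes "connected U" "continuous_on U E" "E ` U \<subseteq> S3 - K"
  and F: "continuous_on U F" "F ` U \<subseteq> X" "!!q. q : U ==> p (F q) = E q"
  and G: "continuous_on U G" "G ` U \<subseteq> X" "!!q. q : U ==> p (G q) = E q"
  and "z : U" "F z = G z" "q : U"
 shows "F q = G q"
 by (rule covering_space_lift_unique[OF covering \<open>F z = G z\<close> assms(2) _ F(1) _ _ G(1) _ _ assms(1) \<open>z : U\<close> \<open>q : U\<close>])
  (use assms in auto)

text \<open>Each of the two points of one fibre starts a lift. Lifts agreeing once agree on the
  whole connected domain, so these two stay apart and exhaust every two-point fibre.\<close>

lemma two_lifts:
 fixes E :: "'a::euclidean_space => real^4"
 assumes U: "open U" "simply_connected U" "U ~= {}" and E: "continuous_on U E" "E ` U \<subseteq> S3 - K"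
 obtains F G where "continuous_on U F" "F ` U \<subseteq> X" "!!q. q : U ==> p (F q) = E q"
  "continuous_on U G" "G ` U \<subseteq> X" "!!q. q : U ==> p (G q) = E q"
  "!!q. q : U ==> F q ~= G q" "!!q x. q : U ==> x : S3 ==> p x = E q ==> x = F q | x = G q"
proof -
 obtain z where z: "z : U" using U(3) by blast
 hence "E z : S3 - K" using E(2) by blast
 then obtain a b where ab: "a ~= b" "a : X" "b : X" "p a = E z" "p b = E z"
  by (rule fiber)
 obtain F where F: "continuous_on U F" "F ` U \<subseteq> X" "!!q. q : U ==> p (F q) = E q" "F z = a"
  by (rule lift_exists[OF U(1,2) E z ab(2,4)]) blast
 obtain G where G: "continuous_on U G" "G ` U \<subseteq> X" "!!q. q : U ==> p (G q) = E q" "G z = b"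
  by (rule lift_exists[OF U(1,2) E z ab(3,5)]) blast
 have conn: "connected U" using simply_connected_imp_connected[OF U(2)] .
 have ne: "F q ~= G q" if q: "q : U" for q
  using lift_unique[OF conn E F(1-3) G(1-3) q _ z] F(4) G(4) ab(1) by auto
 have "x = F q | x = G q" if q: "q : U" and x: "x : S3" "p x = E q" for q x
 proof -
  have "E q : S3 - K" using E(2) q by blast
  then obtain a b where ab: "!!x. x : S3 ==> p x = E q ==> x = a | x = b" by (rule fiber) blast
  have "F q : S3" "G q : S3" using F(2) G(2) q X_S3 by blast+
  thus ?thesis using ab[OF x] ab[of "F q"] ab[of "G q"] F(3)[OF q] G(3)[OF q] ne[OF q] by metis
 qed
 thus thesis using that[OF F(1-3) G(1-3) ne] by blast
qed

text \<open>\<open>F\<close> and \<open>G\<close> exhaust the fibres pointwise, and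
  \<open>tangent_map_p_inj\<close> forces the directions, so the equality holds for oriented curves
  and not only for point sets.\<close>

lemma preimage_directed_arc:
 assumes c: "smooth_on J c" "c ` J \<subseteq> S3 - K" "T \<subseteq> J" "!!t. t : T ==> VD c t ~= 0"
  and F: "continuous_on J F" "F ` J \<subseteq> X" "!!t. t : J ==> p (F t) = c t"
  and G: "continuous_on J G" "G ` J \<subseteq> X" "!!t. t : J ==> p (G t) = c t"
  and FG: "!!t x. t : J ==> x : S3 ==> p x = c t ==> x = F t | x = G t"
 shows "preimage_curve p (directed_arc c T) = directed_arc F T Un directed_arc G T"
  and "!!t. t : T ==> VD F t ~= 0"
proof -
 have L: "smooth_on J F'" "!!t. t : T ==> VD F' t ~= 0" "directed_arc F' T \<subseteq> UT"
  "!!t. t : T ==> tangent_map p (F' t, sgn (VD F' t)) = (c t, sgn (VD c t))"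
  if F': "continuous_on J F'" "F' ` J \<subseteq> X" "!!t. t : J ==> p (F' t) = c t" for F'
 proof -
  show sm: "smooth_on J F'" by (rule lift_smooth(1)[OF F' c(1)])
  have vd: "VD c t = dS p (F' t) (VD F' t)" if "t : T" for t
  proof -
   have t: "t : J" using that c(3) by blast
   have "VD c t = VD (%t. p (F' t)) t" by (rule vector_derivative_cong_open[OF smooth_open[OF c(1)] t]) (simp add: F'(3))
   thus ?thesis using vector_derivative_dS[OF smooth_p sm t F'(2)] by simp
  qed
  show ne: "VD F' t ~= 0" if "t : T" for t
  proof
   assume z: "VD F' t = 0"
   have "F' t : X" using that c(3) F'(2) by blast
   thus False using c(4)[OF that] vd[OF that] z linear_0[OF dS_linear[OF smooth_p]] by simp
  qed
  show "directed_arc F' T \<subseteq> UT" by (rule directed_arc_UT[OF sm c(3) _ ne]) (use F'(2) X_S3 in blast)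
  show "tangent_map p (F' t, sgn (VD F' t)) = (c t, sgn (VD c t))" if "t : T" for t
  proof -
   have "F' t : X" "t : J" using that c(3) F'(2) by blast+
   thus ?thesis unfolding tangent_map_dS vd[OF that] by (simp add: F'(3) sgn_linear_sgn[OF dS_linear[OF smooth_p]])
  qed
 qed
 note LF = L[OF F] and LG = L[OF G]
 show "!!t. t : T ==> VD F t ~= 0" by (rule LF(2))
 show "preimage_curve p (directed_arc c T) = directed_arc F T Un directed_arc G T"
 proof (intro equalityI subsetI)
  fix a assume a: "a : preimage_curve p (directed_arc c T)"
  obtain x v where xv: "a = (x, v)" by fastforce
  have UT: "(x, v) : UT" "tangent_map p (x, v) : directed_arc c T" using a xv preimage_curve_iff by auto
  then obtain t where t: "t : T" "tangent_map p (x, v) = (c t, sgn (VD c t))" by (auto simp: directed_arc_def)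
  have tJ: "t : J" using t c(3) by blast
  have x: "x : S3" "p x = c t" using UT t by (auto simp: UT_iff tangent_map_dS)
  have xX: "x : X" using x c(2) tJ by (auto simp: in_X_iff)
  have "EX H:{F, G}. a : directed_arc H T"
  proof -
   obtain H where H: "H : {F, G}" "x = H t" using FG[OF tJ x] by blast
   have "tangent_map p (x, sgn (VD H t)) = tangent_map p (x, v)"
    "(x, sgn (VD H t)) : UT" using H LF(3,4) LG(3,4) t by (auto simp: directed_arc_def)
   hence "v = sgn (VD H t)" using tangent_map_p_inj[OF UT(1) _ xX] by metis
   thus ?thesis using H t(1) xv by (auto simp: directed_arc_def)
  qed
  thus "a : directed_arc F T Un directed_arc G T" by blast
 next
  fix a assume "a : directed_arc F T Un directed_arc G T"
  thus "a : preimage_curve p (directed_arc c T)" using LF(3,4) LG(3,4) by (auto simp: directed_arc_def preimage_curve_iff subset_iff)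
 qed
qed

end

lemma carrier_tangent_map: "carrier (tangent_map h ` A) = h ` carrier A"
 by (simp add: image_image tangent_map_def case_prod_unfold)

context branched_cover
begin

lemma lift_periodic_knot:
 assumes ga: "!!t. ga (t + 1) = ga t" "inj_on ga {0..<1}"
  and F: "smooth_on UNIV F" "range F \<subseteq> X" "!!t. p (F t) = ga t" "!!t. VD F t ~= 0"
  and per: "!!t. F (t + 1) = F t"
 shows "oriented_knot (directed_arc F UNIV)"
 unfolding oriented_knot_def
proof (intro exI[of _ F] conjI allI F(1,4) per)
 show "range F \<subseteq> S3" using F(2) X_S3 by blast
 show "inj_on F {0..<1}" using inj_onD[OF ga(2)] F(3) by (metis inj_onI)
qed simp

text \<open>The preimage of a knot off the branching set consists of two knots or of one knot traversing
 it twice, according to whether the lifts of a period are closed.\<close>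

lemma preimage_knot:
 assumes k: "oriented_knot k" "carrier k Int K = {}"
 obtains \<F> where "finite \<F>" "!!k. k : \<F> ==> oriented_knot k" "disjoint_family_on carrier \<F>"
  "preimage_curve p k = \<Union>\<F>"
proof -
 obtain ga where ga: "smooth_on UNIV ga" "range ga \<subseteq> S3" "!!t. ga (t + 1) = ga t" "inj_on ga {0..<1}"
  "!!t. VD ga t ~= 0" "k = directed_arc ga UNIV" using k(1) by (rule oriented_knotE) blast
 have gaK: "range ga \<subseteq> S3 - K" using ga(2) k(2) by (auto simp: ga(6) carrier_directed_arc)
 note cga = smooth_continuous[OF ga(1)]
 have sc: "simply_connected (UNIV :: real set)" by (simp add: convex_imp_simply_connected)
 obtain F G where F: "continuous_on UNIV F" "range F \<subseteq> X" "!!t. p (F t) = ga t"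
  and G: "continuous_on UNIV G" "range G \<subseteq> X" "!!t. p (G t) = ga t"
  and ne: "!!t. F t ~= G t" and FG: "!!t x. x : S3 ==> p x = ga t ==> x = F t | x = G t"
  by (rule two_lifts[OF open_UNIV sc UNIV_not_empty cga gaK]) auto
 have S3: "F t : S3" "G t : S3" for t using F(2) G(2) X_S3 by blast+
 have sF: "smooth_on UNIV F" by (rule lift_smooth(1)[OF F(1,2) _ ga(1)]) (rule F(3))
 have sG: "smooth_on UNIV G" by (rule lift_smooth(1)[OF G(1,2) _ ga(1)]) (rule G(3))
 have pre: "preimage_curve p k = directed_arc F UNIV Un directed_arc G UNIV"
  unfolding ga(6) by (rule preimage_directed_arc(1)[OF ga(1) gaK subset_UNIV ga(5) F(1,2) F(3) G(1,2) G(3) FG])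
 have dF: "VD F t ~= 0" for t
  by (rule preimage_directed_arc(2)[OF ga(1) gaK subset_UNIV ga(5) F(1,2) F(3) G(1,2) G(3) FG UNIV_I])
 have GF: "x = G t | x = F t" if "x : S3" "p x = ga t" for t x using FG[OF that] by blast
 have dG: "VD G t ~= 0" for t
  by (rule preimage_directed_arc(2)[OF ga(1) gaK subset_UNIV ga(5) G(1,2) G(3) F(1,2) F(3) GF UNIV_I])
 have uniq: "P t = Q t" if P: "continuous_on UNIV P" "range P \<subseteq> X" "!!t. p (P t) = ga t"
  and Q: "continuous_on UNIV Q" "range Q \<subseteq> X" "!!t. p (Q t) = ga t" and z: "P 0 = Q 0" for P Q and t :: real
  by (rule lift_unique[OF connected_UNIV cga gaK P(1,2) P(3) Q(1,2) Q(3) UNIV_I z UNIV_I])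
 have shift: "continuous_on UNIV (%t. P (t + 1 :: real))" "range (%t. P (t + 1)) \<subseteq> X" "!!t. p (P (t + 1)) = ga t"
  if P: "continuous_on UNIV P" "range P \<subseteq> X" "!!t. p (P t) = ga t" for P
  using P ga(3) by (auto intro!: continuous_on_compose2[OF P(1)] continuous_intros)
 have sh: "P (t + 1) = Q t" if P: "continuous_on UNIV P" "range P \<subseteq> X" "!!t. p (P t) = ga t"
  and Q: "continuous_on UNIV Q" "range Q \<subseteq> X" "!!t. p (Q t) = ga t" and z: "P 1 = Q 0" for P Q and t :: real
  by (rule uniq[of "%t. P (t + 1)" Q t, OF shift[OF P(1,2) P(3)] Q(1,2) Q(3)]) (simp add: z)
 show thesis
 proof (cases "F 1 = F 0")
  case True
  have perF: "F (t + 1) = F t" for t by (rule sh[OF F(1,2) F(3) F(1,2) F(3) True])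
  have "G 1 = G 0" using FG[of "G 1" 0] S3 G(3)[of 1] ga(3)[of 0] ne[of 1] True by auto
  hence perG: "G (t + 1) = G t" for t by (rule sh[OF G(1,2) G(3) G(1,2) G(3)])
  have disj: "F s ~= G t" for s t
  proof
   assume eq: "F s = G t"
   hence "ga s = ga t" using F(3)[of s] G(3)[of t] by simp
   then obtain n :: int where "s = t + of_int n" by (rule periodic_inj[of ga, OF ga(3,4)])
   hence "F s = F t" using periodic_int[of F, OF perF] by simp
   thus False using eq ne[of t] by simp
  qed
  show thesis
  proof (rule that[of "{directed_arc F UNIV, directed_arc G UNIV}"])
   show "oriented_knot k" if "k : {directed_arc F UNIV, directed_arc G UNIV}" for k
    using that lift_periodic_knot[OF ga(3,4) sF F(2) F(3) dF perF] lift_periodic_knot[OF ga(3,4) sG G(2) G(3) dG perG] by blast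
   show "disjoint_family_on carrier {directed_arc F UNIV, directed_arc G UNIV}"
    using disj by (auto simp: disjoint_family_on_def carrier_directed_arc) metis+
  qed (use pre in auto)
 next
  case False
  have F1: "F 1 = G 0" using FG[of "F 1" 0] S3 F(3)[of 1] ga(3)[of 0] False by auto
  have G1: "G 1 = F 0" using FG[of "G 1" 0] S3 G(3)[of 1] ga(3)[of 0] ne[of 1] F1 by auto
  have F_G: "F (t + 1) = G t" for t by (rule sh[OF F(1,2) F(3) G(1,2) G(3) F1])
  have G_F: "G (t + 1) = F t" for t by (rule sh[OF G(1,2) G(3) F(1,2) F(3) G1])
  \<comment> \<open>One period exchanges the two lifts, so \<open>F\<close> closes up after two
    periods and \<open>F (2 * t)\<close> parametrizes a single knot.\<close>
  have F2: "F (t + 2) = F t" for t using F_G[of "t + 1"] G_F[of t] by (simp add: add.assoc)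
  have two: "smooth_on UNIV (%t. 2 * t :: real)" by (intro smooth_mult smooth_const smooth_id) auto
  have one: "smooth_on UNIV (%t. t + 1 :: real)" by (intro smooth_add smooth_const smooth_id) auto
  have vd2: "VD (%t. 2 * t :: real) t = 2" for t
   by (intro vector_derivative_at) (auto intro!: derivative_eq_intros simp: has_vector_derivative_def)
  have vd1: "VD (%t. t + 1 :: real) t = 1" for t
   by (intro vector_derivative_at) (auto intro!: derivative_eq_intros simp: has_vector_derivative_def)
  have r2: "range (%t. 2 * t :: real) = UNIV" by (intro surjI[of _ "%t. t / 2"]) simp
  have r1: "range (%t. t + 1 :: real) = UNIV" by (intro surjI[of _ "%t. t - 1"]) simp
  have a2: "directed_arc (%t. F (2 * t)) UNIV = directed_arc F UNIV"
   using directed_arc_reparam[OF sF two subset_UNIV subset_UNIV] vd2 r2 by simp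
  have a1: "directed_arc G UNIV = directed_arc F UNIV" using directed_arc_reparam[OF sF one subset_UNIV subset_UNIV] vd1 r1 F_G by simp
  have "oriented_knot (directed_arc (%t. F (2 * t)) UNIV)" unfolding oriented_knot_def
  proof (intro exI[of _ "%t. F (2 * t)"] conjI allI)
   show "smooth_on UNIV (%t. F (2 * t))" by (rule smooth_compose[OF two sF]) simp
   show "range (%t. F (2 * t)) \<subseteq> S3" using S3 by blast
   show "F (2 * (t + 1)) = F (2 * t)" for t using F2[of "2 * t"] by (simp add: distrib_left)
   show "inj_on (%t. F (2 * t)) {0..<1}"
   proof (rule inj_onI)
    fix s t :: real assume st: "s : {0..<1}" "t : {0..<1}" "F (2 * s) = F (2 * t)"
    hence "ga (2 * s) = ga (2 * t)" using F(3) by metis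
    then obtain n :: int where n: "2 * s = 2 * t + of_int n" by (rule periodic_inj[of ga, OF ga(3,4)])
    hence "\<bar>of_int n :: real\<bar> < 2" using st by auto
    \<comment> \<open>A shift by 1 or -1 would replace \<open>F\<close> by the disjoint lift
      \<open>G\<close>, so only \<open>n = 0\<close> is left.\<close>
    hence "n : {-1, 0, 1}" by auto
    moreover have "n ~= 1" using n st(3) F_G[of "2 * t"] ne[of "2 * t"] by auto
    moreover have "n ~= - 1" using n st(3) F_G[of "2 * s"] ne[of "2 * s"] by auto
    ultimately show "s = t" using n by simp
   qed
   show "VD (%t. F (2 * t)) t ~= 0" for t
   proof -
    have D: "(F has_derivative (%u. u *\<^sub>R VD F (2 * t))) (at (2 * t))"
     using smooth_has_vector_derivative[OF sF UNIV_I] by (simp add: has_vector_derivative_def)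
    show ?thesis using vector_derivative_chain_smooth[OF two UNIV_I D] dF vd2 by simp
   qed
  qed simp
  thus thesis using that[of "{directed_arc F UNIV}"] pre a1 a2 by (simp add: disjoint_family_on_def)
 qed
qed

lemma preimage_curve_Un: "preimage_curve p (A Un B) = preimage_curve p A Un preimage_curve p B"
 and preimage_curve_UN: "preimage_curve p (UN i:I. L i) = (UN i:I. preimage_curve p (L i))"
 and preimage_curve_mono: "A \<subseteq> B ==> preimage_curve p A \<subseteq> preimage_curve p B"
 by (auto simp: preimage_curve_def)

lemma carrier_preimage: "x : carrier (preimage_curve p A) ==> x : S3 & p x : carrier A"
 by (force simp: preimage_curve_iff UT_iff tangent_map_dS)

lemma preimage_curve_UT: "preimage_curve p A \<subseteq> UT"
 by (auto simp: preimage_curve_iff)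

lemma preimage_oriented_link:
 assumes L: "labelled_link I L" and K: "!!j. j : I ==> carrier (L j) Int K = {}"
 shows "oriented_link (preimage_curve p (UN j:I. L j))"
proof -
 have "EX \<F>. finite \<F> & (ALL k:\<F>. oriented_knot k) & disjoint_family_on carrier \<F> & preimage_curve p (L j) = \<Union>\<F>"
  if "j : I" for j by (rule preimage_knot[OF _ K[OF that]]) (use L that in \<open>auto simp: labelled_link_def\<close>)
 then obtain \<F> where \<F>: "!!j. j : I ==> finite (\<F> j)" "!!j k. j : I ==> k : \<F> j ==> oriented_knot k"
  "!!j. j : I ==> disjoint_family_on carrier (\<F> j)" "!!j. j : I ==> preimage_curve p (L j) = \<Union>(\<F> j)" by metis
 have sub: "x : carrier k ==> p x : carrier (L j)" if "j : I" "k : \<F> j" for j k x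
 proof -
  assume "x : carrier k"
  hence "x : carrier (preimage_curve p (L j))" using \<F>(4)[OF that(1)] that(2) by auto
  thus ?thesis using carrier_preimage by blast
 qed
 show ?thesis
  unfolding oriented_link_def
 proof (intro exI[of _ "UN j:I. \<F> j"] conjI ballI)
  show "finite (UN j:I. \<F> j)" using L \<F>(1) by (auto simp: labelled_link_def)
  show "oriented_knot k" if "k : (UN j:I. \<F> j)" for k using that \<F>(2) by blast
  show "preimage_curve p (UN j:I. L j) = \<Union>(UN j:I. \<F> j)" using \<F>(4) by (auto simp: preimage_curve_UN)
  show "disjoint_family_on carrier (UN j:I. \<F> j)" unfolding disjoint_family_on_def
  proof (intro ballI impI)
   fix k k' assume "k : (UN j:I. \<F> j)" "k' : (UN j:I. \<F> j)" and ne: "k ~= k'"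
   then obtain j j' where j: "j : I" "k : \<F> j" "j' : I" "k' : \<F> j'" by blast
   show "carrier k Int carrier k' = {}"
   proof (cases "j = j'")
    case True
    thus ?thesis using \<F>(3)[OF j(1)] j ne by (auto simp: disjoint_family_on_def)
   next
    case False
    hence "carrier (L j) Int carrier (L j') = {}" using L j by (auto simp: labelled_link_def disjoint_family_on_def)
    thus ?thesis using sub[OF j(1,2)] sub[OF j(3,4)] by blast
   qed
  qed
 qed
qed

lemma tangent_map_p_compose:
 assumes h: "diffeo_S3 h" and "x : X" "h ` K = K"
 shows "tangent_map (%x. h (p x)) (x, v) = tangent_map h (tangent_map p (x, v))"
 by (rule tangent_map_compose[OF smooth_p diffeo_S3D(5)[OF h] p_image_S3]) (simp add: assms(2))

lemma preimage_lift_subset: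
 assumes h: "diffeo_S3 h" "h ` K = K" and h': "diffeo_S3 h'" and ph: "!!x. x : S3 ==> p (h' x) = h (p x)"
  and A: "carrier A Int K = {}"
 shows "tangent_map h' ` preimage_curve p A \<subseteq> preimage_curve p (tangent_map h ` A)"
proof
 fix b assume "b : tangent_map h' ` preimage_curve p A"
 then obtain x v where xv: "(x, v) : preimage_curve p A" "b = tangent_map h' (x, v)" by auto
 hence UT: "(x, v) : UT" "tangent_map p (x, v) : A" by (auto simp: preimage_curve_iff)
 hence pA: "p x : carrier A" by (metis fst_conv image_eqI tangent_map_dS)
 have x: "x : S3" using UT by (simp add: UT_iff)
 hence xX: "x : X" using pA A by (auto simp: in_X_iff)
 have px: "p x : S3 - K" by (rule p_X[OF xX])
 have h'x: "h' y : X" if "y : X" for y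
 proof -
  have "h (p y) ~: K"
  proof
   assume "h (p y) : K"
   then obtain z where "z : K" "h (p y) = h z" using h(2) by (metis imageE)
   hence "p y = z" using inj_onD[OF diffeo_S3D(7)[OF h(1)]] K_S3 p_X[OF that] by blast
   thus False using p_X[OF that] \<open>z : K\<close> by blast
  qed
  moreover have yS: "y : S3" using that X_S3 by blast
  ultimately show ?thesis using in_X_iff[OF diffeo_S3D(1)[OF h' yS]] ph[OF yS] by simp
 qed
 have sm: "smooth_at_S3 X h'" by (rule smooth_at_S3_subset[OF diffeo_S3D(5)[OF h'] openin_X X_S3])
 have "tangent_map p (tangent_map h' (x, v)) = tangent_map (%x. p (h' x)) (x, v)"
  by (rule tangent_map_compose[OF sm smooth_p, symmetric]) (use h'x xX in auto)
 also have "\<dots> = tangent_map (%x. h (p x)) (x, v)"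
  by (rule tangent_map_cong_S3[OF ph UT(1)])
 also have "\<dots> = tangent_map h (tangent_map p (x, v))"
  by (rule tangent_map_p_compose[OF h(1) xX h(2)])
 also have "\<dots> : tangent_map h ` A" using UT(2) by blast
 finally have "tangent_map p b : tangent_map h ` A" using xv(2) by simp
 moreover have "b : UT" unfolding xv(2) by (rule tangent_map_UT[OF h' UT(1)])
 ultimately show "b : preimage_curve p (tangent_map h ` A)"
  using preimage_curve_iff by (metis surj_pair)
qed

text \<open>The remaining inclusion is the one already shown, applied to the inverse
  diffeomorphisms.\<close>

lemma preimage_lift:
 assumes h: "diffeo_S3 h" "h ` K = K" and h': "diffeo_S3 h'" and ph: "!!x. x : S3 ==> p (h' x) = h (p x)"
  and A: "carrier A Int K = {}" "A \<subseteq> UT"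
 shows "preimage_curve p (tangent_map h ` A) = tangent_map h' ` preimage_curve p A"
proof (rule equalityI[OF _ preimage_lift_subset[OF h h' ph A(1)]])
 let ?g = "inv_into S3 h" and ?g' = "inv_into S3 h'"
 have gK: "?g ` K = K"
 proof -
  have "?g ` (h ` K) = (%x. x) ` K" unfolding image_image by (rule image_cong[OF HOL.refl diffeo_S3D(3)[OF h(1)]]) (use K_S3 in blast)
  thus ?thesis by (simp add: h(2))
 qed
 have pg: "p (?g' x) = ?g (p x)" if x: "x : S3" for x
 proof -
  have "p x = h (p (?g' x))" using ph[OF diffeo_S3D(2)[OF h' x]] diffeo_S3D(4)[OF h' x] by simp
  thus ?thesis using diffeo_S3D(3)[OF h(1) p_S3[OF diffeo_S3D(2)[OF h' x]]] by simp
 qed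
 have cA: "carrier (tangent_map h ` A) Int K = {}"
 proof -
  have "h x ~: K" if "x : carrier A" for x
  proof
   assume "h x : K"
   then obtain z where "z : K" "h x = h z" using h(2) by (metis imageE)
   moreover have "x : S3" using that A(2) UT_S3 by blast
   ultimately have "x = z" using inj_onD[OF diffeo_S3D(7)[OF h(1)]] K_S3 by blast
   thus False using \<open>z : K\<close> that A(1) by blast
  qed
  thus ?thesis unfolding carrier_tangent_map by blast
 qed
 have inv_A: "tangent_map ?g ` tangent_map h ` A = A"
 proof -
  have "tangent_map ?g ` tangent_map h ` A = (%a. a) ` A"
   unfolding image_image by (rule image_cong[OF HOL.refl tangent_map_inv[OF h(1)]]) (use A(2) in blast)
  thus ?thesis by simp
 qed
 have sub: "tangent_map ?g' ` preimage_curve p (tangent_map h ` A) \<subseteq> preimage_curve p A"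
  using preimage_lift_subset[OF diffeo_S3_inv[OF h(1)] gK diffeo_S3_inv[OF h'] pg cA] inv_A by simp
 show "preimage_curve p (tangent_map h ` A) \<subseteq> tangent_map h' ` preimage_curve p A"
 proof
  fix b assume b: "b : preimage_curve p (tangent_map h ` A)"
  hence bU: "b : UT" using preimage_curve_UT by blast
  have "tangent_map (%x. h' (?g' x)) b = tangent_map h' (tangent_map ?g' b)"
   by (rule tangent_map_compose[OF diffeo_S3D(6,5)[OF h'] _ UT_S3[OF bU]])
    (simp only: diffeo_S3D(8)[OF diffeo_S3_inv[OF h']] order_refl)
  moreover have "tangent_map (%x. h' (?g' x)) b = tangent_map (%x. x) b" by (rule tangent_map_cong_S3[OF diffeo_S3D(4)[OF h'] bU])
  ultimately have "b = tangent_map h' (tangent_map ?g' b)" using tangent_map_id[OF bU] by simp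
  thus "b : tangent_map h' ` preimage_curve p A" using sub b by blast
 qed
qed

lemma patch_lifts:
 assumes e: "patch U e" "simply_connected U" "U ~= {}" "e ` U Int K = {}"
 obtains e1 e2 where "patch U e1" "patch U e2" "!!q. q : U ==> p (e1 q) = e q" "!!q. q : U ==> p (e2 q) = e q"
  "e1 ` U Int e2 ` U = {}" "!!q x. q : U ==> x : S3 ==> p x = e q ==> x = e1 q | x = e2 q"
  "e1 ` U \<subseteq> X" "e2 ` U \<subseteq> X"
proof -
 have im: "e ` U \<subseteq> S3 - K" using patch_image[OF e(1)] e(4) by blast
 obtain F G where F: "continuous_on U F" "F ` U \<subseteq> X" "!!q. q : U ==> p (F q) = e q"
  and G: "continuous_on U G" "G ` U \<subseteq> X" "!!q. q : U ==> p (G q) = e q"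
  and ne: "!!q. q : U ==> F q ~= G q" and FG: "!!q x. q : U ==> x : S3 ==> p x = e q ==> x = F q | x = G q"
  by (rule two_lifts[OF patch_open[OF e(1)] e(2,3) smooth_continuous[OF patch_smooth[OF e(1)]] im]) blast
 show thesis
 proof (rule that[OF lift_patch[OF e(1) F] lift_patch[OF e(1) G] F(3) G(3) _ FG F(2) G(2)])
  show "F ` U Int G ` U = {}"
  proof -
   have "F q ~= G r" if "q : U" "r : U" for q r
   proof
    assume "F q = G r"
    hence "e q = e r" using F(3)[OF that(1)] G(3)[OF that(2)] by simp
    hence "q = r" using inj_onD[OF patch_inj[OF e(1)]] that by blast
    thus False using \<open>F q = G r\<close> ne that by blast
   qed
   thus ?thesis by blast
  qed
 qed
qed

text \<open>A simply connected patch off the branching set lifts to two disjoint patches. Applying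
  \<open>m\<close> in both of them covers the push downstairs and again ends an ambient
  isotopy.\<close>

lemma lift_push:
 assumes e: "patch U e" "simply_connected U" "U ~= {}" "e ` U Int K = {}" and m: "moves U V m"
  and A: "carrier A Int K = {}" "A \<subseteq> UT"
 shows "isotopic (preimage_curve p A) (preimage_curve p (tangent_map (push U e m) ` A))"
proof -
 obtain e1 e2 where E: "patch U e1" "patch U e2" "!!q. q : U ==> p (e1 q) = e q" "!!q. q : U ==> p (e2 q) = e q"
  "e1 ` U Int e2 ` U = {}" "!!q x. q : U ==> x : S3 ==> p x = e q ==> x = e1 q | x = e2 q" by (rule patch_lifts[OF e]) blast
 obtain g where g: "compact_diffeo U m g" by (rule moves_compact_diffeo[OF m])
 note mU = compact_diffeo_image[OF g]
 let ?h = "push U e m" and ?h' = "%x. push U e1 m (push U e2 m x)"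
 have ih: "iso_end ?h" by (rule iso_end_push[OF e(1) m])
 have ih': "iso_end ?h'" by (rule iso_end_compose[OF iso_end_push[OF E(2) m] iso_end_push[OF E(1) m]])
 have hK: "?h ` K = K"
 proof -
  have "?h ` K = (%x. x) ` K" by (rule image_cong[OF HOL.refl push_outside]) (use e(4) in blast)
  thus ?thesis by simp
 qed
 have ph: "p (?h' x) = ?h (p x)" if x: "x : S3" for x
 proof -
  consider q where "q : U" "x = e1 q" | q where "q : U" "x = e2 q" | "x ~: e1 ` U" "x ~: e2 ` U" by blast
  thus ?thesis
  proof cases
   case 1
   hence "x ~: e2 ` U" using E(5) by blast
   thus ?thesis using 1 mU by (simp add: push_outside push_patch[OF E(1)] push_patch[OF e(1)] E(3))
  next
   case 2
   hence "e2 (m q) ~: e1 ` U" using E(5) mU by blast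
   thus ?thesis using 2 mU by (simp add: push_outside push_patch[OF E(2)] push_patch[OF e(1)] E(4))
  next
   case 3
   hence "p x ~: e ` U" using E(6)[OF _ x] by blast
   thus ?thesis using 3 by (simp add: push_outside)
  qed
 qed
 have "preimage_curve p (tangent_map ?h ` A) = tangent_map ?h' ` preimage_curve p A"
  by (rule preimage_lift[OF iso_end_diffeo[OF ih] hK iso_end_diffeo[OF ih'] ph A])
 thus ?thesis unfolding isotopic_iff[OF preimage_curve_UT] using ih' by blast
qed

end

section \<open>Transport of the cover by an isotopy of the base\<close>

lemma covering_space_compose_homeomorphism:
 assumes "covering_space c p S" "homeomorphism S S' h g"
 shows "covering_space c (%x. h (p x)) S'"
proof
 have pS: "p ` c = S" by (rule covering_space_imp_surjective[OF assms(1)])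
 show "continuous_on c (%x. h (p x))"
  using continuous_on_compose2[OF homeomorphism_cont1[OF assms(2)] covering_space_imp_continuous[OF assms(1)]] pS by simp
 show "(%x. h (p x)) ` c = S'"
  using pS homeomorphism_image1[OF assms(2)] by (metis image_image)
 fix y assume y: "y : S'"
 hence gy: "g y : S" using homeomorphism_image2[OF assms(2)] by blast
 then obtain T v where T: "g y : T" "openin (top_of_set S) T" "\<Union>v = c Int p -` T"
   "ALL u:v. openin (top_of_set c) u" "pairwise disjnt v" "ALL u:v. EX q. homeomorphism u T p q"
  using assms(1) unfolding covering_space_def by blast
 have TS: "T \<subseteq> S" using T(2) openin_imp_subset by blast
 have hT: "openin (top_of_set S') (h ` T)" by (rule homeomorphism_imp_open_map[OF assms(2) T(2)])
 have homT: "homeomorphism T (h ` T) h g"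
  by (rule homeomorphism_of_subsets[OF assms(2) TS]) auto
 show "EX T. y : T & openin (top_of_set S') T & (EX v. \<Union>v = c Int (%x. h (p x)) -` T &
   (ALL u:v. openin (top_of_set c) u) & pairwise disjnt v & (ALL u:v. EX q. homeomorphism u T (%x. h (p x)) q))"
 proof (intro exI[of _ "h ` T"] conjI exI[of _ v] ballI)
  show "y : h ` T" using homeomorphism_apply2[OF assms(2) y] T(1) by (metis image_eqI)
  have "h (p x) : h ` T \<longleftrightarrow> p x : T" if "x : c" for x
  proof
   assume "h (p x) : h ` T"
   then obtain t where t: "t : T" "h (p x) = h t" by blast
   hence "p x = t" using homeomorphism_apply1[OF assms(2)] TS pS that by (metis image_eqI subsetD)
   thus "p x : T" using t by simp
  qed blast
  thus "\<Union>v = c Int (%x. h (p x)) -` (h ` T)" using T(3) by auto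
  show "EX q. homeomorphism u (h ` T) (%x. h (p x)) q" if u: "u : v" for u
  proof -
   obtain q where "homeomorphism u T p q" using T(6) u by blast
   from homeomorphism_compose[OF this homT] show ?thesis by (auto simp: o_def)
  qed
 qed (use T hT in auto)
qed

text \<open>That \<open>h\<close> ends an isotopy, and is not merely a diffeomorphism, keeps the
  charts of the composed cover positively oriented.\<close>

lemma branched_cover_iso:
 assumes bc: "branched_cover p K" and h: "iso_end h"
 shows "branched_cover (%x. h (p x)) (h ` K)"
  and "A \<subseteq> UT ==> carrier A Int K = {} ==>
   preimage_curve (%x. h (p x)) (tangent_map h ` A) = preimage_curve p A"
proof -
 interpret branched_cover p K by (rule bc)
 note hD = diffeo_S3D[OF iso_end_diffeo[OF h]]
 have hK_iff: "h y : h ` K \<longleftrightarrow> y : K" if "y : S3" for y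
  using inj_onD[OF hD(7)] that K_S3 by blast
 have X': "S3 - (%x. h (p x)) -` (h ` K) = X"
  using hK_iff[OF p_S3] unfolding X_def by blast
 have hom: "homeomorphism (S3 - K) (S3 - h ` K) h (inv_into S3 h)"
 proof (rule homeomorphismI)
  show "continuous_on (S3 - K) h" "continuous_on (S3 - h ` K) (inv_into S3 h)"
   by (rule continuous_on_subset[OF smooth_at_S3_continuous[OF hD(5)] Diff_subset],
     rule continuous_on_subset[OF smooth_at_S3_continuous[OF hD(6)] Diff_subset])
  show "h ` (S3 - K) \<subseteq> S3 - h ` K"
  proof (intro image_subsetI)
   fix y assume "y : S3 - K"
   thus "h y : S3 - h ` K" using hD(1)[of y] hK_iff[of y] by blast
  qed
  show "inv_into S3 h ` (S3 - h ` K) \<subseteq> S3 - K"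
  proof (intro image_subsetI DiffI)
   fix y assume y: "y : S3 - h ` K"
   thus "inv_into S3 h y : S3" using hD(2) by blast
   show "inv_into S3 h y ~: K"
   proof
    assume "inv_into S3 h y : K"
    hence "h (inv_into S3 h y) : h ` K" by (rule imageI)
    thus False using y hD(4)[of y] by simp
   qed
  qed
 qed (use hD(3,4) in blast)+
 show "branched_cover (%x. h (p x)) (h ` K)"
 proof
  show "h ` K \<subseteq> S3" using hD(1)[OF subsetD[OF K_S3]] by (rule image_subsetI)
  have "compact (K Int S3)" by (rule closed_Int_compact[OF closed_K compact_sphere])
  hence "compact K" using K_S3 by (simp only: Int_absorb2)
  thus "closed (h ` K)"
   by (intro compact_imp_closed compact_continuous_image[OF continuous_on_subset[OF smooth_at_S3_continuous[OF hD(5)] K_S3]])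
  show "double_branched_cover (%x. h (p x)) (h ` K)" unfolding double_branched_cover_def X'
  proof (intro conjI ballI)
   show "covering_space X (%x. h (p x)) (S3 - h ` K)" by (rule covering_space_compose_homeomorphism[OF covering hom])
  next
   fix y assume y: "y : S3 - h ` K"
   have iy: "inv_into S3 h y : S3 - K" using homeomorphism_image2[OF hom] y by blast
   have "{x : S3. h (p x) = y} = {x : S3. p x = inv_into S3 h y}" using hD(3)[OF p_S3] hD(4)[of y] y by auto
   thus "card {x : S3. h (p x) = y} = 2" using cover iy by (simp add: double_branched_cover_def)
  next
   fix x assume "x : X"
   hence "EX ph. oriented_chart ph & ph 0 = x & oriented_chart (p \<circ> ph)"
    using cover unfolding double_branched_cover_def X_def[symmetric] by blast
   then obtain ph where ph: "oriented_chart ph" "ph 0 = x" "oriented_chart (p \<circ> ph)" by blast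
   have "patch (ball 0 2) (%q. h ((p \<circ> ph) q))" by (rule patch_iso_end[OF h ph(3)[unfolded oriented_chart_iff_patch]])
   thus "EX ph. oriented_chart ph & ph 0 = x & oriented_chart ((%x. h (p x)) \<circ> ph)"
    using ph by (intro exI[of _ ph]) (simp add: oriented_chart_iff_patch o_def)
  next
   fix x assume x: "x : S3 Int (%x. h (p x)) -` (h ` K)"
   hence "x ~: X" "x : S3" using X' by blast+
   hence "x : S3 Int p -` K" using in_X_iff by blast
   hence "EX ph ps. oriented_chart ph & ph 0 = x & oriented_chart ps &
    (ALL q:ball 0 2. ps q : K \<longleftrightarrow> q $ 1 = 0 & q $ 2 = 0) &
    (ALL q:ball 0 1. p (ph q) = ps (vector [(q $ 1)\<^sup>2 - (q $ 2)\<^sup>2, 2 * q $ 1 * q $ 2, q $ 3]))"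
    using cover unfolding double_branched_cover_def by blast
   then obtain ph ps where *: "oriented_chart ph" "ph 0 = x" "oriented_chart ps"
    "ALL q:ball 0 2. ps q : K \<longleftrightarrow> q $ 1 = 0 & q $ 2 = 0"
    "ALL q:ball 0 1. p (ph q) = ps (vector [(q $ 1)\<^sup>2 - (q $ 2)\<^sup>2, 2 * q $ 1 * q $ 2, q $ 3])" by blast
   have pps: "patch (ball 0 2) ps" using *(3) by (simp add: oriented_chart_iff_patch)
   show "EX ph ps. oriented_chart ph & ph 0 = x & oriented_chart ps &
    (ALL q:ball 0 2. ps q : h ` K \<longleftrightarrow> q $ 1 = 0 & q $ 2 = 0) &
    (ALL q:ball 0 1. h (p (ph q)) = ps (vector [(q $ 1)\<^sup>2 - (q $ 2)\<^sup>2, 2 * q $ 1 * q $ 2, q $ 3]))"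
   proof (rule exI[of _ ph], rule exI[of _ "%q. h (ps q)"], intro conjI ballI *(1,2))
    show "oriented_chart (%q. h (ps q))" using patch_iso_end[OF h pps] by (simp add: oriented_chart_iff_patch)
    show "h (ps q) : h ` K \<longleftrightarrow> q $ 1 = 0 & q $ 2 = 0" if "q : ball 0 2" for q
     using hK_iff[OF patch_S3[OF pps that]] *(4) that by blast
    show "h (p (ph q)) = h (ps (vector [(q $ 1)\<^sup>2 - (q $ 2)\<^sup>2, 2 * q $ 1 * q $ 2, q $ 3]))" if "q : ball 0 1" for q
     using *(5) that by simp
   qed
  qed
 qed
 assume A: "A \<subseteq> UT" "carrier A Int K = {}"
 show "preimage_curve (%x. h (p x)) (tangent_map h ` A) = preimage_curve p A"
 proof -
  have "tangent_map (%x. h (p x)) (x, v) : tangent_map h ` A \<longleftrightarrow> tangent_map p (x, v) : A" if xv: "(x, v) : UT" for x v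
  proof (cases "x : X")
   case True
   have eq: "tangent_map (%x. h (p x)) (x, v) = tangent_map h (tangent_map p (x, v))"
    by (rule tangent_map_compose[OF smooth_p hD(5) p_image_S3]) (simp add: True)
   have U: "tangent_map p (x, v) : UT" by (rule tangent_map_p_UT[OF xv True])
   show ?thesis
   proof
    assume "tangent_map (%x. h (p x)) (x, v) : tangent_map h ` A"
    hence "tangent_map h (tangent_map p (x, v)) : tangent_map h ` A" by (simp only: eq)
    then obtain a where a: "a : A" "tangent_map h (tangent_map p (x, v)) = tangent_map h a" by blast
    have aU: "a : UT" using a A by blast
    have "tangent_map p (x, v) = tangent_map (inv_into S3 h) (tangent_map h (tangent_map p (x, v)))"
     by (rule tangent_map_inv[OF iso_end_diffeo[OF h] U, symmetric])
    also have "\<dots> = tangent_map (inv_into S3 h) (tangent_map h a)" unfolding a(2) ..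
    also have "\<dots> = a" by (rule tangent_map_inv[OF iso_end_diffeo[OF h] aU])
    finally have "tangent_map p (x, v) = a" .
    thus "tangent_map p (x, v) : A" using a by simp
   next
    assume "tangent_map p (x, v) : A"
    thus "tangent_map (%x. h (p x)) (x, v) : tangent_map h ` A" unfolding eq by (rule imageI)
   qed
  next
   case False
   have xS: "x : S3" using xv by (simp add: UT_iff)
   hence pxK: "p x : K" using False in_X_iff by blast
   have "p x ~: carrier A" using pxK A(2) by blast
   moreover have "h (p x) ~: h ` carrier A"
   proof
    assume "h (p x) : h ` carrier A"
    then obtain y where y: "y : carrier A" "h (p x) = h y" by blast
    have "y : S3" using y(1) A(1) UT_S3 by blast
    hence "p x = y" using inj_onD[OF hD(7) y(2)] pxK K_S3 by blast
    thus False using y(1) \<open>p x ~: carrier A\<close> by simp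
   qed
   ultimately have "h (p x) ~: carrier (tangent_map h ` A)" "p x ~: carrier A" unfolding carrier_tangent_map by blast+
   thus ?thesis unfolding tangent_map_dS by (metis fst_conv image_eqI)
  qed
  thus ?thesis by (auto simp: preimage_curve_def UT_iff)
 qed
qed

subsection \<open>Moving strands inside a chart\<close>

abbreviation graph_pt :: "(real => real) => real => real^3" where
 "graph_pt g y \<equiv> vector [0, y, g y]"

abbreviation axis_pt :: "real => real^3" where
 "axis_pt x \<equiv> vector [x, 0, 0]"

definition strand :: "(real^3 => real^4) => (real => real) => oriented_curve" where
 "strand e g = directed_arc (%y. e (graph_pt g y)) {-1..1}"

definition axis_strand :: "(real^3 => real^4) => oriented_curve" where
 "axis_strand e = directed_arc (%x. e (axis_pt x)) {-1..1}"

definition small_bump :: "(real => real) => bool" where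
 "small_bump g \<longleftrightarrow> smooth_on UNIV g & (ALL y. \<bar>g y\<bar> <= 1/2) & (ALL y. \<bar>y\<bar> >= 1/2 --> g y = 0)"

lemma small_bumpD:
 assumes "small_bump g"
 shows "smooth_on UNIV g" "\<bar>g y\<bar> <= 1/2" "\<bar>y\<bar> >= 1/2 ==> g y = 0"
 using assms by (auto simp: small_bump_def)

lemma small_bump_uminus: "small_bump g ==> small_bump (%y. - g y)"
 unfolding small_bump_def using smooth_uminus[of UNIV g] by auto

lemma norm_vector_3: "norm (vector [a, b, c] :: real^3) = sqrt (a\<^sup>2 + b\<^sup>2 + c\<^sup>2)"
 by (simp add: norm_vec_def L2_set_def sum_3)

lemma smooth_vector_3:
 assumes "smooth_on J a" "smooth_on J b" "smooth_on J c"
 shows "smooth_on J (%t. vector [a t, b t, c t] :: real^3)"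
proof (rule smooth_vec[OF smooth_open[OF assms(1)]])
 fix i :: 3
 show "smooth_on J (%t. vector [a t, b t, c t] $ i)"
  using exhaust_3[of i] assms by auto
qed

lemma smooth_graph_pt: "smooth_on UNIV g ==> smooth_on UNIV (graph_pt g)"
 by (intro smooth_vector_3 smooth_const smooth_id) auto

lemma smooth_axis_pt: "smooth_on UNIV axis_pt"
 by (intro smooth_vector_3 smooth_const smooth_id) auto

lemma graph_pt_in_cball:
 assumes "small_bump g" "y : {-1..1}"
 shows "graph_pt g y : cball 0 1"
proof -
 have "y\<^sup>2 + (g y)\<^sup>2 <= 1"
 proof (cases "\<bar>y\<bar> >= 1/2")
  case True
  hence "g y = 0" by (rule small_bumpD(3)[OF assms(1)])
  thus ?thesis using assms(2) by (simp add: abs_square_le_1 abs_le_iff)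
 next
  case False
  hence "y\<^sup>2 <= (1/2)\<^sup>2" by (intro power2_le_iff_abs_le[THEN iffD2]) auto
  moreover have "(g y)\<^sup>2 <= (1/2)\<^sup>2" using small_bumpD(2)[OF assms(1)] by (intro power2_le_iff_abs_le[THEN iffD2]) auto
  ultimately show ?thesis by (simp add: power2_eq_square)
 qed
 thus ?thesis by (simp add: norm_vector_3)
qed

lemma axis_pt_in_cball: "x : {-1..1} ==> axis_pt x : cball 0 1"
 by (simp add: norm_vector_3 abs_le_iff)

lemma carrier_strand: "carrier (strand e g) = (%y. e (graph_pt g y)) ` {-1..1}"
 and carrier_axis_strand: "carrier (axis_strand e) = (%x. e (axis_pt x)) ` {-1..1}"
 by (simp_all only: strand_def axis_strand_def carrier_directed_arc)

lemma carrier_strand_subset: "small_bump g ==> carrier (strand e g) \<subseteq> e ` cball 0 1"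
 unfolding carrier_strand using graph_pt_in_cball by blast

lemma carrier_axis_strand_subset: "carrier (axis_strand e) \<subseteq> e ` cball 0 1"
 unfolding carrier_axis_strand using axis_pt_in_cball by blast

lemma chart_curve:
 assumes e: "patch W e" and c: "smooth_on UNIV c" "c ` {-1..1} \<subseteq> W" "!!t::real. VD c t ~= 0"
 obtains J where "open J" "{-1..1} \<subseteq> J" "c ` J \<subseteq> W" "smooth_on J (%t. e (c t))" "(%t. e (c t)) ` J \<subseteq> S3"
  "!!t. t : J ==> VD (%t. e (c t)) t ~= 0"
proof
 let ?J = "c -` W"
 show J: "open ?J" using patch_open[OF e] smooth_continuous[OF c(1)] by (rule open_vimage)
 show "{-1..1} \<subseteq> ?J" using c(2) by blast
 show "c ` ?J \<subseteq> W" by blast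
 have cJ: "smooth_on ?J c" by (rule smooth_subset[OF c(1) J subset_UNIV])
 show "smooth_on ?J (%t. e (c t))" by (rule smooth_compose[OF cJ patch_smooth[OF e]]) blast
 show "(%t. e (c t)) ` ?J \<subseteq> S3" using patch_S3[OF e] by blast
 show "VD (%t. e (c t)) t ~= 0" if t: "t : ?J" for t
 proof
  assume z: "VD (%t. e (c t)) t = 0"
  have cW: "c t : W" using t by blast
  have "FD e (c t) (VD c t) = 0" using vector_derivative_chain_smooth[OF cJ t patch_has_derivative[OF e cW]] z by simp
  thus False using patch_derivative_inj[OF e cW] c(3) by blast
 qed
qed

lemma vector_derivative_graph_pt:
 assumes "smooth_on UNIV g"
 shows "VD (graph_pt g) y ~= 0"
proof
 assume z: "VD (graph_pt g) y = 0"
 have "((%y. graph_pt g y $ 2) has_vector_derivative VD (graph_pt g) y $ 2) (at y)"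
  using smooth_has_vector_derivative[OF smooth_graph_pt[OF assms] UNIV_I]
   bounded_linear.has_vector_derivative[OF bounded_linear_vec_nth] by blast
 hence "((%y::real. y) has_vector_derivative 0) (at y)" using z by simp
 thus False using vector_derivative_at[of "%y. y" 0 y] vector_derivative_at[OF has_vector_derivative_id, of y]
  by (simp add: id_def)
qed

lemma vector_derivative_axis_pt: "VD axis_pt x ~= 0"
proof
 assume z: "VD axis_pt x = 0"
 have "((%x. axis_pt x $ 1) has_vector_derivative VD axis_pt x $ 1) (at x)"
  using smooth_has_vector_derivative[OF smooth_axis_pt UNIV_I]
   bounded_linear.has_vector_derivative[OF bounded_linear_vec_nth] by blast
 hence "((%x::real. x) has_vector_derivative 0) (at x)" using z by simp
 thus False using vector_derivative_at[of "%y. y" 0 x] vector_derivative_at[OF has_vector_derivative_id, of x]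
  by (simp add: id_def)
qed

lemma graph_pt_curve:
 assumes "patch W e" "small_bump g" "cball 0 1 \<subseteq> W"
 shows "smooth_on UNIV (graph_pt g)" "graph_pt g ` {-1..1} \<subseteq> W" "!!t. VD (graph_pt g) t ~= 0"
 using smooth_graph_pt[OF small_bumpD(1)[OF assms(2)]] vector_derivative_graph_pt[OF small_bumpD(1)[OF assms(2)]]
  graph_pt_in_cball[OF assms(2)] assms(3) by blast+

lemma axis_pt_curve:
 assumes "cball 0 1 \<subseteq> W"
 shows "smooth_on UNIV axis_pt" "axis_pt ` {-1..1} \<subseteq> W" "!!t. VD axis_pt t ~= 0"
 using smooth_axis_pt vector_derivative_axis_pt axis_pt_in_cball assms by blast+

lemma strand_UT:
 assumes e: "patch (ball 0 2) e" and g: "small_bump g"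
 shows "strand e g \<subseteq> UT"
proof -
 have W: "cball (0::real^3) 1 \<subseteq> ball 0 2" by auto
 obtain J where J: "{-1..1} \<subseteq> J" "smooth_on J (%t. e (graph_pt g t))" "(%t. e (graph_pt g t)) ` J \<subseteq> S3"
  "!!t. t : J ==> VD (%t. e (graph_pt g t)) t ~= 0" by (rule chart_curve[OF e graph_pt_curve[OF e g W]]) blast
 show ?thesis unfolding strand_def by (rule directed_arc_UT[OF J(2,1,3,4)]) (use J(1) in blast)
qed

lemma push_larger_patch:
 assumes "patch W e" "U \<subseteq> W" "!!q. q ~: U ==> m q = q" "q : W"
 shows "push U e m (e q) = e (m q)"
proof (cases "q : U")
 case True
 thus ?thesis
  using inv_into_f_f[OF inj_on_subset[OF patch_inj[OF assms(1)] assms(2)] True] by (simp add: push_def)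
next
 case False
 hence "e q ~: e ` U" using assms(2,4) inj_onD[OF patch_inj[OF assms(1)]] by blast
 thus ?thesis using False assms(3) by (simp add: push_outside)
qed

lemma compact_diffeo_outside: "compact_diffeo U m g ==> q ~: U ==> m q = q"
 by (auto simp: compact_diffeo_def)

lemma tangent_map_push_outside:
 assumes e: "patch U e" and m: "compact_diffeo U m g" and a: "a : UT" "fst a ~: e ` U"
 shows "tangent_map (push U e m) a = a"
proof -
 obtain C where C: "compact C" "C \<subseteq> U" "!!x. x ~: C ==> m x = x" using m by (auto simp: compact_diffeo_def)
 have "compact (e ` C)"
  by (rule compact_continuous_image[OF continuous_on_subset[OF smooth_continuous[OF patch_smooth[OF e]] C(2)] C(1)])
 hence "open (- (e ` C))" using compact_imp_closed by blast
 hence "openin (top_of_set S3) (S3 - e ` C)"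
  unfolding Diff_eq by (rule openin_open_Int)
 hence "tangent_map (push U e m) a = tangent_map (%x. x) a"
  by (rule tangent_map_cong) (use UT_S3[OF a(1)] a(2) C push_support[OF e, of C m] in blast)+
 thus ?thesis using tangent_map_id[OF a(1)] by simp
qed

lemma tangent_map_push_curve:
 assumes e: "patch (ball 0 2) e" and U: "open U" "U \<subseteq> ball 0 2" and m: "compact_diffeo U m k"
  and c: "smooth_on UNIV c" "c ` {-1..1} \<subseteq> ball 0 2" "!!t::real. VD c t ~= 0"
 shows "tangent_map (push U e m) ` directed_arc (%t. e (c t)) {-1..1} = directed_arc (%t. e (m (c t))) {-1..1}"
proof -
 obtain J where J: "open J" "{-1..1} \<subseteq> J" "c ` J \<subseteq> ball 0 2" "smooth_on J (%t. e (c t))" "(%t. e (c t)) ` J \<subseteq> S3"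
  by (rule chart_curve[OF e c]) blast
 have eU: "patch U e" by (rule patch_subset[OF e U])
 have "tangent_map (push U e m) ` directed_arc (%t. e (c t)) {-1..1} = directed_arc (%t. push U e m (e (c t))) {-1..1}"
  by (rule tangent_map_directed_arc[OF diffeo_S3D(5)[OF diffeo_push[OF eU m]] J(4,2,5)])
 also have "\<dots> = directed_arc (%t. e (m (c t))) {-1..1}"
 proof (rule directed_arc_cong[OF J(1,2)])
  fix t assume "t : J"
  thus "push U e m (e (c t)) = e (m (c t))" using push_larger_patch[OF e U(2) compact_diffeo_outside[OF m], of "c t"] J(3) by blast
 qed
 finally show ?thesis .
qed

lemma tangent_map_push_strand:
 assumes e: "patch (ball 0 2) e" and U: "open U" "U \<subseteq> ball 0 2" and m: "compact_diffeo U m k"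
  and g: "small_bump g" and gr: "!!y. m (graph_pt g y) = graph_pt g' y"
 shows "tangent_map (push U e m) ` strand e g = strand e g'"
proof -
 have W: "cball (0::real^3) 1 \<subseteq> ball 0 2" by auto
 show ?thesis
  unfolding strand_def using tangent_map_push_curve[OF e U m graph_pt_curve[OF e g W]] by (simp only: gr)
qed

text \<open>The graphs are interpolated linearly in \<open>n\<close> equal vertical steps. The
  displacement \<open>g' y - g y\<close> depends only on \<open>y\<close>, so every step uses the
  same field, cut off outside a neighbourhood of the region swept out.\<close>

lemma graph_push:
 assumes U: "open U" and g: "small_bump g" "small_bump g'"
  and C: "!!y s. \<bar>y\<bar> <= 1/2 ==> 0 <= s ==> s <= 1 ==> vector [0, y, (1 - s) * g y + s * g' y] : U"
 obtains m where "moves U UNIV m" "!!y. m (graph_pt g y) = graph_pt g' y"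
proof -
 let ?P = "%p::real \<times> real. vector [0, fst p, (1 - snd p) * g (fst p) + snd p * g' (fst p)] :: real^3"
 have "smooth_on UNIV ?P"
  by (intro smooth_vector_3 smooth_const smooth_fst smooth_snd smooth_add smooth_mult smooth_diff
    smooth_compose[OF smooth_fst small_bumpD(1)[OF g(1)]] smooth_compose[OF smooth_fst small_bumpD(1)[OF g(2)]]) auto
 hence comp: "compact (?P ` ({-1/2..1/2} \<times> {0..1}))"
  by (intro compact_continuous_image continuous_on_subset[OF smooth_continuous] compact_Times) auto
 have sub: "?P ` ({-1/2..1/2} \<times> {0..1}) \<subseteq> U"
  using C by (auto simp: abs_le_iff)
 obtain et C' W where et: "smooth_on UNIV et" "?P ` ({-1/2..1/2} \<times> {0..1}) \<subseteq> W"
  "!!x. x : W ==> et x = (1::real)" "compact C'" "C' \<subseteq> U" "!!x. x ~: C' ==> et x = 0"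
  by (rule bump_function_exists[OF comp U sub]) blast
 define w where "w x = ((g' (x $ 2) - g (x $ 2)) * et x) *\<^sub>R (axis 3 1 :: real^3)" for x :: "real^3"
 have nth: "smooth_on UNIV (%x::real^3. x $ 2)" by (rule smooth_nth[OF smooth_id[OF open_UNIV]])
 have w: "smooth_on UNIV w" unfolding w_def
  by (intro smooth_scaleR smooth_mult smooth_diff smooth_const et(1) open_UNIV
    smooth_compose[OF nth small_bumpD(1)[OF g(1)]] smooth_compose[OF nth small_bumpD(1)[OF g(2)]]) auto
 have w0: "w x = 0" if "x ~: C'" for x using et(6)[OF that] by (simp add: w_def)
 obtain s0 where s0: "s0 > 0" "!!s. \<bar>s\<bar> <= s0 ==> wiggle U UNIV (%x. s *\<^sub>R w x)"
  by (rule small_multiple_wiggle[OF w et(4,5) w0 subspace_UNIV UNIV_I]) (assumption | blast)+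
 obtain n :: nat where n: "1 / s0 < real n" using reals_Archimedean2 by blast
 hence n0: "n > 0" using s0(1) by (cases n) (auto simp: zero_less_divide_iff)
 define u where "u x = inverse (real n) *\<^sub>R w x" for x
 have "\<bar>inverse (real n)\<bar> <= s0" using n n0 s0(1) by (simp add: field_simps)
 hence mv: "moves U UNIV (%x. x + u x)" unfolding u_def by (intro wiggle_moves s0(2))
 have "((%x. x + u x) ^^ k) (graph_pt g y) = vector [0, y, g y + (k / n) * (g' y - g y)]" if "k <= n" for k y
  using that
 proof (induction k)
  case (Suc k)
  let ?q = "vector [0, y, g y + (k / n) * (g' y - g y)] :: real^3"
  have "w ?q = (g' y - g y) *\<^sub>R axis 3 1"
  proof (cases "\<bar>y\<bar> <= 1/2")
   case True
   have "?q = ?P (y, k / n)" by (simp add: algebra_simps diff_divide_distrib)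
   moreover have "(y, k / n) : {-1/2..1/2} \<times> {0..1}" using True Suc.prems by (auto simp: abs_le_iff divide_le_eq_1)
   ultimately have "?q : W" using et(2) by blast
   thus ?thesis using et(3) by (simp add: w_def)
  next
   case False
   hence "g y = 0" "g' y = 0" using small_bumpD(3)[OF g(1)] small_bumpD(3)[OF g(2)] by auto
   thus ?thesis by (simp add: w_def)
  qed
  hence uq: "u ?q = inverse (real n) *\<^sub>R ((g' y - g y) *\<^sub>R axis 3 1)" by (simp only: u_def)
  have "?q + u ?q = vector [0, y, g y + (Suc k / n) * (g' y - g y)]"
   unfolding uq vec_eq_iff using n0 by (simp add: forall_3 axis_def field_simps)
  thus ?case using Suc by simp
 qed (simp add: vec_eq_iff forall_3)
 from this[of n] have "((%x. x + u x) ^^ n) (graph_pt g y) = graph_pt g' y" for y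
  using n0 by simp
 thus thesis using that[OF moves_funpow[OF mv]] by blast
qed

lemma push_replace_strand:
 assumes e: "patch (ball 0 2) e" and U: "open U" "U \<subseteq> ball 0 1" and m: "moves U V m"
  and g: "small_bump g" and gr: "!!y. m (graph_pt g y) = graph_pt g' y"
  and A: "A \<subseteq> UT" "{a : A. fst a : e ` cball 0 1} = strand e g"
 shows "tangent_map (push U e m) ` A = {a : A. fst a ~: e ` cball 0 1} Un strand e g'"
proof -
 obtain k where k: "compact_diffeo U m k" by (rule moves_compact_diffeo[OF m])
 have U2: "U \<subseteq> ball 0 2" using U(2) by auto
 have eU: "patch U e" by (rule patch_subset[OF e U(1) U2])
 have "tangent_map (push U e m) a = a" if "a : A" "fst a ~: e ` cball 0 1" for a
 proof (rule tangent_map_push_outside[OF eU k])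
  show "a : UT" using that(1) A(1) by blast
  show "fst a ~: e ` U" using that(2) U(2) ball_subset_cball[of 0 1] by blast
 qed
 hence "tangent_map (push U e m) ` {a : A. fst a ~: e ` cball 0 1} = {a : A. fst a ~: e ` cball 0 1}" by force
 moreover have "tangent_map (push U e m) ` strand e g = strand e g'"
  by (rule tangent_map_push_strand[OF e U(1) U2 k g gr])
 moreover have "A = {a : A. fst a ~: e ` cball 0 1} Un strand e g" using A(2) by blast
 ultimately show ?thesis using image_Un[of "tangent_map (push U e m)" "{a : A. fst a ~: e ` cball 0 1}" "strand e g"] by simp
qed

lemma small_bump_segment:
 assumes g: "small_bump g" "small_bump g'" and ys: "\<bar>y\<bar> <= 1/2" "0 <= s" "s <= 1"
 shows "vector [0, y, (1 - s) * g y + s * g' y] : ball (0::real^3) 1"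
proof -
 have "\<bar>(1 - s) * g y + s * g' y\<bar> <= (1 - s) * \<bar>g y\<bar> + s * \<bar>g' y\<bar>"
  using abs_triangle_ineq[of "(1 - s) * g y" "s * g' y"] ys by (simp add: abs_mult)
 also have "\<dots> <= (1 - s) * (1/2) + s * (1/2)"
  using ys small_bumpD(2)[OF g(1)] small_bumpD(2)[OF g(2)] by (intro add_mono mult_left_mono) auto
 also have "\<dots> = 1/2" by (simp add: field_simps)
 finally have "((1 - s) * g y + s * g' y)\<^sup>2 <= (1/2)\<^sup>2" by (rule power2_le_iff_abs_le[THEN iffD2, rotated]) simp
 moreover have "y\<^sup>2 <= (1/2)\<^sup>2" using ys by (intro power2_le_iff_abs_le[THEN iffD2]) auto
 ultimately have "y\<^sup>2 + ((1 - s) * g y + s * g' y)\<^sup>2 < 1" by (simp add: power2_eq_square)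
 thus ?thesis by (simp add: norm_vector_3)
qed

text \<open>If no other strand runs through the ball, all of it is free for the move. Applied to one
  component alone, this shows that a crossing change with another component does not alter its knot
  type.\<close>

lemma isotopic_replace_strand:
 assumes e: "patch (ball 0 2) e" and g: "small_bump g" "small_bump g'"
  and A: "A \<subseteq> UT" "{a : A. fst a : e ` cball 0 1} = strand e g"
 obtains h where "iso_end h" "tangent_map h ` A = {a : A. fst a ~: e ` cball 0 1} Un strand e g'"
  "!!a. a : UT ==> fst a ~: e ` cball 0 1 ==> tangent_map h a = a"
proof -
 obtain m where m: "moves (ball 0 1) UNIV m" "!!y. m (graph_pt g y) = graph_pt g' y"
 proof (rule graph_push[OF open_ball g])
  show "vector [0, y, (1 - s) * g y + s * g' y] : ball (0::real^3) 1"
   if "\<bar>y\<bar> <= 1/2" "0 <= s" "s <= 1" for y s by (rule small_bump_segment[OF g that])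
 qed (rule that)
 have b: "ball (0::real^3) 1 \<subseteq> ball 0 2" by auto
 have e1: "patch (ball 0 1) e" by (rule patch_subset[OF e open_ball b])
 obtain k where k: "compact_diffeo (ball 0 1) m k" by (rule moves_compact_diffeo[OF m(1)])
 show thesis
 proof (rule that[OF iso_end_push[OF e1 m(1)]])
  show "tangent_map (push (ball 0 1) e m) ` A = {a : A. fst a ~: e ` cball 0 1} Un strand e g'"
   by (rule push_replace_strand[OF e open_ball order_refl m(1) g(1) m(2) A])
  show "tangent_map (push (ball 0 1) e m) a = a" if "a : UT" "fst a ~: e ` cball 0 1" for a
   by (rule tangent_map_push_outside[OF e1 k that(1)]) (use that(2) in auto)
 qed
qed

subsection \<open>Squashing charts\<close>

text \<open>The frame determinant of an immersion has no zeros, so its sign is constant on a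
  connected domain and one point decides it.\<close>

lemma patch_of_connected:
 assumes e: "smooth_on U e" "inj_on e U" "e ` U \<subseteq> S3"
  and D: "!!q v. q : U ==> FD e q v = 0 ==> v = 0"
  and U: "connected U" "q0 : U" "frame_det e q0 > 0"
 shows "patch U e"
 unfolding patch_def
proof (intro conjI ballI e)
 fix q assume q: "q : U"
 have ne: "frame_det e x ~= 0" if "x : U" for x
  using frame_det_nonzero_iff[OF smooth_has_derivative[OF e(1) that] smooth_open[OF e(1)] that] e(3) D[OF that] by force
 have fd: "smooth_on U (%q. FD e q v)" for v by (rule smooth_frechet[OF e(1)])
 have "smooth_on U (frame_det e)"
  unfolding frame_det_def Let_def
 proof (rule smooth_det)
  show "open U" by (rule smooth_open[OF e(1)])
  fix i j :: 4
  show "smooth_on U (%q. (vector [e q, FD e q (axis 1 1), FD e q (axis 2 1),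
   FD e q (axis 3 1)] :: real^4^4) $ i $ j)"
   using exhaust_4[of i] smooth_nth[OF e(1)] smooth_nth[OF fd] by (auto simp: vector_4)
 qed
 hence "connected (frame_det e ` U)"
  by (intro connected_continuous_image[OF smooth_continuous U(1)])
 hence "~ frame_det e q < 0"
  using connectedD_interval[of "frame_det e ` U" "frame_det e q" "frame_det e q0" 0] q U(2,3) ne by force
 thus "frame_det e q > 0" using ne[OF q] by linarith
qed

text \<open>Points of the ball of radius 2 beyond radius \<open>b\<close> shrink by the factor
  \<open>1 - s\<close> at each step until they enter \<open>ball 0 b\<close>, while points within
  radius \<open>a\<close> never move. The profile \<open>sg\<close> passes from 0 to 1 between the
  two radii.\<close>

lemma squashing_move:
 assumes "0 < a" "a < b"
 obtains f where "moves (ball 0 4) UNIV f" "!!x. norm x <= a ==> f x = x" "f ` ball (0::real^3) 2 \<subseteq> ball 0 b"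
proof -
 obtain th C W where th: "smooth_on UNIV th" "!!x. th x >= 0" "!!x. th x <= (1::real)" "!!x. x : W ==> th x = 1" "cball (0::real^3) 2 \<subseteq> W"
   "compact C" "C \<subseteq> ball 0 4" "!!x. x ~: C ==> th x = 0" by (rule bump_function_exists[of "cball (0::real^3) 2" "ball 0 4"]) auto
 define sg where "sg x = smooth_step ((x \<bullet> x - a\<^sup>2) / (b\<^sup>2 - a\<^sup>2))" for x :: "real^3"
 have ab: "b\<^sup>2 - a\<^sup>2 > 0" using assms by (simp add: power_strict_mono)
 have sg: "smooth_on UNIV sg" unfolding sg_def
  by (rule smooth_compose[OF _ smooth_smooth_step])
   (use ab in \<open>auto intro!: smooth_divide smooth_diff smooth_inner smooth_const smooth_id\<close>)
 have sg0: "sg x = 0" if "norm x <= a" for x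
 proof -
  have "x \<bullet> x <= a\<^sup>2" using that power_mono[OF that norm_ge_zero, of 2] by (simp add: power2_norm_eq_inner)
  thus ?thesis unfolding sg_def using ab by (intro smooth_step_le_0) (simp add: divide_le_0_iff)
 qed
 have sg1: "sg x = 1" if "norm x >= b" for x
 proof -
  have "x \<bullet> x >= b\<^sup>2" using that power_mono[OF that, of 2] assms by (simp add: power2_norm_eq_inner)
  thus ?thesis unfolding sg_def using ab by (intro smooth_step_ge_1) simp
 qed
 define w where "w x = (th x * sg x) *\<^sub>R x" for x
 have w: "smooth_on UNIV w" unfolding w_def by (intro smooth_scaleR smooth_mult th(1) sg smooth_id) auto
 have w0: "w x = 0" if "x ~: C" for x using th(8)[OF that] by (simp add: w_def)
 obtain s0 where s0: "s0 > 0" "!!s. \<bar>s\<bar> <= s0 ==> wiggle (ball 0 4) UNIV (%x. s *\<^sub>R w x)"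
  by (rule small_multiple_wiggle[OF w th(6,7) w0 subspace_UNIV UNIV_I]) (assumption | blast)+
 define s where "s = min s0 (1/2)"
 have s: "0 < s" "s < 1" using s0(1) by (auto simp: s_def)
 define f where "f x = x + (- s) *\<^sub>R w x" for x
 have mv: "moves (ball 0 4) UNIV f"
  unfolding f_def by (rule wiggle_moves[OF s0(2)]) (use s in \<open>auto simp: s_def\<close>)
 have fx: "f x = (1 - s * (th x * sg x)) *\<^sub>R x" for x by (simp add: f_def w_def algebra_simps)
 have c: "0 <= th x * sg x" "th x * sg x <= 1" for x
  using th(2,3)[of x] smooth_step_nonneg smooth_step_le_one by (auto simp: sg_def intro!: mult_nonneg_nonneg mult_le_one)
 have c': "0 <= s * (th x * sg x)" "s * (th x * sg x) <= 1" for x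
  using c[of x] s by (auto intro!: mult_nonneg_nonneg mult_le_one)
 have nf: "norm (f x) = (1 - s * (th x * sg x)) * norm x" for x
  using c'[of x] by (simp add: fx)
 have le: "norm (f x) <= norm x" for x
  unfolding nf using c'[of x] by (intro mult_left_le_one_le) auto
 have it_le: "norm ((f ^^ k) x) <= norm x" for k x
  by (induction k) (use le order_trans in auto)
 have it: "norm ((f ^^ k) x) < b | norm ((f ^^ k) x) <= (1 - s) ^ k * norm x" if x: "x : ball 0 2" for k x
 proof (induction k)
  case (Suc k)
  let ?y = "(f ^^ k) x"
  show ?case
  proof (cases "norm ?y < b")
   case True thus ?thesis using le[of ?y] by auto
  next
   case False
   have "?y : W" using it_le[of k x] x by (intro subsetD[OF th(5)]) simp
   hence "norm (f ?y) = (1 - s) * norm ?y" using nf[of ?y] th(4) sg1[of ?y] False by simp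
   also have "\<dots> <= (1 - s) * ((1 - s) ^ k * norm x)" using Suc False s by (intro mult_left_mono) auto
   finally show ?thesis by simp
  qed
 qed simp
 have b0: "b / 2 > 0" using assms by simp
 obtain n where n: "(1 - s) ^ n < b / 2" using real_arch_pow_inv[OF b0, of "1 - s"] s by auto
 show thesis
 proof (rule that[OF moves_funpow[OF mv, of n]])
  show "(f ^^ n) x = x" if x: "norm x <= a" for x
  proof (induction n)
   case (Suc k) thus ?case using sg0[OF x] by (simp add: fx)
  qed simp
  show "(f ^^ n) ` ball 0 2 \<subseteq> ball 0 b"
  proof (rule image_subsetI)
   fix x :: "real^3" assume x: "x : ball 0 2"
   have "(1 - s) ^ n * norm x <= (1 - s) ^ n * 2" using x s by (intro mult_left_mono) auto
   hence "(1 - s) ^ n * norm x < b" using n by linarith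
   thus "(f ^^ n) x : ball 0 b" using it[OF x, of n] by auto
  qed
 qed
qed

lemma compact_diffeo_derivative_inj:
 assumes "compact_diffeo U f k" "FD f x v = 0"
 shows "v = 0"
proof -
 have f: "smooth_on UNIV f" "smooth_on UNIV k" "!!x. k (f x) = x" using assms(1) by (auto simp: compact_diffeo_def)
 have "((%x. k (f x)) has_derivative (%v. FD k (f x) (FD f x v))) (at x)"
  using diff_chain_at[OF smooth_has_derivative[OF f(1) UNIV_I] smooth_has_derivative[OF f(2) UNIV_I]] by (simp add: o_def)
 hence "((%x. x) has_derivative (%v. FD k (f x) (FD f x v))) (at x)"
  by (simp add: f(3))
 hence "FD k (f x) (FD f x v) = v"
  using has_derivative_unique[OF has_derivative_ident] by (metis (no_types))
 thus ?thesis
  using assms(2) linear_0[OF has_derivative_linear[OF smooth_has_derivative[OF f(2) UNIV_I, of "f x"]]] by simp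
qed

text \<open>Only the closed unit ball of the chart is known to avoid \<open>K\<close>, whereas
  lifting needs an open simply connected domain off \<open>K\<close>. Squashing the ball of radius 2
  into a thin neighbourhood of the unit ball gives a full chart off \<open>K\<close>, unchanged near
  the unit ball.\<close>

lemma squash_chart:
 assumes e: "patch (ball 0 2) e" and K: "closed K" "e ` cball 0 1 Int K = {}"
 obtains e' de where "patch (ball 0 2) e'" "e' ` ball 0 2 Int K = {}" "de > 0" "!!q. q : ball 0 (1 + de) ==> e' q = e q"
proof -
 have "continuous_on (ball 0 2) e" by (rule smooth_continuous[OF patch_smooth[OF e]])
 hence O: "open {q : ball 0 2. e q ~: K}"
  using continuous_open_preimage[of "ball 0 2" e "- K"] K(1) by (simp add: vimage_def Int_def open_Compl)
 have "cball (0::real^3) 1 \<subseteq> {q : ball 0 2. e q ~: K}" using K(2) by auto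
 then obtain r where r: "r > 0" "(UN x:cball 0 1. cball x r) \<subseteq> {q : ball 0 2. e q ~: K}"
  using compact_subset_open_imp_cball_epsilon_subset[OF compact_cball O] by blast
 have sub: "q : ball 0 2 & e q ~: K" if q: "q : ball 0 (1 + r)" for q
 proof -
  have "q : (UN x:cball 0 1. cball x r)"
  proof (cases "norm q <= 1")
   case True thus ?thesis using r(1) by (intro UN_I[of q]) auto
  next
   case False
   \<comment> \<open>The nearest point of the unit ball is \<open>sgn q\<close>, at distance
     \<open>norm q - 1 < r\<close>.\<close>
   hence "sgn q : cball 0 1" "dist (sgn q) q = norm q - 1"
   proof -
    have "sgn q - q = (inverse (norm q) - 1) *\<^sub>R q" by (simp add: sgn_div_norm algebra_simps)
    moreover have "inverse (norm q) < 1" using False by (simp add: inverse_less_1_iff)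
    ultimately have "norm (sgn q - q) = (1 - inverse (norm q)) * norm q" by simp
    also have "\<dots> = norm q - 1" using False by (auto simp: field_simps)
    finally show "dist (sgn q) q = norm q - 1" by (simp add: dist_norm)
    show "sgn q : cball 0 1" by (simp add: norm_sgn)
   qed
   thus ?thesis using q by (intro UN_I[of "sgn q"]) auto
  qed
  thus ?thesis using r(2) by blast
 qed
 have b: "0 < 1 + r / 2" "1 + r / 2 < 1 + r" using r(1) by auto
 obtain f where f: "moves (ball 0 4) UNIV f" "!!x. norm x <= 1 + r / 2 ==> f x = x" "f ` ball 0 2 \<subseteq> ball 0 (1 + r)"
  by (rule squashing_move[OF b]) blast
 obtain k where k: "compact_diffeo (ball 0 4) f k" by (rule moves_compact_diffeo[OF f(1)])
 have sf: "smooth_on UNIV f" and inj: "inj f" using k by (auto simp: compact_diffeo_def inj_on_def dest: arg_cong[of _ _ k]) 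
 have f2: "f q : ball 0 2" "e (f q) ~: K" if "q : ball 0 2" for q using sub f(3) that by blast+
 have sfb: "smooth_on (ball 0 2) f" by (rule smooth_subset[OF sf]) auto
 have eq: "e (f q) = e q" if "q : ball 0 (1 + r / 2)" for q using f(2)[of q] that by simp
 show thesis
 proof (rule that[of "%q. e (f q)" "r / 2"])
  show "patch (ball 0 2) (%q. e (f q))"
  proof (rule patch_of_connected)
   show "smooth_on (ball 0 2) (%q. e (f q))" by (rule smooth_compose[OF sfb patch_smooth[OF e]]) (use f2 in blast)
   show "inj_on (%q. e (f q)) (ball 0 2)"
   proof (rule inj_onI)
    fix x y assume "x : ball 0 2" "y : ball 0 2" "e (f x) = e (f y)"
    hence "f x = f y" using inj_onD[OF patch_inj[OF e]] f2 by blast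
    thus "x = y" using inj by (simp add: inj_eq)
   qed
   show "(%q. e (f q)) ` ball 0 2 \<subseteq> S3" using f2 patch_S3[OF e] by blast
   show "v = 0" if q: "q : ball 0 2" and z: "FD (%q. e (f q)) q v = 0" for q v
   proof -
    have "((%q. e (f q)) has_derivative (%v. FD e (f q) (FD f q v))) (at q)"
     using diff_chain_at[OF smooth_has_derivative[OF sf UNIV_I] patch_has_derivative[OF e f2(1)[OF q]]] by (simp add: o_def)
    hence "FD e (f q) (FD f q v) = 0" using z frechet_derivative_at by metis
    thus ?thesis using patch_derivative_inj[OF e f2(1)[OF q]] compact_diffeo_derivative_inj[OF k] by blast
   qed
   show "connected (ball (0::real^3) 2)" "(0::real^3) : ball 0 2" by auto
   have "patch (ball 0 (min 1 (1 + r / 2))) e" by (rule patch_subset[OF e]) auto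
   moreover have "frame_det (%q. e (f q)) 0 = frame_det e 0"
   proof -
    have "((%q. e (f q)) has_derivative FD e 0) (at 0)"
     by (rule has_derivative_transform_within_open[OF patch_has_derivative[OF e] open_ball[of 0 "1 + r / 2"]])
      (use eq r(1) in auto)
    hence "FD (%q. e (f q)) 0 = FD e 0" by (metis frechet_derivative_at)
    thus ?thesis using eq[of 0] r(1) by (simp add: frame_det_def)
   qed
   ultimately show "0 < frame_det (%q. e (f q)) 0" using e by (simp add: patch_def)
  qed
  show "(%q. e (f q)) ` ball 0 2 Int K = {}" using f2 by blast
 qed (use r(1) eq in auto)
qed

subsection \<open>Lifting a crossing change away from the branching set\<close>

definition crossing_at :: "(real^3 => real^4) => (real => real) => oriented_curve => bool" where
 "crossing_at e g A \<longleftrightarrow> patch (ball 0 2) e & small_bump g & g 0 ~= 0 &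
  {a : A. fst a : e ` cball 0 1} = axis_strand e Un strand e g"

definition crossed :: "(real^3 => real^4) => (real => real) => oriented_curve => oriented_curve" where
 "crossed e g A = {a : A. fst a ~: e ` cball 0 1} Un axis_strand e Un strand e (%y. - g y)"

lemma crossing_change_iff:
 "crossing_change K\<^sub>1 K\<^sub>2 A A' \<longleftrightarrow>
  (EX e g. crossing_at e g A & axis_strand e \<subseteq> K\<^sub>1 & strand e g \<subseteq> K\<^sub>2 & A' = crossed e g A)"
proof -
 have *: "{(x, v) : A. x : B} = {a : A. fst a : B}" "{(x, v) : A. x ~: B} = {a : A. fst a ~: B}" for B :: "(real^4) set"
  by auto
 show ?thesis
  unfolding crossing_change_def Let_def crossing_at_def crossed_def strand_def axis_strand_def
   small_bump_def oriented_chart_iff_patch * by (intro iff_exI) argo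
qed

lemma crossing_atD:
 assumes "crossing_at e g A"
 shows "patch (ball 0 2) e" "small_bump g" "g 0 ~= 0" "{a : A. fst a : e ` cball 0 1} = axis_strand e Un strand e g"
 using assms by (auto simp only: crossing_at_def)

lemma chart_curve_cong:
 assumes "de > 0" "!!q. q : ball 0 (1 + de) ==> e' q = e q" and c: "smooth_on UNIV c" "c ` {-1..1} \<subseteq> cball (0::real^3) 1"
 shows "directed_arc (%t. e' (c t)) {-1..1} = directed_arc (%t. e (c t)) {-1..1}"
proof (rule directed_arc_cong)
 show "open (c -` ball 0 (1 + de))" by (rule open_vimage[OF open_ball smooth_continuous[OF c(1)]])
 have "cball (0::real^3) 1 \<subseteq> ball 0 (1 + de)" using assms(1) by auto
 thus "{-1..1} \<subseteq> c -` ball 0 (1 + de)" using c(2) by blast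
qed (use assms(2) in blast)

lemma strand_cong:
 assumes "de > 0" "!!q. q : ball 0 (1 + de) ==> e' q = e q"
 shows "small_bump g ==> strand e' g = strand e g" "axis_strand e' = axis_strand e" "e' ` cball 0 1 = e ` cball 0 1"
proof -
 show "strand e' g = strand e g" if "small_bump g"
  unfolding strand_def
  by (rule chart_curve_cong[OF assms smooth_graph_pt[OF small_bumpD(1)[OF that]] image_subsetI[OF graph_pt_in_cball[OF that]]])
 show "axis_strand e' = axis_strand e"
  unfolding axis_strand_def
 proof (rule chart_curve_cong[OF assms(1) _ smooth_axis_pt])
  show "axis_pt ` {-1..1} \<subseteq> cball 0 1" by (intro image_subsetI axis_pt_in_cball)
 qed (rule assms(2))
 have "cball (0::real^3) 1 \<subseteq> ball 0 (1 + de)" using assms(1) by auto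
 thus "e' ` cball 0 1 = e ` cball 0 1" using assms(2) by (intro image_cong) blast+
qed

lemma crossing_at_cong:
 assumes "crossing_at e g A" "patch (ball 0 2) e'" "de > 0" "!!q. q : ball 0 (1 + de) ==> e' q = e q"
 shows "crossing_at e' g A" "crossed e' g A = crossed e g A"
 using strand_cong[OF assms(3,4)] assms(1,2) small_bump_uminus[of g] unfolding crossing_at_def crossed_def by auto

text \<open>The carriers are disjoint compact sets, so a connected arc meets only one of them;
  disjointness then places its directions in the same knot.\<close>

lemma in_one_component:
 assumes F: "finite F" "!!k. k : F ==> oriented_knot k" "disjoint_family_on carrier F"
  and S: "connected (carrier S)" "S ~= {}" "S \<subseteq> \<Union>F"
 obtains k where "k : F" "S \<subseteq> k"
proof -
 obtain a k where a: "a : S" "a : k" "k : F" using S by blast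
 let ?R = "UN k':F - {k}. carrier k'"
 have "closed (carrier k)" if "k : F" for k using oriented_knot_carrier(1)[OF F(2)[OF that]] compact_imp_closed by blast
 hence cl: "closed (carrier k)" "closed ?R" using a(3) F(1) by (auto intro!: closed_UN)
 have dj: "carrier k Int ?R = {}" using F(3) a(3) unfolding disjoint_family_on_def by blast
 have "carrier S \<subseteq> carrier k Un ?R" using S(3) by blast
 moreover have "carrier k Int carrier S ~= {}" using a by blast
 moreover have "carrier k Int ?R Int carrier S = {}" unfolding dj by simp
 ultimately have none: "?R Int carrier S = {}" using connected_closedD[OF S(1) _ _ cl] by blast
 have "S \<subseteq> k"
 proof
  fix b assume b: "b : S"
  then obtain k' where k': "k' : F" "b : k'" using S(3) by blast
  show "b : k"
  proof (cases "k' = k")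
   case False
   hence "fst b : ?R" using k' by blast
   thus ?thesis using none b by blast
  qed (use k' in blast)
 qed
 thus thesis using that a(3) by blast
qed

lemma connected_carrier_chart_curve:
 assumes e: "patch W e" and c: "smooth_on UNIV c" "c ` {-1..1} \<subseteq> W"
 shows "connected (carrier (directed_arc (%t. e (c t)) {-1..1}))"
 unfolding carrier_directed_arc
 by (intro connected_continuous_image continuous_on_compose2[OF smooth_continuous[OF patch_smooth[OF e]]]
   continuous_on_subset[OF smooth_continuous[OF c(1)]] c(2)) auto

lemma connected_strand:
 assumes e: "patch (ball 0 2) e"
 shows "small_bump g ==> connected (carrier (strand e g))" "connected (carrier (axis_strand e))"
  "strand e g ~= {}" "axis_strand e ~= {}"
proof -
 have W: "cball (0::real^3) 1 \<subseteq> ball 0 2" by auto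
 show "connected (carrier (strand e g))" if g: "small_bump g"
  unfolding strand_def by (rule connected_carrier_chart_curve[OF e graph_pt_curve(1,2)[OF e g W]])
 show "connected (carrier (axis_strand e))"
  unfolding axis_strand_def by (rule connected_carrier_chart_curve[OF e axis_pt_curve(1,2)[OF W]])
 show "strand e g ~= {}" "axis_strand e ~= {}" by (auto simp: strand_def axis_strand_def directed_arc_def)
qed

lemma crossing_change_distinctI:
 assumes "crossing_at e g A" "oriented_knot k1" "oriented_knot k2" "k1 \<subseteq> A" "k2 \<subseteq> A" "k1 ~= k2"
  "axis_strand e \<subseteq> k1" "strand e g \<subseteq> k2"
 shows "crossing_change_distinct A (crossed e g A)"
proof -
 have "crossing_change k1 k2 A (crossed e g A)" unfolding crossing_change_iff using assms by blast
 thus ?thesis using assms unfolding crossing_change_distinct_def knot_components_def by blast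
qed

context branched_cover
begin

lemma preimage_chart_curve:
 assumes e: "patch W e" and e1: "patch W e1" "!!q. q : W ==> p (e1 q) = e q" "e1 ` W \<subseteq> X"
  and e2: "patch W e2" "!!q. q : W ==> p (e2 q) = e q" "e2 ` W \<subseteq> X"
  and e12: "!!q x. q : W ==> x : S3 ==> p x = e q ==> x = e1 q | x = e2 q"
  and c: "smooth_on UNIV c" "c ` {-1..1} \<subseteq> W" "!!t::real. VD c t ~= 0"
 shows "preimage_curve p (directed_arc (%t. e (c t)) {-1..1}) =
  directed_arc (%t. e1 (c t)) {-1..1} Un directed_arc (%t. e2 (c t)) {-1..1}"
proof -
 obtain J where J: "open J" "{-1..1} \<subseteq> J" "c ` J \<subseteq> W" "smooth_on J (%t. e (c t))" "(%t. e (c t)) ` J \<subseteq> S3"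
  "!!t. t : J ==> VD (%t. e (c t)) t ~= 0" by (rule chart_curve[OF e c]) blast
 have cW: "c t : W" if "t : J" for t using J(3) that by blast
 have cont: "continuous_on J (%t. f (c t))" if "patch W f" for f
  by (rule continuous_on_compose2[OF smooth_continuous[OF patch_smooth[OF that]]
    continuous_on_subset[OF smooth_continuous[OF c(1)] subset_UNIV] J(3)])
 show ?thesis
 proof (rule preimage_directed_arc(1)[OF J(4) _ J(2) J(6)])
  show "(%t. e (c t)) ` J \<subseteq> S3 - K"
  proof (rule image_subsetI)
   fix t assume "t : J"
   thus "e (c t) : S3 - K" using p_X[of "e1 (c t)"] e1(2,3) cW[of t] by force
  qed
  show "continuous_on J (%t. e1 (c t))" "continuous_on J (%t. e2 (c t))" using cont e1(1) e2(1) by blast+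
  show "(%t. e1 (c t)) ` J \<subseteq> X" "(%t. e2 (c t)) ` J \<subseteq> X" using e1(3) e2(3) cW by blast+
  show "p (e1 (c t)) = e (c t)" "p (e2 (c t)) = e (c t)" if "t : J" for t using e1(2) e2(2) cW[OF that] by blast+
  show "x = e1 (c t) | x = e2 (c t)" if "t : J" "x : S3" "p x = e (c t)" for t x using e12 cW[OF that(1)] that(2,3) by blast
 qed (use J(2) in blast)
qed

text \<open>The two copies of the ball are treated one after the other. Each lifted crossing
  involves different components because its strands lie over \<open>k1\<close> and
  \<open>k2\<close>, whose preimages are disjoint.\<close>

lemma crossing_change_lift:
 assumes c: "crossing_at e g A" "axis_strand e \<subseteq> k1" "strand e g \<subseteq> k2" and eK: "e ` cball 0 1 Int K = {}"
  and A: "A \<subseteq> UT" "carrier A Int K = {}" "k1 \<subseteq> A" "k2 \<subseteq> A"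
  and k: "oriented_knot k1" "oriented_knot k2" "carrier k1 Int carrier k2 = {}"
 obtains J where "crossing_change_distinct (preimage_curve p A) J"
  "crossing_change_distinct J (preimage_curve p (crossed e g A))"
proof -
 let ?P = "preimage_curve p"
 obtain E de where E: "patch (ball 0 2) E" "E ` ball 0 2 Int K = {}" "de > 0" "!!q. q : ball 0 (1 + de) ==> E q = e q"
  by (rule squash_chart[OF crossing_atD(1)[OF c(1)] closed_K eK]) blast
 have g: "small_bump g" and g': "small_bump (%y. - g y)"
  using crossing_atD(2)[OF c(1)] small_bump_uminus by blast+
 have cE: "crossing_at E g A" and crE: "crossed E g A = crossed e g A"
  by (rule crossing_at_cong[OF c(1) E(1,3,4)], assumption)+
 have cE2: "axis_strand E \<subseteq> k1" "strand E g \<subseteq> k2"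
  using strand_cong(1)[OF E(3,4) g] strand_cong(2)[OF E(3,4)] c(2,3) by simp_all
 have W: "cball (0::real^3) 1 \<subseteq> ball 0 2" by auto
 have cvx: "simply_connected (ball (0::real^3) 2)" by (intro convex_imp_simply_connected convex_ball)
 have ne: "ball (0::real^3) 2 ~= {}" by simp
 obtain e1 e2 where e1: "patch (ball 0 2) e1" "!!q. q : ball 0 2 ==> p (e1 q) = E q" "e1 ` ball 0 2 \<subseteq> X"
  and e2: "patch (ball 0 2) e2" "!!q. q : ball 0 2 ==> p (e2 q) = E q" "e2 ` ball 0 2 \<subseteq> X"
  and dj: "e1 ` ball 0 2 Int e2 ` ball 0 2 = {}" and e12: "!!q x. q : ball 0 2 ==> x : S3 ==> p x = E q ==> x = e1 q | x = e2 q"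
  by (rule patch_lifts[OF E(1) cvx ne E(2)]) blast
 let ?B = "E ` cball 0 1" and ?B1 = "e1 ` cball 0 1" and ?B2 = "e2 ` cball 0 1"
 have djB: "?B1 Int ?B2 = {}" using dj W by blast
 have inB: "p x : ?B \<longleftrightarrow> x : ?B1 Un ?B2" if "x : S3" for x
  using e12[OF _ that] e1(2) e2(2) W by (smt (verit, best) Un_iff image_iff subset_iff)
 have pS: "?P (axis_strand E) = axis_strand e1 Un axis_strand e2"
  unfolding axis_strand_def by (rule preimage_chart_curve[OF E(1) e1 e2 e12 axis_pt_curve[OF W]])
 have pT: "?P (strand E h) = strand e1 h Un strand e2 h" if "small_bump h" for h
  unfolding strand_def by (rule preimage_chart_curve[OF E(1) e1 e2 e12 graph_pt_curve[OF E(1) that W]])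
 let ?S1 = "axis_strand e1" and ?S2 = "axis_strand e2" and ?T1 = "strand e1 g" and ?T2 = "strand e2 g"
 have cS: "carrier ?S1 \<subseteq> ?B1" "carrier ?S2 \<subseteq> ?B2" "carrier ?T1 \<subseteq> ?B1" "carrier ?T2 \<subseteq> ?B2"
  "carrier (strand e1 (%y. - g y)) \<subseteq> ?B1" "carrier (strand e2 (%y. - g y)) \<subseteq> ?B2"
  using carrier_axis_strand_subset carrier_strand_subset[OF g] carrier_strand_subset[OF g'] by blast+
 have S3: "fst a : S3" if "a : ?P A'" for a A' using carrier_preimage[of "fst a"] that by blast
 have mem: "a : ?P A' \<longleftrightarrow> a : UT & tangent_map p a : A'" for a A' using preimage_curve_iff[of "fst a" "snd a"] by simp
 have fst_tm: "fst (tangent_map p a) = p (fst a)" for a by (cases a) (simp add: tangent_map_def)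
 have AB: "{a : A. fst a : ?B} = axis_strand E Un strand E g" by (rule crossing_atD(4)[OF cE])
 have PB: "{a : ?P A. fst a : ?B1 Un ?B2} = ?S1 Un ?S2 Un (?T1 Un ?T2)"
 proof -
  have "{a : ?P A. fst a : ?B1 Un ?B2} = ?P {a : A. fst a : ?B}"
  proof (intro set_eqI)
   fix a show "a : {a : ?P A. fst a : ?B1 Un ?B2} \<longleftrightarrow> a : ?P {a : A. fst a : ?B}"
    using inB[OF UT_S3, of a] by (simp only: mem mem_Collect_eq fst_tm) blast
  qed
  thus ?thesis unfolding AB preimage_curve_Un pS pT[OF g] .
 qed
 have PB': "?P (crossed E g A) = {a : ?P A. fst a ~: ?B1 Un ?B2} Un (?S1 Un ?S2) Un (strand e1 (%y. - g y) Un strand e2 (%y. - g y))"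
 proof -
  have "?P {a : A. fst a ~: ?B} = {a : ?P A. fst a ~: ?B1 Un ?B2}"
  proof (intro set_eqI)
   fix a show "a : ?P {a : A. fst a ~: ?B} \<longleftrightarrow> a : {a : ?P A. fst a ~: ?B1 Un ?B2}"
    using inB[OF UT_S3, of a] by (simp only: mem mem_Collect_eq fst_tm) blast
  qed
  thus ?thesis unfolding crossed_def preimage_curve_Un pS pT[OF g'] by simp
 qed
 have k1K: "carrier k1 Int K = {}" and k2K: "carrier k2 Int K = {}" using A by blast+
 obtain F1 where F1: "finite F1" "!!k. k : F1 ==> oriented_knot k" "disjoint_family_on carrier F1" "?P k1 = \<Union>F1"
  by (rule preimage_knot[OF k(1) k1K]) blast
 obtain F2 where F2: "finite F2" "!!k. k : F2 ==> oriented_knot k" "disjoint_family_on carrier F2" "?P k2 = \<Union>F2"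
  by (rule preimage_knot[OF k(2) k2K]) blast
 have S1F: "?S1 \<subseteq> \<Union>F1" and S2F: "?S2 \<subseteq> \<Union>F1"
  using preimage_curve_mono[OF cE2(1)] pS F1(4) by blast+
 have T1F: "?T1 \<subseteq> \<Union>F2" and T2F: "?T2 \<subseteq> \<Union>F2"
  using preimage_curve_mono[OF cE2(2)] pT[OF g] F2(4) by blast+
 have dj12: "carrier (?P k1) Int carrier (?P k2) = {}" using carrier_preimage k(3) by blast
 obtain s1 where s1: "s1 : F1" "?S1 \<subseteq> s1"
  by (rule in_one_component[OF F1(1-3) connected_strand(2,4)[OF e1(1)] S1F])
 obtain s2 where s2: "s2 : F1" "?S2 \<subseteq> s2"
  by (rule in_one_component[OF F1(1-3) connected_strand(2,4)[OF e2(1)] S2F])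
 obtain t1 where t1: "t1 : F2" "?T1 \<subseteq> t1"
  by (rule in_one_component[OF F2(1-3) connected_strand(1)[OF e1(1) g] connected_strand(3)[OF e1(1)] T1F])
 obtain t2 where t2: "t2 : F2" "?T2 \<subseteq> t2"
  by (rule in_one_component[OF F2(1-3) connected_strand(1)[OF e2(1) g] connected_strand(3)[OF e2(1)] T2F])
 have P1A: "?P k1 \<subseteq> ?P A" and P2A: "?P k2 \<subseteq> ?P A" using preimage_curve_mono A(3,4) by blast+
 have sub: "s1 \<subseteq> ?P k1" "s2 \<subseteq> ?P k1" "t1 \<subseteq> ?P k2" "t2 \<subseteq> ?P k2" using s1 s2 t1 t2 F1(4) F2(4) by blast+
 have inPB: "a : ?P A & fst a : ?B1 Un ?B2 \<longleftrightarrow> a : ?S1 Un ?S2 Un (?T1 Un ?T2)" for a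
  using PB by blast
 have m1: "fst a : ?B1" if "a : ?S1 | a : ?T1 | a : strand e1 (%y. - g y)" for a
  using that subsetD[OF cS(1) imageI] subsetD[OF cS(3) imageI] subsetD[OF cS(5) imageI] by fast
 have m2: "fst a : ?B2" if "a : ?S2 | a : ?T2 | a : strand e2 (%y. - g y)" for a
  using that subsetD[OF cS(2) imageI] subsetD[OF cS(4) imageI] subsetD[OF cS(6) imageI] by fast
 have n12: "~ (x : ?B1 & x : ?B2)" for x using djB by blast
 have B1: "{a : ?P A. fst a : ?B1} = ?S1 Un ?T1"
 proof (intro set_eqI)
  fix a show "a : {a : ?P A. fst a : ?B1} \<longleftrightarrow> a : ?S1 Un ?T1"
   using inPB[of a] m1[of a] m2[of a] n12[of "fst a"] by (simp only: mem_Collect_eq Un_iff) argo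
 qed
 have c1: "crossing_at e1 g (?P A)"
  unfolding crossing_at_def using e1(1) g crossing_atD(3)[OF c(1)] B1 by blast
 have neq: "s1 ~= t1"
  using sub dj12 s1(2) t1(2) connected_strand(4)[OF e1(1)] by blast
 define J where "J = crossed e1 g (?P A)"
 have J: "J = {a : ?P A. fst a ~: ?B1} Un ?S1 Un strand e1 (%y. - g y)" unfolding J_def crossed_def ..
 have first: "crossing_change_distinct (?P A) J"
  unfolding J_def
 proof (rule crossing_change_distinctI[OF c1 _ _ _ _ neq s1(2) t1(2)])
  show "oriented_knot s1" "oriented_knot t1" using s1 t1 F1 F2 by blast+
  show "s1 \<subseteq> ?P A" "t1 \<subseteq> ?P A" using sub P1A P2A by blast+
 qed
 have "{a : J. fst a : ?B2} = ?S2 Un ?T2"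
 proof (intro set_eqI)
  fix a show "a : {a : J. fst a : ?B2} \<longleftrightarrow> a : ?S2 Un ?T2"
   using inPB[of a] m1[of a] m2[of a] n12[of "fst a"] unfolding J by (simp only: mem_Collect_eq Un_iff) argo
 qed
 hence c2: "crossing_at e2 g J"
  unfolding crossing_at_def using e2(1) g crossing_atD(3)[OF c(1)] by blast
 have P1B1: "{a : ?P k1. fst a : ?B1} \<subseteq> ?S1"
 proof
  fix a assume "a : {a : ?P k1. fst a : ?B1}"
  hence a: "a : ?P k1" "fst a : ?B1" by blast+
  hence "a : ?S1 Un ?T1" using B1 P1A by blast
  moreover have "a ~: ?T1" using a dj12 T1F F2(4) by blast
  ultimately show "a : ?S1" by blast
 qed
 have P2B1: "{a : ?P k2. fst a : ?B1} \<subseteq> ?T1"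
 proof
  fix a assume "a : {a : ?P k2. fst a : ?B1}"
  hence a: "a : ?P k2" "fst a : ?B1" by blast+
  hence "a : ?S1 Un ?T1" using B1 P2A by blast
  moreover have "a ~: ?S1" using a dj12 S1F F1(4) by blast
  ultimately show "a : ?T1" by blast
 qed
 have s2J: "s2 \<subseteq> J" using sub(2) P1A P1B1 unfolding J by blast
 \<comment> \<open>The second crossing needs a component of the intermediate link \<open>J\<close>.
   If both lifted strands lie on one component, the first change has altered it, and its new form is
   an isotopic image of the old one.\<close>
 have "EX t. oriented_knot t & t \<subseteq> J & ?T2 \<subseteq> t"
 proof (cases "t2 = t1")
  case True
  have t2B: "{a : t2. fst a : ?B1} = ?T1" using P2B1 sub(4) t1(2) True m1 by blast
  have t2UT: "t2 \<subseteq> UT" using F2(2)[OF t2(1)] by (rule oriented_knot_UT)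
  obtain h where h: "iso_end h" "tangent_map h ` t2 = {a : t2. fst a ~: ?B1} Un strand e1 (%y. - g y)"
   by (rule isotopic_replace_strand[OF e1(1) g g' t2UT t2B]) blast
  have "oriented_knot (tangent_map h ` t2)" by (rule oriented_knot_image[OF iso_end_diffeo[OF h(1)] F2(2)[OF t2(1)]])
  moreover have "tangent_map h ` t2 \<subseteq> J" unfolding h(2) J using sub(4) P2A by blast
  moreover have "?T2 \<subseteq> tangent_map h ` t2" unfolding h(2) using t2(2) m2 n12 by blast
  ultimately show ?thesis by blast
 next
  case False
  hence "carrier t2 Int carrier t1 = {}" using F2(3) t1(1) t2(1) unfolding disjoint_family_on_def by blast
  hence "a ~: t2" if "a : ?T1" for a using t1(2) that by blast
  hence "t2 \<subseteq> J" unfolding J using P2B1 sub(4) P2A by blast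
  thus ?thesis using F2(2)[OF t2(1)] t2(2) by blast
 qed
 then obtain t where t: "oriented_knot t" "t \<subseteq> J" "?T2 \<subseteq> t" by blast
 obtain a where "a : ?T2" using connected_strand(3)[OF e2(1)] by fast
 hence "a : ?P k2" "a : t" using T2F F2(4) t(3) by blast+
 hence neq2: "s2 ~= t" using sub(2) dj12 by blast
 have "crossing_change_distinct J (crossed e2 g J)"
  by (rule crossing_change_distinctI[OF c2 F1(2)[OF s2(1)] t(1) s2J t(2) neq2 s2(2) t(3)])
 moreover have "crossed e2 g J = ?P (crossed E g A)"
 proof (intro set_eqI)
  fix a show "a : crossed e2 g J \<longleftrightarrow> a : ?P (crossed E g A)"
   using m1[of a] m2[of a] n12[of "fst a"] unfolding PB' unfolding crossed_def J by (simp only: mem_Collect_eq Un_iff) argo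
 qed
 ultimately show thesis using that[OF first] crE by simp
qed

end

subsection \<open>A model of the band\<close>

text \<open>The curve \<open>u = \<plusminus> hyp v\<close> is a compactly supported smoothing of the cross \<open>u\<^sup>2 = v\<^sup>2\<close>. The squaring map
 \<open>sq_pt\<close>, rotated by a right angle, sends its two branches to the graph of \<open>hyp_graph\<close> and those of
 \<open>v = \<plusminus> hyp u\<close> to the graph of \<open>- hyp_graph\<close>.\<close>

definition cap :: "real => real" where
 "cap v = flat_exp (1/4 - v\<^sup>2)"

definition hyp :: "real => real" where
 "hyp v = sqrt (v\<^sup>2 + cap v)"

definition hyp_y :: "real => real" where
 "hyp_y v = v * hyp v / 2"

text \<open>The point \<open>sq_pt (- hyp v, v)\<close> has second coordinate \<open>hyp_y v\<close>
  and height \<open>((hyp v)^2 - v^2) / 4 = cap v / 4\<close>; inverting \<open>hyp_y\<close> turns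
  this curve into a graph.\<close>

definition hyp_graph :: "real => real" where
 "hyp_graph y = cap (inv hyp_y y) / 4"

text \<open>In complex notation \<open>i z^2 / 4\<close>, with values in the plane of the second and
  third coordinates. The factor 1/4 sends the disc of radius 2 to the unit disc.\<close>

definition sq_pt :: "real \<times> real => real^3" where
 "sq_pt q = vector [0, - (fst q * snd q) / 2, ((fst q)\<^sup>2 - (snd q)\<^sup>2) / 4]"

lemma cap_nonneg: "cap v >= 0" and cap_uminus: "cap (- v) = cap v"
 by (simp_all add: cap_def flat_exp_nonneg)

lemma cap_zero: "\<bar>v\<bar> >= 1/2 ==> cap v = 0"
 using power_mono[of "1/2" "\<bar>v\<bar>" 2] by (simp add: cap_def flat_exp_zero power2_eq_square)

lemma cap_pos: "\<bar>v\<bar> < 1/2 ==> cap v > 0"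
 using power_strict_mono[of "\<bar>v\<bar>" "1/2" 2] by (simp add: cap_def flat_exp_pos power2_eq_square)

text \<open>From \<open>exp x >= 1 + x\<close> with \<open>x >= 4\<close>. The bound 1/5 is small
  enough for \<open>hyp v <= 1\<close> on [-1, 1], which keeps the smoothed cross inside the
  square.\<close>

lemma flat_exp_quarter:
 assumes "t <= 1/4"
 shows "flat_exp t <= 1/5"
proof (cases "t > 0")
 case True
 hence "inverse t >= 4" using assms by (simp add: field_simps)
 hence "exp (inverse t) >= 5" using exp_ge_add_one_self[of "inverse t"] by linarith
 thus ?thesis using True by (simp add: flat_exp_def exp_minus field_simps)
qed (simp add: flat_exp_def)

lemma cap_le: "cap v <= 1/5"
 unfolding cap_def by (rule flat_exp_quarter) simp

lemma hyp_pos: "hyp v > 0" and hyp_square: "(hyp v)\<^sup>2 = v\<^sup>2 + cap v"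
proof -
 have "v\<^sup>2 + cap v > 0" using cap_nonneg[of v] cap_pos[of v] by (cases "v = 0") (auto simp: add_pos_nonneg)
 thus "hyp v > 0" "(hyp v)\<^sup>2 = v\<^sup>2 + cap v" by (simp_all add: hyp_def)
qed

lemma hyp_uminus: "hyp (- v) = hyp v"
 by (simp add: hyp_def cap_uminus)

lemma hyp_eq_abs: "\<bar>v\<bar> >= 1/2 ==> hyp v = \<bar>v\<bar>"
 by (simp add: hyp_def cap_zero)

lemma abs_le_hyp: "\<bar>v\<bar> <= hyp v"
 by (rule power2_le_imp_le) (use hyp_square[of v] cap_nonneg[of v] hyp_pos[of v] in auto)

lemma hyp_le_one:
 assumes "\<bar>v\<bar> <= 1"
 shows "hyp v <= 1"
proof (cases "\<bar>v\<bar> >= 1/2")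
 case False
 hence "v\<^sup>2 <= 1/4" using power_mono[of "\<bar>v\<bar>" "1/2" 2] by (simp add: power2_eq_square)
 hence "(hyp v)\<^sup>2 <= 1\<^sup>2" unfolding hyp_square using cap_le[of v] by simp
 thus ?thesis by (rule power2_le_imp_le) simp
qed (use assms hyp_eq_abs in simp)

lemma smooth_cap: "smooth_on UNIV cap"
 unfolding cap_def[abs_def]
 by (rule smooth_compose[OF _ smooth_flat_exp]) (auto intro!: smooth_diff smooth_const smooth_power smooth_id)

lemma smooth_hyp: "smooth_on UNIV hyp"
 unfolding hyp_def[abs_def]
proof (rule smooth_sqrt)
 show "smooth_on UNIV (%v. v\<^sup>2 + cap v)" by (intro smooth_add smooth_power smooth_id smooth_cap open_UNIV)
 show "v\<^sup>2 + cap v > 0" for v using hyp_pos[of v] by (simp add: hyp_def)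
qed

lemma smooth_hyp_y: "smooth_on UNIV hyp_y"
 unfolding hyp_y_def[abs_def] by (intro smooth_divide smooth_mult smooth_id smooth_const smooth_hyp open_UNIV) auto

text \<open>Up to a positive factor the derivative is \<open>v^2 (2 - E) + cap v\<close>, where
  \<open>E\<close> is the derivative of \<open>flat_exp\<close> at \<open>1/4 - v^2\<close>. It is
  positive because \<open>E < 2\<close>, which amounts to \<open>x^2 < 2 exp x\<close> for
  \<open>x = 1 / t\<close>.\<close>

lemma hyp_y_derivative: "EX D>0. (hyp_y has_real_derivative D) (at v)"
proof -
 define t where "t = 1/4 - v\<^sup>2"
 define E where "E = (inverse t)\<^sup>2 * flat_exp t"
 have dE: "(flat_exp has_real_derivative E) (at t)"
  using has_derivative_inverse_power_flat_exp[of 0 t] by (simp add: E_def power2_eq_square)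
 have E: "E < 2"
 proof (cases "t > 0")
  case True
  let ?x = "inverse t"
  have "1 + ?x + ?x\<^sup>2 / 2 <= exp ?x" using True by (intro exp_lower_Taylor_quadratic) simp
  hence "?x\<^sup>2 < 2 * exp ?x" using True positive_imp_inverse_positive[OF True] by linarith
  hence "?x\<^sup>2 * exp (- ?x) < 2 * exp ?x * exp (- ?x)" by (intro mult_strict_right_mono) auto
  hence "?x\<^sup>2 * exp (- ?x) < 2" by (simp only: mult.assoc exp_minus_inverse mult_1_right)
  thus ?thesis using True by (simp add: E_def flat_exp_def)
 qed (simp add: E_def flat_exp_def)
 have "(cap has_real_derivative E * (0 - 2 * v)) (at v)"
  unfolding cap_def[abs_def]
  by (rule DERIV_chain2[of flat_exp E "%v. 1/4 - v\<^sup>2", OF dE[unfolded t_def]]) (auto intro!: derivative_eq_intros)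
 hence "(hyp has_real_derivative (2 * v - 2 * v * E) * (inverse (hyp v) / 2)) (at v)"
  unfolding hyp_def[abs_def] using hyp_pos[of v] by (auto intro!: derivative_eq_intros DERIV_real_sqrt simp: hyp_def algebra_simps)
 hence "(hyp_y has_real_derivative (hyp v + v * ((2 * v - 2 * v * E) * (inverse (hyp v) / 2))) / 2) (at v)"
  unfolding hyp_y_def[abs_def] by (auto intro!: derivative_eq_intros)
 moreover have "hyp v + v * ((2 * v - 2 * v * E) * (inverse (hyp v) / 2)) = ((hyp v)\<^sup>2 + v\<^sup>2 * (1 - E)) / hyp v"
  using hyp_pos[of v] by (simp add: field_simps power2_eq_square)
 moreover have "(hyp v)\<^sup>2 + v\<^sup>2 * (1 - E) > 0"
 proof (cases "v = 0")
  case False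
  hence "v\<^sup>2 * (2 - E) > 0" using E by simp
  thus ?thesis using cap_nonneg[of v] by (simp add: hyp_square algebra_simps)
 qed (use hyp_pos[of 0] in simp)
 ultimately show ?thesis using hyp_pos[of v] by (metis divide_pos_pos zero_less_numeral)
qed

lemma hyp_y_uminus: "hyp_y (- v) = - hyp_y v"
 by (simp add: hyp_y_def hyp_uminus)

lemma strict_mono_hyp_y: "strict_mono hyp_y"
proof (rule strict_monoI)
 fix a b :: real assume "a < b"
 thus "hyp_y a < hyp_y b" by (rule DERIV_pos_imp_increasing) (use hyp_y_derivative in blast)
qed

lemma bij_hyp_y: "bij hyp_y"
proof (rule bijI)
 show inj: "inj hyp_y" using strict_mono_hyp_y by (rule strict_mono_imp_inj_on)
 show "surj hyp_y"
 proof (rule surjI)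
  fix y :: real
  \<comment> \<open>At \<open>M >= 1\<close> the function \<open>hyp\<close> is the absolute value,
    so \<open>hyp_y M = M^2 / 2 >= M / 2 >= |y|\<close>.\<close>
  define M where "M = 1 + 2 * \<bar>y\<bar>"
  have M: "M >= 1" by (simp add: M_def)
  have "hyp_y M = M * M / 2" using M by (simp add: hyp_y_def hyp_eq_abs)
  moreover have "M * M >= M * 1" using M by (intro mult_left_mono) auto
  ultimately have "hyp_y M >= \<bar>y\<bar>" by (simp add: M_def)
  hence b: "hyp_y (- M) <= y" "y <= hyp_y M" by (auto simp: hyp_y_uminus)
  have "EX v>=-M. v <= M & hyp_y v = y" using b M by (intro IVT') (auto intro: continuous_on_subset[OF smooth_continuous[OF smooth_hyp_y]])
  hence "hyp_y (inv hyp_y y) = y" by (metis f_inv_into_f rangeI)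
  thus "hyp_y (inv hyp_y y) = y" .
 qed
qed

lemma inv_hyp_y: "inv hyp_y (hyp_y v) = v" and hyp_y_inv: "hyp_y (inv hyp_y y) = y"
 using bij_hyp_y by (simp_all add: bij_is_inj bij_is_surj surj_f_inv_f)

lemma smooth_inv_hyp_y: "smooth_on UNIV (inv hyp_y)"
proof -
 obtain D where D: "!!v. D v > 0" "!!v. (hyp_y has_real_derivative D v) (at v)" using hyp_y_derivative by metis
 show ?thesis
  by (rule smooth_inverse_function_real[OF smooth_hyp_y bij_hyp_y D(2)]) (use D(1) less_irrefl in metis)
qed

lemma hyp_y_one: "hyp_y 1 = 1/2" and hyp_y_half: "hyp_y (1/2) = 1/8"
 by (simp_all add: hyp_y_def hyp_eq_abs)

lemma hyp_graph_hyp_y: "hyp_graph (hyp_y v) = cap v / 4"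
 by (simp add: hyp_graph_def inv_hyp_y)

text \<open>The number 1/8 is \<open>hyp_y (1/2)\<close>, the image of the point from which on
  \<open>cap\<close> vanishes.\<close>

lemma hyp_graph_zero:
 assumes "\<bar>y\<bar> >= 1/8"
 shows "hyp_graph y = 0"
proof -
 have "\<bar>inv hyp_y y\<bar> >= 1/2"
 proof (rule ccontr)
  assume "~ ?thesis"
  hence "hyp_y (inv hyp_y y) < hyp_y (1/2)" "hyp_y (-1/2) < hyp_y (inv hyp_y y)" by (auto intro!: strict_monoD[OF strict_mono_hyp_y])
  thus False using assms hyp_y_uminus[of "1/2"] by (simp add: hyp_y_half hyp_y_inv)
 qed
 thus ?thesis by (simp add: hyp_graph_def cap_zero)
qed

lemma small_bump_hyp_graph: "small_bump hyp_graph"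
 unfolding small_bump_def
proof (intro conjI allI impI)
 show "smooth_on UNIV hyp_graph"
  unfolding hyp_graph_def[abs_def] by (intro smooth_divide smooth_const smooth_compose[OF smooth_inv_hyp_y smooth_cap] open_UNIV) auto
 show "\<bar>hyp_graph y\<bar> <= 1/2" for y using cap_nonneg cap_le[of "inv hyp_y y"] by (simp add: hyp_graph_def)
 show "hyp_graph y = 0" if "1/2 <= \<bar>y\<bar>" for y using that by (intro hyp_graph_zero) simp
qed

lemma hyp_graph_0: "hyp_graph 0 > 0"
 using hyp_graph_hyp_y[of 0] cap_pos[of 0] by (simp add: hyp_y_def)

lemma sq_pt_uminus: "sq_pt (- q) = sq_pt q"
 by (simp add: sq_pt_def)

lemma sq_pt_hyp:
 "sq_pt (- hyp v, v) = graph_pt hyp_graph (hyp_y v)"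
 "sq_pt (v, - hyp v) = graph_pt (%y. - hyp_graph y) (hyp_y v)"
 using hyp_graph_hyp_y[of v, unfolded hyp_y_def]
 by (simp_all add: sq_pt_def hyp_square hyp_y_def vec_eq_iff forall_3 mult.commute)

lemma norm_sq_pt: "norm (sq_pt q) = (norm q)\<^sup>2 / 4"
proof -
 obtain a b where q: "q = (a, b)" by (cases q)
 have "(- (a * b) / 2)\<^sup>2 + ((a\<^sup>2 - b\<^sup>2) / 4)\<^sup>2 = ((a\<^sup>2 + b\<^sup>2) / 4)\<^sup>2" by (simp add: power2_eq_square field_simps)
 hence "norm (sq_pt q) = sqrt (((a\<^sup>2 + b\<^sup>2) / 4)\<^sup>2)" by (simp only: sq_pt_def norm_vector_3 q fst_conv snd_conv) simp
 thus ?thesis by (simp add: q norm_Pair)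
qed

lemma sq_pt_eq_iff: "sq_pt q = sq_pt q' \<longleftrightarrow> q = q' | q = - q'"
proof
 assume eq: "sq_pt q = sq_pt q'"
 obtain a b c d where q: "q = (a, b)" "q' = (c, d)" by (cases q, cases q')
 have 1: "a * b = c * d" "a\<^sup>2 - b\<^sup>2 = c\<^sup>2 - d\<^sup>2" using eq by (auto simp: sq_pt_def q vec_eq_iff forall_3)
 have "(norm q)\<^sup>2 = (norm q')\<^sup>2" using norm_sq_pt[of q] norm_sq_pt[of q'] eq by simp
 hence "a\<^sup>2 + b\<^sup>2 = c\<^sup>2 + d\<^sup>2" by (simp add: q norm_Pair)
 hence "a\<^sup>2 = c\<^sup>2" "b\<^sup>2 = d\<^sup>2" using 1 by auto
 hence "(a = c | a = - c) & (b = d | b = - d)" by (simp add: power2_eq_iff)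
 thus "q = q' | q = - q'" using 1(1) by (auto simp: q)
qed (auto simp: sq_pt_uminus)

lemma sq_pt_axis_iff: "sq_pt q $ 2 = 0 & sq_pt q $ 3 = 0 \<longleftrightarrow> q = 0"
proof -
 have "sq_pt q $ 2 = 0 & sq_pt q $ 3 = 0 \<longleftrightarrow> sq_pt q = 0" by (simp add: sq_pt_def vec_eq_iff forall_3)
 also have "\<dots> \<longleftrightarrow> q = 0" using norm_sq_pt[of q] norm_eq_zero[of "sq_pt q"] norm_eq_zero[of q] by auto
 finally show ?thesis .
qed

text \<open>\<open>sq_pt\<close> identifies only opposite points and \<open>hyp\<close> is even, so
  \<open>s * hyp v\<close> must be one of the two branch values. This is why the band meets the link
  in its edges only.\<close>

lemma sq_pt_on_graph:
 assumes "sq_pt (s * hyp v, v) = graph_pt hyp_graph y"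
 shows "\<bar>s\<bar> = 1"
proof -
 define v' where "v' = inv hyp_y y"
 have "sq_pt (s * hyp v, v) = sq_pt (- hyp v', v')" using assms by (simp add: sq_pt_hyp v'_def hyp_y_inv)
 hence "(s * hyp v = - hyp v' & v = v') | (s * hyp v = hyp v' & v = - v')" by (simp add: sq_pt_eq_iff)
 hence "s * hyp v = - hyp v | s * hyp v = hyp v" by (auto simp: hyp_uminus)
 hence "(s + 1) * hyp v = 0 | (s - 1) * hyp v = 0" by (auto simp: algebra_simps)
 hence "s = - 1 | s = 1" using hyp_pos[of v] by auto
 thus ?thesis by auto
qed

lemma smooth_sq_pt: "smooth_on UNIV sq_pt"
 unfolding sq_pt_def[abs_def]
 by (intro smooth_vector_3 smooth_const smooth_divide smooth_uminus smooth_mult smooth_diff smooth_power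
   smooth_fst smooth_snd open_UNIV) auto

lemma sq_pt_derivative:
 "(sq_pt has_derivative (%h. vector [0, - (fst q * snd h + fst h * snd q) / 2, (fst q * fst h - snd q * snd h) / 2])) (at q)"
proof (rule has_derivative_componentwise_within[THEN iffD2], intro ballI)
 fix b :: "real^3" assume "b : Basis"
 then obtain i where b: "b = axis i 1" by (auto simp: Basis_vec_def)
 let ?D = "%h. vector [0, - (fst q * snd h + fst h * snd q) / 2, (fst q * fst h - snd q * snd h) / 2] :: real^3"
 have "((%x. sq_pt x $ 1) has_derivative (%h. ?D h $ 1)) (at q)" by (simp add: sq_pt_def)
 moreover have "((%x. sq_pt x $ 2) has_derivative (%h. ?D h $ 2)) (at q)"
  unfolding sq_pt_def vector_3 by (rule derivative_eq_intros HOL.refl | simp add: field_simps fun_eq_iff; fail)+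
 moreover have "((%x. sq_pt x $ 3) has_derivative (%h. ?D h $ 3)) (at q)"
  unfolding sq_pt_def vector_3 by (rule derivative_eq_intros HOL.refl | simp add: field_simps fun_eq_iff; fail)+
 ultimately show "((%x. sq_pt x \<bullet> b) has_derivative (%h. ?D h \<bullet> b)) (at q)"
  using exhaust_3[of i] by (auto simp only: b inner_axis inner_real_def mult_1_right)
qed

subsection \<open>The band over a crossing with the branching set\<close>

lemma hyp_y_interval: "hyp_y ` {-1..1} = {-1/2..1/2}"
proof
 have m: "mono hyp_y" using strict_mono_hyp_y by (rule strict_mono_mono)
 have h: "hyp_y (- 1) = - 1/2" using hyp_y_uminus[of 1] by (simp add: hyp_y_one)
 show "hyp_y ` {-1..1} \<subseteq> {-1/2..1/2}"
  using monoD[OF m, of "-1"] monoD[OF m, of _ 1] by (auto simp: h hyp_y_one)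
 show "{-1/2..1/2} \<subseteq> hyp_y ` {-1..1}"
 proof
  fix y :: real assume y: "y : {-1/2..1/2}"
  have "hyp_y (- 1) <= hyp_y (inv hyp_y y)" "hyp_y (inv hyp_y y) <= hyp_y 1" using y by (auto simp: h hyp_y_one hyp_y_inv)
  hence "inv hyp_y y : {-1..1}" using strict_mono_less_eq[OF strict_mono_hyp_y] by simp
  thus "y : hyp_y ` {-1..1}" using hyp_y_inv by (metis image_eqI)
 qed
qed

lemma vector_derivative_graph_hyp:
 assumes "smooth_on UNIV h"
 shows "VD (%v. graph_pt h (hyp_y v)) v ~= 0"
proof
 assume z: "VD (%v. graph_pt h (hyp_y v)) v = 0"
 have s: "smooth_on UNIV (%v. graph_pt h (hyp_y v))" by (rule smooth_compose[OF smooth_hyp_y smooth_graph_pt[OF assms]]) auto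
 have "((%v. graph_pt h (hyp_y v) $ 2) has_vector_derivative VD (%v. graph_pt h (hyp_y v)) v $ 2) (at v)"
  by (rule bounded_linear.has_vector_derivative[OF bounded_linear_vec_nth smooth_has_vector_derivative[OF s UNIV_I]])
 hence "(hyp_y has_real_derivative 0) (at v)" using z by (simp add: has_real_derivative_iff_has_vector_derivative)
 thus False using hyp_y_derivative[of v] DERIV_unique by fastforce
qed

text \<open>Coordinates \<open>(s, v)\<close> on the region between the branches
  \<open>u = - hyp v\<close> and \<open>u = hyp v\<close>, which correspond to the edges
  \<open>s = -1\<close> and \<open>s = 1\<close> of the band.\<close>

definition unfold_square :: "real \<times> real => real \<times> real" where
 "unfold_square q = (fst q * hyp (snd q), snd q)"

lemma smooth_unfold_square: "smooth_on UNIV unfold_square"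
 unfolding unfold_square_def[abs_def]
 by (intro smooth_on_Pair smooth_mult smooth_fst smooth_snd smooth_compose[OF smooth_snd smooth_hyp] open_UNIV) auto

lemma unfold_square_inj: "inj unfold_square"
proof (rule injI)
 fix q q' assume "unfold_square q = unfold_square q'"
 thus "q = q'" using hyp_pos[of "snd q'"] by (auto simp: unfold_square_def prod_eq_iff)
qed

lemma unfold_square_derivative_inj:
 assumes "FD unfold_square q v = 0"
 shows "v = 0"
proof -
 obtain D where D: "(hyp has_real_derivative D) (at (snd q))"
  using smooth_has_vector_derivative[OF smooth_hyp UNIV_I] by (auto simp: has_real_derivative_iff_has_vector_derivative)
 have "((%x. hyp (snd x)) has_derivative (%h. D * snd h)) (at q)"
  using diff_chain_at[OF has_derivative_snd[OF has_derivative_ident] D[unfolded has_field_derivative_def]] by (simp add: o_def)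
 hence "(unfold_square has_derivative (%h. (fst q * (D * snd h) + fst h * hyp (snd q), snd h))) (at q)"
  unfolding unfold_square_def[abs_def]
  by (intro has_derivative_Pair has_derivative_mult has_derivative_fst has_derivative_snd has_derivative_ident)
 hence "FD unfold_square q = (%h. (fst q * (D * snd h) + fst h * hyp (snd q), snd h))"
  by (rule frechet_derivative_at[symmetric])
 hence "(fst q * (D * snd v) + fst v * hyp (snd q), snd v) = 0" using assms by simp
 thus ?thesis using hyp_pos[of "snd q"] by (auto simp: prod_eq_iff)
qed

lemma unfold_square_ball:
 assumes "q : {-1..1} \<times> {-1..1}"
 shows "unfold_square q : ball 0 2"
proof -
 obtain s v where q: "q = (s, v)" by (cases q)
 have s: "\<bar>s\<bar> <= 1" and v: "\<bar>v\<bar> <= 1" using assms by (auto simp: q abs_le_iff)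
 have "\<bar>s * hyp v\<bar> <= 1" using s hyp_le_one[OF v] hyp_pos[of v] by (simp add: abs_mult mult_le_one)
 hence "(s * hyp v)\<^sup>2 <= 1" "v\<^sup>2 <= 1" using v by (simp_all only: abs_square_le_1)
 hence "(norm (unfold_square q))\<^sup>2 < 2\<^sup>2" by (simp add: unfold_square_def q norm_Pair)
 thus ?thesis using power_less_imp_less_base[of "norm (unfold_square q)" 2 2] by simp
qed

text \<open>The branch \<open>v = - hyp u\<close> in the coordinates of the square.\<close>

definition band_arc :: "real => real \<times> real" where
 "band_arc t = ((2 * t - 1) / hyp (hyp (2 * t - 1)), - hyp (2 * t - 1))"

lemma unfold_band_arc: "unfold_square (band_arc t) = (2 * t - 1, - hyp (2 * t - 1))"
 using hyp_pos[of "hyp (2 * t - 1)"] by (simp add: unfold_square_def band_arc_def hyp_uminus)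

lemma unfold_square_uminus: "unfold_square (- q) = - unfold_square q"
 by (simp add: unfold_square_def hyp_uminus prod_eq_iff)

lemma smooth_band_arc: "smooth_on UNIV band_arc"
proof -
 have t: "smooth_on UNIV (%t::real. 2 * t - 1)" by (intro smooth_diff smooth_mult smooth_const smooth_id open_UNIV)
 have h: "smooth_on UNIV (%t. hyp (2 * t - 1))" by (rule smooth_compose[OF t smooth_hyp]) auto
 have hh: "smooth_on UNIV (%t. hyp (hyp (2 * t - 1)))" by (rule smooth_compose[OF h smooth_hyp]) auto
 show ?thesis unfolding band_arc_def[abs_def]
  by (intro smooth_on_Pair smooth_divide smooth_uminus t h hh) (use hyp_pos less_irrefl in metis)
qed

lemma arc_in_square_band_arc: "arc_in_square band_arc"
 unfolding arc_in_square_def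
proof (intro conjI ballI)
 show "smooth_on UNIV band_arc" by (rule smooth_band_arc)
 show "inj_on band_arc {0..1}"
 proof (rule inj_onI)
  fix s t assume "band_arc s = band_arc t"
  hence "unfold_square (band_arc s) = unfold_square (band_arc t)" by simp
  thus "s = t" by (simp add: unfold_band_arc)
 qed
 show "band_arc ` {0..1} \<subseteq> {-1..1} \<times> {-1..1}"
 proof (rule image_subsetI)
  fix t :: real assume "t : {0..1}"
  have unit: "x : {-1..1}" if "\<bar>x\<bar> <= 1" for x :: real using that by auto
  have t: "\<bar>2 * t - 1\<bar> <= 1" using \<open>t : {0..1}\<close> by (auto simp: abs_le_iff)
  have "\<bar>2 * t - 1\<bar> <= hyp (hyp (2 * t - 1))" using abs_le_hyp[of "2 * t - 1"] abs_le_hyp[of "hyp (2 * t - 1)"] by linarith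
  hence "\<bar>(2 * t - 1) / hyp (hyp (2 * t - 1))\<bar> <= 1" using hyp_pos[of "hyp (2 * t - 1)"] by (simp add: abs_divide)
  hence "(2 * t - 1) / hyp (hyp (2 * t - 1)) : {-1..1}" using unit[of "(2 * t - 1) / hyp (hyp (2 * t - 1))"] by blast
  thus "band_arc t : {-1..1} \<times> {-1..1}" using hyp_le_one[OF t] hyp_pos[of "2 * t - 1"] by (simp add: band_arc_def)
 qed
 show "VD band_arc t ~= 0" for t
 proof
  assume z: "VD band_arc t = 0"
  have lin: "linear (FD unfold_square (band_arc t))"
   by (rule has_derivative_linear[OF smooth_has_derivative[OF smooth_unfold_square UNIV_I]])
  have s: "smooth_on UNIV (%t. unfold_square (band_arc t))" by (rule smooth_compose[OF smooth_band_arc smooth_unfold_square]) auto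
  have "VD (%t. unfold_square (band_arc t)) t = 0"
   using vector_derivative_chain_smooth[OF smooth_band_arc UNIV_I smooth_has_derivative[OF smooth_unfold_square UNIV_I]]
    z linear_0[OF lin] by simp
  hence "((%t. fst (unfold_square (band_arc t))) has_vector_derivative fst (0 :: real \<times> real)) (at t)"
   using bounded_linear.has_vector_derivative[OF bounded_linear_fst smooth_has_vector_derivative[OF s UNIV_I, of t]] by simp
  hence "((%t. 2 * t - 1) has_real_derivative 0) (at t)" by (simp add: unfold_band_arc has_real_derivative_iff_has_vector_derivative)
  moreover have "((%t. 2 * t - 1) has_real_derivative 2) (at t)" by (auto intro!: derivative_eq_intros)
  ultimately show False using DERIV_unique by fastforce
 qed
qed

lemma arc_in_square_uminus:
 assumes "arc_in_square c"
 shows "arc_in_square (%t. - c t)"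
proof -
 have "VD (%t. - c t) t = - VD c t" for t
  using assms by (intro vector_derivative_at has_vector_derivative_minus smooth_has_vector_derivative[of UNIV])
   (auto simp: arc_in_square_def)
 thus ?thesis
  using assms unfolding arc_in_square_def by (auto simp: inj_on_def intro!: smooth_uminus)
qed

text \<open>The cut at 1/2 is \<open>hyp_y 1\<close>, where the band ends. The model graph vanishes
  from 1/8 on, so the cut lies in the straight part, and the strands before and after the change
  have the same outer part.\<close>

definition central_strand :: "(real^3 => real^4) => (real => real) => oriented_curve" where
 "central_strand e g = directed_arc (%y. e (graph_pt g y)) {-1/2..1/2}"

definition outer_strand :: "(real^3 => real^4) => oriented_curve" where
 "outer_strand e = directed_arc (%y. e (graph_pt (%y. 0) y)) ({-1..1} - {-1/2..1/2})"

lemma strand_split: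
 assumes "!!y. \<bar>y\<bar> >= 1/8 ==> g y = 0"
 shows "strand e g = central_strand e g Un outer_strand e"
proof -
 have "outer_strand e = directed_arc (%y. e (graph_pt g y)) ({-1..1} - {-1/2..1/2})"
  unfolding outer_strand_def
 proof (rule directed_arc_cong)
  show "open ({1/8<..} Un {..<-1/8::real})" by auto
  show "{-1..1} - {-1/2..1/2} \<subseteq> {1/8<..} Un {..<-1/8::real}" by auto
  fix y :: real assume "y : {1/8<..} Un {..<-1/8}"
  hence "\<bar>y\<bar> >= 1/8" by auto
  thus "e (vector [0, y, 0]) = e (vector [0, y, g y])" using assms by simp
 qed
 thus ?thesis
  unfolding strand_def central_strand_def by (simp only: directed_arc_Un[symmetric]) (rule arg_cong[where f = "directed_arc _"], auto)
qed

context branched_cover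
begin

text \<open>Parametrized by \<open>y = hyp_y v\<close>, the strand is the image of
  \<open>sq_pt (r v)\<close>, and opposite points have the same image under \<open>sq_pt\<close>; so
  the two lifts come from \<open>r\<close> and \<open>- r\<close>.\<close>

lemma central_strand_preimage:
 assumes e: "patch (ball 0 2) e"
  and axis: "!!q. q : cball 0 1 ==> e q : K \<longleftrightarrow> q $ 2 = 0 & q $ 3 = 0"
  and G: "smooth_on (ball 0 2) G" "G ` ball 0 2 \<subseteq> S3" "!!q. q : ball 0 2 ==> p (G q) = e (sq_pt q)"
   "!!q x. q : ball 0 2 ==> q ~= 0 ==> x : S3 ==> p x = e (sq_pt q) ==> x = G q | x = G (- q)"
  and h: "small_bump h" and r: "smooth_on UNIV r" "!!v. r v ~= 0" "!!v. v : {-1..1} ==> r v : ball 0 2"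
   "!!v. sq_pt (r v) = graph_pt h (hyp_y v)"
 shows "preimage_curve p (central_strand e h) = directed_arc (%v. G (r v)) {-1..1} Un directed_arc (%v. G (- r v)) {-1..1}"
proof -
 let ?J = "r -` ball 0 2" and ?c = "%v. graph_pt h (hyp_y v)"
 have J: "open ?J" by (rule open_vimage[OF open_ball smooth_continuous[OF r(1)]])
 have TJ: "{-1..1} \<subseteq> ?J" using r(3) by blast
 have rJ: "smooth_on ?J r" by (rule smooth_subset[OF r(1) J subset_UNIV])
 have mrJ: "smooth_on ?J (%v. - r v)" by (rule smooth_uminus[OF rJ])
 have hs: "smooth_on UNIV h" by (rule small_bumpD(1)[OF h])
 have cs: "smooth_on UNIV ?c" by (rule smooth_compose[OF smooth_hyp_y smooth_graph_pt[OF hs]]) auto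
 have cJ: "smooth_on ?J ?c" by (rule smooth_subset[OF cs J subset_UNIV])
 have c1: "?c v : ball 0 1" if "v : ?J" for v
 proof -
  have "(norm (r v))\<^sup>2 < 2\<^sup>2" using that by (intro power_strict_mono) auto
  thus ?thesis by (simp add: r(4)[symmetric] norm_sq_pt)
 qed
 have sub: "ball (0::real^3) 1 \<subseteq> ball 0 2" by auto
 have c2: "?c ` ?J \<subseteq> ball 0 2" using c1 sub by blast
 have ec: "smooth_on ?J (%v. e (?c v))" by (rule smooth_compose[OF cJ patch_smooth[OF e] c2])
 have mb: "- q : ball 0 2" if "q : ball 0 2" for q :: "real \<times> real" using that by simp
 have mr: "(%v. - r v) ` ?J \<subseteq> ball 0 2" by (rule image_subsetI) (use mb in blast)
 have Gp: "continuous_on ?J (%v. G (r v))" "continuous_on ?J (%v. G (- r v))"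
  by (rule smooth_continuous[OF smooth_compose[OF rJ G(1)]], blast)
   (rule smooth_continuous[OF smooth_compose[OF mrJ G(1) mr]])
 have notK: "e (?c v) : S3 - K" if "v : ?J" for v
 proof -
  have "?c v : cball 0 1" using c1[OF that] by simp
  moreover have "~ (?c v $ 2 = 0 & ?c v $ 3 = 0)" using sq_pt_axis_iff[of "r v"] r(2)[of v] unfolding r(4) by blast
  ultimately have "e (?c v) ~: K" using axis by blast
  moreover have "e (?c v) : S3" using patch_S3[OF e] c2 that by blast
  ultimately show ?thesis by blast
 qed
 have inX: "G q : X" if "q : ball 0 2" "p (G q) = e (?c v)" "v : ?J" for q v
 proof -
  have GS: "G q : S3" using G(2) that(1) by blast
  have "p (G q) ~: K" unfolding that(2) using notK[OF that(3)] by blast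
  thus ?thesis using in_X_iff[OF GS] by blast
 qed
 have pG: "p (G (r v)) = e (?c v)" "p (G (- r v)) = e (?c v)" if "v : ?J" for v
  using G(3)[of "r v"] G(3)[of "- r v"] that mb by (simp_all add: sq_pt_uminus r(4))
 have "preimage_curve p (directed_arc (%v. e (?c v)) {-1..1}) =
   directed_arc (%v. G (r v)) {-1..1} Un directed_arc (%v. G (- r v)) {-1..1}"
 proof (rule preimage_directed_arc(1)[OF ec _ TJ])
  show "(%v. e (?c v)) ` ?J \<subseteq> S3 - K" using notK by blast
  show "VD (%v. e (?c v)) v ~= 0" if "v : {-1..1}" for v
  proof
   assume z: "VD (%v. e (?c v)) v = 0"
   have v: "v : ?J" using that TJ by blast
   have cW: "?c v : ball 0 2" using c2 v by blast
   have "FD e (?c v) (VD ?c v) = 0" using vector_derivative_chain_smooth[OF cJ v patch_has_derivative[OF e cW]] z by simp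
   thus False using patch_derivative_inj[OF e cW] vector_derivative_graph_hyp[OF hs] by blast
  qed
  show "continuous_on ?J (%v. G (r v))" "continuous_on ?J (%v. G (- r v))" by (rule Gp)+
  show "(%v. G (r v)) ` ?J \<subseteq> X"
  proof (rule image_subsetI)
   fix v assume v: "v : ?J"
   hence "r v : ball 0 2" by blast
   thus "G (r v) : X" by (rule inX[OF _ pG(1)[OF v] v])
  qed
  show "(%v. G (- r v)) ` ?J \<subseteq> X"
  proof (rule image_subsetI)
   fix v assume v: "v : ?J"
   hence "- r v : ball 0 2" using mb by blast
   thus "G (- r v) : X" by (rule inX[OF _ pG(2)[OF v] v])
  qed
  show "x = G (r v) | x = G (- r v)" if "v : ?J" "x : S3" "p x = e (?c v)" for v x
   using G(4)[of "r v" x] that r(2)[of v] by (simp add: r(4))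
 qed (rule pG, assumption)+
 also have "directed_arc (%v. e (?c v)) {-1..1} = directed_arc (%y. e (graph_pt h y)) (hyp_y ` {-1..1})"
 proof -
  let ?V = "graph_pt h -` ball 0 2"
  have V: "open ?V" by (rule open_vimage[OF open_ball smooth_continuous[OF smooth_graph_pt[OF hs]]])
  have "smooth_on ?V (graph_pt h)" by (rule smooth_subset[OF smooth_graph_pt[OF hs] V subset_UNIV])
  hence s: "smooth_on ?V (%y. e (graph_pt h y))" by (rule smooth_compose[OF _ patch_smooth[OF e]]) blast
  have hJ: "smooth_on ?J hyp_y" by (rule smooth_subset[OF smooth_hyp_y J subset_UNIV])
  have im: "hyp_y ` ?J \<subseteq> ?V" using c2 by blast
  have pos: "VD hyp_y t > 0" for t
   using hyp_y_derivative[of t] vector_derivative_at by (metis has_real_derivative_iff_has_vector_derivative)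
  show ?thesis by (rule directed_arc_reparam[OF s hJ TJ im pos])
 qed
 finally show ?thesis unfolding central_strand_def hyp_y_interval .
qed

text \<open>\<open>G\<close> lifts the disc normal to the branching set. The band is the part of
  this lifted disc between the lifts of the old strand, and the lifts of the new strand are rounded
  forms of its other two sides. Outside the band both graphs are flat and nothing changes.\<close>

lemma band_crossing:
 assumes e: "patch (ball 0 2) e"
  and axis: "!!q. q : cball 0 1 ==> e q : K \<longleftrightarrow> q $ 2 = 0 & q $ 3 = 0"
  and G: "smooth_on (ball 0 2) G" "inj_on G (ball 0 2)" "G ` ball 0 2 \<subseteq> S3"
   "!!q v. q : ball 0 2 ==> FD G q v = 0 ==> v = 0"
   "!!q. q : ball 0 2 ==> p (G q) = e (sq_pt q)"
   "!!q x. q : ball 0 2 ==> q ~= 0 ==> x : S3 ==> p x = e (sq_pt q) ==> x = G q | x = G (- q)"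
  and A: "A \<subseteq> UT" "carrier A Int e ` cball 0 1 = {}" "carrier A Int K = {}"
  and link: "oriented_link (preimage_curve p (A Un strand e (%y. - hyp_graph y)))"
 shows "internal_band_sum (preimage_curve p (A Un strand e hyp_graph)) (preimage_curve p (A Un strand e (%y. - hyp_graph y)))"
proof -
 let ?P = "preimage_curve p" and ?Q = "{-1..1} \<times> {-1..1::real}"
 define f where "f q = G (unfold_square q)" for q
 let ?U = "unfold_square -` ball 0 2"
 have U: "open ?U" by (rule open_vimage[OF open_ball smooth_continuous[OF smooth_unfold_square]])
 have QU: "?Q \<subseteq> ?U" using unfold_square_ball by blast
 have us: "smooth_on ?U unfold_square" by (rule smooth_subset[OF smooth_unfold_square U subset_UNIV])
 have fs: "smooth_on ?U f" unfolding f_def[abs_def] by (rule smooth_compose[OF us G(1)]) blast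
 have Qball: "unfold_square q : ball 0 2" if "q : ?Q" for q using unfold_square_ball[OF that] .
 have pf: "p (f q) = e (sq_pt (unfold_square q))" if "q : ?Q" for q
  unfolding f_def by (rule G(5)[OF Qball[OF that]])
 have sqc: "sq_pt q : cball 0 1" if "q : ball 0 2" for q
 proof -
  have "(norm q)\<^sup>2 < 2\<^sup>2" using that by (intro power_strict_mono) auto
  thus ?thesis by (simp add: norm_sq_pt)
 qed
 have emb: "embedded_square f"
  unfolding embedded_square_def
 proof (intro conjI ballI)
  show "EX U. ?Q \<subseteq> U & smooth_on U f" using QU fs by blast
  show "inj_on f ?Q" unfolding f_def[abs_def] by (rule inj_onI) (use inj_onD[OF G(2)] Qball injD[OF unfold_square_inj] in blast)
  show "f ` ?Q \<subseteq> S3" using G(3) Qball unfolding f_def by blast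
  show "inj (FD f q)" if q: "q : ?Q" for q
  proof -
   let ?D = "FD unfold_square q" and ?E = "FD G (unfold_square q)"
   have d1: "(unfold_square has_derivative ?D) (at q)" by (rule smooth_has_derivative[OF smooth_unfold_square UNIV_I])
   have d2: "(G has_derivative ?E) (at (unfold_square q))" by (rule smooth_has_derivative[OF G(1) Qball[OF q]])
   have d: "(f has_derivative (%v. ?E (?D v))) (at q)" using diff_chain_at[OF d1 d2] by (simp add: o_def f_def[abs_def])
   have lin: "linear (%v. ?E (?D v))" by (rule has_derivative_linear[OF d])
   have "v = 0" if "?E (?D v) = 0" for v using G(4)[OF Qball[OF q] that] by (rule unfold_square_derivative_inj)
   hence "inj (%v. ?E (?D v))" using linear_injective_0[OF lin] by blast
   thus ?thesis using frechet_derivative_at[OF d] by simp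
  qed
 qed
 let ?r1 = "%v. (- hyp v, v)" and ?r2 = "%v. (v, - hyp v)"
 have r1s: "smooth_on UNIV ?r1" by (intro smooth_on_Pair smooth_uminus smooth_hyp smooth_id open_UNIV)
 have r2s: "smooth_on UNIV ?r2" by (intro smooth_on_Pair smooth_uminus smooth_hyp smooth_id open_UNIV)
 have rne: "?r1 v ~= 0" "?r2 v ~= 0" for v using hyp_pos[of v] by (auto simp: zero_prod_def)
 \<comment> \<open>The point reflection exchanges the two edges and reverses \<open>v\<close>. Hence
   the second strand runs along its edge in the opposite direction, as a band sum demands.\<close>
 have us1: "unfold_square (- 1, v) = ?r1 v" "unfold_square (1, v) = - ?r1 (- v)" for v
  by (simp_all add: unfold_square_def hyp_uminus)
 have r1b: "?r1 v : ball 0 2" if "v : {-1..1}" for v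
  using unfold_square_ball[of "(- 1, v)"] that by (simp add: us1)
 have r2b: "?r2 v : ball 0 2" if "v : {-1..1}" for v
  using r1b[OF that] by (simp add: norm_Pair add.commute)
 have g: "small_bump hyp_graph" and g': "small_bump (%y. - hyp_graph y)"
  using small_bump_hyp_graph small_bump_uminus by blast+
 let ?F1 = "directed_arc (%v. G (?r1 v)) {-1..1} Un directed_arc (%v. G (- ?r1 v)) {-1..1}"
 let ?F2 = "directed_arc (%v. G (?r2 v)) {-1..1} Un directed_arc (%v. G (- ?r2 v)) {-1..1}"
 have In1: "?P (central_strand e hyp_graph) = ?F1"
  by (rule central_strand_preimage[OF e axis G(1,3,5,6) g r1s rne(1) r1b sq_pt_hyp(1)])
 have In2: "?P (central_strand e (%y. - hyp_graph y)) = ?F2"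
  by (rule central_strand_preimage[OF e axis G(1,3,5,6) g' r2s rne(2) r2b sq_pt_hyp(2)])
 have sp1: "strand e hyp_graph = central_strand e hyp_graph Un outer_strand e"
  by (rule strand_split) (rule hyp_graph_zero)
 have sp2: "strand e (%y. - hyp_graph y) = central_strand e (%y. - hyp_graph y) Un outer_strand e"
  by (rule strand_split) (simp add: hyp_graph_zero)
 let ?R = "?P A Un ?P (outer_strand e)"
 have J1: "?P (A Un strand e hyp_graph) = ?R Un ?F1" unfolding sp1 preimage_curve_Un In1 by blast
 have J2: "?P (A Un strand e (%y. - hyp_graph y)) = ?R Un ?F2" unfolding sp2 preimage_curve_Un In2 by blast
 let ?S = "f ` ({-1, 1} \<times> {-1..1})"
 have f1: "f (- 1, v) = G (?r1 v)" "f (1, v) = G (- ?r1 (- v))" for v by (simp_all only: f_def us1)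
 have cF1: "carrier ?F1 = ?S"
 proof -
  have "carrier ?F1 = (%v. G (?r1 v)) ` {-1..1} Un (%v. G (- ?r1 v)) ` {-1..1}" by (simp only: image_Un carrier_directed_arc)
  moreover have "(%v. G (- ?r1 v)) ` {-1..1} = (%v. f (1, v)) ` {-1..1}"
  proof -
   have "(%v. G (- ?r1 v)) ` {-1..1} = (%v. f (1, v)) ` uminus ` {-1..1}" unfolding image_image f1 by simp
   thus ?thesis by simp
  qed
  moreover have "?S = (%v. f (- 1, v)) ` {-1..1} Un (%v. f (1, v)) ` {-1..1}" by auto
  ultimately show ?thesis unfolding f1(1) by simp
 qed
 have inS: "EX y:{-1/2..1/2}. p x = e (graph_pt hyp_graph y)" if "x : ?S" for x
 proof -
  have "x : carrier (?P (central_strand e hyp_graph))" unfolding In1 cF1 by (rule that)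
  hence "p x : carrier (central_strand e hyp_graph)" using carrier_preimage by blast
  thus ?thesis by (auto simp: central_strand_def carrier_directed_arc)
 qed
 have Rdisj: "carrier ?R Int ?S = {}"
 proof -
  have False if x: "x : carrier ?R" "x : ?S" for x
  proof -
   obtain y where y: "y : {-1/2..1/2}" "p x = e (graph_pt hyp_graph y)" using inS[OF x(2)] by blast
   hence yB: "graph_pt hyp_graph y : cball 0 1" using graph_pt_in_cball[OF g, of y] by auto
   hence "p x : e ` cball 0 1" using y by blast
   hence "p x ~: carrier A" using A(2) by blast
   hence "x ~: carrier (?P A)" using carrier_preimage by blast
   hence "x : carrier (?P (outer_strand e))" using x(1) by blast
   hence "p x : carrier (outer_strand e)" using carrier_preimage by blast
   then obtain y' where y': "y' : {-1..1} - {-1/2..1/2}" "p x = e (graph_pt (%y. 0) y')"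
    unfolding outer_strand_def carrier_directed_arc by blast
   have "graph_pt (%y. 0) y' : cball (0::real^3) 1" using y'(1) by (auto simp: norm_vector_3)
   hence "graph_pt (%y. 0) y' = graph_pt hyp_graph y"
    using inj_onD[OF patch_inj[OF e], of "graph_pt (%y. 0) y'" "graph_pt hyp_graph y"] y y' yB by auto
   hence "y' = y" by (auto simp: vec_eq_iff forall_3)
   thus False using y y' by blast
  qed
  thus ?thesis by blast
 qed
 have inter: "f ` ?Q Int carrier (?R Un ?F1) = ?S"
 proof
  show "?S \<subseteq> f ` ?Q Int carrier (?R Un ?F1)"
  proof -
   have "?S \<subseteq> f ` ?Q" by (rule image_mono) auto
   moreover have "?S \<subseteq> carrier (?R Un ?F1)" unfolding cF1[symmetric] by blast
   ultimately show ?thesis by blast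
  qed
  show "f ` ?Q Int carrier (?R Un ?F1) \<subseteq> ?S"
  proof
   fix x assume "x : f ` ?Q Int carrier (?R Un ?F1)"
   then obtain s v where q: "(s, v) : ?Q" "x = f (s, v)" and x: "x : carrier (?P (A Un strand e hyp_graph))"
    unfolding J1[symmetric] by blast
   have px: "p x = e (sq_pt (unfold_square (s, v)))" using pf q by blast
   have sqB: "sq_pt (unfold_square (s, v)) : cball 0 1" by (rule sqc[OF Qball[OF q(1)]])
   have "p x : carrier (A Un strand e hyp_graph)" using carrier_preimage[OF x] by blast
   moreover have "p x ~: carrier A" using px sqB A(2) by blast
   ultimately have "p x : carrier (strand e hyp_graph)" by blast
   then obtain y where y: "y : {-1..1}" "p x = e (graph_pt hyp_graph y)" unfolding carrier_strand by blast
   have "sq_pt (unfold_square (s, v)) = graph_pt hyp_graph y"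
    by (rule inj_onD[OF patch_inj[OF e]]) (use px y sqB graph_pt_in_cball[OF g y(1)] in auto)
   hence "\<bar>s\<bar> = 1" by (intro sq_pt_on_graph) (simp add: unfold_square_def)
   hence "(s, v) : {-1, 1} \<times> {-1..1}" using q(1) by auto
   thus "x : ?S" using q(2) by blast
  qed
 qed
 have dirs: "(f (- 1, v), sgn (FD f (- 1, v) (0, 1))) : ?F1"
  "(f (1, v), - sgn (FD f (1, v) (0, 1))) : ?F1" if v: "v : {-1..1}" for v
 proof -
  \<comment> \<open>Needed with \<open>a = 1\<close> on the left edge and with
    \<open>a = - 1\<close> on the right edge, which its strand traverses backwards.\<close>
  have line: "VD (%t. f (s, a * t)) t = a *\<^sub>R FD f (s, a * t) (0, 1)"
   if "(s, a * t) : ?Q" for s a t :: real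
  proof -
   have fd: "(f has_derivative FD f (s, a * t)) (at (s, a * t))" by (rule smooth_has_derivative[OF fs]) (use that QU in blast)
   have "((%t. (s, a * t)) has_vector_derivative (0, a)) (at t)" by (auto intro!: derivative_eq_intros has_vector_derivative_Pair)
   hence "((%t. f (s, a * t)) has_vector_derivative FD f (s, a * t) (0, a)) (at t)"
    using vector_derivative_diff_chain_within[of "%t. (s, a * t)" "(0, a)" t UNIV f] fd by (simp add: o_def has_derivative_at_withinI)
   moreover have "FD f (s, a * t) (0, a) = a *\<^sub>R FD f (s, a * t) (0, 1)"
    using linear_scale[OF has_derivative_linear[OF fd], of a "(0, 1)"] by simp
   ultimately show ?thesis using vector_derivative_at by metis
  qed
  have "VD (%t. G (?r1 t)) v = FD f (- 1, v) (0, 1)" using line[of "- 1" 1 v] v by (simp add: f1)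
  hence "(f (- 1, v), sgn (FD f (- 1, v) (0, 1))) : directed_arc (%v. G (?r1 v)) {-1..1}"
   unfolding directed_arc_def f1 by (intro image_eqI[OF _ v]) simp
  thus "(f (- 1, v), sgn (FD f (- 1, v) (0, 1))) : ?F1" by blast
  have "VD (%t. G (- ?r1 t)) (- v) = - FD f (1, v) (0, 1)" using line[of 1 "- 1" "- v"] v by (simp add: f1)
  hence "(f (1, v), - sgn (FD f (1, v) (0, 1))) : directed_arc (%v. G (- ?r1 v)) {-1..1}"
   unfolding directed_arc_def f1 by (intro image_eqI[of _ _ "- v"]) (use v in \<open>auto simp: sgn_minus\<close>)
  thus "(f (1, v), - sgn (FD f (1, v) (0, 1))) : ?F1" by blast
 qed
 let ?c = band_arc and ?d = "%t. - band_arc t"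
 have fc: "f (?c t) = G (?r2 (2 * t - 1))" "f (?d t) = G (- ?r2 (2 * t - 1))" for t
  by (simp_all add: f_def unfold_band_arc unfold_square_uminus)
 have arcs: "directed_arc (f \<circ> ?c) {0..1} Un directed_arc (f \<circ> ?d) {0..1} = ?F2"
 proof -
  let ?W = "?r2 -` ball 0 2" and ?I = "(%t. ?r2 (2 * t - 1)) -` ball 0 2"
  have W: "open ?W" by (rule open_vimage[OF open_ball smooth_continuous[OF r2s]])
  have ls: "smooth_on UNIV (%t::real. 2 * t - 1)" by (intro smooth_diff smooth_mult smooth_const smooth_id open_UNIV)
  have I: "open ?I" by (rule open_vimage[OF open_ball smooth_continuous[OF smooth_compose[OF ls r2s]]]) auto
  have r2W: "smooth_on ?W ?r2" by (rule smooth_subset[OF r2s W subset_UNIV])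
  have G1: "smooth_on ?W (%v. G (?r2 v))" by (rule smooth_compose[OF r2W G(1)]) blast
  have G2: "smooth_on ?W (%v. G (- ?r2 v))" by (rule smooth_compose[OF smooth_uminus[OF r2W] G(1)]) (auto simp: norm_Pair)
  have lI: "smooth_on ?I (%t. 2 * t - 1)" by (rule smooth_subset[OF ls I subset_UNIV])
  have im: "(%t::real. 2 * t - 1) ` {0..1} = {-1..1}"
  proof (intro set_eqI iffI)
   fix x :: real assume "x : {-1..1}"
   thus "x : (%t. 2 * t - 1) ` {0..1}" by (intro image_eqI[of _ _ "(x + 1) / 2"]) (auto simp: field_simps)
  qed auto
  have TI: "{0..1} \<subseteq> ?I" using r2b by auto
  have sub: "(%t. 2 * t - 1) ` ?I \<subseteq> ?W" by auto
  have pos: "VD (%t::real. 2 * t - 1) t > 0" for t using vector_derivative_at[of "%t::real. 2 * t - 1" 2 t]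
   by (auto intro!: derivative_eq_intros simp: has_real_derivative_iff_has_vector_derivative[symmetric])
  have "directed_arc (f \<circ> ?c) {0..1} = directed_arc (%v. G (?r2 v)) {-1..1}"
   using directed_arc_reparam[OF G1 lI TI sub pos] unfolding im fc o_def .
  moreover have "directed_arc (f \<circ> ?d) {0..1} = directed_arc (%v. G (- ?r2 v)) {-1..1}"
   using directed_arc_reparam[OF G2 lI TI sub pos] unfolding im fc o_def .
  ultimately show ?thesis by simp
 qed
 have rest: "{(x, v) : ?R Un ?F1. x ~: ?S} = ?R"
 proof (intro set_eqI)
  fix a
  have "fst a : ?S" if "a : ?F1" using imageI[OF that, of fst] unfolding cF1 .
  moreover have "fst a ~: ?S" if "a : ?R" using imageI[OF that, of fst] Rdisj by blast
  ultimately have "a : ?R Un ?F1 & fst a ~: ?S \<longleftrightarrow> a : ?R" by blast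
  thus "a : {(x, v) : ?R Un ?F1. x ~: ?S} \<longleftrightarrow> a : ?R" by (cases a) (simp only: mem_Collect_eq prod.case fst_conv)
 qed
 have cd: "?c ` {0..1} Int ?d ` {0..1} = {}"
 proof -
  have neg: "snd (?c s) < 0" for s using hyp_pos[of "2 * s - 1"] by (simp add: band_arc_def)
  have "?c s ~= ?d t" for s t using neg[of s] neg[of t] by (metis neg_less_0_iff_less order_less_asym snd_uminus)
  thus ?thesis by blast
 qed
 have ends: "?c 0 = (- 1, - 1)" "?c 1 = (1, - 1)" "?d 0 = (1, 1)" "?d 1 = (- 1, 1)"
  by (simp_all add: band_arc_def hyp_eq_abs)
 show ?thesis
  unfolding internal_band_sum_def J1 J2
 proof (rule exI[of _ f], rule exI[of _ ?c], rule exI[of _ ?d], intro conjI emb inter arc_in_square_band_arc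
   arc_in_square_uminus ends cd)
  show "ALL s:{- 1..1}. (f (- 1, s), sgn (FD f (- 1, s) (0, 1))) : ?R Un ?F1 &
    (f (1, s), - sgn (FD f (1, s) (0, 1))) : ?R Un ?F1"
   using dirs by blast
  show "?R Un ?F2 = {(x, v) : ?R Un ?F1. x ~: ?S} Un directed_arc (f \<circ> ?c) {0..1} Un directed_arc (f \<circ> ?d) {0..1}"
   unfolding rest unfolding arcs[symmetric] by (simp only: Un_assoc)
  show "oriented_link (?R Un ?F2)" using link unfolding J2 .
 qed
qed

end

subsection \<open>Aligning a chart with the branched cover\<close>

lemma derivative_along_x_axis:
 fixes f :: "real^3 => real^3"
 assumes f: "(f has_derivative D) (at 0)" "rh > 0" "!!x. x : x_axis ==> x : ball 0 rh ==> f x : x_axis"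
 shows "D (axis 1 1) : x_axis"
proof -
 have "D (axis 1 1) $ k = 0" if k: "!!x. x : x_axis ==> x $ k = 0" for k
 proof -
  have "((%t::real. t *\<^sub>R axis 1 1 :: real^3) has_vector_derivative axis 1 1) (at 0)" by (auto intro!: derivative_eq_intros)
  hence "((%t. f (t *\<^sub>R axis 1 1)) has_vector_derivative D (axis 1 1)) (at 0)"
   using vector_derivative_diff_chain_within[of "%t. t *\<^sub>R axis 1 1" "axis 1 1 :: real^3" 0 UNIV f D] f(1)
   by (simp add: o_def has_derivative_at_withinI)
  hence "((%t. f (t *\<^sub>R axis 1 1) $ k) has_vector_derivative D (axis 1 1) $ k) (at 0)"
   by (rule bounded_linear.has_vector_derivative[OF bounded_linear_vec_nth])
  moreover have "((%t. f (t *\<^sub>R axis 1 1) $ k) has_vector_derivative 0) (at 0)"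
  proof (rule has_vector_derivative_transform_within_open[OF has_vector_derivative_const open_ball[of 0 rh]])
   show "0 = f (t *\<^sub>R axis 1 1) $ k" if "t : ball 0 rh" for t
   proof -
    have "t *\<^sub>R axis 1 1 : x_axis" by (simp add: x_axis_def axis_def)
    moreover have "t *\<^sub>R axis 1 1 : ball (0::real^3) rh" using that by (simp add: norm_axis_1)
    ultimately show ?thesis using k[OF f(3)] by simp
   qed
  qed (use f(2) in simp)
  ultimately show ?thesis by (rule vector_derivative_unique_at)
 qed
 thus ?thesis by (auto simp: x_axis_def)
qed

text \<open>Charts in the definition of a branched cover have the branching set on the third axis,
  charts of a crossing have it on the first. This permutation of the axes has determinant 1 and
  translates between them.\<close>

abbreviation cyclic :: "real^3 => real^3" where
 "cyclic \<equiv> mat3 0 1 0 0 0 1 1 0 0"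

abbreviation half_turn :: "real^3 => real^3" where
 "half_turn \<equiv> mat3 1 0 0 0 (-1) 0 0 0 (-1)"

abbreviation squaring :: "real^3 => real^3" where
 "squaring q \<equiv> vector [(q $ 1)\<^sup>2 - (q $ 2)\<^sup>2, 2 * q $ 1 * q $ 2, q $ 3]"

lemma inj_cyclic: "inj cyclic" and inj_half_turn: "inj half_turn"
 by (auto intro!: injI simp: vec_eq_iff forall_3 mat3_nth)

lemma det3_cyclic: "det3 cyclic > 0" and det3_half_turn: "det3 half_turn > 0"
 by (simp_all add: det3_def Let_def mat3_nth axis_def)

lemma norm_half_turn: "norm (half_turn q) = norm q"
 by (simp add: norm_vec_def L2_set_def sum_3 mat3_nth)

context branched_cover
begin

text \<open>Off \<open>K\<close> the map is smooth, and near a point over \<open>K\<close> it is the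
  squaring map in charts. Continuity makes the image of \<open>p\<close> closed.\<close>

lemma continuous_on_p: "continuous_on S3 p"
 unfolding continuous_on_eq_continuous_within
proof
 fix x assume x: "x : S3"
 have "EX N. openin (top_of_set S3) N & x : N & continuous_on N p"
 proof (cases "x : X")
  case True
  thus ?thesis using openin_X smooth_at_S3_continuous[OF smooth_p] by blast
 next
  case False
  hence "x : S3 Int p -` K" using x in_X_iff[OF x] by blast
  then obtain ph ps where ph: "patch (ball 0 2) ph" "ph 0 = x" and ps: "patch (ball 0 2) ps"
   and eq: "ALL q:ball 0 1. p (ph q) = ps (squaring q)"
   using cover unfolding double_branched_cover_def oriented_chart_iff_patch by blast
  have p1: "patch (ball 0 1) ph" by (rule patch_subset[OF ph(1)]) auto
  let ?N = "ph ` ball 0 1"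
  have o: "openin (top_of_set S3) ?N" by (rule patch_openin[OF p1])
  have i: "continuous_on ?N (inv_into (ball 0 1) ph)" by (rule smooth_at_S3_continuous[OF patch_smooth_inverse[OF p1]])
  have sq: "squaring q : ball 0 2" if "q : ball 0 1" for q
  proof -
   have n: "(norm q)\<^sup>2 < 1" using that by (simp add: power_less_one_iff)
   have q2: "(norm q)\<^sup>2 = (q $ 1)\<^sup>2 + (q $ 2)\<^sup>2 + (q $ 3)\<^sup>2" unfolding power2_norm_eq_inner inner_vec_def by (simp add: sum_3 power2_eq_square)
   have "((q $ 1)\<^sup>2 - (q $ 2)\<^sup>2)\<^sup>2 + (2 * q $ 1 * q $ 2)\<^sup>2 = ((q $ 1)\<^sup>2 + (q $ 2)\<^sup>2)\<^sup>2" by (simp add: power2_eq_square algebra_simps)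
   moreover have "(q $ 1)\<^sup>2 + (q $ 2)\<^sup>2 <= 1" using n q2 zero_le_power2[of "q $ 3"] by linarith
   hence "((q $ 1)\<^sup>2 + (q $ 2)\<^sup>2)\<^sup>2 <= 1" by (intro power_le_one) auto
   moreover have "(q $ 3)\<^sup>2 <= 1" using n q2 zero_le_power2[of "q $ 1"] zero_le_power2[of "q $ 2"] by linarith
   ultimately have "((q $ 1)\<^sup>2 - (q $ 2)\<^sup>2)\<^sup>2 + (2 * q $ 1 * q $ 2)\<^sup>2 + (q $ 3)\<^sup>2 < 2\<^sup>2" by simp
   hence "sqrt (((q $ 1)\<^sup>2 - (q $ 2)\<^sup>2)\<^sup>2 + (2 * q $ 1 * q $ 2)\<^sup>2 + (q $ 3)\<^sup>2) < 2" by (rule real_less_lsqrt[rotated -1]) auto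
   thus ?thesis by (simp add: norm_vector_3)
  qed
  have nth: "smooth_on UNIV (%q::real^3. q $ k)" for k by (rule smooth_nth[OF smooth_id[OF open_UNIV]])
  have "smooth_on UNIV squaring" by (intro smooth_vector_3 smooth_diff smooth_mult smooth_power smooth_const nth open_UNIV)
  hence "continuous_on (ball 0 1) squaring" by (rule continuous_on_subset[OF smooth_continuous]) auto
  hence "continuous_on (ball 0 1) (%q. ps (squaring q))"
   by (rule continuous_on_compose2[OF smooth_continuous[OF patch_smooth[OF ps]]]) (use sq in blast)
  hence "continuous_on ?N (%y. ps (squaring (inv_into (ball 0 1) ph y)))"
   by (rule continuous_on_compose2[OF _ i]) (intro image_subsetI inv_into_into)
  hence "continuous_on ?N p"
  proof (rule continuous_on_eq)
   fix y assume "y : ?N"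
   thus "ps (squaring (inv_into (ball 0 1) ph y)) = p y"
    using eq[rule_format, OF inv_into_into[of y ph "ball 0 1"]] f_inv_into_f[of y ph "ball 0 1"] by simp
  qed
  moreover have "x : ?N" using ph(2) by (intro image_eqI[of _ _ 0]) auto
  ultimately show ?thesis using o by blast
 qed
 then obtain N where N: "openin (top_of_set S3) N" "x : N" "continuous_on N p" by blast
 then obtain T where T: "open T" "N = S3 Int T" by (auto simp: openin_open)
 have "at x within N = at x within S3"
  by (rule at_within_nhd[of x T]) (use N T in auto)
 thus "continuous (at x within S3) p"
  using N(2,3) by (metis continuous_on_eq_continuous_within)
qed

text \<open>Fibres are prescribed off \<open>K\<close> only, and the local form is given at points
  over \<open>K\<close> without asserting that a particular point of \<open>K\<close> has a
  preimage. The image of \<open>p\<close> is compact and contains points off the axis tending to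
  \<open>e 0\<close>, hence also \<open>e 0\<close>.\<close>

lemma branch_point_exists:
 assumes e: "patch (ball 0 2) e"
  and axis: "!!q. q : cball 0 1 ==> e q : K \<longleftrightarrow> q $ 2 = 0 & q $ 3 = 0"
 obtains x where "x : S3" "p x = e 0"
proof -
 have cl: "closed (p ` S3)" by (intro compact_imp_closed compact_continuous_image continuous_on_p) simp
 let ?q = "%n. vector [0, inverse (real (Suc n)), 0] :: real^3"
 have "e (?q n) : p ` S3" for n
 proof -
  have "inverse (real (Suc n)) <= inverse 1" by (rule le_imp_inverse_le) auto
  hence "?q n : cball 0 1" by (simp add: norm_vector_3)
  hence "e (?q n) : S3 - K" using axis[of "?q n"] patch_S3[OF e, of "?q n"] by auto
  then obtain a where a: "a : X" "p a = e (?q n)" by (rule fiber)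
  hence "a : S3" using X_S3 by blast
  thus ?thesis unfolding a(2)[symmetric] by (rule imageI)
 qed
 moreover have "(%n. e (?q n)) \<longlonglongrightarrow> e 0"
 proof (rule continuous_on_tendsto_compose[OF smooth_continuous[OF patch_smooth[OF e]]])
  have "(%n. inverse (real (Suc n))) \<longlonglongrightarrow> 0" by (rule LIMSEQ_inverse_real_of_nat)
  hence "(%n. (inverse (real (Suc n))) *\<^sub>R axis 2 1) \<longlonglongrightarrow> (0 *\<^sub>R axis 2 1 :: real^3)" by (intro tendsto_scaleR tendsto_const)
  moreover have "?q n = (inverse (real (Suc n))) *\<^sub>R axis 2 1" for n by (simp add: vec_eq_iff forall_3 axis_def)
  ultimately show "?q \<longlonglongrightarrow> 0" by simp
  show "\<forall>\<^sub>F n in sequentially. ?q n : ball 0 2"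
  proof (rule always_eventually, rule allI)
   fix n
   have "inverse (real (Suc n)) <= inverse 1" by (rule le_imp_inverse_le) auto
   hence "inverse (real (Suc n)) < 2" by simp
   thus "?q n : ball 0 2" by (simp only: mem_ball dist_0_norm norm_vector_3) simp
  qed
 qed auto
 ultimately have "e 0 : p ` S3" by (rule closed_sequentially[OF cl])
 thus thesis by (elim imageE) (rule that, assumption, rule sym)
qed

text \<open>Both charts send an axis to \<open>K\<close>, so the transition map preserves the axis
  and its derivative multiplies the axis direction by a number \<open>c\<close>, nonzero because the
  derivative is invertible.\<close>

lemma branch_charts_unsigned:
 assumes e: "patch (ball 0 2) e"
  and axis: "!!q. q : cball 0 1 ==> e q : K \<longleftrightarrow> q $ 2 = 0 & q $ 3 = 0"
 obtains ph ps c where "patch (ball 0 2) ph" "patch (ball 0 2) ps" "ps 0 = e 0"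
  "!!q. q : ball 0 2 ==> ps q : K \<longleftrightarrow> q $ 1 = 0 & q $ 2 = 0"
  "!!q. q : ball 0 1 ==> p (ph q) = ps (squaring q)" "c ~= 0"
  "FD ps 0 (axis 3 1) = c *\<^sub>R FD e 0 (axis 1 1)"
proof -
 obtain x where x: "x : S3" "p x = e 0" by (rule branch_point_exists[OF e axis])
 have "e 0 : K" using axis[of 0] by simp
 hence "x : S3 Int p -` K" using x by simp
 then obtain ph ps where ph: "patch (ball 0 2) ph" "ph 0 = x" and ps: "patch (ball 0 2) ps"
  "ALL q:ball 0 2. ps q : K \<longleftrightarrow> q $ 1 = 0 & q $ 2 = 0" and eq: "ALL q:ball 0 1. p (ph q) = ps (squaring q)"
  using cover unfolding double_branched_cover_def oriented_chart_iff_patch by blast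
 have sq0: "squaring 0 = 0" by (simp add: vec_eq_iff forall_3)
 have ps0: "ps 0 = e 0" using eq[rule_format, of 0, unfolded sq0] ph(2) x(2) by simp
 let ?ps = "%q. ps (cyclic q)"
 have ps1: "patch (cyclic -` ball 0 2) ?ps"
  by (rule patch_precompose_linear[OF ps(1) linear_mat3 inj_cyclic det3_cyclic])
 have c0: "cyclic 0 = 0" by (simp add: vec_eq_iff forall_3 mat3_nth)
 have z1: "0 : cyclic -` ball 0 2" and z2: "(0::real^3) : ball 0 2" by (simp_all add: c0)
 have eq0: "?ps 0 = e 0" using ps0 by (simp add: c0)
 obtain f rh D Dinv where rh: "rh > 0" "ball 0 rh \<subseteq> cyclic -` ball 0 2" and f: "smooth_on (ball 0 rh) f" "f 0 = 0"
  "!!x. x : ball 0 rh ==> f x : ball 0 2" "!!x. x : ball 0 rh ==> e (f x) = ?ps x"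
  and D: "(f has_derivative D) (at 0)" "linear D"
   "!!v. FD ?ps 0 v = FD e 0 (D v)"
  and Dinv: "linear Dinv" "!!x. Dinv (D x) = x"
  by (rule patch_transition[OF ps1 z1 e z2 eq0]) blast
 have "continuous_on (ball 0 rh) f" by (rule smooth_continuous[OF f(1)])
 hence "isCont f 0" using rh(1) by (simp add: continuous_on_eq_continuous_at)
 hence "EX d>0. ALL x:ball 0 d. f x : ball 0 1"
  unfolding continuous_at_ball f(2) by (metis image_subset_iff zero_less_one)
 then obtain d where d: "d > 0" "!!x. x : ball 0 d ==> f x : ball 0 1" by blast
 have "D (axis 1 1) : x_axis"
 proof (rule derivative_along_x_axis[OF D(1), of "min d rh"])
  show "min d rh > 0" using d rh by simp
  fix q assume q: "q : x_axis" "q : ball 0 (min d rh)"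
  hence "cyclic q : ball 0 2" "cyclic q $ 1 = 0" "cyclic q $ 2 = 0" using rh(2) by (auto simp: x_axis_def mat3_nth)
  hence "?ps q : K" using ps(2) by blast
  hence "e (f q) : K" using f(4)[of q] q(2) by simp
  moreover have "f q : cball 0 1" using d(2)[of q] q(2) by simp
  ultimately show "f q : x_axis" using axis by (simp add: x_axis_def)
 qed
 hence Dc: "D (axis 1 1) = (D (axis 1 1) $ 1) *\<^sub>R axis 1 1" by (simp add: x_axis_def vec_eq_iff forall_3 axis_def)
 define c where "c = D (axis 1 1) $ 1"
 have c: "c ~= 0"
 proof
  assume "c = 0"
  hence "D (axis 1 1) = 0" using Dc unfolding c_def by simp
  hence "axis 1 1 = (0 :: real^3)" using Dinv(2)[of "axis 1 1"] linear_0[OF Dinv(1)] by simp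
  thus False by (simp add: axis_eq_0_iff)
 qed
 have bl: "bounded_linear cyclic" using linear_mat3 by (rule linear_conv_bounded_linear[THEN iffD1])
 have p0: "(ps has_derivative FD ps 0) (at (cyclic 0))"
  using patch_has_derivative[OF ps(1) z2] by (simp only: c0)
 have dd: "(?ps has_derivative (%v. FD ps 0 (cyclic v))) (at 0)"
  using diff_chain_at[OF bounded_linear_imp_has_derivative[OF bl] p0] by (simp only: o_def)
 have "FD ?ps 0 (axis 1 1) = FD ps 0 (cyclic (axis 1 1))"
  by (rule fun_cong[OF frechet_derivative_at[OF dd], of "axis 1 1", symmetric])
 moreover have "cyclic (axis 1 1) = axis 3 1" by (simp add: vec_eq_iff forall_3 mat3_nth axis_def)
 moreover have "FD e 0 (D (axis 1 1)) = c *\<^sub>R FD e 0 (axis 1 1)"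
  using linear_scale[OF patch_linear[OF e z2], of c "axis 1 1"] Dc unfolding c_def by simp
 ultimately have fin: "FD ps 0 (axis 3 1) = c *\<^sub>R FD e 0 (axis 1 1)"
  using D(3)[of "axis 1 1"] by simp
 show thesis
  by (rule that[OF ph(1) ps(1) ps0 _ _ c fin]) (use ps(2) eq in blast)+
qed

text \<open>A half-turn that reverses the third axis commutes with \<open>squaring\<close>, so it
  may be applied to both charts at once to make \<open>c\<close> positive.\<close>

lemma branch_charts:
 assumes e: "patch (ball 0 2) e"
  and axis: "!!q. q : cball 0 1 ==> e q : K \<longleftrightarrow> q $ 2 = 0 & q $ 3 = 0"
 obtains ph ps c where "patch (ball 0 2) ph" "patch (ball 0 2) ps" "ps 0 = e 0"
  "!!q. q : ball 0 2 ==> ps q : K \<longleftrightarrow> q $ 1 = 0 & q $ 2 = 0"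
  "!!q. q : ball 0 1 ==> p (ph q) = ps (squaring q)" "c > 0"
  "FD ps 0 (axis 3 1) = c *\<^sub>R FD e 0 (axis 1 1)"
proof -
 obtain ph ps c where *: "patch (ball 0 2) ph" "patch (ball 0 2) ps" "ps 0 = e 0"
  "!!q. q : ball 0 2 ==> ps q : K \<longleftrightarrow> q $ 1 = 0 & q $ 2 = 0"
  "!!q. q : ball 0 1 ==> p (ph q) = ps (squaring q)" "c ~= 0"
  "FD ps 0 (axis 3 1) = c *\<^sub>R FD e 0 (axis 1 1)" by (rule branch_charts_unsigned[OF e axis]) blast+
 show thesis
 proof (cases "c > 0")
  case True
  show ?thesis by (rule that[OF *(1-5) True *(7)])
 next
  case False
  let ?ph = "%q. ph (half_turn q)" and ?ps = "%q. ps (half_turn q)"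
  have b: "half_turn -` ball 0 2 = ball 0 2" by (auto simp: norm_half_turn)
  have h0: "half_turn 0 = 0" by (simp add: vec_eq_iff forall_3 mat3_nth)
  have ps: "patch (ball 0 2) ?ph" "patch (ball 0 2) ?ps" using patch_precompose_linear[OF *(1) linear_mat3 inj_half_turn det3_half_turn]
    patch_precompose_linear[OF *(2) linear_mat3 inj_half_turn det3_half_turn] by (simp_all only: b)
  have bl: "bounded_linear half_turn" using linear_mat3 by (rule linear_conv_bounded_linear[THEN iffD1])
  have z2: "(0::real^3) : ball 0 2" by simp
  have p0: "(ps has_derivative FD ps 0) (at (half_turn 0))" using patch_has_derivative[OF *(2) z2] by (simp only: h0)
  have dd: "(?ps has_derivative (%v. FD ps 0 (half_turn v))) (at 0)"
   using diff_chain_at[OF bounded_linear_imp_has_derivative[OF bl] p0] by (simp only: o_def)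
  have "FD ?ps 0 (axis 3 1) = FD ps 0 (half_turn (axis 3 1))" by (rule fun_cong[OF frechet_derivative_at[OF dd], of "axis 3 1", symmetric])
  moreover have "half_turn (axis 3 1) = (- 1) *\<^sub>R axis 3 1" by (simp add: vec_eq_iff forall_3 mat3_nth axis_def)
  ultimately have D: "FD ?ps 0 (axis 3 1) = (- c) *\<^sub>R FD e 0 (axis 1 1)"
   using linear_scale[OF patch_linear[OF *(2) z2], of "- 1" "axis 3 1"] *(7) by simp
  show ?thesis
  proof (rule that[OF ps _ _ _ _ D])
   show "ps (half_turn 0) = e 0" using *(3) h0 by simp
   show "ps (half_turn q) : K \<longleftrightarrow> q $ 1 = 0 & q $ 2 = 0" if "q : ball 0 2" for q
    using *(4)[of "half_turn q"] that by (simp add: norm_half_turn) (simp add: mat3_nth)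
   show "p (ph (half_turn q)) = ps (half_turn (squaring q))" if "q : ball 0 1" for q
   proof -
    have "half_turn (squaring q) = squaring (half_turn q)" by (simp add: vec_eq_iff forall_3 mat3_nth)
    thus ?thesis using *(5)[of "half_turn q"] that by (simp add: norm_half_turn)
   qed
   show "- c > 0" using False *(6) by simp
  qed
 qed
qed

text \<open>An isotopy keeping the axis realizes upper triangular linear parts with positive
  diagonal. The derivative of the transition is only block triangular; composing it with the
  conformal map \<open>m + i n\<close> of the normal plane makes it upper triangular. The conformal
  factor remains in the conclusion, to be absorbed by the squaring map.\<close>

lemma branch_alignment:
 assumes e: "patch (ball 0 2) e"
  and axis: "!!q. q : cball 0 1 ==> e q : K \<longleftrightarrow> q $ 2 = 0 & q $ 3 = 0" and de: "de > 0"
 obtains h ph ps m n ep where "moves (ball 0 de) x_axis h" "patch (ball 0 2) ph" "ep > 0" "m ~= 0 | n ~= 0"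
  "!!q. q : ball 0 1 ==> p (ph q) = ps (squaring q)"
  "!!q. q : ball 0 ep ==> e (h q) = ps (vector [m * q $ 2 - n * q $ 3, n * q $ 2 + m * q $ 3, q $ 1])"
proof -
 obtain ph ps c where ph: "patch (ball 0 2) ph" and ps: "patch (ball 0 2) ps" "ps 0 = e 0"
  "!!q. q : ball 0 2 ==> ps q : K \<longleftrightarrow> q $ 1 = 0 & q $ 2 = 0"
  and phps: "!!q. q : ball 0 1 ==> p (ph q) = ps (squaring q)" and c: "c > 0"
  "FD ps 0 (axis 3 1) = c *\<^sub>R FD e 0 (axis 1 1)" by (rule branch_charts[OF e axis]) blast+
 let ?ps = "%q. ps (cyclic q)"
 have ps1: "patch (cyclic -` ball 0 2) ?ps"
  by (rule patch_precompose_linear[OF ps(1) linear_mat3 inj_cyclic det3_cyclic])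
 have c0: "cyclic 0 = 0" by (simp add: vec_eq_iff forall_3 mat3_nth)
 have z1: "0 : cyclic -` ball 0 2" and z2: "(0::real^3) : ball 0 2" by (simp_all add: c0)
 have eq0: "?ps 0 = e 0" using ps(2) by (simp add: c0)
 obtain f rh D Dinv where rh: "rh > 0" "ball 0 rh \<subseteq> cyclic -` ball 0 2" and f: "smooth_on (ball 0 rh) f" "f 0 = 0"
  "!!x. x : ball 0 rh ==> f x : ball 0 2" "!!x. x : ball 0 rh ==> e (f x) = ?ps x"
  and D: "(f has_derivative D) (at 0)" "linear D" "det3 D > 0"
   "!!v. FD ?ps 0 v = FD e 0 (D v)"
  and Dinv: "linear Dinv" "!!x. Dinv (D x) = x" "!!x. D (Dinv x) = x"
  by (rule patch_transition[OF ps1 z1 e z2 eq0]) blast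
 have bl: "bounded_linear cyclic" using linear_mat3 by (rule linear_conv_bounded_linear[THEN iffD1])
 have p0: "(ps has_derivative FD ps 0) (at (cyclic 0))"
  using patch_has_derivative[OF ps(1) z2] by (simp only: c0)
 have dd: "(?ps has_derivative (%v. FD ps 0 (cyclic v))) (at 0)"
  using diff_chain_at[OF bounded_linear_imp_has_derivative[OF bl] p0] by (simp only: o_def)
 have "FD ?ps 0 (axis 1 1) = FD ps 0 (cyclic (axis 1 1))"
  by (rule fun_cong[OF frechet_derivative_at[OF dd], of "axis 1 1", symmetric])
 moreover have "cyclic (axis 1 1) = axis 3 1" by (simp add: vec_eq_iff forall_3 mat3_nth axis_def)
 ultimately have "FD e 0 (D (axis 1 1)) = FD e 0 (c *\<^sub>R axis 1 1)"
  using D(4)[of "axis 1 1"] c(2) linear_scale[OF patch_linear[OF e z2], of c "axis 1 1"] by simp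
 hence "FD e 0 (D (axis 1 1) - c *\<^sub>R axis 1 1) = 0"
  using linear_diff[OF patch_linear[OF e z2]] by simp
 hence Dc: "D (axis 1 1) = c *\<^sub>R axis 1 1" using patch_derivative_inj[OF e z2] by fastforce
 define a where "a j k = D (axis k 1) $ j" for j k
 have a1: "a 1 1 = c" "a 2 1 = 0" "a 3 1 = 0" unfolding a_def Dc by (simp_all add: axis_def)
 have Dmat: "D x = mat3 c (a 1 2) (a 1 3) 0 (a 2 2) (a 2 3) 0 (a 3 2) (a 3 3) x" for x
  using linear_eq_mat3[OF D(2), of x] a1 unfolding a_def by simp
 have det: "a 2 2 * a 3 3 - a 2 3 * a 3 2 > 0"
 proof -
  have "c * (a 2 2 * a 3 3 - a 3 2 * a 2 3) > 0" using D(3) a1 by (simp add: det3_def Let_def a_def[symmetric])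
  thus ?thesis using c(1) by (simp add: zero_less_mult_iff mult.commute)
 qed
 \<comment> \<open>With this choice the row \<open>(a 3 2, a 3 3)\<close> times the conformal matrix
   is \<open>(0, m^2 + n^2)\<close>, which is the entry below the diagonal that has to
   vanish.\<close>
 define m n where "m = a 3 3" and "n = - a 3 2"
 have mn: "m ~= 0 | n ~= 0" using det by (auto simp: m_def n_def)
 hence mn0: "m\<^sup>2 + n\<^sup>2 > 0" by (auto simp: sum_power2_gt_zero_iff)
 let ?M = "mat3 1 0 0 0 m (- n) 0 n m"
 define r where "r = inverse (m * m + n * n)"
 have "m * m + n * n ~= 0" using mn0 unfolding power2_eq_square by linarith
 hence r1: "(m * m + n * n) * r = 1" unfolding r_def by (rule right_inverse)
 let ?M' = "mat3 1 0 0 0 (m * r) (n * r) 0 (- n * r) (m * r)"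
 have MM': "?M (?M' x) = x" "?M' (?M x) = x" for x
 proof -
  have "m * (m * r * y + n * r * z) + (- n) * (- n * r * y + m * r * z) = ((m * m + n * n) * r) * y"
   "n * (m * r * y + n * r * z) + m * (- n * r * y + m * r * z) = ((m * m + n * n) * r) * z"
   "m * r * (m * y + (- n) * z) + n * r * (n * y + m * z) = ((m * m + n * n) * r) * y"
   "- n * r * (m * y + (- n) * z) + m * r * (n * y + m * z) = ((m * m + n * n) * r) * z" for y z by (simp_all add: algebra_simps)
  note * = this[unfolded r1 mult_1_left]
  show "?M (?M' x) = x" "?M' (?M x) = x" unfolding vec_eq_iff forall_3 mat3_nth using *[of "x $ 2" "x $ 3"] by simp_all
 qed
 have blM: "bounded_linear ?M" using linear_mat3 by (rule linear_conv_bounded_linear[THEN iffD1])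
 have M0: "?M 0 = 0" by (simp add: vec_eq_iff forall_3 mat3_nth)
 have "open (?M -` ball 0 rh)" by (intro open_vimage linear_continuous_on[OF blM] open_ball)
 then obtain rh' where rh': "rh' > 0" "ball 0 rh' \<subseteq> ?M -` ball 0 rh"
  using open_contains_ball[of "?M -` ball 0 rh"] M0 rh(1) by (metis centre_in_ball vimageI)
 have "isCont f 0" using smooth_continuous[OF f(1)] rh(1) by (simp add: continuous_on_eq_continuous_at)
 hence "isCont f (?M 0)" by (simp only: M0)
 hence "isCont (%x. f (?M x)) 0" by (rule isCont_o2[OF isCont_mat3])
 hence "EX d>0. ALL x:ball 0 d. f (?M x) : ball 0 1"
  unfolding continuous_at_ball M0 f(2) by (metis image_subset_iff zero_less_one)
 then obtain d where d: "d > 0" "!!x. x : ball 0 d ==> f (?M x) : ball 0 1" by blast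
 define rh2 where "rh2 = min d rh'"
 have rh2: "rh2 > 0" "ball 0 rh2 \<subseteq> ?M -` ball 0 rh" "!!x. x : ball 0 rh2 ==> f (?M x) : ball 0 1"
  using d rh' by (auto simp: rh2_def)
 have fM: "smooth_on (ball 0 rh2) (%x. f (?M x))"
  by (rule smooth_compose[OF smooth_linear[OF blM open_ball] f(1)]) (use rh2(2) in blast)
 have DM: "((%x. f (?M x)) has_derivative (%v. D (?M v))) (at 0)"
  using diff_chain_at[OF bounded_linear_imp_has_derivative[OF blM], of f D 0] D(1) by (simp add: o_def M0)
 have ok: "germ_ok x_axis (%v. D (?M v))"
 proof (rule germ_ok_cong)
  have "a 2 2 * m + a 2 3 * n > 0" using det by (simp add: m_def n_def)
  moreover have "m * m + n * n > 0" using mn0 by (simp add: power2_eq_square)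
  ultimately show "germ_ok x_axis (mat3 c (a 1 2 * m + a 1 3 * n) (- a 1 2 * n + a 1 3 * m) 0 (a 2 2 * m + a 2 3 * n)
    (- a 2 2 * n + a 2 3 * m) 0 0 (m * m + n * n))"
   using c(1) by (intro germ_ok_upper_triangular) auto
  show "mat3 c (a 1 2 * m + a 1 3 * n) (- a 1 2 * n + a 1 3 * m) 0 (a 2 2 * m + a 2 3 * n)
    (- a 2 2 * n + a 2 3 * m) 0 0 (m * m + n * n) x = D (?M x)" for x
   unfolding Dmat by (simp add: vec_eq_iff forall_3 mat3_nth m_def n_def algebra_simps)
 qed
 obtain h ep where h: "moves (ball 0 de) x_axis h" "ep > 0" "!!x. x : ball 0 ep ==> h x = f (?M x)"
 proof (rule germ_realization[OF fM rh2(1) _ DM ok _ _ _ subspace_x_axis _ _ de])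
  show "f (?M 0) = 0" by (simp add: M0 f(2))
  show "linear (%x. ?M' (Dinv x))" using linear_compose[OF Dinv(1) linear_mat3] by (simp add: o_def)
  show "?M' (Dinv (D (?M x))) = x" "D (?M (?M' (Dinv x))) = x" for x by (simp_all only: Dinv MM')
  fix q assume q: "q : x_axis"
  have "?M q = q" using q by (simp add: x_axis_def vec_eq_iff forall_3 mat3_nth)
  show "f (?M q) : x_axis" if "q : ball 0 rh2"
  proof -
   have qb: "?M q : ball 0 rh" using rh2(2) that by blast
   have "cyclic q : ball 0 2" using qb rh(2) \<open>?M q = q\<close> by force
   hence "?ps q : K" using ps(3) q by (simp add: x_axis_def mat3_nth)
   hence "e (f (?M q)) : K" using f(4)[OF qb] \<open>?M q = q\<close> by simp
   moreover have "f (?M q) : cball 0 1" using rh2(3)[OF that] by simp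
   ultimately show ?thesis using axis by (simp add: x_axis_def)
  qed
  have "D ((q $ 1 / c) *\<^sub>R axis 1 1) = (q $ 1) *\<^sub>R axis 1 1"
   using c(1) linear_scale[OF D(2), of "q $ 1 / c" "axis 1 1"] by (simp only: Dc scaleR_scaleR) simp
  moreover have "(q $ 1) *\<^sub>R axis 1 1 = q" using q by (simp add: x_axis_def vec_eq_iff forall_3 axis_def)
  ultimately have "q = D ((q $ 1 / c) *\<^sub>R axis 1 1)" by simp
  hence "Dinv q = (q $ 1 / c) *\<^sub>R axis 1 1" using Dinv(2) by metis
  thus "?M' (Dinv q) : x_axis" by (simp add: x_axis_def mat3_nth axis_def)
 qed (rule that)
 show thesis
 proof (rule that[OF h(1) ph _ mn phps, of "min ep rh2"])
  show "min ep rh2 > 0" using h(2) rh2(1) by simp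
  show "e (h q) = ps (vector [m * q $ 2 - n * q $ 3, n * q $ 2 + m * q $ 3, q $ 1])" if q: "q : ball 0 (min ep rh2)" for q
  proof -
   have "?M q : ball 0 rh" using rh2(2) q by force
   hence "e (f (?M q)) = ?ps (?M q)" by (rule f(4))
   moreover have "cyclic (?M q) = vector [m * q $ 2 - n * q $ 3, n * q $ 2 + m * q $ 3, q $ 1]" by (simp add: vec_eq_iff forall_3 mat3_nth)
   ultimately show ?thesis using h(3)[of q] q by simp
  qed
 qed
qed

end

section \<open>Squaring and conformal maps of the normal plane\<close>

lemma complex_square_root:
 obtains m n :: real where "m\<^sup>2 - n\<^sup>2 = s" "2 * m * n = t"
proof
 let ?z = "csqrt (Complex s t)"
 have "?z\<^sup>2 = Complex s t" by simp
 thus "(Re ?z)\<^sup>2 - (Im ?z)\<^sup>2 = s" "2 * Re ?z * Im ?z = t"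
  by (metis Re_power2 complex.sel(1)) (metis \<open>?z\<^sup>2 = Complex s t\<close> Im_power2 complex.sel(2))
qed

definition conformal :: "real => real => real \<times> real => real^3" where
 "conformal m n q = vector [m * fst q - n * snd q, n * fst q + m * snd q, 0]"

lemma linear_conformal: "linear (conformal m n)"
 by (rule linearI) (simp_all add: conformal_def vec_eq_iff forall_3 algebra_simps)

lemma conformal_inj:
 assumes "m ~= 0 | n ~= 0" "conformal m n q = 0"
 shows "q = 0"
proof -
 have 1: "m * fst q - n * snd q = 0" "n * fst q + m * snd q = 0" using assms(2) by (auto simp: conformal_def vec_eq_iff forall_3)
 have "(m\<^sup>2 + n\<^sup>2) * fst q = m * (m * fst q - n * snd q) + n * (n * fst q + m * snd q)"
  "(m\<^sup>2 + n\<^sup>2) * snd q = m * (n * fst q + m * snd q) - n * (m * fst q - n * snd q)"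
  by (simp_all add: power2_eq_square algebra_simps)
 hence z: "(m\<^sup>2 + n\<^sup>2) * fst q = 0" "(m\<^sup>2 + n\<^sup>2) * snd q = 0" unfolding 1 by simp_all
 have "m\<^sup>2 + n\<^sup>2 ~= 0" using assms(1) by (simp add: sum_power2_eq_zero_iff)
 hence "fst q = 0" "snd q = 0" using z by (metis mult_eq_0_iff)+
 thus ?thesis by (simp add: prod_eq_iff)
qed

text \<open>In complex notation the hypotheses say \<open>(m' + i n')^2 = i (m + i n) / 4\<close>,
  the factor \<open>i / 4\<close> being the one in \<open>sq_pt\<close>.\<close>

lemma squaring_conformal:
 assumes "m'\<^sup>2 - n'\<^sup>2 = - n / 4" "2 * m' * n' = m / 4"
 shows "squaring (conformal m' n' q) =
  vector [m * sq_pt q $ 2 - n * sq_pt q $ 3, n * sq_pt q $ 2 + m * sq_pt q $ 3, sq_pt q $ 1]"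
proof -
 obtain a b where q: "q = (a, b)" by (cases q)
 have n: "n = - 4 * (m'\<^sup>2 - n'\<^sup>2)" and m: "m = 8 * m' * n'" using assms by auto
 have "(m' * a - n' * b)\<^sup>2 - (n' * a + m' * b)\<^sup>2 = m * (- (a * b) / 2) - n * ((a\<^sup>2 - b\<^sup>2) / 4)"
  "2 * (m' * a - n' * b) * (n' * a + m' * b) = n * (- (a * b) / 2) + m * ((a\<^sup>2 - b\<^sup>2) / 4)"
  unfolding m n by (simp_all add: power2_eq_square field_simps)
 thus ?thesis by (simp add: conformal_def sq_pt_def q vec_eq_iff forall_3)
qed

lemma sq_pt_ball: "q : ball 0 2 ==> sq_pt q : ball 0 1"
proof -
 assume "q : ball 0 2"
 hence "(norm q)\<^sup>2 < 2\<^sup>2" by (intro power_strict_mono) auto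
 thus ?thesis by (simp add: norm_sq_pt)
qed

lemma sq_pt_derivative_inj:
 assumes "FD sq_pt q h = 0" "q ~= 0"
 shows "h = 0"
proof -
 obtain a b c d where q: "q = (a, b)" "h = (c, d)" by (cases q, cases h)
 have "vector [0, - (a * d + c * b) / 2, (a * c - b * d) / 2] = (0::real^3)"
  using assms(1) fun_cong[OF frechet_derivative_at[OF sq_pt_derivative[of q]], of h] by (simp add: q)
 hence 1: "a * d + c * b = 0" "a * c - b * d = 0" by (auto simp: vec_eq_iff forall_3)
 have "(a\<^sup>2 + b\<^sup>2) * c = a * (a * c - b * d) + b * (a * d + c * b)" "(a\<^sup>2 + b\<^sup>2) * d = a * (a * d + c * b) - b * (a * c - b * d)"
  by (simp_all add: power2_eq_square algebra_simps)
 hence z: "(a\<^sup>2 + b\<^sup>2) * c = 0" "(a\<^sup>2 + b\<^sup>2) * d = 0" unfolding 1 by simp_all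
 have "a\<^sup>2 + b\<^sup>2 ~= 0" using assms(2) by (auto simp: sum_power2_eq_zero_iff q zero_prod_def)
 hence "c = 0" "d = 0" using z by (metis mult_eq_0_iff)+
 thus ?thesis by (simp add: q zero_prod_def)
qed

lemma connected_punctured_disc: "connected (ball (0::real \<times> real) 2 - {0})"
proof (rule connected_punctured_convex[OF convex_ball])
 have "aff_dim (ball (0::real \<times> real) 2) = DIM(real \<times> real)" by (rule aff_dim_open) auto
 thus "aff_dim (ball (0::real \<times> real) 2) ~= 1" by simp
qed

context branched_cover
begin

text \<open>Lifting \<open>e \<circ> sq_pt\<close> from the punctured disc: near the puncture the branched cover gives a lift, which is
 carried outwards by the homotopy lifting property.\<close>

lemma band_disc:
 assumes e: "patch (ball 0 2) e"
  and axis: "!!q. q : cball 0 1 ==> e q : K \<longleftrightarrow> q $ 2 = 0 & q $ 3 = 0"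
  and ph: "patch (ball 0 2) ph" and mn: "m ~= 0 | n ~= 0" and ep: "ep > 0" "ep <= 2"
  and near: "!!q. q : ball 0 ep ==> conformal m n q : ball 0 2" "!!q. q : ball 0 ep ==> p (ph (conformal m n q)) = e (sq_pt q)"
 obtains G where "smooth_on (ball 0 2) G" "inj_on G (ball 0 2)" "G ` ball 0 2 \<subseteq> S3"
  "!!q v. q : ball 0 2 ==> FD G q v = 0 ==> v = 0"
  "!!q. q : ball 0 2 ==> p (G q) = e (sq_pt q)"
  "!!q x. q : ball 0 2 ==> q ~= 0 ==> x : S3 ==> p x = e (sq_pt q) ==> x = G q | x = G (- q)"
proof -
 let ?V = "ball (0::real \<times> real) 2 - {0}"
 let ?l = "conformal m n"
 have b12: "q : ball 0 2" if "q : ball (0::real^3) 1" for q using that by simp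
 have blL: "bounded_linear ?l" using linear_conformal by (rule linear_conv_bounded_linear[THEN iffD1])
 have V: "open ?V" by (intro open_delete open_ball)
 have eK: "e (sq_pt q) : S3 - K" if "q : ?V" for q
 proof -
  have 1: "sq_pt q : ball 0 1" using that by (intro sq_pt_ball) blast
  hence "sq_pt q : cball 0 1" by simp
  hence "e (sq_pt q) ~: K" using axis[of "sq_pt q"] sq_pt_axis_iff[of q] that by blast
  thus ?thesis using patch_S3[OF e b12[OF 1]] by blast
 qed
 have phX: "ph (?l q) : X" if "q : ball 0 ep" "q ~= 0" for q
 proof -
  have "q : ?V" using that ep(2) by auto
  hence "p (ph (?l q)) ~: K" using near(2)[OF that(1)] eK by simp
  thus ?thesis using in_X_iff patch_S3[OF ph near(1)[OF that(1)]] by blast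
 qed
 \<comment> \<open>Scaling by \<open>r\<close> brings the disc of radius 2 into the disc of radius
   \<open>ep / 2\<close>, where a lift is known.\<close>
 define r where "r = ep / 4"
 have r: "0 < r" "r < 1" using ep by (auto simp: r_def)
 let ?s = "%z::real \<times> real \<times> real. (1 - fst z) * r + fst z"
 have s: "0 < ?s z" "?s z <= 1" if "fst z : {0..1}" for z
 proof -
  have "?s z = r + fst z * (1 - r)" "?s z = 1 - (1 - fst z) * (1 - r)" by (simp_all add: algebra_simps)
  moreover have "fst z * (1 - r) >= 0" "(1 - fst z) * (1 - r) >= 0" using that r by simp_all
  ultimately show "0 < ?s z" "?s z <= 1" using r by linarith+
 qed
 have sV: "?s z *\<^sub>R snd z : ?V" if "z : {0..1} \<times> ?V" for z
 proof -
  have z: "fst z : {0..1}" "norm (snd z) < 2" "snd z ~= 0" using that by auto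
  have "norm (?s z *\<^sub>R snd z) <= norm (snd z)" using s[OF z(1)] by (simp add: mult_left_le_one_le)
  hence "?s z *\<^sub>R snd z : ball 0 2" unfolding mem_ball dist_0_norm using z(2) by (rule le_less_trans)
  moreover have "?s z *\<^sub>R snd z ~= 0" using z(3) s(1)[OF z(1)] by simp
  ultimately show ?thesis by blast
 qed
 have rq: "r *\<^sub>R q : ball 0 ep" "r *\<^sub>R q ~= 0" if "q : ?V" for q
 proof -
  have "norm (r *\<^sub>R q) < r * 2" using that r by simp
  thus "r *\<^sub>R q : ball 0 ep" using ep by (simp add: r_def)
  show "r *\<^sub>R q ~= 0" using that r by auto
 qed
 have contE: "continuous_on ?V (%q. e (sq_pt q))"
  by (rule continuous_on_compose2[OF smooth_continuous[OF patch_smooth[OF e]] continuous_on_subset[OF smooth_continuous[OF smooth_sq_pt] subset_UNIV]])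
   (use sq_pt_ball b12 in blast)
 have contph: "continuous_on (ball 0 ep) (%q. ph (?l q))"
  by (rule continuous_on_compose2[OF smooth_continuous[OF patch_smooth[OF ph]] linear_continuous_on[OF blL]]) (use near(1) in blast)
 have conts: "continuous_on ({0..1} \<times> ?V) (%z. ?s z *\<^sub>R snd z)" by (intro continuous_intros)
 have conth: "continuous_on ({0..1} \<times> ?V) (%z. e (sq_pt (?s z *\<^sub>R snd z)))"
  by (rule continuous_on_compose2[OF contE conts], rule image_subsetI, rule sV)
 have himg: "(%z. e (sq_pt (?s z *\<^sub>R snd z))) : ({0..1} \<times> ?V) \<rightarrow> S3 - K" by (intro funcsetI eK sV)
 have heq: "e (sq_pt (?s (0, q) *\<^sub>R snd (0::real, q))) = p (ph (?l (r *\<^sub>R q)))" if "q : ?V" for q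
  using near(2)[OF rq(1)[OF that]] by simp
 have contf: "continuous_on ?V (%q. ph (?l (r *\<^sub>R q)))"
  by (rule continuous_on_compose2[OF contph], intro continuous_intros, rule image_subsetI, rule rq(1))
 have fimg: "(%q. ph (?l (r *\<^sub>R q))) : ?V \<rightarrow> X" by (intro funcsetI phX rq)
 obtain k where k: "continuous_on ({0..1} \<times> ?V) k" "k : ({0..1} \<times> ?V) \<rightarrow> X" "!!q. q : ?V ==> k (0, q) = ph (?l (r *\<^sub>R q))"
  "!!z. z : {0..1} \<times> ?V ==> e (sq_pt (?s z *\<^sub>R snd z)) = p (k z)"
 proof (rule covering_space_lift_homotopy[OF covering conth himg heq contf fimg])
 qed (assumption | rule that)+
 \<comment> \<open>The end of the lifted homotopy; at the puncture the value is supplied by the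
   chart of the cover.\<close>
 define G where "G q = (if q = 0 then ph 0 else k (1, q))" for q
 have l0: "?l 0 = 0" by (rule linear_0[OF linear_conformal])
 have Gnear: "G q = ph (?l q)" if q: "q : ball 0 ep" for q
 proof (cases "q = 0")
  case False
  have qV: "q : ?V" using q False ep(2) by auto
  let ?c = "%t. ?s (t, q) *\<^sub>R q"
  have tV: "(t, q) : {0..1} \<times> ?V" if "t : {0..1}" for t using that qV by blast
  have cep: "?c t : ball 0 ep" "?c t ~= 0" if t: "t : {0..1}" for t
  proof -
   have "norm (?c t) <= norm q" using s[of "(t, q)"] t by (simp add: mult_left_le_one_le)
   thus "?c t : ball 0 ep" using q by simp
   show "?c t ~= 0" using sV[OF tV[OF t]] by simp
  qed
  have contc: "continuous_on {0..1} ?c" by (intro continuous_intros)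
  have cV: "?c t : ?V" if "t : {0..1}" for t using sV[OF tV[OF that]] by (simp only: fst_conv snd_conv)
  \<comment> \<open>Both sides are ends of lifts of the same radial path with the same start. Hence
    \<open>G\<close> is the chart of the cover near 0, and therefore smooth there.\<close>
  have "k (1, q) = ph (?l (?c 1))"
  proof (rule lift_unique[of "{0..1::real}" "%t. e (sq_pt (?c t))" "%t. k (t, q)" "%t. ph (?l (?c t))" 0])
   show "continuous_on {0..1} (%t. e (sq_pt (?c t)))" by (rule continuous_on_compose2[OF contE contc], rule image_subsetI, rule cV)
   show "(%t. e (sq_pt (?c t))) ` {0..1} \<subseteq> S3 - K" by (intro image_subsetI eK cV)
   show "continuous_on {0..1} (%t. k (t, q))"
    by (rule continuous_on_compose2[OF k(1)], intro continuous_intros, rule image_subsetI, rule tV)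
   show "(%t. k (t, q)) ` {0..1} \<subseteq> X" using k(2) tV by blast
   show "p (k (t, q)) = e (sq_pt (?c t))" if "t : {0..1}" for t using k(4)[OF tV[OF that]] by simp
   show "continuous_on {0..1} (%t. ph (?l (?c t)))" by (rule continuous_on_compose2[OF contph contc]) (use cep(1) in blast)
   show "(%t. ph (?l (?c t))) ` {0..1} \<subseteq> X" by (intro image_subsetI phX cep)
   show "p (ph (?l (?c t))) = e (sq_pt (?c t))" if "t : {0..1}" for t using near(2)[OF cep(1)[OF that]] .
   show "k (0, q) = ph (?l (?c 0))" using k(3)[OF qV] by simp
  qed auto
  thus ?thesis using False by (simp add: G_def)
 qed (simp add: G_def l0)
 have GX: "G q : X" and pG: "p (G q) = e (sq_pt q)" if "q : ?V" for q
 proof -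
  have z: "(1::real, q) : {0..1} \<times> ?V" "G q = k (1, q)" using that by (auto simp: G_def)
  show "G q : X" using k(2) z by auto
  show "p (G q) = e (sq_pt q)" using k(4)[OF z(1)] z(2) by simp
 qed
 have pG': "p (G q) = e (sq_pt q)" if "q : ball 0 2" for q
 proof (cases "q = 0")
  case True
  thus ?thesis using near(2)[of 0] ep(1) by (simp add: G_def l0)
 qed (use pG that in blast)
 have GV: "continuous_on ?V G"
 proof (rule continuous_on_eq)
  show "continuous_on ?V (%q. k (1, q))" by (rule continuous_on_compose2[OF k(1)]) (auto intro!: continuous_intros)
 qed (auto simp: G_def)
 have GimV: "G ` ?V \<subseteq> X" using GX by blast
 have Es: "smooth_on ?V (%q. e (sq_pt q))"
  by (rule smooth_compose[OF smooth_subset[OF smooth_sq_pt V subset_UNIV] patch_smooth[OF e]]) (use sq_pt_ball b12 in blast)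
 have s1: "smooth_on ?V G" by (rule lift_smooth(1)[OF GV GimV pG Es])
 have s2: "smooth_on (ball 0 ep) (%q. ph (?l q))"
  by (rule smooth_compose[OF smooth_linear[OF blL open_ball] patch_smooth[OF ph]]) (use near(1) in blast)
 have s3: "smooth_on (ball 0 ep) G" by (rule smooth_cong[OF s2 Gnear[symmetric]])
 have "ball 0 2 = ?V Un ball 0 ep" using ep by auto
 hence Gs: "smooth_on (ball 0 2) G" using smooth_on_Un[OF s1 s3] by simp
 have GS: "G ` ball 0 2 \<subseteq> S3"
 proof (rule image_subsetI)
  fix q :: "real \<times> real" assume "q : ball 0 2"
  thus "G q : S3" using GX[of q] X_S3 patch_S3[OF ph, of 0] by (cases "q = 0") (auto simp: G_def)
 qed
 have mV: "- q : ?V" if "q : ?V" for q using that by simp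
 \<comment> \<open>\<open>G\<close> and its composite with the point reflection lift the same map.
   If they met once they would agree on the whole punctured disc, against the injectivity of the
   chart near 0.\<close>
 have neq: "G q ~= G (- q)" if q: "q : ?V" for q
 proof
  assume eq: "G q = G (- q)"
  let ?q0 = "(ep / 2, 0) :: real \<times> real"
  have q0: "?q0 : ?V" "?q0 : ball 0 ep" "- ?q0 : ball 0 ep"
  proof -
   have n0: "norm ?q0 = ep / 2" using ep by (simp add: norm_Pair)
   thus "?q0 : ball 0 ep" "- ?q0 : ball 0 ep" unfolding mem_ball dist_0_norm norm_minus_cancel using ep by simp_all
   have "?q0 ~= 0" using n0 ep(1) by (metis half_gt_zero less_irrefl norm_zero)
   moreover have "?q0 : ball 0 2" unfolding mem_ball dist_0_norm n0 using ep by simp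
   ultimately show "?q0 : ?V" by blast
  qed
  have "G ?q0 = G (- ?q0)"
  proof (rule lift_unique[of ?V "%q. e (sq_pt q)" G "%q. G (- q)" q])
   show "(%q. e (sq_pt q)) ` ?V \<subseteq> S3 - K" using eK by blast
   show "continuous_on ?V (%q. G (- q))" by (rule continuous_on_compose2[OF GV], intro continuous_intros, rule image_subsetI, rule mV)
   show "(%q. G (- q)) ` ?V \<subseteq> X" by (intro image_subsetI GX mV)
   show "p (G (- q)) = e (sq_pt q)" if "q : ?V" for q using pG[OF mV[OF that]] by (simp add: sq_pt_uminus)
  qed (fact connected_punctured_disc contE GV GimV pG q eq q0(1))+
  hence "ph (?l ?q0) = ph (?l (- ?q0))" using Gnear q0 by simp
  hence "?l ?q0 = ?l (- ?q0)" using inj_onD[OF patch_inj[OF ph]] near(1) q0 by blast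
  hence "?l (?q0 - (- ?q0)) = 0" using linear_diff[OF linear_conformal] by (metis right_minus_eq)
  hence "?q0 - (- ?q0) = 0" by (rule conformal_inj[OF mn])
  thus False using ep(1) by (simp add: zero_prod_def)
 qed
 show thesis
 proof (rule that[OF Gs _ GS _ pG'])
  show "inj_on G (ball 0 2)"
  proof (rule inj_onI)
   fix q q' assume q: "q : ball 0 2" "q' : ball 0 2" and eq: "G q = G q'"
   hence "e (sq_pt q) = e (sq_pt q')" using pG' by metis
   hence "sq_pt q = sq_pt q'" using inj_onD[OF patch_inj[OF e]] sq_pt_ball[OF q(1)] sq_pt_ball[OF q(2)] b12 by blast
   hence "q = q' | q = - q'" by (simp only: sq_pt_eq_iff)
   thus "q = q'"
   proof
    assume m: "q = - q'"
    show ?thesis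
    proof (cases "q' = 0")
     case False
     hence "q' : ?V" using q by blast
     thus ?thesis using neq[of q'] eq m by simp
    qed (use m in simp)
   qed
  qed
  show "v = 0" if q: "q : ball 0 2" and z: "FD G q v = 0" for q v
  proof (cases "q = 0")
   case True
   have 0: "?l 0 : ball 0 2" by (simp add: l0)
   have "((%q. ph (?l q)) has_derivative (%v. FD ph (?l 0) (?l v))) (at 0)"
    using diff_chain_at[OF bounded_linear_imp_has_derivative[OF blL] patch_has_derivative[OF ph 0]] by (simp only: o_def)
   hence d: "(G has_derivative (%v. FD ph (?l 0) (?l v))) (at 0)"
    by (rule has_derivative_transform_within_open[OF _ open_ball[of 0 ep]]) (use ep(1) Gnear in auto)
   have "FD ph (?l 0) (?l v) = 0" using fun_cong[OF frechet_derivative_at[OF d], of v] z True by simp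
   hence "?l v = 0" by (rule patch_derivative_inj[OF ph 0])
   thus ?thesis by (rule conformal_inj[OF mn])
  next
   case False
   hence qV: "q : ?V" using q by blast
   have sB: "sq_pt q : ball 0 2" using sq_pt_ball[OF q] b12 by blast
   have "((%q. e (sq_pt q)) has_derivative (%v. FD e (sq_pt q) (FD sq_pt q v))) (at q)"
    using diff_chain_at[OF smooth_has_derivative[OF smooth_sq_pt UNIV_I] patch_has_derivative[OF e sB]] by (simp only: o_def)
   from fun_cong[OF frechet_derivative_at[OF this], of v]
   have "FD e (sq_pt q) (FD sq_pt q v) = dS p (G q) (FD G q v)" using lift_smooth(2)[OF GV GimV pG Es qV, of v] by simp
   also have "\<dots> = 0" unfolding z by (rule linear_0[OF dS_linear[OF smooth_p GX[OF qV]]])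
   finally have "FD sq_pt q v = 0" by (rule patch_derivative_inj[OF e sB])
   thus ?thesis using False by (rule sq_pt_derivative_inj)
  qed
  show "x = G q | x = G (- q)" if q: "q : ball 0 2" "q ~= 0" and x: "x : S3" "p x = e (sq_pt q)" for q x
  proof -
   have qV: "q : ?V" using q by blast
   obtain a b where ab: "!!x. x : S3 ==> p x = e (sq_pt q) ==> x = a | x = b" by (rule fiber[OF eK[OF qV]]) blast
   have "G q : S3" "G (- q) : S3" "p (G (- q)) = e (sq_pt q)"
    using GX[OF qV] GX[OF mV[OF qV]] X_S3 pG[OF mV[OF qV]] by (auto simp: sq_pt_uminus)
   hence "G q = a | G q = b" "G (- q) = a | G (- q) = b" using ab pG[OF qV] by blast+
   thus ?thesis using ab[OF x] neq[OF qV] by metis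
  qed
 qed
qed

end

section \<open>From a crossing with the branching set to a band sum\<close>

lemma oriented_link_isotopic:
 assumes "isotopic A A'" "oriented_link A" "A \<subseteq> UT"
 shows "oriented_link A'"
proof -
 obtain h where h: "iso_end h" "A' = tangent_map h ` A" using assms(1) isotopic_iff[OF assms(3)] by blast
 have d: "diffeo_S3 h" by (rule iso_end_diffeo[OF h(1)])
 obtain F where F: "finite F" "ALL k:F. oriented_knot k" "disjoint_family_on carrier F" "A = \<Union>F"
  using assms(2) unfolding oriented_link_def by blast
 let ?F = "(%k. tangent_map h ` k) ` F"
 have "disjoint_family_on carrier ?F"
  unfolding disjoint_family_on_def
 proof (intro ballI impI)
  fix a b assume "a : ?F" "b : ?F" and ne: "a ~= b"
  then obtain k l where kl: "k : F" "l : F" "a = tangent_map h ` k" "b = tangent_map h ` l" by blast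
  hence "carrier k Int carrier l = {}" using F(3) ne unfolding disjoint_family_on_def by blast
  moreover have "carrier k \<subseteq> S3" "carrier l \<subseteq> S3" using oriented_knot_carrier(3) F(2) kl by blast+
  ultimately have "h ` carrier k Int h ` carrier l = {}" using inj_on_image_Int[OF diffeo_S3D(7)[OF d]] by (metis image_empty)
  thus "carrier a Int carrier b = {}" unfolding kl carrier_tangent_map .
 qed
 moreover have "ALL k:?F. oriented_knot k" using oriented_knot_image[OF d] F(2) by blast
 moreover have "A' = \<Union>?F" unfolding h(2) F(4) by blast
 ultimately show ?thesis unfolding oriented_link_def using F(1) by blast
qed

text \<open>The slit contains the axis and everything in the plane \<open>q $ 2 = 0\<close> on the
  side away from \<open>sg\<close>. What is left misses the branching set and contains the moving
  part of every strand that passes the axis on the side \<open>sg\<close>.\<close>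

definition slit_ball :: "real => (real^3) set" where
 "slit_ball sg = {q : ball 0 1. ~ (q $ 2 = 0 & sg * q $ 3 <= 0)}"

lemma open_slit_ball: "open (slit_ball sg)"
proof -
 have "closed {q::real^3. q $ 2 = 0 & sg * q $ 3 <= 0}"
  by (intro closed_Collect_conj closed_Collect_eq closed_Collect_le continuous_intros)
 moreover have "slit_ball sg = ball 0 1 - {q. q $ 2 = 0 & sg * q $ 3 <= 0}" by (auto simp: slit_ball_def)
 ultimately show ?thesis by (simp add: open_Diff)
qed

text \<open>The set is star-shaped about the point at height \<open>sg / 2\<close>: a segment from
  there reaches the slit only if its other end lies in the slit.\<close>

lemma simply_connected_slit_ball:
 assumes "\<bar>sg\<bar> = 1"
 shows "simply_connected (slit_ball sg)" "slit_ball sg ~= {}"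
proof -
 let ?a = "vector [0, 0, sg / 2] :: real^3"
 have sg: "sg * sg = 1" using assms by (metis abs_mult_self_eq mult_1)
 have a: "?a : slit_ball sg" using assms sg by (simp add: slit_ball_def norm_vector_3 abs_if split: if_splits)
 thus "slit_ball sg ~= {}" by blast
 have "closed_segment ?a q \<subseteq> slit_ball sg" if q: "q : slit_ball sg" for q
 proof
  fix x assume x: "x : closed_segment ?a q"
  then obtain u where u: "0 <= u" "u <= 1" "x = (1 - u) *\<^sub>R ?a + u *\<^sub>R q" by (auto simp: closed_segment_def)
  have "x : ball 0 1" using x a q closed_segment_subset[OF _ _ convex_ball, of ?a 0 1 q] by (auto simp: slit_ball_def)
  moreover have "~ (x $ 2 = 0 & sg * x $ 3 <= 0)"
  proof
   assume z: "x $ 2 = 0 & sg * x $ 3 <= 0"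
   have "x $ 2 = u * q $ 2" "x $ 3 = (1 - u) * (sg / 2) + u * q $ 3" by (simp_all add: u(3))
   hence "u * q $ 2 = 0" "sg * ((1 - u) * (sg / 2) + u * q $ 3) <= 0" using z by simp_all
   moreover have "sg * ((1 - u) * (sg / 2) + u * q $ 3) = (1 - u) * (sg * sg) / 2 + u * (sg * q $ 3)" by (simp add: algebra_simps)
   ultimately have x23: "u * q $ 2 = 0" "(1 - u) * (sg * sg) / 2 + u * (sg * q $ 3) <= 0" by simp_all
   show False
   proof (cases "u = 0")
    case False
    hence "q $ 2 = 0" using x23(1) by simp
    hence "sg * q $ 3 > 0" using q by (auto simp: slit_ball_def)
    hence "u * (sg * q $ 3) > 0" using False u(1) by simp
    moreover have "(1 - u) * (sg * sg) / 2 >= 0" using u(2) sg by simp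
    ultimately show False using x23(2) by (metis add_nonneg_pos not_less)
   qed (use x23(2) sg in simp)
  qed
  ultimately show "x : slit_ball sg" by (simp add: slit_ball_def)
 qed
 hence "starlike (slit_ball sg)" using a unfolding starlike_def by blast
 thus "simply_connected (slit_ball sg)" by (rule starlike_imp_simply_connected)
qed

text \<open>The model strands keep a positive distance from the origin because
  \<open>hyp_graph 0 > 0\<close>. The alignment with the cover takes place within that distance and
  leaves them fixed.\<close>

lemma hyp_graph_away:
 obtains de where "de > 0" "de <= 1" "!!y. graph_pt hyp_graph y ~: ball 0 de" "!!y. graph_pt (%y. - hyp_graph y) y ~: ball 0 de"
proof -
 have s: "smooth_on UNIV (graph_pt hyp_graph)" by (rule smooth_graph_pt[OF small_bumpD(1)[OF small_bump_hyp_graph]])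
 have c: "continuous_on {-1..1} (%y. norm (graph_pt hyp_graph y))"
  by (rule continuous_on_norm[OF continuous_on_subset[OF smooth_continuous[OF s] subset_UNIV]])
 have "EX y0:{-1..1}. ALL y:{-1..1}. norm (graph_pt hyp_graph y0) <= norm (graph_pt hyp_graph y)"
  by (rule continuous_attains_inf[OF compact_Icc _ c]) auto
 then obtain y0 where y0: "!!y. y : {-1..1} ==> norm (graph_pt hyp_graph y0) <= norm (graph_pt hyp_graph y)" by blast
 have "graph_pt hyp_graph y0 ~= 0" using hyp_graph_0 by (cases "y0 = 0") (auto simp: vec_eq_iff forall_3)
 define de where "de = min 1 (norm (graph_pt hyp_graph y0))"
 have de: "de > 0" "de <= 1" using \<open>graph_pt hyp_graph y0 ~= 0\<close> by (auto simp: de_def)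
 have far: "de <= norm (graph_pt hyp_graph y)" for y
 proof (cases "y : {-1..1}")
  case True thus ?thesis using y0 by (auto simp: de_def intro: min.coboundedI2)
 next
  case False
  have "\<bar>y\<bar> <= norm (graph_pt hyp_graph y)" using component_le_norm_cart[of "graph_pt hyp_graph y" 2] by simp
  thus ?thesis using False de(2) by (auto simp: abs_if split: if_splits)
 qed
 have "norm (graph_pt (%y. - hyp_graph y) y) = norm (graph_pt hyp_graph y)" for y by (simp add: norm_vector_3)
 thus thesis using that[OF de] far by (auto simp: not_less)
qed

lemma strand_move:
 assumes e: "patch (ball 0 2) e" and U: "open U" "U \<subseteq> ball 0 2" and m: "moves U V m"
  and g: "small_bump g" "!!y. graph_pt g y ~: U"
 shows "strand (%q. push U e m (e q)) g = strand e g"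
 unfolding strand_def
proof -
 have W: "cball (0::real^3) 1 \<subseteq> ball 0 2" by auto
 obtain J where J: "open J" "{-1..1} \<subseteq> J" "graph_pt g ` J \<subseteq> ball 0 2"
  by (rule chart_curve[OF e graph_pt_curve[OF e g(1) W]]) blast
 obtain k where k: "compact_diffeo U m k" by (rule moves_compact_diffeo[OF m])
 show "directed_arc (%y. push U e m (e (graph_pt g y))) {-1..1} = directed_arc (%y. e (graph_pt g y)) {-1..1}"
 proof (rule directed_arc_cong[OF J(1,2)])
  fix y assume "y : J"
  hence "graph_pt g y : ball 0 2" using J(3) by blast
  hence "push U e m (e (graph_pt g y)) = e (m (graph_pt g y))"
   using push_larger_patch[OF e U(2) compact_diffeo_outside[OF k], of "graph_pt g y"] by blast
  thus "push U e m (e (graph_pt g y)) = e (graph_pt g y)" using compact_diffeo_outside[OF k g(2)] by simp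
 qed
qed

context branched_cover
begin

text \<open>Strands passing the axis on the same side are deformed into each other inside the slit
  ball, which is simply connected and misses the branching set, so the deformation lifts.\<close>

lemma lift_replace_strand:
 assumes e: "patch (ball 0 2) e"
  and axis: "!!q. q : cball 0 1 ==> e q : K \<longleftrightarrow> q $ 2 = 0 & q $ 3 = 0"
  and g: "small_bump g" "small_bump g'" and sg: "\<bar>sg\<bar> = 1" "sg * g 0 > 0" "sg * g' 0 > 0"
  and A: "A \<subseteq> UT" "carrier A Int e ` cball 0 1 = {}" "carrier A Int K = {}"
 shows "isotopic (preimage_curve p (A Un strand e g)) (preimage_curve p (A Un strand e g'))"
proof -
 let ?U = "slit_ball sg"
 have U1: "?U \<subseteq> ball 0 1" by (auto simp: slit_ball_def)
 have U2: "?U \<subseteq> ball 0 2" using U1 by auto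
 have eU: "patch ?U e" by (rule patch_subset[OF e open_slit_ball U2])
 have UK: "e ` ?U Int K = {}" using axis by (auto simp: slit_ball_def)
 have C: "vector [0, y, (1 - s) * g y + s * g' y] : ?U" if ys: "\<bar>y\<bar> <= 1/2" "0 <= s" "s <= 1" for y s
 proof -
  have "vector [0, y, (1 - s) * g y + s * g' y] : ball (0::real^3) 1" by (rule small_bump_segment[OF g ys])
  moreover have "sg * ((1 - s) * g y + s * g' y) > 0" if "y = 0"
  proof -
   have "(1 - s) * (sg * g 0) + s * (sg * g' 0) > 0" using sg(2,3) ys(2,3) by (cases "s = 0") (auto intro: add_nonneg_pos)
   thus ?thesis using that by (simp add: algebra_simps)
  qed
  ultimately show ?thesis by (auto simp: slit_ball_def)
 qed
 obtain m where m: "moves ?U UNIV m" "!!y. m (graph_pt g y) = graph_pt g' y"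
 proof (rule graph_push[OF open_slit_ball g])
  show "vector [0, y, (1 - s) * g y + s * g' y] : ?U" if "\<bar>y\<bar> <= 1/2" "0 <= s" "s <= 1" for y s using that by (rule C)
 qed (rule that)
 have eB: "fst a : e ` cball 0 1" if "a : strand e g" for a using carrier_strand_subset[OF g(1), of e] that by blast
 have A1: "A Un strand e g \<subseteq> UT" using A(1) strand_UT[OF e g(1)] by blast
 have out: "{a : A. fst a : e ` cball 0 1} = {}" "{a : A. fst a ~: e ` cball 0 1} = A" using A(2) by blast+
 have A2: "{a : A Un strand e g. fst a : e ` cball 0 1} = strand e g" using out(1) eB by blast
 have "carrier (strand e g) Int K = {}"
 proof -
  have "e (graph_pt g y) ~: K" if "y : {-1..1}" for y
  proof
   assume "e (graph_pt g y) : K"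
   hence "y = 0" "g y = 0" using axis[OF graph_pt_in_cball[OF g(1) that]] by auto
   thus False using sg(2) by simp
  qed
  thus ?thesis unfolding carrier_strand by blast
 qed
 hence A3: "carrier (A Un strand e g) Int K = {}" using A(3) by blast
 have "tangent_map (push ?U e m) ` (A Un strand e g) = {a : A Un strand e g. fst a ~: e ` cball 0 1} Un strand e g'"
  by (rule push_replace_strand[OF e open_slit_ball U1 m(1) g(1) m(2) A1 A2])
 also have "{a : A Un strand e g. fst a ~: e ` cball 0 1} = A" using out(2) eB by blast
 finally show ?thesis
  using lift_push[OF eU simply_connected_slit_ball[OF sg(1)] UK m(1) A3 A1] by simp
qed

text \<open>Both strands are replaced by model graphs on their own sides of the axis. The chart is
  then aligned with the cover near the origin, where the model strands do not pass, and the exact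
  computation of the band applies.\<close>

lemma band_step_positive:
 assumes e: "patch (ball 0 2) e"
  and axis: "!!q. q : cball 0 1 ==> e q : K \<longleftrightarrow> q $ 2 = 0 & q $ 3 = 0"
  and g: "small_bump g" "g 0 > 0"
  and A: "A \<subseteq> UT" "carrier A Int e ` cball 0 1 = {}" "carrier A Int K = {}"
  and link: "oriented_link (preimage_curve p (A Un strand e (%y. - g y)))"
 obtains J\<^sub>1 J\<^sub>2 where "isotopic (preimage_curve p (A Un strand e g)) J\<^sub>1" "internal_band_sum J\<^sub>1 J\<^sub>2"
  "isotopic J\<^sub>2 (preimage_curve p (A Un strand e (%y. - g y)))"
proof -
 let ?P = "preimage_curve p"
 note hg = small_bump_hyp_graph
 have g': "small_bump (%y. - g y)" and hg': "small_bump (%y. - hyp_graph y)" using small_bump_uminus g(1) hg by blast+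
 have I1: "isotopic (?P (A Un strand e g)) (?P (A Un strand e hyp_graph))"
  by (rule lift_replace_strand[where sg = 1, OF e axis g(1) hg _ _ _ A]) (use g(2) hyp_graph_0 in auto)
 have I2: "isotopic (?P (A Un strand e (%y. - hyp_graph y))) (?P (A Un strand e (%y. - g y)))"
  by (rule lift_replace_strand[where sg = "- 1", OF e axis hg' g' _ _ _ A]) (use g(2) hyp_graph_0 in auto)
 have I3: "isotopic (?P (A Un strand e (%y. - g y))) (?P (A Un strand e (%y. - hyp_graph y)))"
  by (rule lift_replace_strand[where sg = "- 1", OF e axis g' hg' _ _ _ A]) (use g(2) hyp_graph_0 in auto)
 have link': "oriented_link (?P (A Un strand e (%y. - hyp_graph y)))"
  by (rule oriented_link_isotopic[OF I3 link preimage_curve_UT])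
 obtain de where de: "de > 0" "de <= 1" "!!y. graph_pt hyp_graph y ~: ball 0 de" "!!y. graph_pt (%y. - hyp_graph y) y ~: ball 0 de"
  by (rule hyp_graph_away) blast
 obtain h ph ps m n ep where h: "moves (ball 0 de) x_axis h" and ph: "patch (ball 0 2) ph" and ep: "ep > 0" and mn: "m ~= 0 | n ~= 0"
  and pph: "!!q. q : ball 0 1 ==> p (ph q) = ps (squaring q)"
  and eh: "!!q. q : ball 0 ep ==> e (h q) = ps (vector [m * q $ 2 - n * q $ 3, n * q $ 2 + m * q $ 3, q $ 1])"
  by (rule branch_alignment[OF e axis de(1)]) blast+
 have D2: "ball (0::real^3) de \<subseteq> ball 0 2" and D1: "ball (0::real^3) de \<subseteq> cball 0 1" using de by auto
 have eD: "patch (ball 0 de) e" by (rule patch_subset[OF e open_ball D2])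
 obtain k where k: "compact_diffeo (ball 0 de) h k" by (rule moves_compact_diffeo[OF h])
 let ?e = "%q. push (ball 0 de) e h (e q)"
 have e': "patch (ball 0 2) ?e" by (rule patch_iso_end[OF iso_end_push[OF eD h] e])
 have eh': "?e q = e (h q)" if "q : ball 0 2" for q
  by (rule push_larger_patch[OF e D2 compact_diffeo_outside[OF k] that])
 have hB: "h q : cball 0 1" "k q : cball 0 1" if "q : cball 0 1" for q
  using that compact_diffeo_image[OF k, of q] compact_diffeo_outside[OF k, of q]
   compact_diffeo_image[OF compact_diffeo_sym[OF k], of q] compact_diffeo_outside[OF compact_diffeo_sym[OF k], of q] D1
  by (cases "q : ball 0 de"; metis subsetD)+
 have c2: "q : ball 0 2" if "q : cball (0::real^3) 1" for q using that by auto
 have axis': "?e q : K \<longleftrightarrow> q $ 2 = 0 & q $ 3 = 0" if q: "q : cball 0 1" for q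
  using axis[OF hB(1)[OF q]] moves_preserve[OF h subspace_x_axis, of q] unfolding eh'[OF c2[OF q]] by (simp add: x_axis_def)
 have img: "?e ` cball 0 1 \<subseteq> e ` cball 0 1" using eh' hB(1) c2 by auto
 have A': "carrier A Int ?e ` cball 0 1 = {}" using A(2) img by blast
 have st: "strand ?e hyp_graph = strand e hyp_graph" "strand ?e (%y. - hyp_graph y) = strand e (%y. - hyp_graph y)"
  by (rule strand_move[OF e open_ball D2 h hg de(3)], rule strand_move[OF e open_ball D2 h hg' de(4)])
 \<comment> \<open>A square root of \<open>i (m + i n) / 4\<close>, which absorbs the conformal
   factor left by the alignment.\<close>
 obtain m' n' where mn': "m'\<^sup>2 - n'\<^sup>2 = - n / 4" "2 * m' * n' = m / 4" by (rule complex_square_root)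
 have mn0: "m' ~= 0 | n' ~= 0" using mn mn' by auto
 have blL: "bounded_linear (conformal m' n')" using linear_conformal by (rule linear_conv_bounded_linear[THEN iffD1])
 have "open (conformal m' n' -` ball 0 1)" by (rule open_vimage[OF open_ball linear_continuous_on[OF blL]])
 moreover have "0 : conformal m' n' -` ball 0 1" using linear_0[OF linear_conformal, of m' n'] by simp
 ultimately obtain r where r: "r > 0" "ball 0 r \<subseteq> conformal m' n' -` ball 0 1"
  using open_contains_ball by blast
 define ep' where "ep' = min (min 1 ep) r"
 have ep': "ep' > 0" "ep' <= 2" using ep r(1) by (auto simp: ep'_def)
 have near: "conformal m' n' q : ball 0 2" "p (ph (conformal m' n' q)) = ?e (sq_pt q)" if q: "q : ball 0 ep'" for q
 proof -
  have q3: "norm q < 1" "norm q < ep" "q : ball 0 r" using q by (auto simp: ep'_def)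
  hence c: "conformal m' n' q : ball 0 1" using r(2) by blast
  thus "conformal m' n' q : ball 0 2" by simp
  have "(norm q)\<^sup>2 <= norm q" using q3(1) by (simp add: power2_eq_square mult_left_le)
  hence "norm (sq_pt q) < ep" unfolding norm_sq_pt using q3(2) norm_ge_zero[of q] by linarith
  hence "e (h (sq_pt q)) = ps (squaring (conformal m' n' q))" using eh[of "sq_pt q"] squaring_conformal[OF mn', of q] by simp
  moreover have "sq_pt q : ball 0 2" using sq_pt_ball[of q] q3(1) by simp
  ultimately show "p (ph (conformal m' n' q)) = ?e (sq_pt q)" using pph[OF c] eh' by simp
 qed
 obtain G where G: "smooth_on (ball 0 2) G" "inj_on G (ball 0 2)" "G ` ball 0 2 \<subseteq> S3"
  "!!q v. q : ball 0 2 ==> FD G q v = 0 ==> v = 0"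
  "!!q. q : ball 0 2 ==> p (G q) = ?e (sq_pt q)"
  "!!q x. q : ball 0 2 ==> q ~= 0 ==> x : S3 ==> p x = ?e (sq_pt q) ==> x = G q | x = G (- q)"
  by (rule band_disc[OF e' axis' ph mn0 ep' near]) blast+
 have "internal_band_sum (?P (A Un strand ?e hyp_graph)) (?P (A Un strand ?e (%y. - hyp_graph y)))"
  by (rule band_crossing[OF e' axis' G A(1) A' A(3)]) (use link' st in simp_all)
 thus thesis using that[OF I1 _ I2] st by simp
qed

text \<open>A half-turn about the second axis preserves the branching axis as a set and changes the
  sign of \<open>g\<close>.\<close>

lemma band_step:
 assumes e: "patch (ball 0 2) e"
  and axis: "!!q. q : cball 0 1 ==> e q : K \<longleftrightarrow> q $ 2 = 0 & q $ 3 = 0"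
  and g: "small_bump g" "g 0 ~= 0"
  and A: "A \<subseteq> UT" "carrier A Int e ` cball 0 1 = {}" "carrier A Int K = {}"
  and link: "oriented_link (preimage_curve p (A Un strand e (%y. - g y)))"
 obtains J\<^sub>1 J\<^sub>2 where "isotopic (preimage_curve p (A Un strand e g)) J\<^sub>1" "internal_band_sum J\<^sub>1 J\<^sub>2"
  "isotopic J\<^sub>2 (preimage_curve p (A Un strand e (%y. - g y)))"
proof (cases "g 0 > 0")
 case True
 show ?thesis by (rule band_step_positive[OF e axis g(1) True A link]) (assumption | rule that)+
next
 case False
 let ?R = "mat3 (-1) 0 0 0 1 0 0 0 (-1)"
 let ?e = "%q. e (?R q)"
 have inj: "inj ?R" by (auto intro!: injI simp: vec_eq_iff forall_3 mat3_nth)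
 have det: "det3 ?R > 0" by (simp add: det3_def Let_def mat3_nth axis_def)
 have nR: "norm (?R q) = norm q" for q by (simp add: norm_vec_def L2_set_def sum_3 mat3_nth)
 have b: "?R -` ball 0 2 = ball 0 2" by (auto simp: nR)
 have RR: "?R (?R q) = q" for q by (simp add: vec_eq_iff forall_3 mat3_nth)
 have e': "patch (ball 0 2) ?e" using patch_precompose_linear[OF e linear_mat3 inj det] unfolding b .
 have axis': "?e q : K \<longleftrightarrow> q $ 2 = 0 & q $ 3 = 0" if "q : cball 0 1" for q
  using axis[of "?R q"] that by (simp add: nR) (simp add: mat3_nth)
 have img: "?e ` cball 0 1 \<subseteq> e ` cball 0 1"
  by (rule image_subsetI) (use nR in \<open>auto intro!: imageI\<close>)
 have A': "carrier A Int ?e ` cball 0 1 = {}" using A(2) img by blast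
 have Rg: "?R (graph_pt f y) = graph_pt (%y. - f y) y" for f y by (simp add: vec_eq_iff forall_3 mat3_nth)
 have st: "strand ?e f = strand e (%y. - f y)" for f unfolding strand_def Rg ..
 have g': "small_bump (%y. - g y)" "- g 0 > 0" using small_bump_uminus[OF g(1)] g(2) False by auto
 have link': "oriented_link (preimage_curve p (A Un strand ?e (%y. - (- g y))))" using link unfolding st by simp
 show ?thesis
  by (rule band_step_positive[OF e' axis' g' A(1) A' A(3) link'])
   (use that in \<open>simp_all add: st\<close>)
qed

end

subsection \<open>Tracking the covering link through a crossing change\<close>

text \<open>A vertical shear straightening the second strand and carrying its height over to the first one.\<close>

lemma straightening_move:
 assumes rh: "smooth_on UNIV rh" "!!x. 0 <= rh x" "!!x. rh x <= (1::real)" "rh 0 = 1" "!!x. \<bar>x\<bar> >= 1/4 ==> rh x = 0" and g: "small_bump g"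
 obtains m where "moves (ball 0 1) UNIV m" "!!y. m (graph_pt g y) = graph_pt (%y. 0) y"
  "!!x. m (axis_pt x) = vector [x, 0, - (g 0 * rh x)]"
proof -
 obtain et C W where et: "smooth_on UNIV et" "{-1/2..1/2} \<subseteq> W" "!!x. x : W ==> et x = (1::real)"
  "compact C" "C \<subseteq> {-3/4<..<3/4::real}" "!!x. x ~: C ==> et x = 0"
  by (rule bump_function_exists[of "{-1/2..1/2::real}" "{-3/4<..<3/4}"]) auto
 define w where "w q = (g (q $ 2) * rh (q $ 1) * et (q $ 3)) *\<^sub>R (axis 3 1 :: real^3)" for q :: "real^3"
 have nth: "smooth_on UNIV (%x::real^3. x $ k)" for k by (rule smooth_nth[OF smooth_id[OF open_UNIV]])
 have w: "smooth_on UNIV w" unfolding w_def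
  by (intro smooth_scaleR smooth_mult smooth_const open_UNIV smooth_compose[OF nth small_bumpD(1)[OF g]]
    smooth_compose[OF nth rh(1)] smooth_compose[OF nth et(1)]) auto
 \<comment> \<open>The three factors of \<open>w\<close> confine the support to coordinates of
   absolute value at most 1/4, 1/2 and 3/4, and \<open>1/16 + 4/16 + 9/16 = 14/16\<close>.\<close>
 have w0: "w q = 0" if "q ~: cball 0 (sqrt (14/16))" for q
 proof (rule ccontr)
  assume "w q ~= 0"
  hence "g (q $ 2) ~= 0" "rh (q $ 1) ~= 0" "et (q $ 3) ~= 0" by (auto simp: w_def)
  hence "\<bar>q $ 2\<bar> < 1/2" "\<bar>q $ 1\<bar> < 1/4" "q $ 3 : C" using small_bumpD(3)[OF g, of "q $ 2"] rh(5)[of "q $ 1"] et(6)[of "q $ 3"]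
   by (auto simp: not_le[symmetric])
  moreover from this have "q $ 3 : {-3/4<..<3/4}" using et(5) by blast
  hence "\<bar>q $ 3\<bar> < 3/4" unfolding greaterThanLessThan_iff by linarith
  ultimately have "(q $ 2)\<^sup>2 <= (1/2)\<^sup>2" "(q $ 1)\<^sup>2 <= (1/4)\<^sup>2" "(q $ 3)\<^sup>2 <= (3/4)\<^sup>2"
   by (simp_all only: power2_le_iff_abs_le[of "1/2"] power2_le_iff_abs_le[of "1/4"] power2_le_iff_abs_le[of "3/4"] order_less_imp_le)
  hence "(q $ 1)\<^sup>2 + (q $ 2)\<^sup>2 + (q $ 3)\<^sup>2 <= 14/16" by (simp add: power2_eq_square)
  moreover have "norm q = sqrt ((q $ 1)\<^sup>2 + (q $ 2)\<^sup>2 + (q $ 3)\<^sup>2)" by (simp add: norm_vec_def L2_set_def sum_3)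
  ultimately show False using that by simp
 qed
 have sub: "cball (0::real^3) (sqrt (14/16)) \<subseteq> ball 0 1"
  by (rule cball_subset_ball_iff[THEN iffD2]) simp
 obtain s0 where s0: "s0 > 0" "!!s. \<bar>s\<bar> <= s0 ==> wiggle (ball 0 1) UNIV (%x. s *\<^sub>R w x)"
  by (rule small_multiple_wiggle[OF w compact_cball sub w0 subspace_UNIV UNIV_I]) (assumption | blast)+
 obtain n :: nat where n: "1 / s0 < real n" using reals_Archimedean2 by blast
 hence n0: "n > 0" using s0(1) by (cases n) (auto simp: zero_less_divide_iff)
 have "\<bar>- (1 / real n)\<bar> <= s0" using n n0 s0(1) by (simp add: field_simps)
 hence "wiggle (ball 0 1) UNIV (%x. (- (1 / real n)) *\<^sub>R w x)" by (rule s0(2))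
 hence mv: "moves (ball 0 1) UNIV (%x. x + (- (1 / real n)) *\<^sub>R w x)" by (rule wiggle_moves)
 let ?f = "%x. x + (- (1 / real n)) *\<^sub>R w x"
 have step: "?f (vector [x, y, z]) = vector [x, y, z - g y * rh x / n]" if "\<bar>z\<bar> <= 1/2 | g y = 0" for x y z
 proof -
  have "w (vector [x, y, z]) = (g y * rh x) *\<^sub>R axis 3 1"
  proof (cases "g y = 0")
   case False
   hence "z : {-1/2..1/2}" using that by auto
   hence "z : W" using et(2) by blast
   thus ?thesis using et(3) by (simp add: w_def)
  qed (simp add: w_def)
  thus ?thesis by (simp add: vec_eq_iff forall_3 axis_def)
 qed
 have frac: "0 <= real k / n" "real k / n <= 1" if "k <= n" for k using that by (auto simp: divide_le_eq_1)
 \<comment> \<open>Points starting at height 0, and points of the strand where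
   \<open>rh x = 1\<close>, stay at heights \<open>|z| <= 1/2\<close>, where the cut-off
   \<open>et\<close> is 1; so \<open>n\<close> steps add up to the full shear.\<close>
 have it: "(?f ^^ k) (vector [x, y, z]) = vector [x, y, z - (k / n) * (g y * rh x)]"
  if z: "z = 0 | z = g y & rh x = 1" and k: "k <= n" for k x y z using k
 proof (induction k)
  case (Suc k)
  have b: "\<bar>z - (k / n) * (g y * rh x)\<bar> <= 1/2" using z
  proof
   assume "z = 0"
   have "\<bar>(k / n) * (g y * rh x)\<bar> <= \<bar>g y\<bar>"
   proof -
    have "\<bar>(k / n) * (g y * rh x)\<bar> = (k / n) * (\<bar>g y\<bar> * rh x)" using rh(2)[of x] by (simp add: abs_mult)
    also have "\<dots> <= 1 * (\<bar>g y\<bar> * 1)" using frac[of k] Suc.prems rh(2,3)[of x] by (intro mult_mono) auto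
    finally show ?thesis by simp
   qed
   thus ?thesis unfolding \<open>z = 0\<close> diff_0 abs_minus_cancel using small_bumpD(2)[OF g, of y] by (rule order_trans)
  next
   assume a: "z = g y & rh x = 1"
   have "z - (k / n) * (g y * rh x) = (1 - k / n) * g y" using a by (simp add: algebra_simps)
   moreover have "\<bar>(1 - k / n) * g y\<bar> <= \<bar>g y\<bar>" using frac[of k] Suc.prems by (simp add: abs_mult mult_left_le_one_le)
   ultimately show ?thesis using small_bumpD(2)[OF g, of y] by simp
  qed
  have "(?f ^^ Suc k) (vector [x, y, z]) = ?f (vector [x, y, z - (k / n) * (g y * rh x)])" using Suc by simp
  also have "\<dots> = vector [x, y, z - (k / n) * (g y * rh x) - g y * rh x / n]" by (rule step) (use b in blast)
  also have "z - (k / n) * (g y * rh x) - g y * rh x / n = z - (Suc k / n) * (g y * rh x)" by (simp add: add_divide_distrib distrib_right)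
  finally show ?case .
 qed simp
 show thesis
 proof (rule that[OF moves_funpow[OF mv, of n]])
  show "(?f ^^ n) (graph_pt g y) = graph_pt (%y. 0) y" for y using it[of "g y" y 0 n] rh(4) n0 by simp
  show "(?f ^^ n) (axis_pt x) = vector [x, 0, - (g 0 * rh x)]" for x using it[of 0 0 x n] n0 by simp
 qed
qed

section \<open>Crossing changes component by component\<close>

lemma labelled_linkD:
 assumes "labelled_link I L"
 shows "finite I" "!!j. j : I ==> oriented_knot (L j)" "!!j k. j : I ==> k : I ==> j ~= k ==> carrier (L j) Int carrier (L k) = {}"
 using assms by (auto simp: labelled_link_def disjoint_family_on_def)

text \<open>A crossing change is stated for the union of all components; their disjointness
  localizes it. In the ball only the components \<open>a\<close> and \<open>b\<close> occur, and the
  new strand belongs to \<open>b\<close> because it misses the axis, as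
  \<open>g 0 ~= 0\<close>.\<close>

lemma labelled_crossingE:
 assumes L: "labelled_link I L" and c: "labelled_crossing_change I a b L L'"
 obtains e g where "patch (ball 0 2) e" "small_bump g" "g 0 ~= 0" "a : I" "b : I" "a ~= b" "labelled_link I L'"
  "!!j. j : I - {b} ==> L' j = L j"
  "{x : L a. fst x : e ` cball 0 1} = axis_strand e" "{x : L b. fst x : e ` cball 0 1} = strand e g"
  "!!j. j : I - {a, b} ==> {x : L j. fst x : e ` cball 0 1} = {}"
  "L' b = {x : L b. fst x ~: e ` cball 0 1} Un strand e (%y. - g y)"
proof -
 have ab: "a : I" "b : I" "a ~= b" "labelled_link I L'" "!!j. j : I - {b} ==> L' j = L j"
  and "crossing_change (L a) (L b) (UN j:I. L j) (UN j:I. L' j)"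
  using c by (auto simp: labelled_crossing_change_def)
 then obtain e g where eg: "crossing_at e g (UN j:I. L j)" "axis_strand e \<subseteq> L a" "strand e g \<subseteq> L b"
  "(UN j:I. L' j) = crossed e g (UN j:I. L j)" unfolding crossing_change_iff by blast
 note e = crossing_atD[OF eg(1)]
 let ?B = "e ` cball 0 1"
 have dj: "x ~: L k" if "x : L j" "j : I" "k : I" "j ~= k" for x j k
  using labelled_linkD(3)[OF L that(2-4)] that(1) by blast
 have dj': "x ~: L' k" if "x : L' j" "j : I" "k : I" "j ~= k" for x j k
  using labelled_linkD(3)[OF ab(4) that(2-4)] that(1) by blast
 have inB: "x : axis_strand e | x : strand e g" if "x : L j" "j : I" "fst x : ?B" for x j
  using e(4) that by blast
 have SB: "fst x : ?B" if "x : axis_strand e" for x using carrier_axis_strand_subset that by blast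
 have TB: "fst x : ?B" if "x : strand e g" for x using carrier_strand_subset[OF e(2)] that by blast
 have TB': "fst x : ?B" if "x : strand e (%y. - g y)" for x using carrier_strand_subset[OF small_bump_uminus[OF e(2)]] that by blast
 have a: "{x : L a. fst x : ?B} = axis_strand e"
  using inB[OF _ ab(1)] eg(2,3) dj[OF _ ab(1,2,3)] SB by blast
 have b: "{x : L b. fst x : ?B} = strand e g"
  using inB[OF _ ab(2)] eg(2,3) dj[OF _ ab(1,2,3)] TB by blast
 have o: "{x : L j. fst x : ?B} = {}" if "j : I - {a, b}" for j
  using inB[of _ j] eg(2,3) dj[of _ j a] dj[of _ j b] ab that by blast
 have ST: "x ~: axis_strand e" if "x : strand e (%y. - g y)" for x
 proof
  assume "x : axis_strand e"
  hence "fst x : carrier (axis_strand e)" "fst x : carrier (strand e (%y. - g y))" using that by blast+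
  then obtain t y where ty': "t : {-1..1}" "fst x = e (axis_pt t)" "y : {-1..1}" "fst x = e (graph_pt (%y. - g y) y)"
   unfolding carrier_axis_strand carrier_strand by (elim imageE)
  hence ty: "t : {-1..1}" "y : {-1..1}" "e (axis_pt t) = e (graph_pt (%y. - g y) y)" by simp_all
  have "axis_pt t = graph_pt (%y. - g y) y" by (rule inj_onD[OF patch_inj[OF e(1)] ty(3)])
    (use axis_pt_in_cball[OF ty(1)] graph_pt_in_cball[OF small_bump_uminus[OF e(2)] ty(2)] in auto)
  thus False using e(3) by (auto simp: vec_eq_iff forall_3)
 qed
 have "L' b = {x : L b. fst x ~: ?B} Un strand e (%y. - g y)"
 proof (intro set_eqI iffI)
  fix x assume x: "x : L' b"
  hence "x : crossed e g (UN j:I. L j)" using eg(4) ab(2) by blast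
  then consider j where "j : I" "x : L j" "fst x ~: ?B" | "x : axis_strand e" | "x : strand e (%y. - g y)" unfolding crossed_def by blast
  thus "x : {x : L b. fst x ~: ?B} Un strand e (%y. - g y)"
  proof cases
   case 1
   hence "j = b" using dj'[OF x ab(2), of j] ab(5)[of j] by blast
   thus ?thesis using 1 by blast
  next
   case 2
   hence "x : L' a" using eg(2) ab(5)[of a] ab(1,3) by blast
   thus ?thesis using dj'[OF x ab(2,1)] ab(3) by blast
  qed blast
 next
  fix x assume x: "x : {x : L b. fst x ~: ?B} Un strand e (%y. - g y)"
  hence "x : crossed e g (UN j:I. L j)" unfolding crossed_def using ab(2) by blast
  then obtain j where j: "j : I" "x : L' j" using eg(4) by blast
  show "x : L' b"
  proof (cases "j = b")
   case False
   hence xj: "x : L j" using j ab(5)[of j] by blast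
   have "x ~: L b" using dj[OF xj j(1) ab(2) False] .
   hence x': "x : strand e (%y. - g y)" using x by blast
   hence "x : {x : L j. fst x : ?B}" using xj TB' by blast
   hence "j = a" "x : axis_strand e" using o[of j] a j(1) False by blast+
   thus ?thesis using ST[OF x'] by blast
  qed (use j in blast)
 qed
 thus thesis using that[OF e(1-3) ab a b o] by blast
qed

text \<open>Only the component with the second strand changes, and once the other components are
  ignored its change is an isotopy. Hence the knots at the end are copies of the original
  ones.\<close>

lemma labelled_crossing_isotopic:
 assumes L: "labelled_link I L" and c: "labelled_crossing_change I a b L L'" and j: "j : I"
 shows "isotopic (L j) (L' j)"
proof -
 obtain e g where e: "patch (ball 0 2) e" "small_bump g" and L': "!!j. j : I - {b} ==> L' j = L j"
  and b: "{x : L b. fst x : e ` cball 0 1} = strand e g" "L' b = {x : L b. fst x ~: e ` cball 0 1} Un strand e (%y. - g y)"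
  by (rule labelled_crossingE[OF L c]) blast
 have UT: "L j \<subseteq> UT" using labelled_linkD(2)[OF L j] by (rule oriented_knot_UT)
 show ?thesis
 proof (cases "j = b")
  case True
  have UTb: "L b \<subseteq> UT" using UT True by simp
  obtain h where "iso_end h" "tangent_map h ` L b = L' b"
   unfolding b(2) by (rule isotopic_replace_strand[OF e small_bump_uminus[OF e(2)] UTb b(1)]) blast
  thus ?thesis unfolding True isotopic_iff[OF UTb] by blast
 next
  case False
  thus ?thesis using L'[of j] j isotopic_refl[OF UT] by simp
 qed
qed

lemma labelled_link_subset: "labelled_link I L ==> I' \<subseteq> I ==> labelled_link I' L"
 unfolding labelled_link_def using finite_subset[of I' I] disjoint_family_on_mono[of I' I] by blast

lemma link_altered_band:
 assumes "link_altered \<alpha> n J A" "isotopic A A\<^sub>1" "internal_band_sum A\<^sub>1 A\<^sub>2" "isotopic A\<^sub>2 A'"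
 shows "link_altered (Suc \<alpha>) n J A'"
 using link_altered.isotopy[OF link_altered.band[OF link_altered.isotopy[OF assms(1,2)] assms(3)] assms(4)] .

lemma link_carrier_disjoint:
 assumes "labelled_link I L" "i : I"
 shows "carrier (UN j:I - {i}. L j) Int carrier (L i) = {}" "j : I - {i} ==> carrier (L j) Int carrier (L i) = {}"
  "(UN j:I - {i}. L j) \<subseteq> UT"
proof -
 show *: "carrier (L j) Int carrier (L i) = {}" if "j : I - {i}" for j
  using labelled_linkD(3)[OF assms(1), of j i] that assms(2) by blast
 thus "carrier (UN j:I - {i}. L j) Int carrier (L i) = {}" by blast
 show "(UN j:I - {i}. L j) \<subseteq> UT" using labelled_linkD(2)[OF assms(1)] oriented_knot_UT by blast
qed

lemma carrier_axis_iff: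
 assumes e: "patch (ball 0 2) e" and k: "{x : k. fst x : e ` cball 0 1} = axis_strand e" and q: "q : cball 0 1"
 shows "e q : carrier k \<longleftrightarrow> q $ 2 = 0 & q $ 3 = 0"
proof
 assume "e q : carrier k"
 then obtain x where x: "x : k" "e q = fst x" by (elim imageE)
 hence "x : axis_strand e" using q k by (metis (mono_tags, lifting) imageI mem_Collect_eq)
 hence "e q : carrier (axis_strand e)" unfolding x(2) by (rule imageI)
 then obtain t where t: "t : {-1..1}" "e q = e (axis_pt t)" unfolding carrier_axis_strand by (elim imageE)
 have "q = axis_pt t"
  by (rule inj_onD[OF patch_inj[OF e] t(2)]) (use q axis_pt_in_cball[OF t(1)] in auto)
 thus "q $ 2 = 0 & q $ 3 = 0" by simp
next
 assume z: "q $ 2 = 0 & q $ 3 = 0"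
 have "\<bar>q $ 1\<bar> <= 1" using component_le_norm_cart[of q 1] q by simp
 hence "q $ 1 : {-1..1}" by (simp add: abs_le_iff)
 moreover have "q = axis_pt (q $ 1)" using z by (simp add: vec_eq_iff forall_3)
 ultimately have "e q : carrier (axis_strand e)" unfolding carrier_axis_strand by (metis (no_types, lifting) imageI)
 thus "e q : carrier k" using k by blast
qed

lemma track_not_involving:
 assumes L: "labelled_link I L" and c: "labelled_crossing_change I a b L L'" and i: "i : I" "i ~: {a, b}"
  and p: "branched_cover p (carrier (L i))" and J: "link_altered \<alpha> n J (preimage_curve p (UN j:I - {i}. L j))"
 shows "branched_cover p (carrier (L' i))" "link_altered \<alpha> (Suc (Suc n)) J (preimage_curve p (UN j:I - {i}. L' j))"
proof -
 interpret branched_cover p "carrier (L i)" by (rule p)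
 let ?A = "UN j:I - {i}. L j" and ?A' = "UN j:I - {i}. L' j"
 obtain e g where e: "patch (ball 0 2) e" "small_bump g" "g 0 ~= 0" and ab: "a : I" "b : I" "a ~= b"
  and L': "!!j. j : I - {b} ==> L' j = L j"
  and B: "{x : L a. fst x : e ` cball 0 1} = axis_strand e" "{x : L b. fst x : e ` cball 0 1} = strand e g"
   "!!j. j : I - {a, b} ==> {x : L j. fst x : e ` cball 0 1} = {}"
   "L' b = {x : L b. fst x ~: e ` cball 0 1} Un strand e (%y. - g y)" by (rule labelled_crossingE[OF L c]) blast
 have abi: "a : I - {i}" "b : I - {i}" using ab i by blast+
 have AB: "{x : ?A. fst x : e ` cball 0 1} = axis_strand e Un strand e g"
 proof (intro set_eqI)
  fix x
  have "x : {x : ?A. fst x : e ` cball 0 1} \<longleftrightarrow> (EX j:I - {i}. x : {x : L j. fst x : e ` cball 0 1})" by blast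
  also have "\<dots> \<longleftrightarrow> x : {x : L a. fst x : e ` cball 0 1} | x : {x : L b. fst x : e ` cball 0 1}"
  proof
   assume "EX j:I - {i}. x : {x : L j. fst x : e ` cball 0 1}"
   then obtain j where "j : I - {i}" "x : {x : L j. fst x : e ` cball 0 1}" by blast
   thus "x : {x : L a. fst x : e ` cball 0 1} | x : {x : L b. fst x : e ` cball 0 1}" using B(3)[of j] by (cases "j = a | j = b") blast+
  qed (use abi in blast)
  finally show "x : {x : ?A. fst x : e ` cball 0 1} \<longleftrightarrow> x : axis_strand e Un strand e g" unfolding B(1,2) by blast
 qed
 have ca: "crossing_at e g ?A" unfolding crossing_at_def using e AB by blast
 have cr: "crossed e g ?A = ?A'"
 proof -
  have La: "L' a = {x : L a. fst x ~: e ` cball 0 1} Un axis_strand e" using L'[of a] ab B(1) by blast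
  have Lo: "L' j = {x : L j. fst x ~: e ` cball 0 1}" if "j : I - {a, b}" for j using L'[of j] B(3)[OF that] that by blast
  have split: "(UN j:I - {i}. M j) = (UN j:I - {i, a, b}. M j) Un M a Un M b" for M :: "_ => oriented_curve" using abi by auto
  have "(UN j:I - {i, a, b}. L' j) = (UN j:I - {i, a, b}. {x : L j. fst x ~: e ` cball 0 1})"
   by (rule SUP_cong[OF HOL.refl]) (rule Lo, blast)
  hence "?A' = (UN j:I - {i}. {x : L j. fst x ~: e ` cball 0 1}) Un axis_strand e Un strand e (%y. - g y)" unfolding split La B(4) by blast
  thus ?thesis unfolding crossed_def by blast
 qed
 have eK: "e ` cball 0 1 Int carrier (L i) = {}"
 proof (rule equals0I)
  fix y assume "y : e ` cball 0 1 Int carrier (L i)"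
  then obtain x where "x : L i" "fst x : e ` cball 0 1" by (elim IntE imageE[of _ fst]) simp
  thus False using B(3)[of i] i by blast
 qed
 have S: "axis_strand e \<subseteq> L a" and T: "strand e g \<subseteq> L b" using B(1,2) by blast+
 have sub: "L a \<subseteq> ?A" "L b \<subseteq> ?A" using abi by blast+
 obtain J' where J': "crossing_change_distinct (preimage_curve p ?A) J'" "crossing_change_distinct J' (preimage_curve p (crossed e g ?A))"
  by (rule crossing_change_lift[OF ca S T eK link_carrier_disjoint(3)[OF L i(1)] link_carrier_disjoint(1)[OF L i(1)] sub
    labelled_linkD(2)[OF L ab(1)] labelled_linkD(2)[OF L ab(2)] labelled_linkD(3)[OF L ab]])
 show "link_altered \<alpha> (Suc (Suc n)) J (preimage_curve p ?A')"
  using link_altered.crossing[OF link_altered.crossing[OF J J'(1)] J'(2)] unfolding cr .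
 show "branched_cover p (carrier (L' i))" using p L'[of i] i by auto
qed

text \<open>Here \<open>L i\<close> contains the first strand, the axis of the chart, which the
  crossing change does not move. The cover stays the same and the covering link undergoes one band
  sum.\<close>

lemma track_involving_first:
 assumes L: "labelled_link I L" and c: "labelled_crossing_change I i b L L'"
  and p: "branched_cover p (carrier (L i))" and J: "link_altered \<alpha> n J (preimage_curve p (UN j:I - {i}. L j))"
 shows "branched_cover p (carrier (L' i))" "link_altered (Suc \<alpha>) n J (preimage_curve p (UN j:I - {i}. L' j))"
proof -
 interpret branched_cover p "carrier (L i)" by (rule p)
 let ?A = "UN j:I - {i}. L j" and ?A' = "UN j:I - {i}. L' j"
 obtain e g where e: "patch (ball 0 2) e" "small_bump g" "g 0 ~= 0" and ab: "i : I" "b : I" "i ~= b" and LL': "labelled_link I L'"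
  and L': "!!j. j : I - {b} ==> L' j = L j"
  and B: "{x : L i. fst x : e ` cball 0 1} = axis_strand e" "{x : L b. fst x : e ` cball 0 1} = strand e g"
   "!!j. j : I - {i, b} ==> {x : L j. fst x : e ` cball 0 1} = {}"
   "L' b = {x : L b. fst x ~: e ` cball 0 1} Un strand e (%y. - g y)" by (rule labelled_crossingE[OF L c]) blast
 define R where "R = {x : ?A. fst x ~: e ` cball 0 1}"
 have split: "(UN j:I - {i}. M j) = (UN j:I - {i, b}. M j) Un M b" for M :: "_ => oriented_curve" using ab by auto
 have Lo: "L j = {x : L j. fst x ~: e ` cball 0 1}" if "j : I - {i, b}" for j using B(3)[OF that] by blast
 let ?U = "UN j:I - {i, b}. {x : L j. fst x ~: e ` cball 0 1}" and ?b = "{x : L b. fst x ~: e ` cball 0 1}"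
 have U: "(UN j:I - {i, b}. L j) = ?U" by (rule SUP_cong[OF HOL.refl]) (rule Lo, blast)
 have U': "(UN j:I - {i, b}. L' j) = (UN j:I - {i, b}. L j)" by (rule SUP_cong[OF HOL.refl]) (rule L', blast)
 have R: "R = ?U Un ?b" unfolding R_def split by blast
 have Lb: "L b = ?b Un strand e g" using B(2) by blast
 have "?A = ?U Un L b" unfolding split U ..
 also have "\<dots> = ?U Un (?b Un strand e g)" by (rule arg_cong[OF Lb])
 finally have A: "?A = R Un strand e g" unfolding R Un_assoc .
 have A': "?A' = R Un strand e (%y. - g y)" unfolding split U' U B(4) R Un_assoc ..
 have axis: "e q : carrier (L i) \<longleftrightarrow> q $ 2 = 0 & q $ 3 = 0" if "q : cball 0 1" for q
  by (rule carrier_axis_iff[OF e(1) B(1) that])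
 have RUT: "R \<subseteq> UT" using link_carrier_disjoint(3)[OF L ab(1)] unfolding R_def by blast
 have RB: "carrier R Int e ` cball 0 1 = {}" unfolding R_def by blast
 have RK: "carrier R Int carrier (L i) = {}" using link_carrier_disjoint(1)[OF L ab(1)] unfolding R_def by blast
 have Li: "L' i = L i" using L' ab by blast
 have "oriented_link (preimage_curve p ?A')"
  by (rule preimage_oriented_link[OF labelled_link_subset[OF LL']]) (use link_carrier_disjoint(2)[OF LL' ab(1)] Li in auto)
 hence link: "oriented_link (preimage_curve p (R Un strand e (%y. - g y)))" unfolding A' .
 obtain J1 J2 where "isotopic (preimage_curve p (R Un strand e g)) J1" "internal_band_sum J1 J2"
  "isotopic J2 (preimage_curve p (R Un strand e (%y. - g y)))" by (rule band_step[OF e(1) axis e(2,3) RUT RB RK link]) blast+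
 thus "link_altered (Suc \<alpha>) n J (preimage_curve p ?A')"
  using link_altered_band[OF J[unfolded A]] unfolding A' by blast
 show "branched_cover p (carrier (L' i))" using p Li by simp
qed

text \<open>If the second strand belongs to the branching set, both strands are straightened by shears, which turns
 the crossing by a quarter into one whose first strand belongs to the branching set.\<close>

lemma track_involving_second:
 assumes L: "labelled_link I L" and c: "labelled_crossing_change I a i L L'"
  and p: "branched_cover p (carrier (L i))" and J: "link_altered \<alpha> n J (preimage_curve p (UN j:I - {i}. L j))"
 obtains p' where "branched_cover p' (carrier (L' i))" "link_altered (Suc \<alpha>) n J (preimage_curve p' (UN j:I - {i}. L' j))"
proof -
 let ?A = "UN j:I - {i}. L j" and ?A' = "UN j:I - {i}. L' j"
 obtain e g where e: "patch (ball 0 2) e" "small_bump g" "g 0 ~= 0" and ab: "a : I" "i : I" "a ~= i" and LL': "labelled_link I L'"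
  and L': "!!j. j : I - {i} ==> L' j = L j"
  and B: "{x : L a. fst x : e ` cball 0 1} = axis_strand e" "{x : L i. fst x : e ` cball 0 1} = strand e g"
   "!!j. j : I - {a, i} ==> {x : L j. fst x : e ` cball 0 1} = {}"
   "L' i = {x : L i. fst x ~: e ` cball 0 1} Un strand e (%y. - g y)" by (rule labelled_crossingE[OF L c]) blast
 have A'A: "?A' = ?A" by (rule SUP_cong[OF HOL.refl]) (rule L')
 define R where "R = {x : ?A. fst x ~: e ` cball 0 1}"
 define Q where "Q = {x : L i. fst x ~: e ` cball 0 1}"
 have split: "(UN j:I - {i}. M j) = (UN j:I - {a, i}. M j) Un M a" for M :: "_ => oriented_curve" using ab by auto
 let ?U = "UN j:I - {a, i}. {x : L j. fst x ~: e ` cball 0 1}" and ?a = "{x : L a. fst x ~: e ` cball 0 1}"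
 have Lo: "L j = {x : L j. fst x ~: e ` cball 0 1}" if "j : I - {a, i}" for j using B(3)[OF that] by blast
 have U: "(UN j:I - {a, i}. L j) = ?U" by (rule SUP_cong[OF HOL.refl]) (rule Lo, blast)
 have R: "R = ?U Un ?a" unfolding R_def split by blast
 have La: "L a = ?a Un axis_strand e" using B(1) by blast
 have "?A = ?U Un L a" unfolding split U ..
 also have "\<dots> = ?U Un (?a Un axis_strand e)" by (rule arg_cong[OF La])
 finally have A: "?A = R Un axis_strand e" unfolding R Un_assoc .
 have Li: "L i = Q Un strand e g" using B(2) unfolding Q_def by blast
 have Li': "L' i = Q Un strand e (%y. - g y)" unfolding B(4) Q_def ..
 have RUT: "R \<subseteq> UT" and QUT: "Q \<subseteq> UT"
  using link_carrier_disjoint(3)[OF L ab(2)] oriented_knot_UT[OF labelled_linkD(2)[OF L ab(2)]] unfolding R_def Q_def by blast+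
 have RB: "fst x ~: e ` cball 0 1" if "x : R" for x using that unfolding R_def by blast
 have QB: "fst x ~: e ` cball 0 1" if "x : Q" for x using that unfolding Q_def by blast
 obtain rh C W where rh: "smooth_on UNIV rh" "!!x. 0 <= rh x" "!!x. rh x <= (1::real)" "{0} \<subseteq> W" "!!x. x : W ==> rh x = 1"
  "C \<subseteq> {-1/4<..<1/4::real}" "!!x. x ~: C ==> rh x = 0" by (rule bump_function_exists[of "{0::real}" "{-1/4<..<1/4}"]) auto
 have rh0: "rh 0 = 1" and rhout: "rh x = 0" if "\<bar>x\<bar> >= 1/4" for x
 proof -
  show "rh 0 = 1" using rh(4,5) by blast
  have "x ~: {-1/4<..<1/4}" using that by auto
  thus "rh x = 0" using rh(6,7) by blast
 qed
 have rh01: "rh 0 = 1" using rh(4,5) by blast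
 \<comment> \<open>The straightening shear bends the axis strand to the height
   \<open>- g 0 * rh x\<close>; exchanging the axes turns it into the graph of \<open>G\<close>, and
   for the crossing after the change into that of \<open>- G\<close>.\<close>
 define G where "G x = g 0 * rh x" for x
 have G: "small_bump G"
  unfolding small_bump_def
 proof (intro conjI allI impI)
  show "smooth_on UNIV G" unfolding G_def by (intro smooth_mult smooth_const rh(1) open_UNIV)
  show "\<bar>G x\<bar> <= 1/2" for x
  proof -
   have "\<bar>G x\<bar> <= \<bar>g 0\<bar>" using rh(2,3)[of x] by (simp add: G_def abs_mult mult_left_le)
   thus ?thesis using small_bumpD(2)[OF e(2), of 0] by linarith
  qed
  show "G x = 0" if "1/2 <= \<bar>x\<bar>" for x using rhout[of x] that by (simp add: G_def)
 qed
 have G0: "G 0 ~= 0" using e(3) rh01 by (simp add: G_def)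
 obtain m1 where m1: "moves (ball 0 1) UNIV m1" "!!y. m1 (graph_pt g y) = graph_pt (%y. 0) y"
  "!!x. m1 (axis_pt x) = vector [x, 0, - (g 0 * rh x)]" by (rule straightening_move[OF rh(1-3) rh01 rhout e(2)]) (assumption | rule that)+
 obtain m2 where m2: "moves (ball 0 1) UNIV m2" "!!y. m2 (graph_pt (%y. - g y) y) = graph_pt (%y. 0) y"
  "!!x. m2 (axis_pt x) = vector [x, 0, - (- g 0 * rh x)]"
  by (rule straightening_move[OF rh(1-3) rh01 rhout small_bump_uminus[OF e(2)]]) (assumption | rule that)+
 obtain k1 where k1: "compact_diffeo (ball 0 1) m1 k1" by (rule moves_compact_diffeo[OF m1(1)])
 obtain k2 where k2: "compact_diffeo (ball 0 1) m2 k2" by (rule moves_compact_diffeo[OF m2(1)])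
 have b1: "ball (0::real^3) 1 \<subseteq> ball 0 2" and W: "cball (0::real^3) 1 \<subseteq> ball 0 2" by auto
 have e1: "patch (ball 0 1) e" by (rule patch_subset[OF e(1) open_ball b1])
 let ?h1 = "push (ball 0 1) e m1" and ?h2 = "push (ball 0 1) e m2"
 have h1: "iso_end ?h1" and h2: "iso_end ?h2" by (rule iso_end_push[OF e1 m1(1)], rule iso_end_push[OF e1 m2(1)])
 have fix1: "tangent_map ?h1 ` M = M" and fix2: "tangent_map ?h2 ` M = M"
  if "M \<subseteq> UT" "!!x. x : M ==> fst x ~: e ` cball 0 1" for M
 proof -
  have "tangent_map ?h1 x = x" "tangent_map ?h2 x = x" if "x : M" for x
  proof -
   have "x : UT" "fst x ~: e ` ball 0 1" using \<open>M \<subseteq> UT\<close> \<open>!!x. x : M ==> fst x ~: e ` cball 0 1\<close>[OF that] that ball_subset_cball[of 0 1] by blast+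
   thus "tangent_map ?h1 x = x" "tangent_map ?h2 x = x"
    using tangent_map_push_outside[OF e1 k1] tangent_map_push_outside[OF e1 k2] by blast+
  qed
  thus "tangent_map ?h1 ` M = M" "tangent_map ?h2 ` M = M" by force+
 qed
 have fQ: "tangent_map ?h1 ` Q = Q" "tangent_map ?h2 ` Q = Q"
  by (rule fix1[OF QUT], rule QB, assumption) (rule fix2[OF QUT], rule QB)
 have fR: "tangent_map ?h1 ` R = R" "tangent_map ?h2 ` R = R"
  by (rule fix1[OF RUT], rule RB, assumption) (rule fix2[OF RUT], rule RB)
 \<comment> \<open>Exchanges the first two axes; the sign on the third one keeps the
   orientation.\<close>
 let ?Sw = "mat3 0 1 0 1 0 0 0 0 (-1)"
 let ?e = "%q. e (?Sw q)"
 have inj: "inj ?Sw" by (auto intro!: injI simp: vec_eq_iff forall_3 mat3_nth)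
 have det: "det3 ?Sw > 0" by (simp add: det3_def Let_def mat3_nth axis_def)
 have nS: "norm (?Sw q) = norm q" for q by (simp add: norm_vec_def L2_set_def sum_3 mat3_nth add_ac)
 have SS: "?Sw (?Sw q) = q" for q by (simp add: vec_eq_iff forall_3 mat3_nth)
 have bS: "?Sw -` ball 0 2 = ball 0 2" by (auto simp: nS)
 have e': "patch (ball 0 2) ?e" using patch_precompose_linear[OF e(1) linear_mat3 inj det] unfolding bS .
 have img: "?e ` cball 0 1 = e ` cball 0 1"
 proof (intro equalityI subsetI)
  fix y assume "y : ?e ` cball 0 1"
  then obtain q where "q : cball 0 1" "y = e (?Sw q)" by blast
  thus "y : e ` cball 0 1" using nS[of q] by (intro image_eqI[of _ _ "?Sw q"]) auto
 next
  fix y assume "y : e ` cball 0 1"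
  then obtain q where "q : cball 0 1" "y = e q" by blast
  thus "y : ?e ` cball 0 1" using nS[of q] SS[of q] by (intro image_eqI[of _ _ "?Sw q"]) auto
 qed
 have Sw1: "?Sw (axis_pt x) = graph_pt (%y. 0) x" "?Sw (vector [0, y, z]) = vector [y, 0, - z]" for x y z
  by (simp_all add: vec_eq_iff forall_3 mat3_nth)
 have axis_e: "axis_strand ?e = strand e (%y. 0)" unfolding axis_strand_def strand_def Sw1 ..
 have zero: "small_bump (%y. 0)" by (simp add: small_bump_def smooth_const)
 have T1: "tangent_map ?h1 ` strand e g = axis_strand ?e" and T2: "tangent_map ?h2 ` strand e (%y. - g y) = axis_strand ?e"
  unfolding axis_e by (rule tangent_map_push_strand[OF e(1) open_ball b1 k1 e(2) m1(2)],
   rule tangent_map_push_strand[OF e(1) open_ball b1 k2 small_bump_uminus[OF e(2)] m2(2)])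
 have S1: "tangent_map ?h1 ` axis_strand e = strand ?e G" and S2: "tangent_map ?h2 ` axis_strand e = strand ?e (%y. - G y)"
  using tangent_map_push_curve[OF e(1) open_ball b1 k1 axis_pt_curve[OF W]] tangent_map_push_curve[OF e(1) open_ball b1 k2 axis_pt_curve[OF W]]
  unfolding axis_strand_def strand_def m1(3) m2(3) Sw1 G_def by simp_all
 \<comment> \<open>Both positions of \<open>L i\<close> are straightened to the same knot
   \<open>?k\<close>. The other components do not move in the crossing change, but the two
   straightenings carry their strand to opposite sides of \<open>?k\<close>.\<close>
 let ?k = "Q Un axis_strand ?e"
 have K1: "tangent_map ?h1 ` L i = ?k" and K2: "tangent_map ?h2 ` L' i = ?k"
  unfolding Li Li' image_Un fQ T1 T2 by (rule HOL.refl)+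
 have A1: "tangent_map ?h1 ` ?A = R Un strand ?e G" and A2: "tangent_map ?h2 ` ?A = R Un strand ?e (%y. - G y)"
  unfolding A image_Un fR S1 S2 by (rule HOL.refl)+
 let ?p1 = "%x. ?h1 (p x)"
 have bc1: "branched_cover ?p1 (carrier ?k)"
  using branched_cover_iso(1)[OF p h1] unfolding K1[symmetric] carrier_tangent_map .
 have P1: "preimage_curve ?p1 (R Un strand ?e G) = preimage_curve p ?A"
  using branched_cover_iso(2)[OF p h1 link_carrier_disjoint(3)[OF L ab(2)] link_carrier_disjoint(1)[OF L ab(2)]] unfolding A1 .
 let ?i2 = "inv_into S3 ?h2"
 have d2: "diffeo_S3 ?h2" by (rule iso_end_diffeo[OF h2])
 have i2: "iso_end ?i2" by (rule iso_end_inv[OF h2])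
 have undo: "tangent_map ?i2 ` tangent_map ?h2 ` M = M" if "M \<subseteq> UT" for M
  using tangent_map_inv[OF d2] that by (force simp: image_image)
 have kUT: "?k \<subseteq> UT" using QUT strand_UT[OF e(1) zero] unfolding axis_e by blast
 have L'UT: "L' i \<subseteq> UT" by (rule oriented_knot_UT[OF labelled_linkD(2)[OF LL' ab(2)]])
 \<comment> \<open>Straightening by \<open>?h1\<close> and undoing the straightening
   \<open>?h2\<close> turns the cover branched along \<open>L i\<close> into one branched along
   \<open>L' i\<close>.\<close>
 let ?p2 = "%x. ?i2 (?p1 x)"
 have bc2: "branched_cover ?p2 (carrier (L' i))"
  using branched_cover_iso(1)[OF bc1 i2] undo[OF L'UT] unfolding K2 by (simp only: carrier_tangent_map[symmetric])
 have AUT: "?A \<subseteq> UT" by (rule link_carrier_disjoint(3)[OF L ab(2)])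
 have kB: "{x : ?k. fst x : ?e ` cball 0 1} = axis_strand ?e"
  using QB carrier_axis_strand_subset[of ?e] unfolding img by blast
 have axis: "?e q : carrier ?k \<longleftrightarrow> q $ 2 = 0 & q $ 3 = 0" if "q : cball 0 1" for q
  by (rule carrier_axis_iff[OF e' kB that])
 have Rk: "carrier R Int carrier ?k = {}"
 proof -
  have "carrier R Int carrier Q = {}" using link_carrier_disjoint(1)[OF L ab(2)] unfolding R_def Q_def by blast
  moreover have "carrier R Int carrier (axis_strand ?e) = {}" using RB carrier_axis_strand_subset[of ?e] unfolding img by blast
  ultimately show ?thesis by blast
 qed
 have RG: "carrier (R Un strand ?e (%y. - G y)) Int carrier ?k = {}"
 proof -
  have "carrier ?A Int carrier (L' i) = {}" using link_carrier_disjoint(1)[OF LL' ab(2)] unfolding A'A .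
  moreover have "carrier ?A \<subseteq> S3" "carrier (L' i) \<subseteq> S3"
   by (rule image_subsetI, rule UT_S3, rule subsetD[OF AUT], assumption) (rule image_subsetI, rule UT_S3, rule subsetD[OF L'UT])
  ultimately have "?h2 ` carrier ?A Int ?h2 ` carrier (L' i) = {}"
   using inj_on_image_Int[OF diffeo_S3D(7)[OF d2], of "carrier ?A" "carrier (L' i)"] by (simp only: image_empty)
  thus ?thesis unfolding carrier_tangent_map[symmetric] A2 K2 .
 qed
 have P2: "preimage_curve ?p2 ?A' = preimage_curve ?p1 (R Un strand ?e (%y. - G y))"
 proof -
  have "R Un strand ?e (%y. - G y) \<subseteq> UT" using RUT strand_UT[OF e' small_bump_uminus[OF G]] by blast
  from branched_cover_iso(2)[OF bc1 i2 this RG] show ?thesis unfolding A'A A2[symmetric] undo[OF AUT] .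
 qed
 interpret c1: branched_cover ?p1 "carrier ?k" by (rule bc1)
 interpret c2: branched_cover ?p2 "carrier (L' i)" by (rule bc2)
 have link: "oriented_link (preimage_curve ?p1 (R Un strand ?e (%y. - G y)))"
  unfolding P2[symmetric]
  by (rule c2.preimage_oriented_link[OF labelled_link_subset[OF LL']]) (use link_carrier_disjoint(2)[OF LL' ab(2)] in auto)
 have RB': "carrier R Int ?e ` cball 0 1 = {}" using RB unfolding img by blast
 obtain J1 J2 where "isotopic (preimage_curve ?p1 (R Un strand ?e G)) J1" "internal_band_sum J1 J2"
  "isotopic J2 (preimage_curve ?p1 (R Un strand ?e (%y. - G y)))" by (rule c1.band_step[OF e' axis G G0 RUT RB' Rk link]) blast+
 hence "link_altered (Suc \<alpha>) n J (preimage_curve ?p2 ?A')"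
  using link_altered_band[OF J] unfolding P1 P2 by blast
 thus thesis using that bc2 by blast
qed

text \<open>The cover is quantified existentially because moving the branching component changes it;
  \<open>J\<close>, the covering link of the initial link, stays as the reference.\<close>

definition tracked :: "'k set => 'k => nat => nat => oriented_curve => ('k => oriented_curve) => ('k => oriented_curve) => bool" where
 "tracked I i \<alpha> \<beta> J L L' \<longleftrightarrow> labelled_link I L' & (ALL j:I. isotopic (L j) (L' j)) &
  (EX p. branched_cover p (carrier (L' i)) & link_altered \<alpha> (2 * \<beta>) J (preimage_curve p (UN j:I - {i}. L' j)))"

lemma tracked_isotopy:
 assumes i: "i : I" and L: "labelled_link I L" and t: "tracked I i \<alpha> \<beta> J L L'" and iso: "labelled_isotopic I L' L''"
 shows "tracked I i \<alpha> \<beta> J L L''"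
proof -
 obtain h where h: "iso_end h" "!!j. j : I ==> L'' j = tangent_map h ` L' j"
  using iso iso_end_of unfolding labelled_isotopic_def by blast
 have L': "labelled_link I L'" and il: "!!j. j : I ==> isotopic (L j) (L' j)"
  using t unfolding tracked_def by blast+
 obtain p where p: "branched_cover p (carrier (L' i))" "link_altered \<alpha> (2 * \<beta>) J (preimage_curve p (UN j:I - {i}. L' j))"
  using t unfolding tracked_def by blast
 have d: "diffeo_S3 h" by (rule iso_end_diffeo[OF h(1)])
 have UT: "L j \<subseteq> UT" "L' j \<subseteq> UT" if "j : I" for j
  using labelled_linkD(2)[OF L that] labelled_linkD(2)[OF L' that] oriented_knot_UT by blast+
 have "labelled_link I L''"
  unfolding labelled_link_def disjoint_family_on_def
 proof (intro conjI ballI impI)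
  show "finite I" using L by (rule labelled_linkD(1))
  show "oriented_knot (L'' j)" if "j : I" for j unfolding h(2)[OF that] by (rule oriented_knot_image[OF d labelled_linkD(2)[OF L' that]])
  fix j k assume jk: "j : I" "k : I" "j ~= k"
  have "carrier (L' j) \<subseteq> S3" "carrier (L' k) \<subseteq> S3" using oriented_knot_carrier(3) labelled_linkD(2)[OF L'] jk by blast+
  hence "h ` carrier (L' j) Int h ` carrier (L' k) = h ` (carrier (L' j) Int carrier (L' k))"
   using inj_on_image_Int[OF diffeo_S3D(7)[OF d]] by simp
  thus "carrier (L'' j) Int carrier (L'' k) = {}"
   unfolding h(2)[OF jk(1)] h(2)[OF jk(2)] carrier_tangent_map labelled_linkD(3)[OF L' jk] by simp
 qed
 moreover have "isotopic (L j) (L'' j)" if "j : I" for j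
 proof (rule isotopic_trans[OF il[OF that] _ UT(1)[OF that]])
  show "isotopic (L' j) (L'' j)" unfolding isotopic_iff[OF UT(2)[OF that]] using h that by blast
 qed
 moreover have "branched_cover (%x. h (p x)) (carrier (L'' i))"
  unfolding h(2)[OF i] carrier_tangent_map by (rule branched_cover_iso(1)[OF p(1) h(1)])
 moreover have "(UN j:I - {i}. L'' j) = tangent_map h ` (UN j:I - {i}. L' j)"
  unfolding image_UN by (rule SUP_cong[OF HOL.refl]) (rule h(2), blast)
 moreover have "preimage_curve (%x. h (p x)) (tangent_map h ` (UN j:I - {i}. L' j)) = preimage_curve p (UN j:I - {i}. L' j)"
  by (rule branched_cover_iso(2)[OF p(1) h(1) link_carrier_disjoint(3,1)[OF L' i]])
 ultimately show ?thesis unfolding tracked_def using p(2) by metis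
qed

lemma link_unlinks_tracked:
 assumes "link_unlinks I i \<alpha> \<beta> L L'" and i: "i : I" and L: "labelled_link I L"
  and p: "branched_cover p (carrier (L i))" "J = preimage_curve p (UN j:I - {i}. L j)"
 shows "tracked I i \<alpha> \<beta> J L L'"
 using assms(1) L p
proof (induction rule: link_unlinks.induct)
 case (refl L)
 have "isotopic (L j) (L j)" if "j : I" for j
  using isotopic_refl[OF oriented_knot_UT[OF labelled_linkD(2)[OF refl(1) that]]] .
 thus ?case unfolding tracked_def using refl link_altered.refl by auto
next
 case (isotopy \<alpha> \<beta> L L' L'')
 thus ?case using tracked_isotopy[OF i] by blast
next
 case (involving \<alpha> \<beta> L L' a b L'')
 hence t: "tracked I i \<alpha> \<beta> J L L'" by blast
 have L': "labelled_link I L'" and il: "!!j. j : I ==> isotopic (L j) (L' j)"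
  using t unfolding tracked_def by blast+
 obtain p' where p': "branched_cover p' (carrier (L' i))" "link_altered \<alpha> (2 * \<beta>) J (preimage_curve p' (UN j:I - {i}. L' j))"
  using t unfolding tracked_def by blast
 have L'': "labelled_link I L''" using involving(2) by (simp add: labelled_crossing_change_def)
 have is': "isotopic (L j) (L'' j)" if "j : I" for j
  by (rule isotopic_trans[OF il[OF that] labelled_crossing_isotopic[OF L' involving(2) that]
    oriented_knot_UT[OF labelled_linkD(2)[OF involving(5) that]]])
 have "EX p. branched_cover p (carrier (L'' i)) & link_altered (Suc \<alpha>) (2 * \<beta>) J (preimage_curve p (UN j:I - {i}. L'' j))"
 proof (cases "a = i")
  case True
  show ?thesis using track_involving_first[OF L' involving(2)[unfolded True] p'] by blast
 next
  case False
  hence "b = i" using involving(3) by blast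
  thus ?thesis using track_involving_second[OF L' involving(2)[unfolded \<open>b = i\<close>] p'] by blast
 qed
 thus ?case unfolding tracked_def using L'' is' by blast
next
 case (not_involving \<alpha> \<beta> L L' a b L'')
 hence t: "tracked I i \<alpha> \<beta> J L L'" by blast
 have L': "labelled_link I L'" and il: "!!j. j : I ==> isotopic (L j) (L' j)"
  using t unfolding tracked_def by blast+
 obtain p' where p': "branched_cover p' (carrier (L' i))" "link_altered \<alpha> (2 * \<beta>) J (preimage_curve p' (UN j:I - {i}. L' j))"
  using t unfolding tracked_def by blast
 have L'': "labelled_link I L''" using not_involving(2) by (simp add: labelled_crossing_change_def)
 have is': "isotopic (L j) (L'' j)" if "j : I" for j
  by (rule isotopic_trans[OF il[OF that] labelled_crossing_isotopic[OF L' not_involving(2) that]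
    oriented_knot_UT[OF labelled_linkD(2)[OF not_involving(5) that]]])
 have "2 * Suc \<beta> = Suc (Suc (2 * \<beta>))" by simp
 thus ?case unfolding tracked_def
  using L'' is' track_not_involving[OF L' not_involving(2) i not_involving(3) p'] by metis
qed

subsection \<open>The preimage of a split link\<close>

context branched_cover
begin

text \<open>Oriented charts of the sphere are isotopic, so some isotopy takes the chart
  \<open>E\<close> around \<open>k\<close> to either of its lifts, and with it \<open>k\<close> to
  its copy in that sheet. The booleans name the two sheets.\<close>

lemma lifted_ball:
 assumes B: "three_ball B" "B Int K = {}" and k: "oriented_knot k" "carrier k \<subseteq> B"
 obtains k' B' :: "bool => _" where "!!s. isotopic k (k' s)" "!!s. oriented_knot (k' s)" "!!s. three_ball (B' s)"
  "!!s. carrier (k' s) \<subseteq> B' s" "!!s. p ` B' s \<subseteq> B" "B' True Int B' False = {}" "preimage_curve p k = (\<Union>s. k' s)"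
proof -
 obtain e where e: "patch (ball 0 2) e" "B = e ` cball 0 1"
  using B(1) by (auto simp: three_ball_def oriented_chart_iff_patch)
 have eK: "e ` cball 0 1 Int K = {}" using B(2) e(2) by simp
 obtain E de where E: "patch (ball 0 2) E" "E ` ball 0 2 Int K = {}" "de > 0" "!!q. q : ball 0 (1 + de) ==> E q = e q"
  by (rule squash_chart[OF e(1) closed_K eK]) blast
 have EB: "E ` cball 0 1 = B" unfolding e(2) by (rule strand_cong(3)[OF E(3,4)])
 have W: "cball (0::real^3) 1 \<subseteq> ball 0 2" "ball (0::real^3) (3/2) \<subseteq> ball 0 2" "cball (0::real^3) 1 \<subseteq> ball 0 (3/2)" by auto
 have sc: "simply_connected (ball (0::real^3) 2)" by (intro convex_imp_simply_connected convex_ball)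
 have ne: "ball (0::real^3) 2 ~= {}" by simp
 obtain e1 e2 where e1: "patch (ball 0 2) e1" "!!q. q : ball 0 2 ==> p (e1 q) = E q" "e1 ` ball 0 2 \<subseteq> X"
  and e2: "patch (ball 0 2) e2" "!!q. q : ball 0 2 ==> p (e2 q) = E q" "e2 ` ball 0 2 \<subseteq> X"
  and dj: "e1 ` ball 0 2 Int e2 ` ball 0 2 = {}" and e12: "!!q x. q : ball 0 2 ==> x : S3 ==> p x = E q ==> x = e1 q | x = e2 q"
  by (rule patch_lifts[OF E(1) sc ne E(2)]) blast
 obtain h1 where h1: "iso_end h1" "!!q. q : ball 0 (3/2) ==> h1 (E q) = e1 q"
  by (rule charts_isotopic[OF E(1) e1(1)], rule that)
 obtain h2 where h2: "iso_end h2" "!!q. q : ball 0 (3/2) ==> h2 (E q) = e2 q"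
  by (rule charts_isotopic[OF E(1) e2(1)], rule that)
 define ep where "ep s = (if s then e1 else e2)" for s
 define h where "h s = (if s then h1 else h2)" for s
 have ep: "patch (ball 0 2) (ep s)" "!!q. q : ball 0 2 ==> p (ep s q) = E q" "ep s ` ball 0 2 \<subseteq> X" for s
  using e1 e2 by (auto simp: ep_def)
 have h: "iso_end (h s)" "!!q. q : ball 0 (3/2) ==> h s (E q) = ep s q" for s
  using h1 h2 by (auto simp: ep_def h_def)
 have kUT: "k \<subseteq> UT" by (rule oriented_knot_UT[OF k(1)])
 let ?N = "E ` ball 0 (3/2)"
 have EN: "patch (ball 0 (3/2)) E" by (rule patch_subset[OF E(1) open_ball W(2)])
 have N: "openin (top_of_set S3) ?N" by (rule patch_openin[OF EN])
 \<comment> \<open>On the neighbourhood \<open>?N\<close> of the ball, \<open>h s\<close> is a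
   section of \<open>p\<close> into the sheet \<open>s\<close>.\<close>
 have hN: "h s ` ?N \<subseteq> X" "!!y. y : ?N ==> p (h s y) = y" for s
 proof -
  have "h s (E q) : X & p (h s (E q)) = E q" if q: "q : ball 0 (3/2)" for q
  proof -
   have q2: "q : ball 0 2" using W(2) q by blast
   hence "ep s q : X" using ep(3) by blast
   thus ?thesis using h(2)[OF q] ep(2)[OF q2] by simp
  qed
  thus "h s ` ?N \<subseteq> X" "!!y. y : ?N ==> p (h s y) = y" by auto
 qed
 have tm: "tangent_map p (tangent_map (h s) a) = a" if a: "a : UT" "fst a : ?N" for s a
 proof -
  have N3: "?N \<subseteq> S3" by (rule patch_image[OF EN])
  have sm: "smooth_at_S3 ?N (h s)" by (rule smooth_at_S3_subset[OF diffeo_S3D(5)[OF iso_end_diffeo[OF h(1)]] N N3])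
  have "tangent_map (%x. p (h s x)) a = tangent_map p (tangent_map (h s) a)" by (rule tangent_map_compose[OF sm smooth_p hN(1) a(2)])
  moreover have "tangent_map (%x. p (h s x)) a = tangent_map (%x. x) a" by (rule tangent_map_cong[OF N a(2)]) (rule hN(2))
  ultimately show ?thesis using tangent_map_id[OF a(1)] by simp
 qed
 have kN: "EX q:cball 0 1. fst a = E q" "fst a : ?N" if "a : k" for a
 proof -
  have "fst a : E ` cball 0 1" using k(2) that unfolding EB by blast
  thus "EX q:cball 0 1. fst a = E q" "fst a : ?N" using W(3) by blast+
 qed
 have fst_tm: "fst (tangent_map f a) = f (fst a)" for f a by (cases a) (simp add: tangent_map_def)
 define k' where "k' s = tangent_map (h s) ` k" for s
 have pre: "preimage_curve p k = (\<Union>s. k' s)"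
 proof (intro equalityI subsetI)
  fix a assume a: "a : preimage_curve p k"
  hence aUT: "a : UT" and ta: "tangent_map p a : k" using preimage_curve_iff[of "fst a" "snd a"] by simp_all
  let ?b = "tangent_map p a"
  obtain q where q: "q : cball 0 1" "p (fst a) = E q" using kN(1)[OF ta] unfolding fst_tm by blast
  have q2: "q : ball 0 2" using W(1) q(1) by blast
  have q3: "q : ball 0 (3/2)" using W(3) q(1) by blast
  obtain s where s: "fst a = ep s q" using e12[OF q2 UT_S3[OF aUT] q(2)] by (metis ep_def)
  have "h s (p (fst a)) = ep s q" unfolding q(2) by (rule h(2)[OF q3])
  hence hb: "fst (tangent_map (h s) ?b) = fst a" unfolding fst_tm using s by (rule trans[OF _ sym])
  have bUT: "?b : UT" using ta kUT by blast
  have "tangent_map (h s) ?b : UT" by (rule tangent_map_UT[OF iso_end_diffeo[OF h(1)] bUT])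
  moreover have "tangent_map p (tangent_map (h s) ?b) = tangent_map p a" by (rule tm[OF bUT kN(2)[OF ta]])
  moreover have "fst a : X" using ep(3)[of s] q2 s by auto
  ultimately have "snd (tangent_map (h s) ?b) = snd a"
   using tangent_map_p_inj[of "fst a" "snd (tangent_map (h s) ?b)" "snd a"] aUT hb by (metis prod.collapse)
  hence "tangent_map (h s) ?b = a" using hb by (simp add: prod_eq_iff)
  thus "a : (\<Union>s. k' s)" unfolding k'_def using ta by (metis UNIV_I UN_I imageI)
 next
  fix a assume "a : (\<Union>s. k' s)"
  then obtain s b where b: "b : k" "a = tangent_map (h s) b" unfolding k'_def by blast
  have "a : UT" unfolding b(2) by (rule tangent_map_UT[OF iso_end_diffeo[OF h(1)]]) (use b(1) kUT in blast)
  moreover have "tangent_map p a = b" unfolding b(2) by (rule tm[OF _ kN(2)[OF b(1)]]) (use b(1) kUT in blast)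
  ultimately show "a : preimage_curve p k" using b(1) preimage_curve_iff[of "fst a" "snd a"] by simp
 qed
 show thesis
 proof (rule that[of k' "%s. ep s ` cball 0 1", OF _ _ _ _ _ _ pre])
  fix s
  show "isotopic k (k' s)" unfolding isotopic_iff[OF kUT] k'_def using h(1) by blast
  show "oriented_knot (k' s)" unfolding k'_def by (rule oriented_knot_image[OF iso_end_diffeo[OF h(1)] k(1)])
  show "three_ball (ep s ` cball 0 1)" unfolding three_ball_def oriented_chart_iff_patch using ep(1) by blast
  show "carrier (k' s) \<subseteq> ep s ` cball 0 1"
  proof (rule image_subsetI)
   fix a assume "a : k' s"
   then obtain b where b: "b : k" "a = tangent_map (h s) b" unfolding k'_def by blast
   obtain q where q: "q : cball 0 1" "fst b = E q" using kN(1)[OF b(1)] by blast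
   have q3: "q : ball 0 (3/2)" using W(3) q(1) by blast
   show "fst a : ep s ` cball 0 1" unfolding b(2) fst_tm q(2) h(2)[OF q3] using q(1) by (rule imageI)
  qed
  show "p ` (ep s ` cball 0 1) \<subseteq> B"
  proof (rule image_subsetI)
   fix y assume "y : ep s ` cball 0 1"
   then obtain q where q: "q : cball 0 1" "y = ep s q" by blast
   hence "p y = E q" using ep(2)[of q s] W(1) by blast
   thus "p y : B" unfolding EB[symmetric] using q(1) by simp
  qed
 next
  show "ep True ` cball 0 1 Int ep False ` cball 0 1 = {}"
   using dj image_mono[OF W(1), of e1] image_mono[OF W(1), of e2] by (simp add: ep_def) blast
 qed
qed

text \<open>Balls over different components are disjoint because \<open>p\<close> maps them into
  disjoint balls; the two balls over one component are disjoint as lifts.\<close>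

lemma preimage_split_link:
 assumes L: "labelled_link I L"
  and B: "!!j. j : I ==> three_ball (B j)" "!!j. j : I ==> carrier (L j) \<subseteq> B j" "disjoint_family_on B I"
  "!!j. j : I ==> B j Int K = {}"
 obtains M :: "'k \<times> bool => oriented_curve" where "split_link (I \<times> UNIV) M"
  "preimage_curve p (UN j:I. L j) = (UN k:I \<times> UNIV. M k)" "!!j s. j : I ==> isotopic (L j) (M (j, s))"
proof -
 have knot: "oriented_knot (L j)" if "j : I" for j by (rule labelled_linkD(2)[OF L that])
 have "EX k' B'. (ALL s::bool. isotopic (L j) (k' s) & oriented_knot (k' s) & three_ball (B' s) & carrier (k' s) \<subseteq> B' s & p ` B' s \<subseteq> B j) &
   B' True Int B' False = {} & preimage_curve p (L j) = (\<Union>s. k' s)" if j: "j : I" for j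
  by (rule lifted_ball[OF B(1)[OF j] B(4)[OF j] knot[OF j] B(2)[OF j]]) blast
 then obtain k' B' where kB: "!!j s. j : I ==> isotopic (L j) (k' j s) & oriented_knot (k' j s) & three_ball (B' j s) &
    carrier (k' j s) \<subseteq> B' j s & p ` B' j s \<subseteq> B j"
   "!!j. j : I ==> B' j True Int B' j False = {}" "!!j. j : I ==> preimage_curve p (L j) = (\<Union>s::bool. k' j s)" by metis
 let ?M = "%(j, s). k' j s" and ?B = "%(j, s). B' j s"
 have djB: "?B x Int ?B y = {}" if xy: "x : I \<times> UNIV" "y : I \<times> UNIV" "x ~= y" for x y
 proof -
  obtain j s l t where x: "x = (j, s)" "j : I" and y: "y = (l, t)" "l : I" using xy by auto
  show ?thesis
  proof (cases "j = l")
   case True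
   hence "s ~= t" using xy(3) x y by simp
   thus ?thesis using kB(2)[OF x(2)] True by (cases s; cases t) (auto simp: x y)
  next
   case False
   hence "B j Int B l = {}" using B(3) x y unfolding disjoint_family_on_def by blast
   moreover have "p ` B' j s \<subseteq> B j" "p ` B' l t \<subseteq> B l" using kB(1) x y by blast+
   ultimately show ?thesis unfolding x y prod.case by blast
  qed
 qed
 have fin: "finite (I \<times> (UNIV :: bool set))" using labelled_linkD(1)[OF L] by simp
 have M: "oriented_knot (?M x)" "three_ball (?B x)" "carrier (?M x) \<subseteq> ?B x" if "x : I \<times> UNIV" for x
 proof -
  obtain j s where x: "x = (j, s)" by (cases x)
  hence "j : I" using that by simp
  from kB(1)[OF this, of s] show "oriented_knot (?M x)" "three_ball (?B x)" "carrier (?M x) \<subseteq> ?B x"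
   unfolding x prod.case by - (elim conjE, assumption)+
 qed
 have "labelled_link (I \<times> UNIV) ?M"
  unfolding labelled_link_def disjoint_family_on_def
 proof (intro conjI ballI impI)
  show "finite (I \<times> (UNIV :: bool set))" by (rule fin)
  show "oriented_knot (?M x)" if "x : I \<times> UNIV" for x by (rule M(1)[OF that])
  show "carrier (?M x) Int carrier (?M y) = {}" if "x : I \<times> UNIV" "y : I \<times> UNIV" "x ~= y" for x y
   using Int_mono[OF M(3)[OF that(1)] M(3)[OF that(2)]] unfolding djB[OF that] by (rule subset_empty[THEN iffD1])
 qed
 moreover have "disjoint_family_on ?B (I \<times> UNIV)" unfolding disjoint_family_on_def by (intro ballI impI djB)
 ultimately have "split_link (I \<times> UNIV) ?M"
  unfolding split_link_def by (intro conjI exI[of _ ?B] ballI M(2,3))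
 moreover have "preimage_curve p (UN j:I. L j) = (UN k:I \<times> UNIV. ?M k)"
 proof -
  have "preimage_curve p (UN j:I. L j) = (UN j:I. \<Union>s. k' j s)"
   unfolding preimage_curve_UN by (rule SUP_cong[OF HOL.refl]) (rule kB(3))
  thus ?thesis by auto
 qed
 moreover have "isotopic (L j) (?M (j, s))" if "j : I" for j s using kB(1)[OF that, of s] by simp
 ultimately show thesis using that by blast
qed

end

theorem theorem3p2:
  fixes m i \<alpha> \<beta> :: nat
    and L L' :: "nat \<Rightarrow> oriented_curve"
    and p :: "real^4 \<Rightarrow> real^4"
    and J :: oriented_curve
  assumes "labelled_link {1..m} L"
    and "i \<in> {1..m}"
    and "unknotted (L i)"
    and "link_unlinks {1..m} i \<alpha> \<beta> L L'"
    and "split_link {1..m} L'"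
    and "double_branched_cover p (carrier (L i))"
    and "J = preimage_curve p (\<Union>j\<in>{1..m} - {i}. L j)"
  shows "\<exists>K :: nat \<times> bool \<Rightarrow> oriented_curve.
           link_altered \<alpha> (2 * \<beta>) J (\<Union>k\<in>({1..m} - {i}) \<times> UNIV. K k) \<and>
           split_link (({1..m} - {i}) \<times> UNIV) K \<and>
           (\<forall>j\<in>{1..m} - {i}. \<forall>s. isotopic (L j) (K (j, s)))"
proof -
 let ?I = "{1..m}" and ?I' = "{1..m} - {i}"
 have Li: "oriented_knot (L i)" by (rule labelled_linkD(2)[OF assms(1,2)])
 have "branched_cover p (carrier (L i))"
  using assms(6) oriented_knot_carrier[OF Li] by (simp add: branched_cover_def compact_imp_closed)
 hence t: "tracked ?I i \<alpha> \<beta> J L L'"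
  by (rule link_unlinks_tracked[OF assms(4,2,1) _ assms(7)])
 have iso: "isotopic (L j) (L' j)" if "j : ?I" for j using t that unfolding tracked_def by blast
 obtain q where q: "branched_cover q (carrier (L' i))" "link_altered \<alpha> (2 * \<beta>) J (preimage_curve q (UN j:?I'. L' j))"
  using t unfolding tracked_def by blast
 obtain B where B: "!!j. j : ?I ==> three_ball (B j)" "!!j. j : ?I ==> carrier (L' j) \<subseteq> B j" "disjoint_family_on B ?I"
  using assms(5) unfolding split_link_def by blast
 interpret branched_cover q "carrier (L' i)" by (rule q(1))
 have sub: "labelled_link ?I' L'"
  by (rule labelled_link_subset[of ?I]) (use assms(5) in \<open>auto simp: split_link_def\<close>)
 \<comment> \<open>The branching component lies in a ball of its own, so the remaining balls miss it
   and lift.\<close>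
 have BK: "B j Int carrier (L' i) = {}" if "j : ?I'" for j
  using B(2)[OF assms(2)] B(3) that assms(2) unfolding disjoint_family_on_def by blast
 obtain M :: "nat \<times> bool => oriented_curve" where M: "split_link (?I' \<times> UNIV) M"
  "preimage_curve q (UN j:?I'. L' j) = (UN k:?I' \<times> UNIV. M k)" "!!j s. j : ?I' ==> isotopic (L' j) (M (j, s))"
 proof (rule preimage_split_link[OF sub])
  show "three_ball (B j)" "carrier (L' j) \<subseteq> B j" "B j Int carrier (L' i) = {}" if "j : ?I'" for j using B(1,2) BK that by blast+
  show "disjoint_family_on B ?I'" using B(3) by (rule disjoint_family_on_mono[rotated]) blast
 qed (rule that)
 have "isotopic (L j) (M (j, s))" if j: "j : ?I'" for j s
  by (rule isotopic_trans[OF iso M(3)[OF j]]) (use j oriented_knot_UT labelled_linkD(2)[OF assms(1)] in blast)+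
 thus ?thesis using q(2) M(1) unfolding M(2) by blast
qed

end
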